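(* Suppose that $\alpha,V\in P_0(\mathcal T)$ are piecewise constant. For every $k\in\mathbb{N}$, the $k$-th exact eigenvalue $\lambda=\lambda_k$ of $-\operatorname{div}(\alpha\nabla u)+Vu=\lambda u$ in $\Omega$, $u=0$ on $\partial\Omega$, and the $k$-th eigenvalue $\lambda_{\mathrm{es}}=\lambda_{\mathrm{es}(k)}$ of the corresponding extra-stabilised (sCR) eigenvalue problem satisfy, with $\varepsilon'':=h_{\max}^2\kappa_{\mathrm{eCR}}^2$ and $(\bullet)_+:=\max\{0,\bullet\}$, $$\mathrm{GLB}:=\frac{\lambda_{\mathrm{es}}}{1+(\varepsilon''\lambda_{\mathrm{es}}\,\underline{\alpha}^{-1}-1)_+}\le\lambda .$$
   Context: Let $\Omega\subset\mathbb{R}^n$, $n\ge2$, be a polyhedral bounded Lipschitz domain, $V\in L^\infty(\Omega)$ with $\operatorname{ess\,inf}_\Omega V=0$, and $\alpha$ a diffusion coefficient with constants $0<\underline\alpha\le\alpha\le\overline\alpha<\infty$ in $\Omega$. Write $(v,w)_V:=\int_\Omega V v w\,dx$. The exact eigenvalues $0<\lambda_1\le\lambda_2\le\dots$ (counted with multiplicity) are those of the weak form: find $(\lambda,u)\in\mathbb{R}_+\times H_0^1(\Omega)$, $u\ne0$, with $\int_\Omega\alpha\nabla u\cdot\nabla v\,dx+(u,v)_V=\lambda\int_\Omega uv\,dx$ for all $v\in H^1_0(\Omega)$. $\mathcal{T}$ is a regular (face-to-face) triangulation of $\Omega$ into non-degenerate compact $n$-simplices, $h_T:=\operatorname{diam}(T)$,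 $h_{\mathcal T}|_T:=h_T$, $h_{\max}:=\max_Th_T$, $\mathcal F$ is the set of all faces, $\mathcal F(\Omega)$ the set of interior faces, $\mathcal V(T)$ the set of vertices of $T$, $\operatorname{mid}(\cdot)$ denotes the barycenter. The jump $[v]_F$ of a piecewise continuous function is the difference of the traces from the two adjacent simplices if $F$ is interior and the trace $v|_F$ if $F\subset\partial\Omega$. $P_m(\mathcal T)$ is the space of piecewise polynomials of total degree at most $m$ and $\Pi_0$ the $L^2$ projection onto $P_0(\mathcal T)$. Set $\mathrm{CR}_0^1(\mathcal T):=\{v\in P_1(\mathcal T): [v]_F(\operatorname{mid}(F))=0\ \forall F\in\mathcal F\}$. For $T\in\mathcal T$ the bubble is $$\flat_T(x):=\frac{n+2}{2}-\frac{n(n+1)^2(n+2)}{\sum_{P\ne Q\in\mathcal V(T)}|P-Q|^2}\,|x-\operatorname{mid}(T)|^2\quad(x\in T),$$ extended by zero outside $T$ (sum over ordered pairs, so that $\int_F\flat_T\,ds=0$ for each face $F$ of $T$ and $|T|^{-1}\int_T\flat_T\,dx=1$). Let $B(\mathcal T)$ be the span of all $\flat_T$, $\mathbb{V}_{\mathrm{nc}}:=\mathrm{CR}_0^1(\mathcal T)\oplus B(\mathcal T)$, $\mathbb{V}_{\mathrm{pw}}:=P_1(\mathcal T)\oplus B(\mathcal T)$, and $\mathbb{V}_{\mathrm{es}}:=\mathbb{V}_{\mathrm{pw}}\times\mathbb{V}_{\mathrm{nc}}$. Let $a_{\alpha,\mathrm{pw}}(v,w):=\sum_{T\in\mathcal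 T}\int_T\alpha\nabla v\cdot\nabla w\,dx$. Interpolation: for $F\in\mathcal F(\Omega)$ let $\psi_F\in\mathrm{CR}^1_0(\mathcal T)$ be equal to $1$ at $\operatorname{mid}(F)$ and $0$ at the midpoints of all other faces, $I_{\mathrm{CR}}v:=\sum_{F\in\mathcal F(\Omega)}\big(|F|^{-1}\int_Fv\,ds\big)\psi_F$, and $I_{\mathrm{eCR}}v:=I_{\mathrm{CR}}v+\sum_{T\in\mathcal T}\big(|T|^{-1}\int_T(v-I_{\mathrm{CR}}v)\,dx\big)\flat_T$. The constant $\kappa_{\mathrm{eCR}}>0$ is such that $\|v-I_{\mathrm{eCR}}v\|_{L^2(T)}\le\kappa_{\mathrm{eCR}}h_T\|\nabla(v-I_{\mathrm{eCR}}v)\|_{L^2(T)}$ for all $v\in H_0^1(\Omega)$, $T\in\mathcal T$. sCR eigenvalue problem: find $(\lambda_{\mathrm{es}},u_{\mathrm{es}})\in\mathbb{R}_+\times(\mathbb{V}_{\mathrm{es}}\setminus\{0\})$ with $a_{\mathrm{es}}(u_{\mathrm{es}},v_{\mathrm{es}})=\lambda_{\mathrm{es}}b_{\mathrm{es}}(u_{\mathrm{es}},v_{\mathrm{es}})$ for all $v_{\mathrm{es}}\in\mathbb{V}_{\mathrm{es}}$, where for $u_{\mathrm{es}}=(u_{\mathrm{pw}},u_{\mathrm{nc}})$, $v_{\mathrm{es}}=(v_{\mathrm{pw}},v_{\mathrm{nc}})$, $$a_{\mathrm{es}}(u_{\mathrm{es}},v_{\mathrm{es}})=a_{\alpha,\mathrm{pw}}(u_{\mathrm{nc}},v_{\mathrm{nc}})+(\Pi_0u_{\mathrm{nc}},\Pi_0v_{\mathrm{nc}})_V+\underline\alpha\,\kappa_{\mathrm{eCR}}^{-2}\int_\Omega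 h_{\mathcal T}^{-2}(u_{\mathrm{pw}}-u_{\mathrm{nc}})(v_{\mathrm{pw}}-v_{\mathrm{nc}})\,dx,$$ $$b_{\mathrm{es}}(u_{\mathrm{es}},v_{\mathrm{es}})=\int_\Omega u_{\mathrm{pw}}v_{\mathrm{pw}}\,dx .$$ Its finite positive eigenvalues are $0<\lambda_{\mathrm{es}(1)}\le\dots\le\lambda_{\mathrm{es}(N)}<\infty$, $N=\dim\mathbb{V}_{\mathrm{pw}}$ (with multiplicity); $\lambda_{\mathrm{es}(k)}:=+\infty$ for $k>N$, in which case the bound is read as the limit $\underline\alpha/\varepsilon''$. *)

theory Defs
  imports
    "HOL-Analysis.Analysis"
    "HOL-Library.Function_Algebras"
    "HOL-Library.Extended_Nat"
    "HOL-Probability.Essential_Supremum"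
begin

section \<open>Real functions as a vector space\<close>

instantiation "fun" :: (type, real_vector) real_vector
begin

definition scaleR_fun :: "real \<Rightarrow> ('a \<Rightarrow> 'b) \<Rightarrow> 'a \<Rightarrow> 'b"
  where "scaleR_fun c f = (\<lambda>x. c *\<^sub>R f x)"

instance
  by standard (auto simp: scaleR_fun_def fun_eq_iff scaleR_add_right scaleR_add_left)

end


section \<open>Lipschitz domains\<close>

text \<open>Near every boundary point the domain is the strict epigraph, in some direction \<open>e\<close>, of a
  Lipschitz function on the hyperplane orthogonal to \<open>e\<close>.\<close>

definition lipschitz_domain :: "'a::euclidean_space set \<Rightarrow> bool" where
  "lipschitz_domain \<Omega> \<longleftrightarrow>
     open \<Omega> \<and> connected \<Omega> \<and> \<Omega> \<noteq> {} \<and>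
     (\<forall>x\<in>frontier \<Omega>. \<exists>U e \<phi> L.
        open U \<and> x \<in> U \<and> norm e = 1 \<and> L-lipschitz_on {z. z \<bullet> e = 0} \<phi> \<and>
        \<Omega> \<inter> U = {y\<in>U. \<phi> (y - (y \<bullet> e) *\<^sub>R e) < y \<bullet> e})"

definition polyhedral :: "'a::euclidean_space set \<Rightarrow> bool" where
  "polyhedral \<Omega> \<longleftrightarrow> (\<exists>\<P>. finite \<P> \<and> (\<forall>P\<in>\<P>. polytope P) \<and> closure \<Omega> = \<Union>\<P>)"


section \<open>Lebesgue and Sobolev spaces\<close>

text \<open>Elements of the function spaces are represented by functions on the whole type. Values
  outside the domain, and on null sets, are irrelevant; \<open>null_functions \<Omega>\<close> represents the zero
  class.\<close>

definition null_functions :: "'a::euclidean_space set \<Rightarrow> ('a \<Rightarrow> real) set" where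
  "null_functions \<Omega> = {u. AE x in lebesgue_on \<Omega>. u x = 0}"

definition L2_functions :: "'a::euclidean_space set \<Rightarrow> ('a \<Rightarrow> 'b::euclidean_space) set" where
  "L2_functions S = {f. f \<in> borel_measurable (lebesgue_on S) \<and>
                        integrable (lebesgue_on S) (\<lambda>x. (norm (f x))\<^sup>2)}"

definition L2_norm :: "'a::euclidean_space set \<Rightarrow> ('a \<Rightarrow> 'b::euclidean_space) \<Rightarrow> real" where
  "L2_norm S f = sqrt (\<integral>x. (norm (f x))\<^sup>2 \<partial>lebesgue_on S)"

definition L_infty :: "'a::euclidean_space set \<Rightarrow> ('a \<Rightarrow> real) set" where
  "L_infty S = {f. f \<in> borel_measurable (lebesgue_on S) \<and>
                   esssup (lebesgue_on S) (\<lambda>x. ereal \<bar>f x\<bar>) < \<infinity>}"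

definition essinf :: "'a measure \<Rightarrow> ('a \<Rightarrow> ereal) \<Rightarrow> ereal" where
  "essinf M f = - esssup M (\<lambda>x. - f x)"

fun C_k :: "nat \<Rightarrow> ('a::euclidean_space \<Rightarrow> real) \<Rightarrow> bool" where
  "C_k 0 f \<longleftrightarrow> continuous_on UNIV f"
| "C_k (Suc k) f \<longleftrightarrow> (\<forall>x. f differentiable at x) \<and>
                     (\<forall>b\<in>Basis. C_k k (\<lambda>x. frechet_derivative f (at x) b))"

definition test_functions :: "'a::euclidean_space set \<Rightarrow> ('a \<Rightarrow> real) set" where
  "test_functions \<Omega> = {\<phi>. (\<forall>k. C_k k \<phi>) \<and>
                          compact (closure {x. \<phi> x \<noteq> 0}) \<and> closure {x. \<phi> x \<noteq> 0} \<subseteq> \<Omega>}"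

definition grad :: "('a::euclidean_space \<Rightarrow> real) \<Rightarrow> 'a \<Rightarrow> 'a" where
  "grad f x = (THE D. GDERIV f x :> D)"

definition has_weak_gradient ::
  "'a::euclidean_space set \<Rightarrow> ('a \<Rightarrow> real) \<Rightarrow> ('a \<Rightarrow> 'a) \<Rightarrow> bool" where
  "has_weak_gradient \<Omega> u g \<longleftrightarrow>
     u \<in> L2_functions \<Omega> \<and> g \<in> L2_functions \<Omega> \<and>
     (\<forall>\<phi>\<in>test_functions \<Omega>.
        (\<integral>x. u x *\<^sub>R grad \<phi> x \<partial>lebesgue_on \<Omega>) = - (\<integral>x. \<phi> x *\<^sub>R g x \<partial>lebesgue_on \<Omega>))"

text \<open>The weak gradient is unique only up to null sets; all uses below are insensitive to the
  representative chosen.\<close>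

definition weak_grad :: "'a::euclidean_space set \<Rightarrow> ('a \<Rightarrow> real) \<Rightarrow> 'a \<Rightarrow> 'a" where
  "weak_grad \<Omega> u = (SOME g. has_weak_gradient \<Omega> u g)"

definition H1 :: "'a::euclidean_space set \<Rightarrow> ('a \<Rightarrow> real) set" where
  "H1 \<Omega> = {u. \<exists>g. has_weak_gradient \<Omega> u g}"

definition H1_approx ::
  "'a::euclidean_space set \<Rightarrow> (nat \<Rightarrow> 'a \<Rightarrow> real) \<Rightarrow> ('a \<Rightarrow> real) \<Rightarrow> bool" where
  "H1_approx \<Omega> \<phi> u \<longleftrightarrow>
     (\<forall>j. \<phi> j \<in> test_functions \<Omega>) \<and>
     (\<lambda>j. L2_norm \<Omega> (\<phi> j - u)) \<longlonglongrightarrow> 0 \<and>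
     (\<lambda>j. L2_norm \<Omega> (\<lambda>x. grad (\<phi> j) x - weak_grad \<Omega> u x)) \<longlonglongrightarrow> 0"

definition H10 :: "'a::euclidean_space set \<Rightarrow> ('a \<Rightarrow> real) set" where
  "H10 \<Omega> = {u\<in>H1 \<Omega>. \<exists>\<phi>. H1_approx \<Omega> \<phi> u}"


section \<open>Eigenvalues of a pair of bilinear forms, counted with multiplicity\<close>

definition eigenspace ::
  "'v::real_vector set \<Rightarrow> ('v \<Rightarrow> 'v \<Rightarrow> real) \<Rightarrow> ('v \<Rightarrow> 'v \<Rightarrow> real) \<Rightarrow> real \<Rightarrow> 'v set" where
  "eigenspace X a b \<mu> = {u\<in>X. \<forall>v\<in>X. a u v = \<mu> * b u v}"

text \<open>The dimension of \<open>E\<close> in the quotient by the subspace \<open>Z\<close> of representatives of zero.\<close>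

definition dim_modulo :: "'v::real_vector set \<Rightarrow> 'v set \<Rightarrow> enat" where
  "dim_modulo Z E =
     (SUP B\<in>{B. finite B \<and> B \<subseteq> E \<and> independent B \<and> span B \<inter> Z \<subseteq> {0}}. enat (card B))"

text \<open>The number of eigenvalues in \<open>(0, \<mu>]\<close>, each repeated according to its multiplicity, the
  dimension of its eigenspace.\<close>

definition eigenvalue_count ::
  "'v::real_vector set \<Rightarrow> 'v set \<Rightarrow> ('v \<Rightarrow> 'v \<Rightarrow> real) \<Rightarrow> ('v \<Rightarrow> 'v \<Rightarrow> real) \<Rightarrow> real \<Rightarrow> enat" where
  "eigenvalue_count Z X a b \<mu> =
     (SUP M\<in>{M. finite M \<and> M \<subseteq> {0<..\<mu>}}. \<Sum>\<nu>\<in>M. dim_modulo Z (eigenspace X a b \<nu>))"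

text \<open>The \<open>k\<close>-th smallest positive eigenvalue (\<open>k \<ge> 1\<close>); it is \<open>\<infinity>\<close> if there are fewer than \<open>k\<close> finite
  positive eigenvalues, since \<open>Inf {} = \<infinity>\<close>.\<close>

definition kth_eigenvalue ::
  "'v::real_vector set \<Rightarrow> 'v set \<Rightarrow> ('v \<Rightarrow> 'v \<Rightarrow> real) \<Rightarrow> ('v \<Rightarrow> 'v \<Rightarrow> real) \<Rightarrow> nat \<Rightarrow> ereal" where
  "kth_eigenvalue Z X a b k =
     Inf {ereal \<mu> |\<mu>. \<mu> > 0 \<and> enat k \<le> eigenvalue_count Z X a b \<mu>}"


section \<open>The exact eigenvalue problem\<close>

definition inner_V ::
  "'a::euclidean_space set \<Rightarrow> ('a \<Rightarrow> real) \<Rightarrow> ('a \<Rightarrow> real) \<Rightarrow> ('a \<Rightarrow> real) \<Rightarrow> real" where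
  "inner_V \<Omega> V v w = (\<integral>x. V x * v x * w x \<partial>lebesgue_on \<Omega>)"

definition exact_a ::
  "'a::euclidean_space set \<Rightarrow> ('a \<Rightarrow> real) \<Rightarrow> ('a \<Rightarrow> real) \<Rightarrow> ('a \<Rightarrow> real) \<Rightarrow> ('a \<Rightarrow> real) \<Rightarrow> real" where
  "exact_a \<Omega> \<alpha> V u v =
     (\<integral>x. \<alpha> x * (weak_grad \<Omega> u x \<bullet> weak_grad \<Omega> v x) \<partial>lebesgue_on \<Omega>) + inner_V \<Omega> V u v"

definition exact_b :: "'a::euclidean_space set \<Rightarrow> ('a \<Rightarrow> real) \<Rightarrow> ('a \<Rightarrow> real) \<Rightarrow> real" where
  "exact_b \<Omega> u v = (\<integral>x. u x * v x \<partial>lebesgue_on \<Omega>)"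

definition exact_eigenvalue ::
  "'a::euclidean_space set \<Rightarrow> ('a \<Rightarrow> real) \<Rightarrow> ('a \<Rightarrow> real) \<Rightarrow> nat \<Rightarrow> ereal" where
  "exact_eigenvalue \<Omega> \<alpha> V =
     kth_eigenvalue (null_functions \<Omega>) (H10 \<Omega>) (exact_a \<Omega> \<alpha> V) (exact_b \<Omega>)"


section \<open>Triangulations\<close>

text \<open>\<open>triangulation\<close> contains the face-to-face condition.\<close>

definition regular_triangulation :: "'a::euclidean_space set set \<Rightarrow> 'a set \<Rightarrow> bool" where
  "regular_triangulation \<T> \<Omega> \<longleftrightarrow>
     triangulation \<T> \<and> (\<forall>T\<in>\<T>. int DIM('a) simplex T) \<and> \<Union>\<T> = closure \<Omega>"

definition vertices :: "'a::euclidean_space set \<Rightarrow> 'a set" where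
  "vertices T = {x. x extreme_point_of T}"

definition mid :: "'a::euclidean_space set \<Rightarrow> 'a" where
  "mid S = (1 / real (card (vertices S))) *\<^sub>R \<Sum>(vertices S)"

definition faces :: "'a::euclidean_space set set \<Rightarrow> 'a set set" where
  "faces \<T> = {F. \<exists>T\<in>\<T>. F facet_of T}"

definition interior_faces :: "'a::euclidean_space set \<Rightarrow> 'a set set \<Rightarrow> 'a set set" where
  "interior_faces \<Omega> \<T> = {F\<in>faces \<T>. \<not> F \<subseteq> frontier \<Omega>}"

definition mesh_size :: "'a::euclidean_space set set \<Rightarrow> 'a \<Rightarrow> real" where
  "mesh_size \<T> x = diameter (THE T. T \<in> \<T> \<and> x \<in> interior T)"

definition h_max :: "'a::euclidean_space set set \<Rightarrow> real" where
  "h_max \<T> = Max (diameter ` \<T>)"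


section \<open>Surface integrals and traces on faces\<close>

text \<open>The surface measure of a face \<open>F\<close>: the prism over \<open>F\<close> is the product of \<open>F\<close> and an interval of
  length one in the normal direction, so projecting Lebesgue measure from the prism onto the
  hyperplane of \<open>F\<close> gives the surface measure restricted to \<open>F\<close>.\<close>

definition face_prism :: "'a::euclidean_space set \<Rightarrow> 'a set" where
  "face_prism F = {x. closest_point (affine hull F) x \<in> F \<and>
                      dist x (closest_point (affine hull F) x) \<le> 1 / 2}"

definition face_measure :: "'a::euclidean_space set \<Rightarrow> 'a measure" where
  "face_measure F = distr (lebesgue_on (face_prism F)) borel (closest_point (affine hull F))"

text \<open>The trace on \<open>F\<close> of a function in \<open>H10 \<Omega>\<close>, as the continuous extension of the restriction
  of test functions to \<open>F\<close>.\<close>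

definition has_trace ::
  "'a::euclidean_space set \<Rightarrow> 'a set \<Rightarrow> ('a \<Rightarrow> real) \<Rightarrow> ('a \<Rightarrow> real) \<Rightarrow> bool" where
  "has_trace \<Omega> F v t \<longleftrightarrow>
     t \<in> borel_measurable borel \<and> integrable (face_measure F) (\<lambda>x. (t x)\<^sup>2) \<and>
     (\<forall>\<phi>. H1_approx \<Omega> \<phi> v \<longrightarrow>
        (\<lambda>j. \<integral>x. (\<phi> j x - t x)\<^sup>2 \<partial>face_measure F) \<longlonglongrightarrow> 0)"

definition face_trace :: "'a::euclidean_space set \<Rightarrow> 'a set \<Rightarrow> ('a \<Rightarrow> real) \<Rightarrow> 'a \<Rightarrow> real" where
  "face_trace \<Omega> F v = (SOME t. has_trace \<Omega> F v t)"

definition face_mean :: "'a::euclidean_space set \<Rightarrow> 'a set \<Rightarrow> ('a \<Rightarrow> real) \<Rightarrow> real" where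
  "face_mean \<Omega> F v = (\<integral>x. face_trace \<Omega> F v x \<partial>face_measure F) / measure (face_measure F) F"


section \<open>Piecewise polynomials and the nonconforming spaces\<close>

text \<open>Piecewise polynomials are prescribed on the interiors of the simplices only; their values
  on the skeleton (a null set) are left arbitrary.\<close>

definition P0 :: "'a::euclidean_space set set \<Rightarrow> ('a \<Rightarrow> real) set" where
  "P0 \<T> = {v. \<forall>T\<in>\<T>. \<exists>c. \<forall>x\<in>interior T. v x = c}"

definition P1 :: "'a::euclidean_space set set \<Rightarrow> ('a \<Rightarrow> real) set" where
  "P1 \<T> = {v. \<forall>T\<in>\<T>. \<exists>c g. \<forall>x\<in>interior T. v x = c + g \<bullet> x}"

definition L2_proj0 ::
  "'a::euclidean_space set \<Rightarrow> 'a set set \<Rightarrow> ('a \<Rightarrow> real) \<Rightarrow> 'a \<Rightarrow> real" where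
  "L2_proj0 \<Omega> \<T> v =
     (SOME p. p \<in> P0 \<T> \<and> (\<forall>q\<in>P0 \<T>. (\<integral>x. (v x - p x) * q x \<partial>lebesgue_on \<Omega>) = 0))"

text \<open>The trace from inside \<open>T\<close> of a piecewise continuous function.\<close>

definition trace_from :: "'a::euclidean_space set \<Rightarrow> ('a \<Rightarrow> real) \<Rightarrow> 'a \<Rightarrow> real" where
  "trace_from T v x = Lim (at x within interior T) v"

text \<open>The orientation of the jump across an interior face is arbitrary.\<close>

definition jump ::
  "'a::euclidean_space set \<Rightarrow> 'a set set \<Rightarrow> ('a \<Rightarrow> real) \<Rightarrow> 'a set \<Rightarrow> 'a \<Rightarrow> real" where
  "jump \<Omega> \<T> v F x =
     (if F \<subseteq> frontier \<Omega> then trace_from (THE T. T \<in> \<T> \<and> F facet_of T) v x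
      else (case (SOME (T1, T2). T1 \<in> \<T> \<and> T2 \<in> \<T> \<and> T1 \<noteq> T2 \<and> F facet_of T1 \<and> F facet_of T2)
            of (T1, T2) \<Rightarrow> trace_from T1 v x - trace_from T2 v x))"

definition CR10 :: "'a::euclidean_space set \<Rightarrow> 'a set set \<Rightarrow> ('a \<Rightarrow> real) set" where
  "CR10 \<Omega> \<T> = {v\<in>P1 \<T>. \<forall>F\<in>faces \<T>. jump \<Omega> \<T> v F (mid F) = 0}"

definition bubble :: "'a::euclidean_space set \<Rightarrow> 'a \<Rightarrow> real" where
  "bubble T x =
     (let n = real DIM('a) in
      if x \<in> T
      then (n + 2) / 2 -
           n * (n + 1)\<^sup>2 * (n + 2) / (\<Sum>P\<in>vertices T. \<Sum>Q\<in>vertices T - {P}. (norm (P - Q))\<^sup>2)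
             * (norm (x - mid T))\<^sup>2
      else 0)"

definition bubbles :: "'a::euclidean_space set set \<Rightarrow> ('a \<Rightarrow> real) set" where
  "bubbles \<T> = span (bubble ` \<T>)"

definition V_nc :: "'a::euclidean_space set \<Rightarrow> 'a set set \<Rightarrow> ('a \<Rightarrow> real) set" where
  "V_nc \<Omega> \<T> = {v + w |v w. v \<in> CR10 \<Omega> \<T> \<and> w \<in> bubbles \<T>}"

definition V_pw :: "'a::euclidean_space set set \<Rightarrow> ('a \<Rightarrow> real) set" where
  "V_pw \<T> = {v + w |v w. v \<in> P1 \<T> \<and> w \<in> bubbles \<T>}"

definition V_es :: "'a::euclidean_space set \<Rightarrow> 'a set set \<Rightarrow> (('a \<Rightarrow> real) \<times> ('a \<Rightarrow> real)) set" where
  "V_es \<Omega> \<T> = V_pw \<T> \<times> V_nc \<Omega> \<T>"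


section \<open>Interpolation\<close>

definition CR_basis ::
  "'a::euclidean_space set \<Rightarrow> 'a set set \<Rightarrow> 'a set \<Rightarrow> 'a \<Rightarrow> real" where
  "CR_basis \<Omega> \<T> F =
     (SOME \<psi>. \<psi> \<in> CR10 \<Omega> \<T> \<and>
        (\<forall>T\<in>\<T>. \<forall>F'. F' facet_of T \<longrightarrow> trace_from T \<psi> (mid F') = (if F' = F then 1 else 0)))"

definition I_CR :: "'a::euclidean_space set \<Rightarrow> 'a set set \<Rightarrow> ('a \<Rightarrow> real) \<Rightarrow> 'a \<Rightarrow> real" where
  "I_CR \<Omega> \<T> v = (\<Sum>F\<in>interior_faces \<Omega> \<T>. face_mean \<Omega> F v *\<^sub>R CR_basis \<Omega> \<T> F)"

definition I_eCR :: "'a::euclidean_space set \<Rightarrow> 'a set set \<Rightarrow> ('a \<Rightarrow> real) \<Rightarrow> 'a \<Rightarrow> real" where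
  "I_eCR \<Omega> \<T> v = I_CR \<Omega> \<T> v +
     (\<Sum>T\<in>\<T>. ((\<integral>x. v x - I_CR \<Omega> \<T> v x \<partial>lebesgue_on T) / measure lebesgue T) *\<^sub>R bubble T)"

definition eCR_constant :: "'a::euclidean_space set \<Rightarrow> 'a set set \<Rightarrow> real \<Rightarrow> bool" where
  "eCR_constant \<Omega> \<T> \<kappa> \<longleftrightarrow>
     \<kappa> > 0 \<and>
     (\<forall>v\<in>H10 \<Omega>. \<forall>T\<in>\<T>.
        L2_norm T (v - I_eCR \<Omega> \<T> v)
          \<le> \<kappa> * diameter T * L2_norm T (weak_grad (interior T) (v - I_eCR \<Omega> \<T> v)))"


section \<open>The extra-stabilised eigenvalue problem\<close>

definition a_pw ::
  "'a::euclidean_space set set \<Rightarrow> ('a \<Rightarrow> real) \<Rightarrow> ('a \<Rightarrow> real) \<Rightarrow> ('a \<Rightarrow> real) \<Rightarrow> real" where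
  "a_pw \<T> \<alpha> v w =
     (\<Sum>T\<in>\<T>. \<integral>x. \<alpha> x * (weak_grad (interior T) v x \<bullet> weak_grad (interior T) w x) \<partial>lebesgue_on T)"

definition a_es ::
  "'a::euclidean_space set \<Rightarrow> 'a set set \<Rightarrow> ('a \<Rightarrow> real) \<Rightarrow> ('a \<Rightarrow> real) \<Rightarrow> real \<Rightarrow> real \<Rightarrow>
   ('a \<Rightarrow> real) \<times> ('a \<Rightarrow> real) \<Rightarrow> ('a \<Rightarrow> real) \<times> ('a \<Rightarrow> real) \<Rightarrow> real" where
  "a_es \<Omega> \<T> \<alpha> V \<alpha>lo \<kappa> = (\<lambda>(u_pw, u_nc) (v_pw, v_nc).
     a_pw \<T> \<alpha> u_nc v_nc +
     inner_V \<Omega> V (L2_proj0 \<Omega> \<T> u_nc) (L2_proj0 \<Omega> \<T> v_nc) +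
     \<alpha>lo / \<kappa>\<^sup>2 *
       (\<integral>x. (u_pw x - u_nc x) * (v_pw x - v_nc x) / (mesh_size \<T> x)\<^sup>2 \<partial>lebesgue_on \<Omega>))"

definition b_es ::
  "'a::euclidean_space set \<Rightarrow>
   ('a \<Rightarrow> real) \<times> ('a \<Rightarrow> real) \<Rightarrow> ('a \<Rightarrow> real) \<times> ('a \<Rightarrow> real) \<Rightarrow> real" where
  "b_es \<Omega> = (\<lambda>(u_pw, u_nc) (v_pw, v_nc). \<integral>x. u_pw x * v_pw x \<partial>lebesgue_on \<Omega>)"

text \<open>The problem has exactly \<open>N = dim (V_pw \<T>)\<close> finite positive eigenvalues, so the value is \<open>\<infinity>\<close>
  precisely for \<open>k > N\<close>.\<close>

definition sCR_eigenvalue ::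
  "'a::euclidean_space set \<Rightarrow> 'a set set \<Rightarrow> ('a \<Rightarrow> real) \<Rightarrow> ('a \<Rightarrow> real) \<Rightarrow> real \<Rightarrow> real \<Rightarrow> nat \<Rightarrow>
   ereal" where
  "sCR_eigenvalue \<Omega> \<T> \<alpha> V \<alpha>lo \<kappa> =
     kth_eigenvalue (null_functions \<Omega> \<times> null_functions \<Omega>) (V_es \<Omega> \<T>)
       (a_es \<Omega> \<T> \<alpha> V \<alpha>lo \<kappa>) (b_es \<Omega>)"

text \<open>For an infinite discrete eigenvalue the bound is the limit \<open>\<alpha>lo / \<epsilon>\<close> of the formula.\<close>

definition GLB :: "real \<Rightarrow> real \<Rightarrow> ereal \<Rightarrow> ereal" where
  "GLB \<epsilon> \<alpha>lo l =
     (if l = \<infinity> then ereal (\<alpha>lo / \<epsilon>)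
      else l / (1 + max 0 (ereal \<epsilon> * l / ereal \<alpha>lo - 1)))"

end

theory Submission
  imports Defs
begin

text \<open>Both spectra are compared through \<open>k\<close>-dimensional families on which the Rayleigh quotient is at most
  \<open>\<mu>\<close>. Let \<open>\<mu> < \<alpha>lo / \<epsilon>\<close> and let \<open>u\<close> belong to such a family for the exact problem. Pair
  \<open>w = I_eCR u\<close> with the elementwise \<open>L\<^sup>2\<close> projection \<open>y\<close> of \<open>u\<close> onto quadratics. Integration by
  parts on a simplex, where \<open>u - w\<close> has mean zero on the simplex and on its faces, makes the gradient of
  \<open>u - w\<close> orthogonal to that of \<open>w\<close>; the definition of \<open>\<kappa>\<close> and Pythagoras for
  \<open>u - w = (u - y) + (y - w)\<close> then give \<open>a_es (y, w) \<le> a u - (\<alpha>lo / \<epsilon>) \<parallel>u - y\<parallel>\<^sup>2\<close>. As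
  \<open>\<parallel>y\<parallel>\<^sup>2 = \<parallel>u\<parallel>\<^sup>2 - \<parallel>u - y\<parallel>\<^sup>2\<close>, the discrete Rayleigh quotient of \<open>(y, w)\<close> is at most
  \<open>\<mu>\<close> as well, so the discrete eigenvalue is at most \<open>\<mu>\<close>. If \<open>\<mu> \<ge> \<alpha>lo / \<epsilon>\<close> there is
  nothing to show, since the bound never exceeds \<open>\<alpha>lo / \<epsilon>\<close>.\<close>


section \<open>Symmetric positive semidefinite forms\<close>

text \<open>The spaces consist of functions rather than classes modulo null sets, so all forms are
  merely semidefinite. Vectors with \<open>a u u = 0\<close> lie in the radical of \<open>a\<close>,
  and this fact replaces passing to a quotient. Eigenvectors are handed over by the definition of
  the count on the exact side and constructed by maximisation on the discrete side.

  The analytic device is to turn face conditions into volume integrals. For a vertex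
  \<open>p\<close>, the field \<open>x - p\<close> is tangential on the faces through
  \<open>p\<close> and has constant normal component on the opposite face. The divergence theorem
  for \<open>f (x - p)\<close> thus expresses the mean of \<open>f\<close> over that face by
  integrals over the simplex, which pass to limits in \<open>H10\<close> and are linear there,
  although traces are arbitrary choices.

  The strict inequality \<open>\<mu> < \<alpha>lo / \<epsilon>\<close> keeps the family of pairs
  nondegenerate: a nonzero \<open>u\<close> with vanishing \<open>y\<close> would give negative
  discrete energy. The discrete form also has to be definite, and this is where the geometry of the
  mesh enters: a nonconforming function with zero piecewise gradient is constant on each simplex,
  and the constants have to be carried from simplex to simplex until the boundary is met.\<close>

lemma homogeneous_system_nontrivial:
  fixes f :: "'i \<Rightarrow> 'b \<Rightarrow> real"
  assumes "finite I" "finite B" "card I < card B"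
  shows "\<exists>c. (\<exists>b\<in>B. c b \<noteq> 0) \<and> (\<forall>i\<in>I. (\<Sum>b\<in>B. c b * f i b) = 0)"
  using assms
proof (induction I arbitrary: B f rule: finite_induct)
  case empty
  then have "B \<noteq> {}" by auto
  then show ?case by (intro exI[of _ "\<lambda>_. 1"]) auto
next
  case (insert i I)
  show ?case
  proof (cases "\<forall>b\<in>B. f i b = 0")
    case True
    from insert.IH[of B f] insert.prems insert.hyps obtain c where
      "\<exists>b\<in>B. c b \<noteq> 0" "\<forall>i\<in>I. (\<Sum>b\<in>B. c b * f i b) = 0" by auto
    then show ?thesis using True by (intro exI[of _ c]) auto
  next
    case False
    then obtain b0 where b0: "b0 \<in> B" "f i b0 \<noteq> 0" by auto
    \<comment> \<open>Equation \<open>i\<close> is solved for the unknown \<open>b0\<close>;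
      \<open>f'\<close> holds the other equations after this substitution, and \<open>- s\<close>
      below is the value that equation \<open>i\<close> then forces on \<open>b0\<close>.\<close>
    define f' where "f' j b = f j b - f j b0 * f i b / f i b0" for j b
    have "card I < card (B - {b0})" using insert.prems insert.hyps b0 by auto
    from insert.IH[OF _ this, of f'] insert.prems obtain c where
      c: "\<exists>b\<in>B - {b0}. c b \<noteq> 0" "\<And>j. j \<in> I \<Longrightarrow> (\<Sum>b\<in>B - {b0}. c b * f' j b) = 0" by auto
    define s where "s = (\<Sum>b\<in>B - {b0}. c b * f i b) / f i b0"
    define c' where "c' = c(b0 := - s)"
    have eq: "(\<Sum>b\<in>B. c' b * f j b) = (\<Sum>b\<in>B - {b0}. c b * f j b) - s * f j b0" for j
    proof -
      have "(\<Sum>b\<in>B. c' b * f j b) = c' b0 * f j b0 + (\<Sum>b\<in>B - {b0}. c' b * f j b)"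
        using b0 insert.prems by (intro sum.remove) auto
      also have "(\<Sum>b\<in>B - {b0}. c' b * f j b) = (\<Sum>b\<in>B - {b0}. c b * f j b)"
        by (intro sum.cong) (auto simp: c'_def)
      finally show ?thesis by (simp add: c'_def)
    qed
    have "(\<Sum>b\<in>B. c' b * f j b) = 0" if "j \<in> insert i I" for j
    proof (cases "j = i")
      case True
      then show ?thesis unfolding eq s_def using b0 by simp
    next
      case False
      then have "(\<Sum>b\<in>B - {b0}. c b * f' j b) = 0" using c that by auto
      moreover have "(\<Sum>b\<in>B - {b0}. c b * f' j b)
          = (\<Sum>b\<in>B - {b0}. c b * f j b) - s * f j b0"
        unfolding f'_def s_def
        by (simp add: algebra_simps sum_subtractf sum_divide_distrib sum_distrib_left)
      ultimately show ?thesis unfolding eq by simp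
    qed
    moreover have "\<exists>b\<in>B. c' b \<noteq> 0" using c(1) by (auto simp: c'_def)
    ultimately show ?thesis by (intro exI[of _ c']) auto
  qed
qed

text \<open>Linearity is demanded only on the carrier \<open>X\<close>, because integrals of
  products are additive only where the products are integrable.\<close>

locale bilinear_form =
  fixes X :: "'v::real_vector set" and a :: "'v \<Rightarrow> 'v \<Rightarrow> real"
  assumes subspace: "subspace X"
    and add_left: "\<lbrakk>u \<in> X; v \<in> X; w \<in> X\<rbrakk> \<Longrightarrow> a (u + v) w = a u w + a v w"
    and scale_left: "\<lbrakk>u \<in> X; w \<in> X\<rbrakk> \<Longrightarrow> a (c *\<^sub>R u) w = c * a u w"
    and sym: "\<lbrakk>u \<in> X; v \<in> X\<rbrakk> \<Longrightarrow> a u v = a v u"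
begin

lemmas closed = subspace_add[OF subspace] subspace_scale[OF subspace] subspace_0[OF subspace]
  subspace_diff[OF subspace] subspace_neg[OF subspace]

lemma add_right: "\<lbrakk>u \<in> X; v \<in> X; w \<in> X\<rbrakk> \<Longrightarrow> a w (u + v) = a w u + a w v"
  using add_left sym closed by metis

lemma scale_right: "\<lbrakk>u \<in> X; w \<in> X\<rbrakk> \<Longrightarrow> a w (c *\<^sub>R u) = c * a w u"
  using scale_left sym closed by metis

lemma diff_left: "\<lbrakk>u \<in> X; v \<in> X; w \<in> X\<rbrakk> \<Longrightarrow> a (u - v) w = a u w - a v w"
  using add_left[of u "- v" w] scale_left[of v w "-1"] closed by simp

lemma diff_right: "\<lbrakk>u \<in> X; v \<in> X; w \<in> X\<rbrakk> \<Longrightarrow> a w (u - v) = a w u - a w v"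
  using diff_left sym closed by metis

lemma sum_in: "(\<And>j. j \<in> J \<Longrightarrow> u j \<in> X) \<Longrightarrow> (\<Sum>j\<in>J. c j *\<^sub>R u j) \<in> X"
  by (intro subspace_sum[OF subspace] closed) auto

lemma zero_left: "v \<in> X \<Longrightarrow> a 0 v = 0"
  using scale_left[of v v 0] by simp

lemma sum_left':
  assumes "\<And>j. j \<in> J \<Longrightarrow> u j \<in> X" "v \<in> X"
  shows "a (\<Sum>j\<in>J. u j) v = (\<Sum>j\<in>J. a (u j) v)"
proof (cases "finite J")
  case True
  from True assms(1) show ?thesis
    by (induction J rule: finite_induct)
       (auto simp: zero_left add_left assms(2) subspace_sum[OF subspace])
qed (simp add: zero_left assms)

lemma sum_left:
  assumes "\<And>j. j \<in> J \<Longrightarrow> u j \<in> X" "v \<in> X"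
  shows "a (\<Sum>j\<in>J. c j *\<^sub>R u j) v = (\<Sum>j\<in>J. c j * a (u j) v)"
  using assms by (subst sum_left') (auto simp: closed scale_left)

lemma sum_right:
  assumes "\<And>j. j \<in> J \<Longrightarrow> u j \<in> X" "v \<in> X"
  shows "a v (\<Sum>j\<in>J. c j *\<^sub>R u j) = (\<Sum>j\<in>J. c j * a v (u j))"
  using sum_left[of J u v c] sym[OF sum_in[of J u c], of v] sym[of _ v] assms by simp

end

locale psd_form = bilinear_form +
  assumes nonneg: "u \<in> X \<Longrightarrow> 0 \<le> a u u"
begin

text \<open>Otherwise the form along the line \<open>v + t *\<^sub>R u\<close> would be an affine
  function of \<open>t\<close> with nonzero slope and would take negative values.\<close>

lemma null_left:
  assumes "u \<in> X" "v \<in> X" "a u u = 0"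
  shows "a u v = 0"
proof (rule ccontr)
  assume neq: "a u v \<noteq> 0"
  define t where "t = - (a v v + 1) / (2 * a u v)"
  have "a (v + t *\<^sub>R u) (v + t *\<^sub>R u) = a v v + 2 * t * a u v"
    using assms sym[of u v]
    by (simp add: add_left add_right scale_left scale_right closed algebra_simps)
  also have "\<dots> = -1" using neq by (simp add: t_def field_simps)
  finally show False using nonneg[of "v + t *\<^sub>R u"] assms by (simp add: closed)
qed

lemma null_right: "\<lbrakk>u \<in> X; v \<in> X; a u u = 0\<rbrakk> \<Longrightarrow> a v u = 0"
  using null_left sym by metis

text \<open>Gram-Schmidt for a semidefinite form. If the new direction \<open>d\<close> satisfies
  \<open>a d d = 0\<close>, it lies in the radical, so orthogonality to it is automatic whatever its
  coefficient.\<close>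

lemma projection_exists:
  assumes "finite B" "B \<subseteq> X" "x \<in> X"
  shows "\<exists>y\<in>span B. \<forall>z\<in>span B. a (x - y) z = 0"
  using assms
proof (induction B arbitrary: x rule: finite_induct)
  case empty
  then show ?case by (simp add: zero_left closed sym[of _ 0])
next
  case (insert b B)
  have sp: "span B \<subseteq> X" using insert.prems span_minimal[OF _ subspace] by auto
  obtain y where y: "y \<in> span B" "\<And>z. z \<in> span B \<Longrightarrow> a (x - y) z = 0"
    using insert.IH[of x] insert.prems by blast
  obtain b' where b': "b' \<in> span B" "\<And>z. z \<in> span B \<Longrightarrow> a (b - b') z = 0"
    using insert.IH[of b] insert.prems by blast
  define d where "d = b - b'"
  have X: "y \<in> X" "b' \<in> X" "b \<in> X" "d \<in> X" "x \<in> X"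
    using sp y b' insert.prems by (auto simp: d_def closed)
  define s where "s = a (x - y) d / a d d"
  define p where "p = y + s *\<^sub>R d"
  have dspan: "d \<in> span (insert b B)"
    unfolding d_def using b'(1) by (meson insertI1 span_base span_diff span_mono subsetD subset_insertI)
  have pspan: "p \<in> span (insert b B)"
    unfolding p_def using y(1) dspan by (meson span_add span_scale span_mono subsetD subset_insertI)
  have pd: "a (x - p) d = 0"
  proof (cases "a d d = 0")
    case True
    then show ?thesis using X null_right[of d "x - p"] by (simp add: p_def closed)
  next
    case False
    have "a (x - p) d = a (x - y) d - s * a d d"
      using X by (simp add: p_def diff_left add_left scale_left closed)
    then show ?thesis using False by (simp add: s_def)
  qed
  have pB: "a (x - p) z = 0" if z: "z \<in> span B" for z
  proof -
    have "z \<in> X" using z sp by auto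
    then have "a (x - p) z = a (x - y) z - s * a d z"
      using X by (simp add: p_def diff_left add_left scale_left closed)
    then show ?thesis using y(2)[OF z] b'(2)[OF z] by (simp add: d_def)
  qed
  have "a (x - p) z = 0" if zin: "z \<in> span (insert b B)" for z
  proof -
    obtain k where k: "z - k *\<^sub>R b \<in> span B" using zin unfolding span_breakdown_eq by blast
    define r where "r = z - k *\<^sub>R d"
    have r: "r \<in> span B"
    proof -
      have "r = (z - k *\<^sub>R b) + k *\<^sub>R b'" by (simp add: r_def d_def algebra_simps)
      then show ?thesis using k b'(1) by (simp add: span_add span_scale)
    qed
    have "z = r + k *\<^sub>R d" by (simp add: r_def)
    moreover have "r \<in> X" using r sp by auto
    ultimately have "a (x - p) z = a (x - p) r + k * a (x - p) d"
      using X by (simp add: add_right scale_right closed p_def)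
    then show ?thesis using pd pB[OF r] by simp
  qed
  then show ?case using pspan by blast
qed

lemma orthonormal_diff:
  fixes e :: "nat \<Rightarrow> 'a"
  assumes e: "\<And>i. i < N \<Longrightarrow> e i \<in> X"
    and on: "\<And>i j. i < N \<Longrightarrow> j < N \<Longrightarrow> a (e i) (e j) = (if i = j then 1 else 0)"
    and x: "x \<in> X" and j: "j < N"
  shows "a (x - (\<Sum>i<N. a x (e i) *\<^sub>R e i)) (e j) = 0"
proof -
  have "a (\<Sum>i<N. a x (e i) *\<^sub>R e i) (e j) = (\<Sum>i<N. a x (e i) * a (e i) (e j))"
    using e j by (intro sum_left) auto
  also have "\<dots> = (\<Sum>i<N. if i = j then a x (e i) else 0)"
    using j by (intro sum.cong) (auto simp: on)
  also have "\<dots> = a x (e j)" using j by simp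
  finally show ?thesis using x e j sum_in[of "{..<N}" e "\<lambda>i. a x (e i)"] by (simp add: diff_left)
qed

lemma orthonormal_square:
  fixes e :: "nat \<Rightarrow> 'a"
  assumes e: "\<And>i. i < N \<Longrightarrow> e i \<in> X"
    and on: "\<And>i j. i < N \<Longrightarrow> j < N \<Longrightarrow> a (e i) (e j) = (if i = j then 1 else 0)"
  shows "a (\<Sum>i<N. c i *\<^sub>R e i) (\<Sum>i<N. c i *\<^sub>R e i) = (\<Sum>i<N. (c i)\<^sup>2)"
proof -
  have "a (\<Sum>i<N. c i *\<^sub>R e i) (\<Sum>i<N. c i *\<^sub>R e i) = (\<Sum>i<N. c i * a (e i) (\<Sum>i<N. c i *\<^sub>R e i))"
    using e by (intro sum_left sum_in) auto
  also have "\<dots> = (\<Sum>i<N. c i * (\<Sum>j<N. c j * a (e i) (e j)))"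
    using e by (intro sum.cong refl) (subst sum_right, auto)
  also have "\<dots> = (\<Sum>i<N. c i * (\<Sum>j<N. if j = i then c j else 0))"
    by (intro sum.cong refl arg_cong[where f="(*) _"]) (auto simp: on)
  finally show ?thesis by (simp add: power2_eq_square)
qed

text \<open>Finitely many functionals that separate points up to the radical bound the length of
  every orthonormal system by \<open>card I\<close>. A system of greatest length is complete, since
  a remaining vector of positive square could be normalised and appended. This is the form in which
  finite dimension modulo the radical is used.\<close>

lemma orthonormal_basis_exists:
  assumes I: "finite I"
    and add: "\<And>i u v. \<lbrakk>i \<in> I; u \<in> X; v \<in> X\<rbrakk> \<Longrightarrow> f i (u + v) = f i u + f i v"
    and scale: "\<And>i u c. \<lbrakk>i \<in> I; u \<in> X\<rbrakk> \<Longrightarrow> f i (c *\<^sub>R u) = c * (f i u :: real)"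
    and sep: "\<And>u. \<lbrakk>u \<in> X; \<And>i. i \<in> I \<Longrightarrow> f i u = 0\<rbrakk> \<Longrightarrow> a u u = 0"
  obtains e :: "nat \<Rightarrow> 'a" and N where "\<And>i. i < N \<Longrightarrow> e i \<in> X"
    "\<And>i j. i < N \<Longrightarrow> j < N \<Longrightarrow> a (e i) (e j) = (if i = j then 1 else 0)"
    "\<And>x. \<lbrakk>x \<in> X; \<And>i. i < N \<Longrightarrow> a x (e i) = 0\<rbrakk> \<Longrightarrow> a x x = 0"
proof -
  define P where "P N e \<longleftrightarrow> (\<forall>i<N. e i \<in> X) \<and>
    (\<forall>i<N. \<forall>j<N. a (e i) (e j) = (if i = j then 1 else 0))" for N and e :: "nat \<Rightarrow> 'a"
  \<comment> \<open>A longer system would admit a nontrivial combination killed by every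
    \<open>f i\<close>, yet its square is the sum of the squared coefficients.\<close>
  have bound: "N \<le> card I" if P: "P N e" for N e
  proof (rule ccontr)
    assume "\<not> N \<le> card I"
    then obtain c where c: "\<exists>j<N. c j \<noteq> 0" "\<And>i. i \<in> I \<Longrightarrow> (\<Sum>j<N. c j * f i (e j)) = 0"
      using homogeneous_system_nontrivial[OF I, of "{..<N}" "\<lambda>i j. f i (e j)"] by auto
    define w where "w = (\<Sum>j<N. c j *\<^sub>R e j)"
    have f: "f i w = (\<Sum>j<N. c j * f i (e j))" if "i \<in> I" for i
    proof -
      have "f i (\<Sum>j<m. c j *\<^sub>R e j) = (\<Sum>j<m. c j * f i (e j))" if "m \<le> N" for m
        using that
      proof (induction m)
        case 0
        then show ?case using scale[OF \<open>i \<in> I\<close>, of 0 0] by (simp add: closed)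
      next
        case (Suc m)
        then have "e m \<in> X" "(\<Sum>j<m. c j *\<^sub>R e j) \<in> X" using P by (auto simp: P_def intro!: sum_in)
        then show ?case using Suc \<open>i \<in> I\<close> by (simp add: add scale closed)
      qed
      then show ?thesis by (simp add: w_def)
    qed
    have "w \<in> X" using P by (auto simp: P_def w_def intro!: sum_in)
    then have "a w w = 0" using sep f c(2) by simp
    moreover have "a w w = (\<Sum>j<N. (c j)\<^sup>2)"
      unfolding w_def using P by (intro orthonormal_square) (auto simp: P_def)
    ultimately show False using c(1) by (auto simp: sum_nonneg_eq_0_iff)
  qed
  define N where "N = (GREATEST N. \<exists>e. P N e)"
  have ex0: "\<exists>e. P 0 e" by (auto simp: P_def)
  have "\<exists>e. P N e"
    unfolding N_def by (rule GreatestI_nat[of _ 0 "card I"]) (use ex0 bound in auto)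
  then obtain e where e: "P N e" by auto
  have "a x x = 0" if x: "x \<in> X" "\<And>i. i < N \<Longrightarrow> a x (e i) = 0" for x
  proof (rule ccontr)
    assume ne: "a x x \<noteq> 0"
    then have pos: "a x x > 0" using nonneg[OF x(1)] by simp
    define y where "y = (1 / sqrt (a x x)) *\<^sub>R x"
    have eX: "\<And>i. i < N \<Longrightarrow> e i \<in> X" using e by (simp add: P_def)
    have y: "y \<in> X" unfolding y_def using x by (simp add: closed)
    have y1: "a y y = 1"
      using x(1) pos by (simp add: y_def scale_left scale_right closed)
    have y2: "\<And>i. i < N \<Longrightarrow> a y (e i) = 0" using x eX by (simp add: y_def scale_left)
    have y3: "\<And>i. i < N \<Longrightarrow> a (e i) y = 0" using y2 sym[OF y eX] by simp
    have "P (Suc N) (e(N := y))"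
      using e y y1 y2 y3 by (simp add: P_def less_Suc_eq)
    then have "Suc N \<le> N"
      unfolding N_def by (intro Greatest_le_nat[of _ _ "card I"]) (use bound in auto)
    then show False by simp
  qed
  then show thesis using that[of N e] e unfolding P_def by blast
qed

end

section \<open>Eigenvectors from a family with bounded Rayleigh quotient\<close>

lemma compact_box_functions:
  fixes L :: "nat \<Rightarrow> real set"
  assumes "\<And>i. compact (L i)"
  shows "compact {c. \<forall>i. c i \<in> L i}"
proof -
  have "compactin (product_topology (\<lambda>_. euclidean) UNIV) (PiE UNIV L)"
    using assms by (subst compactin_PiE) auto
  moreover have "PiE UNIV L = {c. \<forall>i. c i \<in> L i}" by auto
  ultimately show ?thesis by (simp add: euclidean_product_topology)
qed

text \<open>The greedy step: the next eigenvector maximises \<open>b\<close> on the \<open>a\<close>-unit sphere of the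
  \<open>a\<close>-orthogonal complement of the eigenvectors found so far.\<close>

lemma next_eigenvector:
  fixes X :: "'v::real_vector set" and g :: "nat \<Rightarrow> 'v"
  assumes a: "psd_form X a" and b: "psd_form X b"
    and ab: "\<And>u. \<lbrakk>u \<in> X; a u u = 0\<rbrakk> \<Longrightarrow> b u u = 0"
    and e: "\<And>i. i < N \<Longrightarrow> e i \<in> X"
    and on: "\<And>i j. i < N \<Longrightarrow> j < N \<Longrightarrow> a (e i) (e j) = (if i = j then 1 else 0)"
    and complete: "\<And>x. \<lbrakk>x \<in> X; \<And>i::nat. i < N \<Longrightarrow> a x (e i) = 0\<rbrakk> \<Longrightarrow> a x x = 0"
    and g: "\<And>j. j < m \<Longrightarrow> g j \<in> eigenspace X a b (\<nu> j)" "\<And>j. j < m \<Longrightarrow> 0 < \<nu> j"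
    and gon: "\<And>i j. i < m \<Longrightarrow> j < m \<Longrightarrow> a (g i) (g j) = (if i = j then 1 else 0)"
    and w: "w \<in> X" "\<And>j. j < m \<Longrightarrow> a w (g j) = 0" "0 < b w w" "a w w \<le> \<mu> * b w w" "0 < \<mu>"
  shows "\<exists>v \<tau>. v \<in> eigenspace X a b \<tau> \<and> 0 < \<tau> \<and> \<tau> \<le> \<mu> \<and> a v v = 1 \<and> (\<forall>j<m. a v (g j) = 0)"
proof -
  interpret a: psd_form X a by fact
  interpret b: psd_form X b by fact
  have gX: "g j \<in> X" if "j < m" for j using g(1)[OF that] by (auto simp: eigenspace_def)
  define Y where "Y = {x\<in>X. \<forall>j<m. a x (g j) = 0}"
  have Y: "subspace Y"
    unfolding subspace_def Y_def
    using gX by (auto simp: a.closed a.zero_left a.add_left a.scale_left)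
  have YX: "Y \<subseteq> X" by (auto simp: Y_def)
  have coords: "a (x - (\<Sum>i<N. a x (e i) *\<^sub>R e i)) (x - (\<Sum>i<N. a x (e i) *\<^sub>R e i)) = 0"
    if "x \<in> X" for x
    using that e a.orthonormal_diff[OF e on that] a.sum_in[of "{..<N}" e]
    by (intro complete) (auto simp: a.closed)
  define S where "S c = (\<Sum>i<N. c i *\<^sub>R e i)" for c
  have S: "S c \<in> X" for c unfolding S_def using e by (intro a.sum_in) auto
  \<comment> \<open>In both forms \<open>x\<close> may be replaced by its expansion in the
    \<open>e i\<close>: the difference is \<open>a\<close>-null, hence \<open>b\<close>-null by
    \<open>ab\<close>, and null vectors lie in the radicals.\<close>
  have repr: "a x z = a (S (\<lambda>i. a x (e i))) z \<and> b x z = b (S (\<lambda>i. a x (e i))) z"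
    if x: "x \<in> X" and z: "z \<in> X" for x z
  proof -
    let ?d = "x - S (\<lambda>i. a x (e i))"
    have d: "?d \<in> X" using S x by (simp add: a.closed)
    have "a ?d ?d = 0" using coords[OF x] by (simp add: S_def)
    then have "a ?d z = 0" "b ?d z = 0"
      using a.null_left[OF d z] b.null_left[OF d z] ab[OF d] by auto
    then show ?thesis using x z S by (simp add: a.diff_left b.diff_left)
  qed
  have repr2: "a x x = a (S (\<lambda>i. a x (e i))) (S (\<lambda>i. a x (e i)))"
      "b x x = b (S (\<lambda>i. a x (e i))) (S (\<lambda>i. a x (e i)))" if x: "x \<in> X" for x
    using repr[OF x x] repr[OF x S] a.sym[OF x S] b.sym[OF x S] by metis+
  \<comment> \<open>Coordinates of the \<open>a\<close>-unit sphere of \<open>Y\<close>. Forcing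
    zero beyond \<open>N\<close> puts them into a product of compact intervals, which is compact by
    Tychonoff's theorem.\<close>
  define K where "K = {c. (\<forall>i. c i \<in> (if i < N then {-1..1} else {0::real})) \<and> (\<Sum>i<N. (c i)\<^sup>2) = 1
      \<and> (\<forall>j\<in>{..<m}. (\<Sum>i<N. c i * a (e i) (g j)) = 0)}"
  define q where "q c = (\<Sum>i<N. \<Sum>j<N. c i * c j * b (e i) (e j))" for c
  have [continuous_intros]: "continuous_on UNIV (\<lambda>c::nat\<Rightarrow>real. c i)" for i
    by (rule continuous_on_product_coordinates)
  have cK: "compact K"
  proof -
    have "K = {c. \<forall>i. c i \<in> (if i < N then {-1..1} else {0::real})} \<inter>
        ({c. (\<Sum>i<N. (c i)\<^sup>2) = 1} \<inter> (\<Inter>j\<in>{..<m}. {c. (\<Sum>i<N. c i * a (e i) (g j)) = 0}))"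
      by (auto simp: K_def)
    moreover have "closed {c::nat\<Rightarrow>real. (\<Sum>i<N. (c i)\<^sup>2) = 1}"
      by (intro closed_Collect_eq continuous_intros)
    moreover have "closed (\<Inter>j\<in>{..<m}. {c. (\<Sum>i<N. c i * a (e i) (g j)) = 0})"
      by (intro closed_INT ballI closed_Collect_eq continuous_intros)
    moreover have "compact {c. \<forall>i. c i \<in> (if i < N then {-1..1} else {0::real})}"
      by (intro compact_box_functions) auto
    ultimately show ?thesis by (simp only:) (rule compact_Int_closed[OF _ closed_Int])
  qed
  have cq: "continuous_on K q"
    unfolding q_def by (rule continuous_on_subset[of UNIV]) (auto intro!: continuous_intros)
  have Sa: "a (S c) (S c) = (\<Sum>i<N. (c i)\<^sup>2)" for c
    unfolding S_def using e on by (intro a.orthonormal_square) auto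
  have Sb: "b (S c) (S c) = q c" for c
  proof -
    have "b (S c) (S c) = (\<Sum>i<N. c i * b (e i) (S c))"
      unfolding S_def using e by (intro b.sum_left b.sum_in) auto
    also have "\<dots> = (\<Sum>i<N. c i * (\<Sum>j<N. c j * b (e i) (e j)))"
      unfolding S_def using e by (intro sum.cong refl) (subst b.sum_right, auto)
    finally show ?thesis by (simp add: q_def sum_distrib_left mult_ac)
  qed
  have Sg: "a (S c) (g j) = (\<Sum>i<N. c i * a (e i) (g j))" if "j < m" for c j
    unfolding S_def using e gX[OF that] by (intro a.sum_left) auto
  have unit: "\<exists>c\<in>K. b x x = a x x * q c" if x: "x \<in> Y" "a x x > 0" for x
  proof -
    define r where "r = sqrt (a x x)"
    have r: "r > 0" "r\<^sup>2 = a x x" using x by (auto simp: r_def)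
    define c where "c i = (if i < N then a x (e i) / r else 0)" for i
    have xX: "x \<in> X" using x YX by auto
    have Sc: "S c = (1 / r) *\<^sub>R S (\<lambda>i. a x (e i))"
      by (auto simp: S_def c_def scaleR_sum_right intro!: sum.cong)
    have 1: "a (S c) (S c) = a x x / r\<^sup>2"
      unfolding Sc using repr2(1)[OF xX] S by (simp add: a.scale_left a.scale_right a.closed power2_eq_square)
    have 2: "b (S c) (S c) = b x x / r\<^sup>2"
      unfolding Sc using repr2(2)[OF xX] S by (simp add: b.scale_left b.scale_right b.closed power2_eq_square)
    have 3: "a (S c) (g j) = 0" if "j < m" for j
      unfolding Sc using repr[OF xX gX[OF that]] S gX[OF that] x(1) that by (simp add: a.scale_left Y_def)
    have s1: "(\<Sum>i<N. (c i)\<^sup>2) = 1" using 1 Sa[of c] r x(2) by simp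
    have "\<bar>c i\<bar> \<le> 1" if "i < N" for i
    proof -
      have "(c i)\<^sup>2 \<le> (\<Sum>i<N. (c i)\<^sup>2)" using that by (intro member_le_sum) auto
      then show ?thesis using s1 by (simp add: abs_square_le_1)
    qed
    then have "c i \<in> (if i < N then {-1..1} else {0})" for i
      by (cases "i < N") (auto simp: abs_le_iff minus_le_iff[of _ 1], auto simp: c_def)
    then have "c \<in> K" using s1 3 Sg by (simp add: K_def)
    moreover have "b x x = a x x * q c" using 2 Sb[of c] r x(2) by (simp add: field_simps)
    ultimately show ?thesis by blast
  qed
  have wY: "w \<in> Y" using w by (auto simp: Y_def)
  have aw: "a w w > 0" using a.nonneg[OF w(1)] ab[OF w(1)] w(3) by fastforce
  obtain c0 where c0: "c0 \<in> K" "b w w = a w w * q c0" using unit[OF wY aw] by auto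
  obtain c where c: "c \<in> K" "\<And>c'. c' \<in> K \<Longrightarrow> q c' \<le> q c"
    using continuous_attains_sup[OF cK _ cq] c0 by blast
  define \<beta> where "\<beta> = q c"
  define v where "v = S c"
  have "a w w \<le> \<mu> * (a w w * q c0)" using w(4) c0(2) by simp
  then have "1 \<le> \<mu> * q c0" using aw by (simp add: field_simps)
  also have "\<dots> \<le> \<mu> * \<beta>" using c(2)[OF c0(1)] w(5) by (simp add: \<beta>_def)
  finally have mb: "1 \<le> \<mu> * \<beta>" .
  then have \<beta>: "\<beta> > 0" using w(5) by (metis less_le_not_le linorder_le_less_linear mult_nonneg_nonpos order.strict_implies_order zero_less_one order_trans)
  have vY: "v \<in> Y" using c(1) S Sg by (auto simp: v_def Y_def K_def)
  have avv: "a v v = 1" using c(1) Sa by (auto simp: v_def K_def)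
  have bvv: "b v v = \<beta>" using Sb by (simp add: v_def \<beta>_def)
  \<comment> \<open>Maximality of \<open>\<beta>\<close> makes this form semidefinite on
    \<open>Y\<close>, and it vanishes at \<open>v\<close>. So \<open>v\<close> lies in its radical,
    which is the eigenvalue equation tested with \<open>Y\<close>.\<close>
  define d where "d x y = \<beta> * a x y - b x y" for x y
  have bnd: "0 \<le> d x x" if x: "x \<in> Y" for x
  proof (cases "a x x > 0")
    case True
    then obtain c' where "c' \<in> K" "b x x = a x x * q c'" using unit[OF x] by auto
    then show ?thesis using c(2)[of c'] True by (simp add: d_def \<beta>_def algebra_simps)
  next
    case False
    then have "a x x = 0" "b x x = 0" using x YX a.nonneg[of x] ab[of x] by auto
    then show ?thesis by (simp add: d_def)
  qed
  interpret d: psd_form Y d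
    using Y YX bnd
  proof unfold_locales
    fix u v assume "u \<in> Y" "v \<in> Y"
    then show "d u v = d v u" using a.sym[of u v] b.sym[of u v] YX by (simp add: d_def subset_eq)
  qed (auto simp: d_def a.add_left b.add_left a.scale_left b.scale_left subset_eq algebra_simps)
  have dv: "d v v = 0" using avv bvv by (simp add: d_def)
  have vX: "v \<in> X" using vY YX by auto
  \<comment> \<open>Since the earlier eigenvalues are positive, \<open>a\<close>-orthogonality to
    their eigenvectors is also \<open>b\<close>-orthogonality. Both sides of the eigenvalue equation
    then vanish on the span of the \<open>g j\<close>, so the equation extends from \<open>Y\<close>
    to \<open>X\<close>.\<close>
  have bg: "b v (g j) = 0" if j: "j < m" for j
  proof -
    have "a (g j) v = \<nu> j * b (g j) v" using g(1)[OF j] vX by (auto simp: eigenspace_def)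
    moreover have "a (g j) v = 0" using vY a.sym[OF vX gX[OF j]] j by (simp add: Y_def)
    ultimately show ?thesis using g(2)[OF j] b.sym[OF vX gX[OF j]] by simp
  qed
  have eig: "a v x = (1 / \<beta>) * b v x" if x: "x \<in> X" for x
  proof -
    define s where "s = (\<Sum>j<m. a x (g j) *\<^sub>R g j)"
    have s: "s \<in> X" unfolding s_def using gX by (intro a.sum_in) auto
    have "x - s \<in> Y"
      using a.orthonormal_diff[OF gX gon x] x s by (auto simp: Y_def a.closed s_def)
    then have "d v (x - s) = 0" using d.null_left[OF vY _ dv] by auto
    moreover have "a v s = 0"
      unfolding s_def using gX vX vY by (subst a.sum_right) (auto simp: Y_def)
    moreover have "b v s = 0"
      unfolding s_def using gX vX bg by (subst b.sum_right) auto
    ultimately have "\<beta> * a v x = b v x"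
      using x s vX by (simp add: d_def a.diff_right b.diff_right)
    then show ?thesis using \<beta> by (simp add: field_simps)
  qed
  have "v \<in> eigenspace X a b (1 / \<beta>)" using eig vX by (auto simp: eigenspace_def)
  moreover have "1 / \<beta> \<le> \<mu>" using mb \<beta> by (simp add: field_simps)
  ultimately show ?thesis using \<beta> avv vY by (intro exI[of _ v] exI[of _ "1/\<beta>"]) (auto simp: Y_def)
qed

text \<open>Upper half of the min-max principle. In a \<open>k\<close>-dimensional family some
  combination is \<open>a\<close>-orthogonal to any \<open>m < k\<close> eigenvectors already found,
  and the greedy step converts it into one more eigenvector with eigenvalue at most
  \<open>\<mu>\<close>. The functionals \<open>f\<close> supply finite dimension modulo the
  radical.\<close>

proposition eigenvalue_count_ge:
  fixes X :: "'v::real_vector set"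
  assumes a: "psd_form X a" and b: "psd_form X b"
    and ab: "\<And>u. \<lbrakk>u \<in> X; a u u = 0\<rbrakk> \<Longrightarrow> b u u = 0"
    and Z: "\<And>u. \<lbrakk>u \<in> X; u \<in> Z\<rbrakk> \<Longrightarrow> a u u = 0"
    and I: "finite I"
    and f_add: "\<And>i u v. \<lbrakk>i \<in> I; u \<in> X; v \<in> X\<rbrakk> \<Longrightarrow> f i (u + v) = f i u + f i v"
    and f_scale: "\<And>i u c. \<lbrakk>i \<in> I; u \<in> X\<rbrakk> \<Longrightarrow> f i (c *\<^sub>R u) = c * (f i u :: real)"
    and f_sep: "\<And>u. \<lbrakk>u \<in> X; \<And>i. i \<in> I \<Longrightarrow> f i u = 0\<rbrakk> \<Longrightarrow> a u u = 0"
    and \<mu>: "0 < \<mu>"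
    and w: "\<And>j. j < k \<Longrightarrow> w j \<in> X"
    and w_bound: "\<And>c. \<exists>j<k. c j \<noteq> 0 \<Longrightarrow>
       0 < b (\<Sum>j<k. c j *\<^sub>R w j) (\<Sum>j<k. c j *\<^sub>R w j) \<and>
       a (\<Sum>j<k. c j *\<^sub>R w j) (\<Sum>j<k. c j *\<^sub>R w j) \<le> \<mu> * b (\<Sum>j<k. c j *\<^sub>R w j) (\<Sum>j<k. c j *\<^sub>R w j)"
  shows "enat k \<le> eigenvalue_count Z X a b \<mu>"
proof -
  interpret a: psd_form X a by fact
  interpret b: psd_form X b by fact
  obtain e :: "nat \<Rightarrow> 'v" and N where e: "\<And>i. i < N \<Longrightarrow> e i \<in> X"
    "\<And>i j. i < N \<Longrightarrow> j < N \<Longrightarrow> a (e i) (e j) = (if i = j then 1 else 0)"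
    "\<And>x. \<lbrakk>x \<in> X; \<And>i. i < N \<Longrightarrow> a x (e i) = 0\<rbrakk> \<Longrightarrow> a x x = 0"
    by (rule a.orthonormal_basis_exists[where f=f and I=I]) (use I f_add f_scale f_sep in blast)+
  define Q where "Q m g \<nu> \<longleftrightarrow> (\<forall>i<m. g i \<in> eigenspace X a b (\<nu> i)) \<and> (\<forall>i<m. 0 < \<nu> i) \<and>
      (\<forall>i<m. \<nu> i \<le> \<mu>) \<and> (\<forall>i<m. \<forall>j<m. a (g i) (g j) = (if i = j then 1 else 0))"
    for m and g :: "nat \<Rightarrow> 'v" and \<nu>
  have "\<exists>g \<nu>. Q m g \<nu>" if "m \<le> k" for m
    using that
  proof (induction m)
    case 0
    then show ?case by (simp add: Q_def)
  next
    case (Suc m)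
    then obtain g \<nu> where Q: "Q m g \<nu>" by auto
    then have g: "\<And>i. i < m \<Longrightarrow> g i \<in> eigenspace X a b (\<nu> i)" "\<And>i. i < m \<Longrightarrow> 0 < \<nu> i"
      "\<And>i j. i < m \<Longrightarrow> j < m \<Longrightarrow> a (g i) (g j) = (if i = j then 1 else 0)"
      by (simp_all add: Q_def)
    have gX: "g j \<in> X" if "j < m" for j using g(1)[OF that] by (auto simp: eigenspace_def)
    \<comment> \<open>There are \<open>k\<close> unknown coefficients and \<open>m < k\<close>
      orthogonality conditions.\<close>
    obtain c where c: "\<exists>j<k. c j \<noteq> 0" "\<And>i. i < m \<Longrightarrow> (\<Sum>j<k. c j * a (w j) (g i)) = 0"
      using homogeneous_system_nontrivial[of "{..<m}" "{..<k}" "\<lambda>i j. a (w j) (g i)"] Suc.prems by auto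
    define x where "x = (\<Sum>j<k. c j *\<^sub>R w j)"
    have x: "x \<in> X" unfolding x_def using w by (intro a.sum_in) auto
    have xg: "a x (g i) = 0" if "i < m" for i
      unfolding x_def using w gX[OF that] c(2)[OF that] by (subst a.sum_left) auto
    have xb: "0 < b x x" "a x x \<le> \<mu> * b x x" using w_bound[OF c(1)] by (auto simp: x_def)
    obtain v \<tau> where v: "v \<in> eigenspace X a b \<tau>" "0 < \<tau>" "\<tau> \<le> \<mu>" "a v v = 1" "\<forall>j<m. a v (g j) = 0"
      using next_eigenvector[OF a b ab e g x xg xb \<mu>] by blast
    have "v \<in> X" using v(1) by (auto simp: eigenspace_def)
    then have v': "\<forall>j<m. a (g j) v = 0" using v(5) a.sym[OF _ gX] by simp
    have "Q (Suc m) (g(m := v)) (\<nu>(m := \<tau>))"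
      using v v' Q unfolding Q_def by (simp add: less_Suc_eq)
    then show ?case by blast
  qed
  from this[OF order_refl] obtain g \<nu> where "Q k g \<nu>" by blast
  then have g: "\<And>i. i < k \<Longrightarrow> g i \<in> eigenspace X a b (\<nu> i)"
      "\<And>i. i < k \<Longrightarrow> 0 < \<nu> i" "\<And>i. i < k \<Longrightarrow> \<nu> i \<le> \<mu>"
      "\<And>i j. i < k \<Longrightarrow> j < k \<Longrightarrow> a (g i) (g j) = (if i = j then 1 else 0)"
    by (simp_all add: Q_def)
  have gX: "g j \<in> X" if "j < k" for j using g(1)[OF that] by (auto simp: eigenspace_def)
  have inj: "inj_on g {..<k}"
    using g(4) by (intro inj_onI) (metis lessThan_iff zero_neq_one)
  define M where "M = \<nu> ` {..<k}"
  \<comment> \<open>The count adds multiplicities over distinct eigenvalues, so the eigenvectors are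
    sorted into groups with a common eigenvalue.\<close>
  define J where "J t = {j. j < k \<and> \<nu> j = t}" for t
  \<comment> \<open>Pairing with \<open>a\<close> reads off each coefficient of a combination. This
    gives independence of a group and also a trivial intersection of its span with \<open>Z\<close>,
    whose elements in \<open>X\<close> are \<open>a\<close>-null.\<close>
  have coeff: "(\<Sum>v\<in>g ` J t. h v *\<^sub>R v) \<in> X \<and> (\<forall>v\<in>g ` J t. a (\<Sum>v\<in>g ` J t. h v *\<^sub>R v) v = h v)" for t h
  proof -
    have gJ: "\<And>v. v \<in> g ` J t \<Longrightarrow> v \<in> X" using gX by (auto simp: J_def)
    have "a (\<Sum>v\<in>g ` J t. h v *\<^sub>R v) u = h u" if u: "u \<in> g ` J t" for u
    proof -
      have "a (\<Sum>v\<in>g ` J t. h v *\<^sub>R v) u = (\<Sum>v\<in>g ` J t. h v * a v u)"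
        using gJ u by (intro a.sum_left) auto
      also have "\<dots> = (\<Sum>v\<in>g ` J t. if v = u then h v else 0)"
        using u by (intro sum.cong) (auto simp: J_def g(4) split: if_splits)
      also have "\<dots> = h u" using u by (simp add: J_def)
      finally show ?thesis .
    qed
    then show ?thesis using gJ by (auto intro!: a.sum_in)
  qed
  have dm: "enat (card (J t)) \<le> dim_modulo Z (eigenspace X a b t)" for t
  proof -
    have fin: "finite (g ` J t)" by (simp add: J_def)
    have "independent (g ` J t)"
    proof
      assume "dependent (g ` J t)"
      then obtain h where h: "\<exists>v\<in>g ` J t. h v \<noteq> 0" "(\<Sum>v\<in>g ` J t. h v *\<^sub>R v) = 0"
        using dependent_finite[OF fin] by auto
      then obtain v where v: "v \<in> g ` J t" "h v \<noteq> 0" by auto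
      then have "v \<in> X" using gX by (auto simp: J_def)
      then show False using coeff[of h t] h(2) v by (auto simp: a.zero_left)
    qed
    moreover have "span (g ` J t) \<inter> Z \<subseteq> {0}"
    proof
      fix x assume x: "x \<in> span (g ` J t) \<inter> Z"
      then obtain h where h: "x = (\<Sum>v\<in>g ` J t. h v *\<^sub>R v)" using span_finite[OF fin] by auto
      have xX: "x \<in> X" using coeff h by auto
      then have "a x x = 0" using Z x by auto
      then have "h v = 0" if "v \<in> g ` J t" for v
        using coeff[of h t] that h a.null_left[OF xX, of v] gX by (auto simp: J_def)
      then show "x \<in> {0}" by (simp add: h)
    qed
    moreover have "g ` J t \<subseteq> eigenspace X a b t" using g(1) by (auto simp: J_def)
    moreover have "card (g ` J t) = card (J t)"
      using inj by (intro card_image) (auto intro: inj_on_subset simp: J_def)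
    ultimately show ?thesis
      unfolding dim_modulo_def using fin by (intro SUP_upper2[of "g ` J t"]) auto
  qed
  have "k = card (\<Union>t\<in>M. J t)"
  proof -
    have "(\<Union>t\<in>M. J t) = {..<k}" by (auto simp: M_def J_def)
    then show ?thesis by simp
  qed
  also have "\<dots> = (\<Sum>t\<in>M. card (J t))"
    by (intro card_UN_disjoint) (auto simp: M_def J_def)
  finally have "enat k = (\<Sum>t\<in>M. enat (card (J t)))" by (simp flip: of_nat_eq_enat)
  also have "\<dots> \<le> (\<Sum>t\<in>M. dim_modulo Z (eigenspace X a b t))" by (intro sum_mono dm)
  also have "\<dots> \<le> eigenvalue_count Z X a b \<mu>"
    unfolding eigenvalue_count_def using g by (intro SUP_upper) (auto simp: M_def)
  finally show ?thesis .
qed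

section \<open>Families with bounded Rayleigh quotient from an eigenvalue count\<close>

lemma enat_le_sum_split:
  fixes d :: "'i \<Rightarrow> enat"
  assumes "finite M" "enat k \<le> (\<Sum>i\<in>M. d i)"
  shows "\<exists>m. (\<forall>i\<in>M. enat (m i) \<le> d i) \<and> k \<le> (\<Sum>i\<in>M. m i)"
proof (cases "\<exists>i\<in>M. d i = \<infinity>")
  case True
  then obtain i where i: "i \<in> M" "d i = \<infinity>" by auto
  then show ?thesis using assms(1)
    by (intro exI[of _ "\<lambda>j. if j = i then k else 0"]) (auto simp: zero_enat_def[symmetric])
next
  case False
  then have d: "\<forall>i\<in>M. enat (the_enat (d i)) = d i" by auto
  then have "(\<Sum>i\<in>M. d i) = (\<Sum>i\<in>M. enat (the_enat (d i)))" by (intro sum.cong) auto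
  also have "\<dots> = enat (\<Sum>i\<in>M. the_enat (d i))" by (simp flip: of_nat_eq_enat)
  finally show ?thesis using d assms(2) by (intro exI[of _ "\<lambda>i. the_enat (d i)"]) auto
qed

text \<open>A supremum that reaches \<open>Suc m\<close> exceeds \<open>m\<close>, hence so does
  some member, and a member above \<open>m\<close> is at least \<open>Suc m\<close>. Positivity of
  \<open>k\<close> excludes an empty index set.\<close>

lemma enat_le_SUP:
  assumes "enat k \<le> (SUP x\<in>A. f x)" "k > 0"
  shows "\<exists>x\<in>A. enat k \<le> f x"
proof -
  obtain m where k: "k = Suc m" using assms(2) by (cases k) auto
  then have "enat m < (SUP x\<in>A. f x)" using assms(1) by (simp add: Suc_ile_eq)
  then obtain x where "x \<in> A" "enat m < f x" by (auto simp: less_SUP_iff)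
  then show ?thesis using k by (auto simp: Suc_ile_eq)
qed

lemma dim_modulo_witness:
  assumes "enat m \<le> dim_modulo Z E"
  shows "\<exists>B. finite B \<and> B \<subseteq> E \<and> independent B \<and> span B \<inter> Z \<subseteq> {0} \<and> m \<le> card B"
proof (cases "m = 0")
  case True
  then show ?thesis by (intro exI[of _ "{}"]) (auto simp: independent_empty)
next
  case False
  then show ?thesis using enat_le_SUP assms unfolding dim_modulo_def by fastforce
qed

text \<open>Lower half of the min-max principle. The count is a supremum over finite sets of
  eigenvalues and of independent eigenvectors, so \<open>k\<close> eigenvectors can be drawn from
  it. Symmetry makes distinct eigenspaces \<open>b\<close>-orthogonal, and the Rayleigh quotient of
  a combination is then a weighted average of eigenvalues at most \<open>\<mu>\<close>.\<close>

proposition eigenvalue_count_family: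
  fixes X :: "'v::real_vector set"
  assumes a: "bilinear_form X a" and b: "psd_form X b"
    and null: "\<And>u. \<lbrakk>u \<in> X; b u u = 0\<rbrakk> \<Longrightarrow> u \<in> Z"
    and count: "enat k \<le> eigenvalue_count Z X a b \<mu>" and k: "k > 0"
  obtains u where "\<And>j. j < k \<Longrightarrow> u j \<in> X"
    "\<And>c. \<exists>j<k. c j \<noteq> 0 \<Longrightarrow>
       0 < b (\<Sum>j<k. c j *\<^sub>R u j) (\<Sum>j<k. c j *\<^sub>R u j) \<and>
       a (\<Sum>j<k. c j *\<^sub>R u j) (\<Sum>j<k. c j *\<^sub>R u j) \<le> \<mu> * b (\<Sum>j<k. c j *\<^sub>R u j) (\<Sum>j<k. c j *\<^sub>R u j)"
proof -
  interpret a: bilinear_form X a by fact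
  interpret b: psd_form X b by fact
  obtain M where M: "finite M" "M \<subseteq> {0<..\<mu>}"
    and "enat k \<le> (\<Sum>\<nu>\<in>M. dim_modulo Z (eigenspace X a b \<nu>))"
    using enat_le_SUP[OF count[unfolded eigenvalue_count_def] k] by blast
  then obtain m where m: "\<And>\<nu>. \<nu> \<in> M \<Longrightarrow> enat (m \<nu>) \<le> dim_modulo Z (eigenspace X a b \<nu>)"
    "k \<le> (\<Sum>\<nu>\<in>M. m \<nu>)"
    using enat_le_sum_split by metis
  have "\<forall>\<nu>. \<exists>B. \<nu> \<in> M \<longrightarrow> finite B \<and> B \<subseteq> eigenspace X a b \<nu> \<and> independent B \<and> span B \<inter> Z \<subseteq> {0} \<and> m \<nu> \<le> card B"
    using dim_modulo_witness m(1) by meson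
  then obtain B where B: "\<And>\<nu>. \<nu> \<in> M \<Longrightarrow> finite (B \<nu>) \<and> B \<nu> \<subseteq> eigenspace X a b \<nu> \<and>
      independent (B \<nu>) \<and> span (B \<nu>) \<inter> Z \<subseteq> {0} \<and> m \<nu> \<le> card (B \<nu>)" by metis
  \<comment> \<open>The chosen bases may contain more than \<open>k\<close> vectors altogether; any
    \<open>k\<close> of the pairs are kept, and the coefficients are extended by zero to the
    rest.\<close>
  define J where "J = Sigma M B"
  have "k \<le> card J"
    unfolding J_def using M B m(2) sum_mono[of M m "\<lambda>\<nu>. card (B \<nu>)"] by (subst card_SigmaI) auto
  then obtain J' where J': "J' \<subseteq> J" "card J' = k" "finite J'"
    by (meson obtain_subset_with_card_n)
  then obtain h where h: "bij_betw h {..<k} J'"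
    using ex_bij_betw_nat_finite[of J'] by (auto simp: atLeast0LessThan)
  define u where "u j = snd (h j)" for j
  have hJ: "h j \<in> J" if "j < k" for j using h J' that by (auto simp: bij_betw_def)
  have EX: "eigenspace X a b \<nu> \<subseteq> X" for \<nu> by (auto simp: eigenspace_def)
  have uX: "u j \<in> X" if "j < k" for j using hJ[OF that] B EX by (fastforce simp: u_def J_def)
  have main: "0 < b w w \<and> a w w \<le> \<mu> * b w w"
    if c: "\<exists>j<k. c j \<noteq> 0" and w_def: "w = (\<Sum>j<k. c j *\<^sub>R u j)" for c w
  proof -
    define c' where "c' p = (if p \<in> J' then c (inv_into {..<k} h p) else 0)" for p
    have ch: "c' (h j) = c j" if "j < k" for j
      using h that by (auto simp: c'_def bij_betw_def inv_into_f_f)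
    \<comment> \<open>The component of the combination that belongs to the eigenvalue
      \<open>\<nu>\<close>.\<close>
    define y where "y \<nu> = (\<Sum>v\<in>B \<nu>. c' (\<nu>, v) *\<^sub>R v)" for \<nu>
    have fJ: "finite J" unfolding J_def using M B by auto
    have "w = (\<Sum>p\<in>J'. c' p *\<^sub>R snd p)"
      unfolding w_def u_def by (subst sum.reindex_bij_betw[OF h, symmetric]) (auto simp: ch)
    also have "\<dots> = (\<Sum>p\<in>J. c' p *\<^sub>R snd p)"
      using fJ J' by (intro sum.mono_neutral_left) (auto simp: c'_def)
    also have "\<dots> = (\<Sum>\<nu>\<in>M. y \<nu>)"
      unfolding J_def y_def using M B by (subst sum.Sigma) (auto simp: case_prod_unfold)
    finally have w: "w = (\<Sum>\<nu>\<in>M. y \<nu>)" .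
    have yX: "y \<nu> \<in> X" if "\<nu> \<in> M" for \<nu>
      unfolding y_def using B[OF that] EX by (intro a.sum_in) auto
    have yE: "a (y \<nu>) x = \<nu> * b (y \<nu>) x" if "\<nu> \<in> M" "x \<in> X" for \<nu> x
    proof -
      have BX: "\<And>v. v \<in> B \<nu> \<Longrightarrow> v \<in> X" using B[OF that(1)] EX by auto
      have BE: "a v x = \<nu> * b v x" if "v \<in> B \<nu>" for v
        using that B[OF \<open>\<nu> \<in> M\<close>] \<open>x \<in> X\<close> by (auto simp: eigenspace_def)
      show ?thesis unfolding y_def using BX BE that
        by (simp add: a.sum_left b.sum_left sum_distrib_left mult_ac)
    qed
    \<comment> \<open>Both eigenvalue equations evaluate the same number
      \<open>a (y \<nu>) (y \<nu>')\<close>, with different factors.\<close>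
    have orth: "b (y \<nu>) (y \<nu>') = 0" if "\<nu> \<in> M" "\<nu>' \<in> M" "\<nu> \<noteq> \<nu>'" for \<nu> \<nu>'
    proof -
      have "\<nu> * b (y \<nu>) (y \<nu>') = \<nu>' * b (y \<nu>) (y \<nu>')"
        using yE[OF that(1) yX[OF that(2)]] yE[OF that(2) yX[OF that(1)]]
          a.sym[OF yX yX] b.sym[OF yX yX] that by metis
      then show ?thesis using that by simp
    qed
    have wX: "w \<in> X" unfolding w using yX by (intro subspace_sum a.subspace) auto
    have bw: "b (y \<nu>) w = b (y \<nu>) (y \<nu>)" if "\<nu> \<in> M" for \<nu>
    proof -
      have "b (y \<nu>) w = (\<Sum>\<nu>'\<in>M. b (y \<nu>') (y \<nu>))"
        using b.sym[OF yX[OF that] wX] yX that unfolding w by (simp add: b.sum_left')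
      also have "\<dots> = (\<Sum>\<nu>'\<in>M. if \<nu>' = \<nu> then b (y \<nu>) (y \<nu>) else 0)"
        using that orth by (intro sum.cong) auto
      finally show ?thesis using that M by simp
    qed
    have "b w w = (\<Sum>\<nu>\<in>M. b (y \<nu>) w)"
      by (subst (1) w, subst b.sum_left') (use yX wX in auto)
    then have bww: "b w w = (\<Sum>\<nu>\<in>M. b (y \<nu>) (y \<nu>))" using bw by simp
    have "a w w = (\<Sum>\<nu>\<in>M. a (y \<nu>) w)"
      by (subst (1) w, subst a.sum_left') (use yX wX in auto)
    then have aww: "a w w = (\<Sum>\<nu>\<in>M. \<nu> * b (y \<nu>) (y \<nu>))" using bw yE wX by simp
    have le: "a w w \<le> \<mu> * b w w"
      unfolding aww bww sum_distrib_left
      using M yX b.nonneg by (intro sum_mono mult_right_mono) auto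
    obtain j where j: "j < k" "c j \<noteq> 0" using c by auto
    obtain \<nu> v where hj: "h j = (\<nu>, v)" by fastforce
    have \<nu>: "\<nu> \<in> M" "v \<in> B \<nu>" "c' (\<nu>, v) \<noteq> 0" using hJ[OF j(1)] ch[OF j(1)] j hj by (auto simp: J_def)
    \<comment> \<open>A component with a nonzero coefficient is nonzero by independence and outside
      \<open>Z\<close> because the span of its basis meets \<open>Z\<close> trivially. By
      \<open>null\<close> its \<open>b\<close>-square is positive, which makes \<open>b w w\<close>
      strictly positive.\<close>
    have "y \<nu> \<noteq> 0"
    proof
      assume "y \<nu> = 0"
      then have "dependent (B \<nu>)"
        using \<nu> B[OF \<nu>(1)] by (subst dependent_finite) (auto simp: y_def intro!: exI[of _ "\<lambda>v. c' (\<nu>, v)"])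
      then show False using B \<nu> by auto
    qed
    moreover have "y \<nu> \<in> span (B \<nu>)"
      unfolding y_def by (intro span_sum span_scale span_base)
    ultimately have "y \<nu> \<notin> Z" using B[OF \<nu>(1)] by auto
    then have "b (y \<nu>) (y \<nu>) > 0" using null[OF yX[OF \<nu>(1)]] b.nonneg[OF yX[OF \<nu>(1)]] by fastforce
    then have "b w w > 0"
      unfolding bww using M \<nu>(1) yX b.nonneg by (intro sum_pos2[of _ \<nu>]) auto
    then show ?thesis using le by simp
  qed
  show thesis by (rule that[OF uX main[OF _ refl]])
qed

section \<open>Continuously differentiable functions and test functions\<close>

text \<open>A globally continuously differentiable function together with its gradient field. Test
  functions, quadratics and barycentric coordinates all have this form, so integration by parts is
  proved once for all of them.\<close>

definition C1_grad :: "('a::euclidean_space \<Rightarrow> real) \<Rightarrow> ('a \<Rightarrow> 'a) \<Rightarrow> bool" where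
  "C1_grad f G \<longleftrightarrow> (\<forall>x. GDERIV f x :> G x) \<and> continuous_on UNIV G"

lemma GDERIV_unique:
  fixes f :: "'a::euclidean_space \<Rightarrow> real"
  assumes "GDERIV f x :> D" "GDERIV f x :> D'"
  shows "D = D'"
proof -
  have "(\<lambda>h. h \<bullet> D) = (\<lambda>h. h \<bullet> D')"
    using assms unfolding gderiv_def by (rule has_derivative_unique)
  then have "\<forall>h. h \<bullet> D = h \<bullet> D'" by (simp add: fun_eq_iff)
  then show ?thesis by (simp only: vector_eq_ldot)
qed

lemma grad_eq:
  assumes "GDERIV f x :> D"
  shows "grad f x = D"
  unfolding grad_def using assms by (rule the_equality[where P="\<lambda>D. GDERIV f x :> D"]) (rule GDERIV_unique[OF _ assms])

lemma C1_grad_GDERIV: "C1_grad f G \<Longrightarrow> GDERIV f x :> G x"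
  by (simp add: C1_grad_def)

lemma C1_grad_has_derivative: "C1_grad f G \<Longrightarrow> (f has_derivative (\<lambda>h. h \<bullet> G x)) (at x within S)"
  using C1_grad_GDERIV[of f G x] unfolding gderiv_def by (rule has_derivative_at_withinI)

lemma C1_grad_continuous:
  assumes "C1_grad f G"
  shows "continuous_on S f"
  unfolding continuous_on_eq_continuous_within
  using has_derivative_continuous[OF C1_grad_has_derivative[OF assms]] by simp

lemma C1_grad_continuous_grad: "C1_grad f G \<Longrightarrow> continuous_on S G"
  unfolding C1_grad_def by (elim conjE) (rule continuous_on_subset, auto)

lemma C1_gradI: "(\<And>x. GDERIV f x :> G x) \<Longrightarrow> continuous_on UNIV G \<Longrightarrow> C1_grad f G"
  by (simp add: C1_grad_def)

lemma C1_grad_diff: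
  assumes "C1_grad f F" "C1_grad g G"
  shows "C1_grad (\<lambda>x. f x - g x) (\<lambda>x. F x - G x)"
  by (rule C1_gradI, rule GDERIV_diff[OF assms[THEN C1_grad_GDERIV]])
     (rule continuous_on_diff[OF assms[THEN C1_grad_continuous_grad]])

lemma C1_grad_mult:
  assumes "C1_grad f F" "C1_grad g G"
  shows "C1_grad (\<lambda>x. f x * g x) (\<lambda>x. f x *\<^sub>R G x + g x *\<^sub>R F x)"
  by (rule C1_gradI, rule GDERIV_mult[OF assms[THEN C1_grad_GDERIV]])
     (intro continuous_on_add continuous_on_scaleR assms[THEN C1_grad_continuous]
       assms[THEN C1_grad_continuous_grad])

lemma C1_grad_const: "C1_grad (\<lambda>x. c) (\<lambda>x. 0)"
  by (rule C1_gradI, rule GDERIV_const, rule continuous_on_const)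

lemma C1_grad_quadratic:
  "C1_grad (\<lambda>x. c + g \<bullet> x + d * (norm (x - m))\<^sup>2) (\<lambda>x. g + (2 * d) *\<^sub>R (x - m))"
proof (rule C1_gradI)
  fix x :: 'a
  have "((\<lambda>x. c + g \<bullet> x + d * ((x - m) \<bullet> (x - m))) has_derivative
      (\<lambda>h. 0 + g \<bullet> h + d * ((x - m) \<bullet> (h - 0) + (h - 0) \<bullet> (x - m)))) (at x)"
    by (intro has_derivative_add has_derivative_const has_derivative_inner_right has_derivative_ident
        has_derivative_mult_right has_derivative_inner has_derivative_diff)
  then show "GDERIV (\<lambda>x. c + g \<bullet> x + d * (norm (x - m))\<^sup>2) x :> g + (2 * d) *\<^sub>R (x - m)"
    unfolding gderiv_def power2_norm_eq_inner
    by (rule has_derivative_eq_rhs) (auto simp: inner_commute inner_add_right algebra_simps)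
qed (intro continuous_intros)

lemma C1_grad_affine: "C1_grad (\<lambda>x. c + g \<bullet> x) (\<lambda>x. g)"
  using C1_grad_quadratic[of c g 0] by simp

lemma C1_grad_bounded_on_compact:
  assumes "C1_grad f G" "compact K"
  obtains M where "0 \<le> M" "\<And>x. x \<in> K \<Longrightarrow> norm (G x) \<le> M"
proof -
  have "compact (G ` K)"
    using assms by (intro compact_continuous_image C1_grad_continuous_grad)
  then obtain M where "\<And>y. y \<in> G ` K \<Longrightarrow> norm y \<le> M"
    using compact_imp_bounded bounded_iff by metis
  then show thesis using that[of "max 0 M"] by fastforce
qed

lemma C1_grad_lipschitz:
  assumes f: "C1_grad f G" and "convex S" and M: "\<And>x. x \<in> S \<Longrightarrow> norm (G x) \<le> M" "0 \<le> M"
    and "x \<in> S" "y \<in> S"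
  shows "\<bar>f x - f y\<bar> \<le> M * norm (x - y)"
proof -
  have "onorm (\<lambda>h. h \<bullet> G z) \<le> M" if "z \<in> S" for z
  proof (rule onorm_bound)
    fix h show "norm (h \<bullet> G z) \<le> M * norm h"
      using Cauchy_Schwarz_ineq2[of h "G z"] mult_right_mono[OF M(1)[OF that], of "norm h"]
      by (simp add: mult.commute)
  qed (use M in auto)
  from differentiable_bound[OF assms(2) C1_grad_has_derivative[OF f] this assms(5,6)]
  show ?thesis by simp
qed

lemma C1_grad_difference_quotient:
  fixes t :: "nat \<Rightarrow> real"
  assumes f: "C1_grad f G" and t: "t \<longlonglongrightarrow> 0" "\<And>j. t j \<noteq> 0"
  shows "(\<lambda>j. (f (x + t j *\<^sub>R v) - f x) / t j) \<longlonglongrightarrow> v \<bullet> G x"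
proof -
  have "((\<lambda>s. f (x + s *\<^sub>R v)) has_derivative (\<lambda>s. (s *\<^sub>R v) \<bullet> G (x + 0 *\<^sub>R v))) (at 0)"
    by (rule has_derivative_compose[OF _ C1_grad_has_derivative[OF f]])
       (auto intro!: derivative_eq_intros)
  then have "((\<lambda>s. f (x + s *\<^sub>R v)) has_field_derivative (v \<bullet> G x)) (at 0)"
    by (simp add: has_field_derivative_def mult_commute_abs)
  then have "((\<lambda>s. (f (x + s *\<^sub>R v) - f x) / s) \<longlongrightarrow> v \<bullet> G x) (at 0)"
    by (simp add: DERIV_def)
  moreover have "filterlim t (at 0) sequentially"
    using t by (auto simp: filterlim_at)
  ultimately show ?thesis by (rule filterlim_compose)
qed

text \<open>The integral of a translate of \<open>f\<close> does not depend on the translation.\<close>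

lemma integral_gradient_compact_support:
  assumes f: "C1_grad f G" and K: "compact K" and out: "\<And>x. x \<notin> K \<Longrightarrow> f x = 0"
  shows "integrable lborel G" "integral\<^sup>L lborel G = 0"
proof -
  obtain r where r: "r > 0" "K \<subseteq> ball 0 r"
    using compact_imp_bounded[OF K] bounded_subset_ballD by blast
  \<comment> \<open>The radius \<open>r + 1\<close> accommodates \<open>K\<close> and its translates
    by vectors of length at most one. Difference quotients with steps at most one therefore vanish
    outside \<open>B\<close> and are bounded by the Lipschitz constant \<open>M\<close>, which
    supplies the dominating function below.\<close>
  define B where "B = cball (0::'a) (r + 1)"
  obtain M where M: "0 \<le> M" "\<And>x. x \<in> B \<Longrightarrow> norm (G x) \<le> M"
    using C1_grad_bounded_on_compact[OF f, of B] by (auto simp: B_def)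
  have G0: "G x = 0" if "x \<notin> K" for x
  proof -
    have "open (- K)" using K by (simp add: compact_imp_closed open_Compl)
    from _ this have "GDERIV f x :> 0"
      unfolding gderiv_def
      by (rule has_derivative_transform_within_open[where f="\<lambda>_. 0"])
         (use that out in auto)
    then show ?thesis using C1_grad_GDERIV[OF f, of x] GDERIV_unique by blast
  qed
  have Gb: "norm (G x) \<le> M" for x
    using M G0[of x] r by (cases "x \<in> K") (auto simp: B_def subset_eq)
  have mG[measurable]: "G \<in> borel_measurable borel"
    by (intro borel_measurable_continuous_onI C1_grad_continuous_grad[OF f])
  have mf[measurable]: "f \<in> borel_measurable borel"
    by (intro borel_measurable_continuous_onI C1_grad_continuous[OF f])
  have iB: "integrable lborel (\<lambda>x. M * indicator B x)" for M :: real
    using emeasure_bounded_finite[of B] by (intro integrable_mult_right integrable_real_indicator) (auto simp: B_def)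
  have KB: "x \<in> B" if "x \<in> K" for x using r that by (auto simp: B_def subset_eq)
  have "norm (G x) \<le> norm (M * indicator B x)" for x
    using Gb[of x] G0[of x] KB[of x] M(1) by (cases "x \<in> B") auto
  then show "integrable lborel G"
    by (intro Bochner_Integration.integrable_bound[OF iB[of M]] AE_I2) auto
  then have iG: "integrable lborel (\<lambda>x. b \<bullet> G x)" for b by auto
  obtain C where C: "\<And>x. \<bar>f x\<bar> \<le> C"
  proof -
    have "compact (f ` K)" by (intro compact_continuous_image C1_grad_continuous[OF f] K)
    then obtain C where "\<And>y. y \<in> f ` K \<Longrightarrow> norm y \<le> C"
      using compact_imp_bounded bounded_iff by metis
    then have "\<bar>f x\<bar> \<le> max 0 C" for x by (cases "x \<in> K") (fastforce simp: out)+
    then show ?thesis using that by blast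
  qed
  have "norm (f x) \<le> norm (C * indicator B x)" for x
    using C[of x] out[of x] KB[of x] by (cases "x \<in> B") auto
  then have if_: "integrable lborel f"
    by (intro Bochner_Integration.integrable_bound[OF iB[of C]] AE_I2) auto
  have zero: "(\<integral>x. b \<bullet> G x \<partial>lborel) = 0" if b: "norm b = 1" for b
  proof -
    define t where "t j = 1 / real (Suc j)" for j
    have t: "t \<longlonglongrightarrow> 0" "\<And>j. t j \<noteq> 0" "\<And>j. 0 < t j" "\<And>j. t j \<le> 1"
      unfolding t_def using LIMSEQ_inverse_real_of_nat by (auto simp: inverse_eq_divide)
    define q where "q j x = (f (x + t j *\<^sub>R b) - f x) / t j" for j x
    have tr: "integrable lborel (\<lambda>x. f (x + t j *\<^sub>R b))"
        "(\<integral>x. f (x + t j *\<^sub>R b) \<partial>lborel) = (\<integral>x. f x \<partial>lborel)" for j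
    proof -
      have L: "lborel = distr lborel borel ((+) (t j *\<^sub>R b))" using lborel_distr_plus[of "t j *\<^sub>R b"] by simp
      have "integrable (distr lborel borel ((+) (t j *\<^sub>R b))) f" using if_ L by metis
      then show "integrable lborel (\<lambda>x. f (x + t j *\<^sub>R b))" by (simp add: integrable_distr_eq add.commute)
      have "(\<integral>x. f x \<partial>lborel) = (\<integral>x. f x \<partial>distr lborel borel ((+) (t j *\<^sub>R b)))" using L by metis
      also have "\<dots> = (\<integral>x. f (x + t j *\<^sub>R b) \<partial>lborel)" by (subst integral_distr) (auto simp: add.commute)
      finally show "(\<integral>x. f (x + t j *\<^sub>R b) \<partial>lborel) = (\<integral>x. f x \<partial>lborel)" by simp
    qed
    have qb: "\<bar>q j x\<bar> \<le> M * indicator B x" for j x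
    proof (cases "x \<in> B")
      case True
      have "\<bar>f (x + t j *\<^sub>R b) - f x\<bar> \<le> M * norm (x + t j *\<^sub>R b - x)"
        using Gb M(1) by (intro C1_grad_lipschitz[OF f convex_UNIV]) auto
      also have "\<dots> = M * t j" using b t(3)[of j] by simp
      finally show ?thesis using True t(3)[of j] by (simp add: q_def field_simps)
    next
      case False
      then have "norm x > r + 1" by (simp add: B_def)
      moreover have "norm (x + t j *\<^sub>R b) \<ge> norm x - t j"
        using norm_triangle_ineq2[of x "- (t j *\<^sub>R b)"] b t(3)[of j] by simp
      ultimately have "x + t j *\<^sub>R b \<notin> K" "x \<notin> K" using t(4)[of j] r by force+
      then show ?thesis using False by (simp add: q_def out)
    qed
    have "(\<lambda>j. \<integral>x. q j x \<partial>lborel) \<longlonglongrightarrow> (\<integral>x. b \<bullet> G x \<partial>lborel)"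
      using qb by (intro integral_dominated_convergence[OF _ _ iB[of M]])
        (auto simp: q_def intro!: C1_grad_difference_quotient[OF f] t)
    moreover have "(\<integral>x. q j x \<partial>lborel) = 0" for j
      using tr[of j] if_ by (simp add: q_def)
    ultimately show ?thesis by (simp add: LIMSEQ_const_iff)
  qed
  show "integral\<^sup>L lborel G = 0"
  proof (rule euclidean_eqI)
    fix b :: 'a assume "b \<in> Basis"
    then show "integral\<^sup>L lborel G \<bullet> b = 0 \<bullet> b"
      using zero[of b] \<open>integrable lborel G\<close> by (simp add: inner_commute)
  qed
qed

lemma test_function_C1:
  assumes "\<phi> \<in> test_functions U"
  shows "C1_grad \<phi> (grad \<phi>)"
proof -
  have C: "C_k (Suc 0) \<phi>" using assms by (auto simp: test_functions_def)
  have d: "\<phi> differentiable at x" for x using C by simp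
  have cont: "continuous_on UNIV (\<lambda>x. frechet_derivative \<phi> (at x) b)" if "b \<in> Basis" for b
    using C that by simp
  define G where "G x = (\<Sum>b\<in>Basis. frechet_derivative \<phi> (at x) b *\<^sub>R b)" for x
  have "GDERIV \<phi> x :> G x" for x
  proof -
    have D: "(\<phi> has_derivative frechet_derivative \<phi> (at x)) (at x)"
      using d by (simp add: frechet_derivative_works)
    then interpret bounded_linear "frechet_derivative \<phi> (at x)" by (rule has_derivative_bounded_linear)
    have "frechet_derivative \<phi> (at x) h = h \<bullet> G x" for h
    proof -
      have "frechet_derivative \<phi> (at x) h = frechet_derivative \<phi> (at x) (\<Sum>b\<in>Basis. (h \<bullet> b) *\<^sub>R b)"
        by (simp add: euclidean_representation)
      then show ?thesis by (simp add: sum scaleR G_def inner_sum_right mult.commute)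
    qed
    then have "frechet_derivative \<phi> (at x) = (\<lambda>h. h \<bullet> G x)" by auto
    then show ?thesis unfolding gderiv_def using D by simp
  qed
  moreover from this have "grad \<phi> = G" by (auto intro: grad_eq)
  moreover have "continuous_on UNIV G" unfolding G_def by (intro continuous_intros cont)
  ultimately show ?thesis by (auto simp: C1_grad_def)
qed

lemma test_function_support:
  assumes "\<phi> \<in> test_functions U"
  obtains K where "compact K" "K \<subseteq> U" "\<And>x. x \<notin> K \<Longrightarrow> \<phi> x = 0" "\<And>x. x \<notin> K \<Longrightarrow> grad \<phi> x = 0"
proof -
  define K where "K = closure {x. \<phi> x \<noteq> 0}"
  have out: "\<phi> x = 0" if "x \<notin> K" for x using that closure_subset[of "{x. \<phi> x \<noteq> 0}"] by (auto simp: K_def)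
  have out': "grad \<phi> x = 0" if "x \<notin> K" for x
  proof (rule grad_eq)
    have o: "open (- K)" by (simp add: open_Compl K_def)
    have z: "((\<lambda>_. 0) has_derivative (\<lambda>h. h \<bullet> 0)) (at x)" by simp
    show "GDERIV \<phi> x :> 0"
      unfolding gderiv_def
    proof (rule has_derivative_transform_within_open[OF z o])
      show "x \<in> - K" using that by simp
    qed (simp add: out)
  qed
  have K: "compact K" "K \<subseteq> U" using assms by (simp_all add: test_functions_def K_def)
  show thesis by (rule that[OF K out out'])
qed

lemma test_functions_mono: "U \<subseteq> W \<Longrightarrow> test_functions U \<subseteq> test_functions W"
  by (auto simp: test_functions_def)

section \<open>Smooth cutoff functions\<close>

text \<open>The classical flat functions s^(-j) exp(-1/s), continued by zero. Carrying along every
  power \<open>j\<close> makes the family closed under differentiation up to linear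
  combinations.\<close>

definition flat :: "nat \<Rightarrow> real \<Rightarrow> real" where
  "flat j s = (if s > 0 then (inverse s) ^ j * exp (- inverse s) else 0)"

lemma power_div_fact_le_exp:
  fixes y :: real
  assumes "0 \<le> y"
  shows "y ^ n / fact n \<le> exp y"
proof -
  have "(\<Sum>k\<in>{n}. y ^ k /\<^sub>R fact k) \<le> (\<Sum>k. y ^ k /\<^sub>R fact k)"
    using assms by (intro sum_le_suminf summable_exp_generic) auto
  then show ?thesis by (simp add: exp_def divide_inverse mult.commute)
qed

text \<open>With y = 1/s this is the exponential series bound y^n / n! <= exp y for n = j + 2. The
  decay of second order is what makes the derivative at the origin vanish.\<close>

lemma flat_quadratic: "\<bar>flat j s\<bar> \<le> fact (j + 2) * s\<^sup>2"
proof (cases "s > 0")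
  case True
  define y where "y = inverse s"
  have y: "y > 0" "s\<^sup>2 = inverse (y\<^sup>2)" using True by (auto simp: y_def power_inverse)
  define C :: real where "C = fact (j + 2)"
  have "C > 0" unfolding C_def by (rule fact_gt_zero)
  then have "y ^ j * y\<^sup>2 \<le> C * exp y"
    using power_div_fact_le_exp[of y "j + 2", folded C_def] y(1)
    by (simp add: pos_divide_le_eq power_add mult.commute power2_eq_square mult.left_commute)
  then have "y ^ j * exp (- y) \<le> C * inverse (y\<^sup>2)"
    using y(1) by (simp add: exp_minus field_simps)
  then show ?thesis unfolding C_def[symmetric] using True y by (simp add: flat_def y_def[symmetric])
qed (simp add: flat_def)

lemma DERIV_flat: "DERIV (flat j) s :> flat (j + 2) s - real j * flat (j + 1) s"
proof -
  consider "s > 0" | "s < 0" | "s = 0" by linarith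
  then show ?thesis
  proof cases
    case 1
    have "DERIV (\<lambda>s. (inverse s) ^ j * exp (- inverse s)) s :> flat (j + 2) s - real j * flat (j + 1) s"
    proof -
      have "real j * (inverse s) ^ (j - 1) * inverse s * inverse s = real j * inverse s ^ (j + 1)"
        by (cases j) auto
      then show ?thesis using 1
        by (auto intro!: derivative_eq_intros simp: flat_def power2_eq_square algebra_simps)
    qed
    then show ?thesis
      unfolding has_field_derivative_def
      by (rule has_derivative_transform_within_open[of _ _ _ _ "{0<..}"])
         (use 1 in \<open>auto simp: flat_def\<close>)
  next
    case 2
    have "DERIV (\<lambda>s. 0) s :> flat (j + 2) s - real j * flat (j + 1) s"
      using 2 by (simp add: flat_def)
    then show ?thesis
      unfolding has_field_derivative_def
      by (rule has_derivative_transform_within_open[of _ _ _ _ "{..<0}"])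
         (use 2 in \<open>auto simp: flat_def\<close>)
  next
    \<comment> \<open>At the junction the difference quotient is at most a constant times
      \<open>\<bar>h\<bar>\<close>, so the derivative is zero, in agreement with the formula
      evaluated at zero.\<close>
    case 3
    obtain C where C: "\<And>s. \<bar>flat j s\<bar> \<le> C * s\<^sup>2" using flat_quadratic by blast
    have "((\<lambda>h. flat j h / h) \<longlongrightarrow> 0) (at 0)"
    proof (rule Lim_null_comparison)
      have "norm (flat j h / h) \<le> C * \<bar>h\<bar>" for h
      proof (cases "h = 0")
        case False
        have "\<bar>flat j h\<bar> \<le> (C * \<bar>h\<bar>) * \<bar>h\<bar>" using C[of h] by (simp add: power2_eq_square abs_mult_self_eq)
        then show ?thesis using False by (simp add: pos_divide_le_eq)
      qed simp
      then show "\<forall>\<^sub>F h in at 0. norm (flat j h / h) \<le> C * \<bar>h\<bar>" by simp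
      have "((\<lambda>h. C * \<bar>h\<bar>) \<longlongrightarrow> C * \<bar>0::real\<bar>) (at 0)"
        by (intro tendsto_intros)
      then show "((\<lambda>h::real. C * \<bar>h\<bar>) \<longlongrightarrow> 0) (at 0)" by simp
    qed
    then show ?thesis using 3 by (simp add: DERIV_def flat_def)
  qed
qed

lemma flat_0_bounds: "0 \<le> flat 0 s" "flat 0 s \<le> 1"
  by (auto simp: flat_def)

lemma flat_0_tendsto:
  assumes "c > 0"
  shows "(\<lambda>j. flat 0 (real (Suc j) * c)) \<longlonglongrightarrow> 1"
proof -
  have "(\<lambda>j. exp (- inverse (real (Suc j)) * inverse c)) \<longlonglongrightarrow> exp (- 0 * inverse c)"
    by (intro tendsto_intros LIMSEQ_inverse_real_of_nat)
  moreover have "flat 0 (real (Suc j) * c) = exp (- inverse (real (Suc j)) * inverse c)" for j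
    using assms by (simp add: flat_def)
  ultimately show ?thesis by simp
qed

text \<open>Closed under partial derivatives, so all its elements are smooth.\<close>

inductive_set smooth_algebra :: "('a::euclidean_space \<Rightarrow> real) set" where
  const: "(\<lambda>_. c) \<in> smooth_algebra"
| flat: "(\<lambda>x. flat j (c + s * (x \<bullet> b))) \<in> smooth_algebra"
| add: "f \<in> smooth_algebra \<Longrightarrow> g \<in> smooth_algebra \<Longrightarrow> (\<lambda>x. f x + g x) \<in> smooth_algebra"
| mult: "f \<in> smooth_algebra \<Longrightarrow> g \<in> smooth_algebra \<Longrightarrow> (\<lambda>x. f x * g x) \<in> smooth_algebra"

lemma smooth_algebra_derivative:
  assumes "f \<in> smooth_algebra"
  shows "\<exists>f'. (\<forall>x. (f has_derivative f' x) (at x)) \<and> (\<forall>h. (\<lambda>x. f' x h) \<in> smooth_algebra)"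
  using assms
proof induction
  case (const c)
  then show ?case by (intro exI[of _ "\<lambda>_ _. 0"]) (auto intro: smooth_algebra.const)
next
  case (flat j c s b)
  let ?d = "\<lambda>y. flat (j + 2) y + (- real j) * flat (j + 1) y"
  have "((\<lambda>x. flat j (c + s * (x \<bullet> b))) has_derivative (\<lambda>h. s * (h \<bullet> b) * ?d (c + s * (x \<bullet> b)))) (at x)" for x
  proof -
    have "((\<lambda>x. flat j (c + s * (x \<bullet> b))) has_derivative (\<lambda>h. ?d (c + s * (x \<bullet> b)) * (s * (h \<bullet> b)))) (at x)"
      by (rule has_derivative_compose[where g="flat j" and f="\<lambda>x. c + s * (x \<bullet> b)" and f'="\<lambda>h. s * (h \<bullet> b)"])
         (use DERIV_flat[of j "c + s * (x \<bullet> b)"] in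
           \<open>auto intro!: derivative_eq_intros simp: has_field_derivative_def\<close>)
    then show ?thesis by (simp add: mult.commute)
  qed
  moreover have "(\<lambda>x. s * (h \<bullet> b) * ?d (c + s * (x \<bullet> b))) \<in> smooth_algebra" for h
    by (intro smooth_algebra.mult[OF smooth_algebra.const] smooth_algebra.add smooth_algebra.flat)
  ultimately show ?case by (intro exI[of _ "\<lambda>x h. s * (h \<bullet> b) * ?d (c + s * (x \<bullet> b))"] conjI allI)
next
  case (add f g)
  then obtain f' g' where *:
    "\<And>x. (f has_derivative f' x) (at x)" "\<And>h. (\<lambda>x. f' x h) \<in> smooth_algebra"
    "\<And>x. (g has_derivative g' x) (at x)" "\<And>h. (\<lambda>x. g' x h) \<in> smooth_algebra" by metis
  show ?case
    by (intro exI[of _ "\<lambda>x h. f' x h + g' x h"] conjI allI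
        has_derivative_add[OF *(1) *(3)] smooth_algebra.add[OF *(2) *(4)])
next
  case (mult f g)
  then obtain f' g' where *:
    "\<And>x. (f has_derivative f' x) (at x)" "\<And>h. (\<lambda>x. f' x h) \<in> smooth_algebra"
    "\<And>x. (g has_derivative g' x) (at x)" "\<And>h. (\<lambda>x. g' x h) \<in> smooth_algebra" by metis
  show ?case using mult.hyps *(2,4)
    by (intro exI[of _ "\<lambda>x h. f x * g' x h + f' x h * g x"] conjI allI
        has_derivative_mult[OF *(1) *(3)] smooth_algebra.add smooth_algebra.mult)
qed

lemma smooth_algebra_C_k: "f \<in> smooth_algebra \<Longrightarrow> C_k k f"
proof (induction k arbitrary: f)
  case 0
  obtain f' where "\<forall>x. (f has_derivative f' x) (at x)" using smooth_algebra_derivative[OF 0] by blast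
  then show ?case
    by (auto intro!: continuous_at_imp_continuous_on has_derivative_continuous)
next
  case (Suc k)
  obtain f' where f': "\<forall>x. (f has_derivative f' x) (at x)" "\<forall>h. (\<lambda>x. f' x h) \<in> smooth_algebra"
    using smooth_algebra_derivative[OF Suc.prems] by blast
  have "frechet_derivative f (at x) = f' x" for x using f'(1) frechet_derivative_at by metis
  then show ?case using f' Suc.IH by (auto simp: differentiable_def)
qed

lemma smooth_algebra_prod:
  "finite A \<Longrightarrow> (\<And>i. i \<in> A \<Longrightarrow> f i \<in> smooth_algebra) \<Longrightarrow> (\<lambda>x. \<Prod>i\<in>A. f i x) \<in> smooth_algebra"
proof (induction A rule: finite_induct)
  case empty
  then show ?case by (simp add: smooth_algebra.const)
next
  case (insert a A)
  then have "(\<lambda>x. f a x * (\<Prod>i\<in>A. f i x)) \<in> smooth_algebra" by (intro smooth_algebra.mult) auto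
  then show ?case using insert.hyps by simp
qed

text \<open>Multiplying the arguments by \<open>Suc j\<close> steepens the transition at the sides
  of the box. The functions stay between zero and one and converge pointwise to the indicator of the
  open box, as dominated convergence requires.\<close>

definition cutoff :: "'a::euclidean_space \<Rightarrow> 'a \<Rightarrow> nat \<Rightarrow> 'a \<Rightarrow> real" where
  "cutoff a b j x = (\<Prod>i\<in>Basis. flat 0 (real (Suc j) * (x \<bullet> i - a \<bullet> i)) * flat 0 (real (Suc j) * (b \<bullet> i - x \<bullet> i)))"

lemma cutoff_outside:
  assumes "x \<notin> box a b"
  shows "cutoff a b j x = 0"
proof -
  obtain i where i: "i \<in> Basis" "x \<bullet> i - a \<bullet> i \<le> 0 \<or> b \<bullet> i - x \<bullet> i \<le> 0"
    using assms by (auto simp: mem_box not_less)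
  then have "flat 0 (real (Suc j) * (x \<bullet> i - a \<bullet> i)) = 0 \<or> flat 0 (real (Suc j) * (b \<bullet> i - x \<bullet> i)) = 0"
    using mult_nonneg_nonpos[of "real (Suc j)"] unfolding flat_def by (metis not_less of_nat_0_le_iff)
  then show ?thesis unfolding cutoff_def using i(1) by (intro prod_zero) auto
qed

lemma cutoff_bounds: "0 \<le> cutoff a b j x" "cutoff a b j x \<le> 1"
  unfolding cutoff_def
  by (intro prod_nonneg prod_le_1 ballI conjI mult_le_one mult_nonneg_nonneg flat_0_bounds)+

lemma cutoff_tendsto: "(\<lambda>j. cutoff a b j x) \<longlonglongrightarrow> indicator (box a b) x"
proof (cases "x \<in> box a b")
  case True
  have "(\<lambda>j. cutoff a b j x) \<longlonglongrightarrow> (\<Prod>i\<in>(Basis::'a set). 1 * 1)"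
    unfolding cutoff_def using True by (intro tendsto_intros flat_0_tendsto) (auto simp: mem_box)
  then show ?thesis using True by simp
qed (simp add: cutoff_outside)

lemma cutoff_test_function:
  assumes "cbox a b \<subseteq> U"
  shows "cutoff a b j \<in> test_functions U"
proof -
  have "cutoff a b j \<in> smooth_algebra"
    unfolding cutoff_def[abs_def]
  proof (intro smooth_algebra_prod smooth_algebra.mult)
    fix i :: 'a
    have "(\<lambda>x. flat 0 (- real (Suc j) * (a \<bullet> i) + real (Suc j) * (x \<bullet> i))) \<in> smooth_algebra"
      "(\<lambda>x. flat 0 (real (Suc j) * (b \<bullet> i) + (- real (Suc j)) * (x \<bullet> i))) \<in> smooth_algebra"
      by (rule smooth_algebra.flat)+
    then show "(\<lambda>x. flat 0 (real (Suc j) * (x \<bullet> i - a \<bullet> i))) \<in> smooth_algebra"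
        "(\<lambda>x. flat 0 (real (Suc j) * (b \<bullet> i - x \<bullet> i))) \<in> smooth_algebra"
      by (simp_all add: algebra_simps)
  qed auto
  moreover have "closure {x. cutoff a b j x \<noteq> 0} \<subseteq> cbox a b"
    using cutoff_outside[of _ a b j] box_subset_cbox[of a b] by (intro closure_minimal) auto
  ultimately show ?thesis
    using assms bounded_subset[OF bounded_cbox order_trans[OF closure_subset]]
    unfolding test_functions_def compact_closure by (blast intro: smooth_algebra_C_k)
qed

section \<open>Square integrable functions\<close>

text \<open>Completeness of Lebesgue measure: the part of a preimage inside the exceptional null set
  is measurable, whatever \<open>g\<close> does there.\<close>

lemma borel_measurable_lebesgue_on_AE:
  fixes f g :: "'a::euclidean_space \<Rightarrow> 'b::topological_space"
  assumes S: "S \<in> sets lebesgue" and f: "f \<in> borel_measurable (lebesgue_on S)"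
    and ae: "AE x in lebesgue_on S. f x = g x"
  shows "g \<in> borel_measurable (lebesgue_on S)"
proof (rule measurableI)
  fix B :: "'b set" assume B: "B \<in> sets borel"
  obtain N where N: "{x \<in> S. f x \<noteq> g x} \<subseteq> N" "N \<in> null_sets (lebesgue_on S)"
    using ae by (auto elim!: AE_E simp: null_sets_def)
  have NS: "N \<in> null_sets lebesgue" using N(2) S by (simp add: null_sets_restrict_space)
  have "g -` B \<inter> S \<inter> N \<in> null_sets lebesgue"
    using NS by (rule completion.complete2[rotated]) auto
  then have "g -` B \<inter> S \<inter> N \<in> sets lebesgue" by (rule null_setsD2)
  then have 1: "g -` B \<inter> S \<inter> N \<in> sets (lebesgue_on S)"
    using S by (auto simp: sets_restrict_space_iff)
  have 2: "(f -` B \<inter> S) - N \<in> sets (lebesgue_on S)"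
    using measurable_sets[OF f B] N(2) by (intro sets.Diff) (auto dest: null_setsD2)
  have "g -` B \<inter> space (lebesgue_on S) = ((f -` B \<inter> S) - N) \<union> (g -` B \<inter> S \<inter> N)"
    using N(1) by auto
  then show "g -` B \<inter> space (lebesgue_on S) \<in> sets (lebesgue_on S)"
    using 1 2 by (metis sets.Un)
qed auto

lemma L2_functionsI:
  "f \<in> borel_measurable (lebesgue_on S) \<Longrightarrow> integrable (lebesgue_on S) (\<lambda>x. (norm (f x))\<^sup>2) \<Longrightarrow>
   f \<in> L2_functions S"
  by (simp add: L2_functions_def)

lemma L2_measurable: "f \<in> L2_functions S \<Longrightarrow> f \<in> borel_measurable (lebesgue_on S)"
  by (simp add: L2_functions_def)

lemma L2_square_integrable: "f \<in> L2_functions S \<Longrightarrow> integrable (lebesgue_on S) (\<lambda>x. (norm (f x))\<^sup>2)"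
  by (simp add: L2_functions_def)

lemma L2_AE_cong:
  assumes S: "S \<in> sets lebesgue" and f: "f \<in> L2_functions S" and ae: "AE x in lebesgue_on S. f x = g x"
  shows "g \<in> L2_functions S"
proof (rule L2_functionsI)
  show g: "g \<in> borel_measurable (lebesgue_on S)"
    by (rule borel_measurable_lebesgue_on_AE[OF S L2_measurable[OF f] ae])
  show "integrable (lebesgue_on S) (\<lambda>x. (norm (g x))\<^sup>2)"
    by (rule integrable_cong_AE_imp[OF L2_square_integrable[OF f]])
       (use g ae in \<open>auto simp: eq_commute\<close>)
qed

lemma norm_add_square_le: "(norm (a + b))\<^sup>2 \<le> 2 * (norm a)\<^sup>2 + 2 * (norm (b::'a::real_inner))\<^sup>2"
proof -
  have "0 \<le> (norm (a - b))\<^sup>2" by simp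
  moreover have "(norm (a + b))\<^sup>2 + (norm (a - b))\<^sup>2 = 2 * (norm a)\<^sup>2 + 2 * (norm b)\<^sup>2"
    by (simp add: power2_norm_eq_inner inner_add_left inner_add_right inner_diff_left inner_diff_right)
  ultimately show ?thesis by linarith
qed

lemma norm_product_le: "norm a * norm b \<le> (norm a)\<^sup>2 + (norm b)\<^sup>2"
proof -
  have "2 * norm a * norm b \<le> (norm a)\<^sup>2 + (norm b)\<^sup>2" by (rule sum_squares_bound)
  moreover have "0 \<le> norm a * norm b" by simp
  ultimately show ?thesis by linarith
qed

lemma L2_add:
  assumes "f \<in> L2_functions S" "g \<in> L2_functions S"
  shows "(\<lambda>x. f x + g x) \<in> L2_functions S"
proof (rule L2_functionsI)
  note m = assms[THEN L2_measurable] and i = assms[THEN L2_square_integrable]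
  show "(\<lambda>x. f x + g x) \<in> borel_measurable (lebesgue_on S)" using m by measurable
  then show "integrable (lebesgue_on S) (\<lambda>x. (norm (f x + g x))\<^sup>2)"
    using norm_add_square_le
    by (intro Bochner_Integration.integrable_bound[OF Bochner_Integration.integrable_add
          [OF integrable_mult_right[OF i(1), of 2] integrable_mult_right[OF i(2), of 2]]] AE_I2) auto
qed

lemma L2_scale:
  assumes "f \<in> L2_functions S"
  shows "(\<lambda>x. c *\<^sub>R f x) \<in> L2_functions S"
  using assms by (auto simp: L2_functions_def power_mult_distrib)

lemma L2_diff:
  assumes "f \<in> L2_functions S" "g \<in> L2_functions S"
  shows "(\<lambda>x. f x - g x) \<in> L2_functions S"
  using L2_add[OF assms(1) L2_scale[OF assms(2), of "-1"]] by simp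

lemma L2_product_integrable:
  fixes h :: "'a::euclidean_space \<Rightarrow> 'b::euclidean_space"
  assumes f: "f \<in> L2_functions S" and g: "g \<in> L2_functions S"
    and m: "h \<in> borel_measurable (lebesgue_on S)" and h: "\<And>x. norm (h x) \<le> norm (f x) * norm (g x)"
  shows "integrable (lebesgue_on S) h"
proof (rule Bochner_Integration.integrable_bound[OF Bochner_Integration.integrable_add
      [OF f[THEN L2_square_integrable] g[THEN L2_square_integrable]] m], rule AE_I2)
  show "norm (h x) \<le> norm ((norm (f x))\<^sup>2 + (norm (g x))\<^sup>2)" for x
    using h[of x] norm_product_le[of "f x" "g x"] by simp
qed

lemma L2_inner_integrable:
  assumes "f \<in> L2_functions S" "g \<in> L2_functions S"
  shows "integrable (lebesgue_on S) (\<lambda>x. f x \<bullet> g x)"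
proof (rule L2_product_integrable[OF assms])
  show "(\<lambda>x. f x \<bullet> g x) \<in> borel_measurable (lebesgue_on S)"
    using assms[THEN L2_measurable] by measurable
qed (simp add: Cauchy_Schwarz_ineq2)

lemma L2_scaleR_integrable:
  assumes "f \<in> L2_functions S" "g \<in> L2_functions S"
  shows "integrable (lebesgue_on S) (\<lambda>x. f x *\<^sub>R g x)"
proof (rule L2_product_integrable[OF assms])
  show "(\<lambda>x. f x *\<^sub>R g x) \<in> borel_measurable (lebesgue_on S)"
    using assms[THEN L2_measurable] by measurable
qed simp

lemma L2_subset:
  assumes "W \<subseteq> U" "W \<in> sets lebesgue" "U \<in> sets lebesgue" "f \<in> L2_functions U"
  shows "f \<in> L2_functions W"
proof -
  have R: "lebesgue_on W = restrict_space (lebesgue_on U) W"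
    using assms(1) by (simp add: restrict_restrict_space Int_absorb1 assms)
  have W: "W \<inter> space (lebesgue_on U) \<in> sets (lebesgue_on U)"
    using assms by (simp add: sets_restrict_space_iff Int_absorb2)
  show ?thesis
  proof (rule L2_functionsI)
    show "f \<in> borel_measurable (lebesgue_on W)"
      unfolding R by (rule measurable_restrict_space1[OF L2_measurable[OF assms(4)]])
    have "integrable (lebesgue_on U) (\<lambda>x. indicator W x *\<^sub>R (norm (f x))\<^sup>2)"
      using W assms(1) by (intro integrable_mult_indicator L2_square_integrable assms(4)) (simp add: Int_absorb2)
    then show "integrable (lebesgue_on W) (\<lambda>x. (norm (f x))\<^sup>2)"
      unfolding R integrable_restrict_space[OF W] .
  qed
qed

lemma L2_integrable:
  assumes S: "S \<in> lmeasurable" and f: "f \<in> L2_functions S"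
  shows "integrable (lebesgue_on S) f"
proof -
  interpret finite_measure "lebesgue_on S" by (rule finite_measure_lebesgue_on[OF S])
  have "norm (f x) \<le> norm (1 + (norm (f x))\<^sup>2)" for x
    using norm_product_le[of "1::real" "norm (f x)"] by simp
  then show ?thesis
    by (intro Bochner_Integration.integrable_bound[OF Bochner_Integration.integrable_add
          [OF integrable_const[of 1] L2_square_integrable[OF f]]] AE_I2 L2_measurable[OF f]) auto
qed

lemma L2_bounded:
  assumes S: "S \<in> lmeasurable" and f: "f \<in> borel_measurable (lebesgue_on S)" "\<And>x. x \<in> S \<Longrightarrow> norm (f x) \<le> C"
  shows "f \<in> L2_functions S"
proof (rule L2_functionsI[OF f(1)])
  interpret finite_measure "lebesgue_on S" by (rule finite_measure_lebesgue_on[OF S])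
  have "norm ((norm (f x))\<^sup>2) \<le> C\<^sup>2" if "x \<in> S" for x
    using f(2)[OF that] by (simp add: power_mono)
  then show "integrable (lebesgue_on S) (\<lambda>x. (norm (f x))\<^sup>2)"
    using f(1) by (intro integrable_const_bound[where B="C\<^sup>2"] AE_I2) auto
qed

lemma L2_continuous:
  fixes f :: "'a::euclidean_space \<Rightarrow> 'b::euclidean_space"
  assumes "continuous_on UNIV f" "bounded S" "S \<in> sets lebesgue"
  shows "f \<in> L2_functions S"
proof -
  have S: "S \<in> lmeasurable" using assms by (simp add: bounded_set_imp_lmeasurable)
  have "compact (f ` closure S)"
    using assms by (intro compact_continuous_image continuous_on_subset[OF assms(1)]) auto
  then obtain C where "\<And>y. y \<in> f ` closure S \<Longrightarrow> norm y \<le> C"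
    using compact_imp_bounded bounded_iff by metis
  then have "norm (f x) \<le> C" if "x \<in> S" for x using that closure_subset[of S] by auto
  moreover have "f \<in> borel_measurable (lebesgue_on S)"
    using assms by (intro continuous_imp_measurable_on_sets_lebesgue continuous_on_subset[OF assms(1)]) auto
  ultimately show ?thesis using L2_bounded[OF S] by blast
qed

lemma L2_norm_square: "(L2_norm S f)\<^sup>2 = (\<integral>x. (norm (f x))\<^sup>2 \<partial>lebesgue_on S)"
  unfolding L2_norm_def by (simp add: integral_nonneg_AE)

lemma L2_norm_tendsto_iff:
  "(\<lambda>j. L2_norm S (f j)) \<longlonglongrightarrow> 0 \<longleftrightarrow> (\<lambda>j. \<integral>x. (norm (f j x))\<^sup>2 \<partial>lebesgue_on S) \<longlonglongrightarrow> 0"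
proof
  assume "(\<lambda>j. L2_norm S (f j)) \<longlonglongrightarrow> 0"
  from tendsto_power[OF this, of 2]
  show "(\<lambda>j. \<integral>x. (norm (f j x))\<^sup>2 \<partial>lebesgue_on S) \<longlonglongrightarrow> 0" by (simp add: L2_norm_square)
next
  assume "(\<lambda>j. \<integral>x. (norm (f j x))\<^sup>2 \<partial>lebesgue_on S) \<longlonglongrightarrow> 0"
  from tendsto_real_sqrt[OF this] show "(\<lambda>j. L2_norm S (f j)) \<longlonglongrightarrow> 0" by (simp add: L2_norm_def)
qed

text \<open>The source of both Cauchy-Schwarz inequalities, on a set and on a face. For
  \<open>a > 0\<close> the quadratic is evaluated at its minimiser \<open>- b / a\<close>; for
  \<open>a = 0\<close> a nonnegative affine function must be constant.\<close>

lemma discriminant_nonneg: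
  fixes a b c :: real
  assumes "\<And>t. 0 \<le> a * t\<^sup>2 + 2 * b * t + c" "0 \<le> a"
  shows "b\<^sup>2 \<le> a * c"
proof (cases "a = 0")
  case True
  have "b = 0"
  proof (rule ccontr)
    assume "b \<noteq> 0"
    then show False using assms(1)[of "- (c + 1) / (2 * b)"] True by simp
  qed
  then show ?thesis using True by simp
next
  case False
  then have a: "a > 0" using assms(2) by simp
  have "0 \<le> a * (- b / a)\<^sup>2 + 2 * b * (- b / a) + c" by (rule assms(1))
  also have "\<dots> = c - b\<^sup>2 / a" using a by (simp add: power2_eq_square)
  finally show ?thesis using a by (simp add: pos_divide_le_eq mult.commute)
qed

lemma L2_Cauchy_Schwarz:
  assumes f: "f \<in> L2_functions S" and g: "g \<in> L2_functions S"
  shows "(\<integral>x. f x \<bullet> g x \<partial>lebesgue_on S)\<^sup>2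
    \<le> (\<integral>x. (norm (f x))\<^sup>2 \<partial>lebesgue_on S) * (\<integral>x. (norm (g x))\<^sup>2 \<partial>lebesgue_on S)"
proof (rule discriminant_nonneg)
  fix t :: real
  have "0 \<le> (\<integral>x. (norm (t *\<^sub>R f x + g x))\<^sup>2 \<partial>lebesgue_on S)"
    by (intro integral_nonneg_AE AE_I2) simp
  also have "\<dots> = (\<integral>x. t\<^sup>2 * (norm (f x))\<^sup>2 + 2 * t * (f x \<bullet> g x) + (norm (g x))\<^sup>2 \<partial>lebesgue_on S)"
    by (intro Bochner_Integration.integral_cong refl)
       (simp only: power2_norm_eq_inner, simp add: inner_add_left inner_add_right inner_commute
         power2_eq_square[of t] algebra_simps)
  also have "\<dots> = t\<^sup>2 * (\<integral>x. (norm (f x))\<^sup>2 \<partial>lebesgue_on S) + 2 * t * (\<integral>x. f x \<bullet> g x \<partial>lebesgue_on S)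
      + (\<integral>x. (norm (g x))\<^sup>2 \<partial>lebesgue_on S)"
    using L2_square_integrable[OF f] L2_square_integrable[OF g] L2_inner_integrable[OF f g] by simp
  finally show "0 \<le> (\<integral>x. (norm (f x))\<^sup>2 \<partial>lebesgue_on S) * t\<^sup>2
      + 2 * (\<integral>x. f x \<bullet> g x \<partial>lebesgue_on S) * t + (\<integral>x. (norm (g x))\<^sup>2 \<partial>lebesgue_on S)"
    by (simp add: mult_ac)
qed (intro integral_nonneg_AE AE_I2, simp)

lemma L2_inner_tendsto_0:
  assumes f: "\<And>j. f j \<in> L2_functions S" and g: "g \<in> L2_functions S"
    and lim: "(\<lambda>j. \<integral>x. (norm (f j x))\<^sup>2 \<partial>lebesgue_on S) \<longlonglongrightarrow> 0"
  shows "(\<lambda>j. \<integral>x. f j x \<bullet> g x \<partial>lebesgue_on S) \<longlonglongrightarrow> 0"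
proof -
  have "(\<lambda>j. \<integral>x. (norm (f j x))\<^sup>2 \<partial>lebesgue_on S) \<longlonglongrightarrow> 0" by fact
  then have "(\<lambda>j. (\<integral>x. (norm (f j x))\<^sup>2 \<partial>lebesgue_on S) * (\<integral>x. (norm (g x))\<^sup>2 \<partial>lebesgue_on S)) \<longlonglongrightarrow> 0"
    by (rule tendsto_mult_left_zero)
  then have "(\<lambda>j. (\<integral>x. f j x \<bullet> g x \<partial>lebesgue_on S)\<^sup>2) \<longlonglongrightarrow> 0"
    by (rule Lim_null_comparison[rotated]) (use L2_Cauchy_Schwarz[OF f g] in simp)
  from tendsto_real_sqrt[OF this] show ?thesis
    by (simp add: tendsto_rabs_zero_iff)
qed

section \<open>The fundamental lemma of the calculus of variations\<close>

text \<open>Open boxes are stable under intersection and generate the Borel sets, so vanishing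
  integrals spread from boxes to all Borel sets by the pi-lambda argument. A Borel representative
  \<open>g\<close> is used because that argument runs over Borel sets.\<close>

lemma integral_box_eq_0_imp_AE_0:
  fixes f :: "'a::euclidean_space \<Rightarrow> real"
  assumes f: "integrable lebesgue f" and box: "\<And>c d. (\<integral>x. indicator (box c d) x * f x \<partial>lebesgue) = 0"
  shows "AE x in lebesgue. f x = 0"
proof -
  obtain g where g[measurable]: "g \<in> borel_measurable lborel" and ae: "AE x in lborel. f x = g x"
    using completion_ex_borel_measurable_real[of f lborel] f by auto
  have fm: "f \<in> borel_measurable lebesgue" using f by simp
  have gm: "g \<in> borel_measurable lebesgue" using g by (rule measurable_completion)
  have ae': "AE x in lebesgue. f x = g x" using ae by (rule AE_completion)
  have "integrable lebesgue g"
    by (rule integrable_cong_AE_imp[OF f gm]) (use ae' in \<open>auto simp: eq_commute\<close>)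
  then have ig: "integrable lborel g" using integrable_completion[of g lborel] g by simp
  have eq: "(\<integral>x. indicator A x * g x \<partial>lborel) = (\<integral>x. indicator A x * f x \<partial>lebesgue)" if A: "A \<in> sets borel" for A
  proof -
    have Am: "indicator A \<in> borel_measurable lebesgue"
      using A by (intro borel_measurable_indicator) auto
    have "(\<integral>x. indicator A x * g x \<partial>lborel) = (\<integral>x. indicator A x * g x \<partial>lebesgue)"
      using A g by (subst integral_completion) auto
    also have "\<dots> = (\<integral>x. indicator A x * f x \<partial>lebesgue)"
      using ae' fm gm Am by (intro integral_cong_AE borel_measurable_times) auto
    finally show ?thesis .
  qed
  let ?E = "range (\<lambda>(a, b). box a b::'a set)"
  have int: "integrable lborel (\<lambda>x. indicator A x * g x)" if "A \<in> sets borel" for A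
    using integrable_mult_indicator[of A lborel g] ig that by simp
  have "(\<integral>x. indicator A x * g x \<partial>lborel) = 0" if A: "A \<in> sets borel" for A
  proof -
    have B: "sets borel = sigma_sets UNIV ?E" by (simp add: borel_eq_box)
    have st: "Int_stable ?E" by (auto simp: Int_stable_def box_Int_box)
    \<comment> \<open>The complement step needs the integral over the whole space, which is the
      limit along growing boxes.\<close>
    have tot: "(\<integral>x. g x \<partial>lborel) = 0"
    proof -
      let ?A = "\<lambda>n::nat. box (- (real n *\<^sub>R One)) (real n *\<^sub>R One) :: 'a set"
      have "(\<lambda>n. \<integral>x. indicator (?A n) x * g x \<partial>lborel) \<longlonglongrightarrow> (\<integral>x. g x \<partial>lborel)"
      proof (rule integral_dominated_convergence[where w="\<lambda>x. norm (g x)"])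
        show "AE x in lborel. (\<lambda>n. indicator (?A n) x * g x) \<longlonglongrightarrow> g x"
        proof (rule AE_I2)
          fix x :: 'a
          have "x \<in> (\<Union>i. ?A i)" unfolding UN_box_eq_UNIV by simp
          then obtain m where m: "x \<in> ?A m" by auto
          have "x \<in> ?A n" if "m \<le> n" for n
          proof -
            have "?A m \<subseteq> ?A n" using that by (intro subset_box_imp) auto
            then show ?thesis using m by auto
          qed
          then have "eventually (\<lambda>n. indicator (?A n) x * g x = g x) sequentially"
            by (auto simp: eventually_sequentially intro!: exI[of _ m])
          then show "(\<lambda>n. indicator (?A n) x * g x) \<longlonglongrightarrow> g x" by (rule tendsto_eventually)
        qed
      qed (use ig in \<open>auto simp: indicator_def\<close>)
      moreover have "(\<integral>x. indicator (?A n) x * g x \<partial>lborel) = 0" for n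
        using eq[of "?A n"] box by simp
      ultimately show ?thesis by (simp add: LIMSEQ_const_iff)
    qed
    have "?E \<subseteq> Pow UNIV" by simp
    from st this A[unfolded B] show ?thesis
    proof (induction rule: sigma_sets_induct_disjoint)
      case (basic A)
      then show ?case using eq[of A] box by auto
    next
      case (compl A)
      then have A: "A \<in> sets borel" using B by simp
      have "(\<integral>x. indicator (UNIV - A) x * g x \<partial>lborel) = (\<integral>x. g x - indicator A x * g x \<partial>lborel)"
        by (intro Bochner_Integration.integral_cong) (auto simp: indicator_def)
      then show ?case using compl.IH tot ig int[OF A] by simp
    next
      case (union A)
      then have A: "\<And>i. A i \<in> sets lborel" using B by auto
      have "(LINT x:(\<Union>i. A i)|lborel. g x) = (\<Sum>i. (LINT x:(A i)|lborel. g x))"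
      proof (rule lebesgue_integral_countable_add[OF A])
        show "A i \<inter> A j = {}" if "i \<noteq> j" for i j
          using union.hyps(1) that by (auto simp: disjoint_family_on_def)
        have "(\<Union>i. A i) \<in> sets borel" using A by auto
        then show "set_integrable lborel (\<Union>i. A i) g" using int by (simp add: set_integrable_def)
      qed
      then show ?case using union.IH by (simp add: set_lebesgue_integral_def)
    qed auto
  qed
  then have "AE x in lborel. g x = 0"
    by (intro sigma_finite_measure.density_zero[OF sigma_finite_lborel ig]) (simp add: set_lebesgue_integral_def)
  then have "AE x in lebesgue. g x = 0" by (rule AE_completion)
  then show ?thesis using ae' by auto
qed

text \<open>The cutoffs show that \<open>g\<close> integrates to zero over every box whose closure
  lies in \<open>U\<close>. Each such box is then treated separately, and countably many of them
  cover \<open>U\<close>.\<close>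

lemma fundamental_lemma_real:
  fixes g :: "'a::euclidean_space \<Rightarrow> real"
  assumes U: "open U" and g: "integrable (lebesgue_on U) g"
    and zero: "\<And>\<phi>. \<phi> \<in> test_functions U \<Longrightarrow> (\<integral>x. \<phi> x * g x \<partial>lebesgue_on U) = 0"
  shows "AE x in lebesgue_on U. g x = 0"
proof -
  have US: "U \<inter> space lebesgue \<in> sets lebesgue" using U by simp
  have gU: "integrable lebesgue (\<lambda>x. indicator U x * g x)"
    using g US by (simp add: integrable_restrict_space)
  have boxzero: "(\<integral>x. indicator (box a b) x * g x \<partial>lebesgue) = 0" if ab: "cbox a b \<subseteq> U" for a b
  proof -
    have cm: "(\<lambda>x. cutoff a b j x * (indicator U x * g x)) \<in> borel_measurable lebesgue" for j
    proof -
      have "cutoff a b j \<in> borel_measurable borel"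
        using test_function_C1[OF cutoff_test_function[OF order_refl]]
        by (intro borel_measurable_continuous_onI C1_grad_continuous)
      then have "cutoff a b j \<in> borel_measurable lebesgue" by (intro measurable_completion) simp
      then show ?thesis using gU by measurable
    qed
    have "(\<lambda>j. \<integral>x. cutoff a b j x * (indicator U x * g x) \<partial>lebesgue) \<longlonglongrightarrow>
       (\<integral>x. indicator (box a b) x * (indicator U x * g x) \<partial>lebesgue)"
    proof (rule integral_dominated_convergence[where w="\<lambda>x. norm (indicator U x * g x)"])
      show "AE x in lebesgue. (\<lambda>j. cutoff a b j x * (indicator U x * g x))
          \<longlonglongrightarrow> indicator (box a b) x * (indicator U x * g x)"
        by (intro AE_I2 tendsto_mult cutoff_tendsto tendsto_const)
      show "AE x in lebesgue. norm (cutoff a b j x * (indicator U x * g x)) \<le> norm (indicator U x * g x)" for j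
        using mult_right_mono[OF cutoff_bounds(2), of "norm (indicator U x * g x)" for x] cutoff_bounds(1)[of a b j]
        by (intro AE_I2) (simp add: abs_mult)
      show "(\<lambda>x. indicator (box a b) x * (indicator U x * g x)) \<in> borel_measurable lebesgue"
        by (intro borel_measurable_times[OF borel_measurable_indicator borel_measurable_integrable[OF gU]]) simp
      show "integrable lebesgue (\<lambda>x. norm (indicator U x * g x))" using gU by (rule integrable_norm)
    qed (rule cm)
    moreover have "(\<integral>x. cutoff a b j x * (indicator U x * g x) \<partial>lebesgue) = 0" for j
      using zero[OF cutoff_test_function[OF ab]] US
      by (simp add: integral_restrict_space mult.left_commute)
    moreover have "indicator (box a b) x * (indicator U x * g x) = indicator (box a b) x * g x" for x
      using ab box_subset_cbox[of a b] by (auto simp: indicator_def)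
    ultimately show ?thesis by (simp add: LIMSEQ_const_iff)
  qed
  \<comment> \<open>The function cut off to \<open>box a b\<close> integrates to zero over every box
    of the whole space, since the intersection of two boxes is a box whose closure again lies in
    \<open>U\<close>. The boundary of the box is a null set.\<close>
  have local: "AE x in lebesgue. x \<in> cbox a b \<longrightarrow> g x = 0" if ab: "cbox a b \<subseteq> U" for a b
  proof -
    have bU: "indicator (box a b) x * g x = indicator (box a b) x * (indicator U x * g x)" for x
      using ab box_subset_cbox[of a b] by (auto simp: indicator_def)
    have "AE x in lebesgue. indicator (box a b) x * g x = 0"
    proof (rule integral_box_eq_0_imp_AE_0)
      show "integrable lebesgue (\<lambda>x. indicator (box a b) x * g x)"
        unfolding bU using integrable_mult_indicator[OF _ gU, of "box a b"] by simp
      fix c d :: 'a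
      define c' d' where "c' = (\<Sum>i\<in>Basis. max (c\<bullet>i) (a\<bullet>i) *\<^sub>R i)" and "d' = (\<Sum>i\<in>Basis. min (d\<bullet>i) (b\<bullet>i) *\<^sub>R i)"
      have I: "box c d \<inter> box a b = box c' d'" unfolding c'_def d'_def by (rule box_Int_box)
      have "cbox c' d' \<subseteq> cbox a b" unfolding c'_def d'_def by (auto simp: mem_box)
      then have "(\<integral>x. indicator (box c' d') x * g x \<partial>lebesgue) = 0" using ab by (intro boxzero) auto
      then show "(\<integral>x. indicator (box c d) x * (indicator (box a b) x * g x) \<partial>lebesgue) = 0"
        unfolding I[symmetric] indicator_inter_arith by (simp add: mult.assoc)
    qed
    moreover have "AE x in lebesgue. x \<notin> cbox a b - box a b"
      by (intro AE_not_in) (simp add: negligible_frontier_interval flip: negligible_iff_null_sets)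
    ultimately show ?thesis by eventually_elim (auto simp: indicator_def)
  qed
  obtain \<D> where D: "countable \<D>" "\<D> \<subseteq> Pow U" "\<And>X. X \<in> \<D> \<Longrightarrow> \<exists>a b. X = cbox a b" "\<Union>\<D> = U"
    using open_countable_Union_open_cbox[OF U] by metis
  have "AE x in lebesgue. \<forall>X\<in>\<D>. x \<in> X \<longrightarrow> g x = 0"
  proof (subst AE_ball_countable[OF D(1)], intro ballI)
    fix X assume "X \<in> \<D>"
    then show "AE x in lebesgue. x \<in> X \<longrightarrow> g x = 0" using D(2) D(3)[of X] local by blast
  qed
  then have "AE x in lebesgue. x \<in> U \<longrightarrow> g x = 0"
    by eventually_elim (use D(4) in blast)
  then show ?thesis using US by (simp add: AE_restrict_space_iff)
qed

lemma test_function_L2: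
  assumes "\<phi> \<in> test_functions W" "bounded S" "S \<in> sets lebesgue"
  shows "\<phi> \<in> L2_functions S" "grad \<phi> \<in> L2_functions S"
  using assms test_function_C1[OF assms(1)]
  by (auto intro!: L2_continuous intro: C1_grad_continuous C1_grad_continuous_grad)

lemma fundamental_lemma:
  fixes g :: "'a::euclidean_space \<Rightarrow> 'b::euclidean_space"
  assumes U: "open U" "bounded U" and g: "g \<in> L2_functions U"
    and zero: "\<And>\<phi>. \<phi> \<in> test_functions U \<Longrightarrow> (\<integral>x. \<phi> x *\<^sub>R g x \<partial>lebesgue_on U) = 0"
  shows "AE x in lebesgue_on U. g x = 0"
proof -
  have L: "U \<in> lmeasurable" using U by (simp add: lmeasurable_open)
  have ig: "integrable (lebesgue_on U) g" by (rule L2_integrable[OF L g])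
  have "AE x in lebesgue_on U. g x \<bullet> b = 0" if b: "b \<in> Basis" for b
  proof (rule fundamental_lemma_real[OF U(1)])
    show "integrable (lebesgue_on U) (\<lambda>x. g x \<bullet> b)" using ig by simp
    fix \<phi> :: "'a \<Rightarrow> real" assume p: "\<phi> \<in> test_functions U"
    have ip: "integrable (lebesgue_on U) (\<lambda>x. \<phi> x *\<^sub>R g x)"
      using U p g by (intro L2_scaleR_integrable test_function_L2[of _ U]) auto
    have "(\<integral>x. \<phi> x * (g x \<bullet> b) \<partial>lebesgue_on U) = (\<integral>x. (\<phi> x *\<^sub>R g x) \<bullet> b \<partial>lebesgue_on U)" by simp
    also have "\<dots> = (\<integral>x. \<phi> x *\<^sub>R g x \<partial>lebesgue_on U) \<bullet> b" using ip by (rule integral_inner_left)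
    finally show "(\<integral>x. \<phi> x * (g x \<bullet> b) \<partial>lebesgue_on U) = 0" using zero[OF p] by simp
  qed
  then have "AE x in lebesgue_on U. \<forall>b\<in>Basis. g x \<bullet> b = 0"
    by (intro AE_finite_allI) auto
  then show ?thesis by eventually_elim (simp add: euclidean_all_zero_iff)
qed

section \<open>Weak gradients\<close>

text \<open>This is what makes the arbitrary choice in \<open>weak_grad\<close> harmless: any
  concrete weak gradient may replace it almost everywhere.\<close>

lemma has_weak_gradient_unique:
  assumes U: "open U" "bounded U" and g: "has_weak_gradient U u g" and h: "has_weak_gradient U u h"
  shows "AE x in lebesgue_on U. g x = h x"
proof -
  have L2: "g \<in> L2_functions U" "h \<in> L2_functions U" using g h by (auto simp: has_weak_gradient_def)
  have "AE x in lebesgue_on U. g x - h x = 0"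
  proof (rule fundamental_lemma[OF U L2_diff[OF L2]])
    fix \<phi> :: "'a \<Rightarrow> real" assume p: "\<phi> \<in> test_functions U"
    have i: "integrable (lebesgue_on U) (\<lambda>x. \<phi> x *\<^sub>R g x)" "integrable (lebesgue_on U) (\<lambda>x. \<phi> x *\<^sub>R h x)"
      using U p L2 by (auto intro!: L2_scaleR_integrable test_function_L2[of _ U])
    have "(\<integral>x. \<phi> x *\<^sub>R g x \<partial>lebesgue_on U) = (\<integral>x. \<phi> x *\<^sub>R h x \<partial>lebesgue_on U)"
      using g h p unfolding has_weak_gradient_def by (metis neg_equal_iff_equal)
    then show "(\<integral>x. \<phi> x *\<^sub>R (g x - h x) \<partial>lebesgue_on U) = 0"
      using i by (simp add: scaleR_diff_right)
  qed
  then show ?thesis by eventually_elim simp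
qed

lemma weak_grad_works: "u \<in> H1 U \<Longrightarrow> has_weak_gradient U u (weak_grad U u)"
  unfolding weak_grad_def H1_def by (simp add: someI_ex)

lemma weak_grad_AE:
  assumes "open U" "bounded U" "has_weak_gradient U u g"
  shows "AE x in lebesgue_on U. weak_grad U u x = g x"
  using assms by (intro has_weak_gradient_unique[OF assms(1,2) weak_grad_works]) (auto simp: H1_def)

lemma has_weak_gradient_AE_cong:
  assumes U: "open U" and u: "has_weak_gradient U u g" and ae: "AE x in lebesgue_on U. u x = v x"
    and ae': "AE x in lebesgue_on U. g x = h x"
  shows "has_weak_gradient U v h"
proof -
  have US: "U \<in> sets lebesgue" using U by simp
  have v: "v \<in> L2_functions U" "h \<in> L2_functions U" "u \<in> L2_functions U" "g \<in> L2_functions U"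
    using L2_AE_cong[OF US _ ae] L2_AE_cong[OF US _ ae'] u by (auto simp: has_weak_gradient_def)
  have "(\<integral>x. v x *\<^sub>R grad \<phi> x \<partial>lebesgue_on U) = - (\<integral>x. \<phi> x *\<^sub>R h x \<partial>lebesgue_on U)"
    if p: "\<phi> \<in> test_functions U" for \<phi>
  proof -
    have pm: "\<phi> \<in> borel_measurable (lebesgue_on U)" "grad \<phi> \<in> borel_measurable (lebesgue_on U)"
      using C1_grad_continuous[OF test_function_C1[OF p], of U] C1_grad_continuous_grad[OF test_function_C1[OF p], of U] US
      by (auto intro: continuous_imp_measurable_on_sets_lebesgue)
    have "(\<integral>x. v x *\<^sub>R grad \<phi> x \<partial>lebesgue_on U) = (\<integral>x. u x *\<^sub>R grad \<phi> x \<partial>lebesgue_on U)"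
      using ae pm v[THEN L2_measurable] by (intro integral_cong_AE) auto
    also have "\<dots> = - (\<integral>x. \<phi> x *\<^sub>R g x \<partial>lebesgue_on U)"
      using u p by (simp add: has_weak_gradient_def)
    also have "(\<integral>x. \<phi> x *\<^sub>R g x \<partial>lebesgue_on U) = (\<integral>x. \<phi> x *\<^sub>R h x \<partial>lebesgue_on U)"
      using ae' pm v[THEN L2_measurable] by (intro integral_cong_AE) auto
    finally show ?thesis .
  qed
  then show ?thesis using v by (simp add: has_weak_gradient_def)
qed

lemma has_weak_gradient_add:
  assumes U: "open U" "bounded U" and u: "has_weak_gradient U u g" and v: "has_weak_gradient U v h"
  shows "has_weak_gradient U (\<lambda>x. u x + v x) (\<lambda>x. g x + h x)"
proof -
  have US: "U \<in> sets lebesgue" using U by simp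
  have L: "u \<in> L2_functions U" "g \<in> L2_functions U" "v \<in> L2_functions U" "h \<in> L2_functions U"
    using u v by (auto simp: has_weak_gradient_def)
  have "(\<integral>x. (u x + v x) *\<^sub>R grad \<phi> x \<partial>lebesgue_on U) = - (\<integral>x. \<phi> x *\<^sub>R (g x + h x) \<partial>lebesgue_on U)"
    if p: "\<phi> \<in> test_functions U" for \<phi>
  proof -
    note i = L2_scaleR_integrable[OF _ test_function_L2(2)[OF p U(2) US]]
      L2_scaleR_integrable[OF test_function_L2(1)[OF p U(2) US]]
    show ?thesis
      using u v p i(1)[OF L(1)] i(1)[OF L(3)] i(2)[OF L(2)] i(2)[OF L(4)]
      by (simp add: has_weak_gradient_def scaleR_add_left scaleR_add_right)
  qed
  then show ?thesis using L by (simp add: has_weak_gradient_def L2_add)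
qed

lemma has_weak_gradient_scale:
  assumes u: "has_weak_gradient U u g"
  shows "has_weak_gradient U (\<lambda>x. c * u x) (\<lambda>x. c *\<^sub>R g x)"
proof -
  have L: "(\<lambda>x. c * u x) \<in> L2_functions U" "(\<lambda>x. c *\<^sub>R g x) \<in> L2_functions U"
    using u L2_scale[of u U c] L2_scale[of g U c] by (auto simp: has_weak_gradient_def)
  have "(\<integral>x. (c * u x) *\<^sub>R grad \<phi> x \<partial>lebesgue_on U) = - (\<integral>x. \<phi> x *\<^sub>R c *\<^sub>R g x \<partial>lebesgue_on U)"
    if p: "\<phi> \<in> test_functions U" for \<phi>
  proof -
    have "(\<integral>x. (c * u x) *\<^sub>R grad \<phi> x \<partial>lebesgue_on U) = c *\<^sub>R (\<integral>x. u x *\<^sub>R grad \<phi> x \<partial>lebesgue_on U)"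
      by (simp flip: integral_scaleR_right scaleR_scaleR)
    also have "\<dots> = - (c *\<^sub>R (\<integral>x. \<phi> x *\<^sub>R g x \<partial>lebesgue_on U))"
      using u p by (simp add: has_weak_gradient_def)
    also have "c *\<^sub>R (\<integral>x. \<phi> x *\<^sub>R g x \<partial>lebesgue_on U) = (\<integral>x. \<phi> x *\<^sub>R c *\<^sub>R g x \<partial>lebesgue_on U)"
      by (simp add: mult.commute flip: integral_scaleR_right)
    finally show ?thesis .
  qed
  then show ?thesis using L by (simp add: has_weak_gradient_def)
qed

lemma has_weak_gradient_diff:
  assumes U: "open U" "bounded U" and u: "has_weak_gradient U u g" and v: "has_weak_gradient U v h"
  shows "has_weak_gradient U (\<lambda>x. u x - v x) (\<lambda>x. g x - h x)"
  using has_weak_gradient_add[OF U u has_weak_gradient_scale[OF v, of "-1"]] by simp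

lemma integral_restrict_supported:
  fixes f :: "'a::euclidean_space \<Rightarrow> 'b::euclidean_space"
  assumes "W \<subseteq> U" "W \<in> sets lebesgue" "U \<in> sets lebesgue" "\<And>x. x \<notin> W \<Longrightarrow> f x = 0"
  shows "integral\<^sup>L (lebesgue_on W) f = integral\<^sup>L (lebesgue_on U) f"
proof -
  have "(\<lambda>x. indicator W x *\<^sub>R f x) = (\<lambda>x. indicator U x *\<^sub>R f x)"
    using assms(1,4) by (auto simp: indicator_def fun_eq_iff)
  then show ?thesis using assms by (simp add: integral_restrict_space)
qed

text \<open>Test functions on \<open>W\<close> are test functions on \<open>U\<close>, and the
  integrands vanish outside their supports.\<close>

lemma has_weak_gradient_restrict:
  assumes W: "open W" "W \<subseteq> U" "open U" and u: "has_weak_gradient U u g"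
  shows "has_weak_gradient W u g"
proof -
  have S: "W \<in> sets lebesgue" "U \<in> sets lebesgue" using W by auto
  have "(\<integral>x. u x *\<^sub>R grad \<phi> x \<partial>lebesgue_on W) = - (\<integral>x. \<phi> x *\<^sub>R g x \<partial>lebesgue_on W)"
    if p: "\<phi> \<in> test_functions W" for \<phi>
  proof -
    obtain K where K: "compact K" "K \<subseteq> W" "\<And>x. x \<notin> K \<Longrightarrow> \<phi> x = 0" "\<And>x. x \<notin> K \<Longrightarrow> grad \<phi> x = 0"
      by (rule test_function_support[OF p]) (rule that)
    have "\<phi> \<in> test_functions U" using p test_functions_mono[OF W(2)] by auto
    moreover have "(\<integral>x. u x *\<^sub>R grad \<phi> x \<partial>lebesgue_on W) = (\<integral>x. u x *\<^sub>R grad \<phi> x \<partial>lebesgue_on U)"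
      using K by (intro integral_restrict_supported W S) auto
    moreover have "(\<integral>x. \<phi> x *\<^sub>R g x \<partial>lebesgue_on W) = (\<integral>x. \<phi> x *\<^sub>R g x \<partial>lebesgue_on U)"
      using K by (intro integral_restrict_supported W S) auto
    ultimately show ?thesis using u by (simp add: has_weak_gradient_def)
  qed
  then show ?thesis
    using u L2_subset[OF W(2) S, of u] L2_subset[OF W(2) S, of g] by (auto simp: has_weak_gradient_def)
qed

text \<open>The product with a test function has compact support, so the integral of its gradient is
  zero; the product rule splits that into the two integrals of the definition.\<close>

lemma C1_has_weak_gradient:
  assumes f: "C1_grad f G" and U: "open U" "bounded U"
  shows "has_weak_gradient U f G"
proof -
  have US: "U \<in> sets lebesgue" using U by simp
  have L: "f \<in> L2_functions U" "G \<in> L2_functions U"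
    using C1_grad_continuous[OF f] C1_grad_continuous_grad[OF f] U US by (auto intro!: L2_continuous)
  have "(\<integral>x. f x *\<^sub>R grad \<phi> x \<partial>lebesgue_on U) = - (\<integral>x. \<phi> x *\<^sub>R G x \<partial>lebesgue_on U)"
    if p: "\<phi> \<in> test_functions U" for \<phi>
  proof -
    obtain K where K: "compact K" "K \<subseteq> U" "\<And>x. x \<notin> K \<Longrightarrow> \<phi> x = 0" "\<And>x. x \<notin> K \<Longrightarrow> grad \<phi> x = 0"
      by (rule test_function_support[OF p]) (rule that)
    have C: "C1_grad (\<lambda>x. f x * \<phi> x) (\<lambda>x. f x *\<^sub>R grad \<phi> x + \<phi> x *\<^sub>R G x)"
      by (rule C1_grad_mult[OF f test_function_C1[OF p]])
    have Z: "integral\<^sup>L lborel (\<lambda>x. f x *\<^sub>R grad \<phi> x + \<phi> x *\<^sub>R G x) = 0"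
      by (rule integral_gradient_compact_support(2)[OF C K(1)]) (simp add: K)
    have m: "(\<lambda>x. f x *\<^sub>R grad \<phi> x + \<phi> x *\<^sub>R G x) \<in> borel_measurable lborel"
      using borel_measurable_continuous_onI[OF C1_grad_continuous_grad[OF C]] by simp
    have "integral\<^sup>L (lebesgue_on U) (\<lambda>x. f x *\<^sub>R grad \<phi> x + \<phi> x *\<^sub>R G x)
      = integral\<^sup>L (lebesgue_on UNIV) (\<lambda>x. f x *\<^sub>R grad \<phi> x + \<phi> x *\<^sub>R G x)"
    proof (rule integral_restrict_supported)
      fix x assume "x \<notin> U"
      then have "x \<notin> K" using K(2) by auto
      then show "f x *\<^sub>R grad \<phi> x + \<phi> x *\<^sub>R G x = 0" using K(3,4) by simp
    qed (use US in auto)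
    also have "\<dots> = 0" using Z m by (simp add: lebesgue_on_UNIV_eq integral_completion)
    finally have "integral\<^sup>L (lebesgue_on U) (\<lambda>x. f x *\<^sub>R grad \<phi> x + \<phi> x *\<^sub>R G x) = 0" .
    moreover have "integrable (lebesgue_on U) (\<lambda>x. f x *\<^sub>R grad \<phi> x)" "integrable (lebesgue_on U) (\<lambda>x. \<phi> x *\<^sub>R G x)"
      using L test_function_L2[OF p U(2) US] by (auto intro: L2_scaleR_integrable)
    ultimately show ?thesis by (simp add: eq_neg_iff_add_eq_0)
  qed
  then show ?thesis using L by (simp add: has_weak_gradient_def)
qed

section \<open>Barycentric coordinates\<close>

locale full_simplex =
  fixes C :: "'a::euclidean_space set"
  assumes indep: "\<not> affine_dependent C" and card_C: "card C = DIM('a) + 1"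
begin

lemma finite_C: "finite C"
  using indep by (rule aff_independent_finite)

definition T :: "'a set" where "T = convex hull C"

definition face :: "'a \<Rightarrow> 'a set" where "face p = convex hull (C - {p})"

text \<open>Barycentric coordinates on the whole space, negative values included: the vertices
  affinely span the space, and affine independence makes the chosen coefficients unique on
  \<open>C\<close>.\<close>

definition bary :: "'a \<Rightarrow> 'a \<Rightarrow> real" where
  "bary q y = (SOME u. sum u C = 1 \<and> (\<Sum>v\<in>C. u v *\<^sub>R v) = y) q"

lemma bary_works: "sum (\<lambda>q. bary q y) C = 1 \<and> (\<Sum>q\<in>C. bary q y *\<^sub>R q) = y"
proof -
  have "aff_dim C = int DIM('a)"
    using aff_dim_affine_independent[OF indep] card_C by simp
  then have "affine hull C = UNIV" using aff_dim_eq_full by blast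
  then have "y \<in> {y. \<exists>u. sum u C = 1 \<and> (\<Sum>v\<in>C. u v *\<^sub>R v) = y}"
    using affine_hull_finite[OF finite_C] by auto
  then have "\<exists>u. sum u C = 1 \<and> (\<Sum>v\<in>C. u v *\<^sub>R v) = y" by simp
  from someI_ex[OF this] show ?thesis unfolding bary_def .
qed

lemma sum_bary: "(\<Sum>q\<in>C. bary q y) = 1" and bary_repr: "(\<Sum>q\<in>C. bary q y *\<^sub>R q) = y"
  using bary_works by auto

lemma bary_unique:
  assumes "sum u C = 1" "(\<Sum>v\<in>C. u v *\<^sub>R v) = y" "q \<in> C"
  shows "bary q y = u q"
proof (rule ccontr)
  assume neq: "bary q y \<noteq> u q"
  have "affine_dependent C"
    unfolding affine_dependent_explicit_finite[OF finite_C]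
  proof (intro exI conjI)
    show "(\<Sum>v\<in>C. bary v y - u v) = 0" using sum_bary assms by (simp add: sum_subtractf)
    show "\<exists>v\<in>C. bary v y - u v \<noteq> 0" using neq assms by (intro bexI[of _ q]) auto
    show "(\<Sum>v\<in>C. (bary v y - u v) *\<^sub>R v) = 0"
      using bary_repr[of y] assms by (simp add: scaleR_diff_left sum_subtractf)
  qed
  then show False using indep by simp
qed

text \<open>The gradient of the affine function \<open>bary q\<close>. It is normal to the face
  opposite to \<open>q\<close>, points towards \<open>q\<close>, and its norm is the reciprocal of
  the distance from \<open>q\<close> to that face.\<close>

definition slope :: "'a \<Rightarrow> 'a" where
  "slope q = (\<Sum>b\<in>Basis. (bary q b - bary q 0) *\<^sub>R b)"

lemma bary_add:
  assumes "q \<in> C"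
  shows "bary q (x + y) = bary q x + bary q y - bary q 0"
proof (rule bary_unique[OF _ _ assms])
  show "(\<Sum>q\<in>C. bary q x + bary q y - bary q 0) = 1"
    using sum_bary by (simp add: sum.distrib sum_subtractf)
  show "(\<Sum>q\<in>C. (bary q x + bary q y - bary q 0) *\<^sub>R q) = x + y"
    using bary_repr by (simp add: scaleR_diff_left scaleR_add_left sum.distrib sum_subtractf)
qed

lemma bary_scale:
  assumes "q \<in> C"
  shows "bary q (r *\<^sub>R x) = r * bary q x + (1 - r) * bary q 0"
proof (rule bary_unique[OF _ _ assms])
  show "(\<Sum>q\<in>C. r * bary q x + (1 - r) * bary q 0) = 1"
    using sum_bary by (simp add: sum.distrib flip: sum_distrib_left)
  show "(\<Sum>q\<in>C. (r * bary q x + (1 - r) * bary q 0) *\<^sub>R q) = r *\<^sub>R x"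
  proof -
    have "(\<Sum>q\<in>C. (r * bary q x + (1 - r) * bary q 0) *\<^sub>R q)
        = r *\<^sub>R (\<Sum>q\<in>C. bary q x *\<^sub>R q) + (1 - r) *\<^sub>R (\<Sum>q\<in>C. bary q 0 *\<^sub>R q)"
      by (simp add: scaleR_add_left sum.distrib scaleR_sum_right)
    then show ?thesis using bary_repr by simp
  qed
qed

lemma bary_affine:
  assumes q: "q \<in> C"
  shows "bary q y = bary q 0 + slope q \<bullet> y"
proof -
  have "linear (\<lambda>x. bary q x - bary q 0)"
    by (rule linearI) (simp_all add: bary_add[OF q] bary_scale[OF q] algebra_simps)
  then interpret linear "\<lambda>x. bary q x - bary q 0" .
  have "bary q y - bary q 0 = bary q (\<Sum>b\<in>Basis. (y \<bullet> b) *\<^sub>R b) - bary q 0"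
    by (simp add: euclidean_representation)
  also have "\<dots> = (\<Sum>b\<in>Basis. (y \<bullet> b) * (bary q b - bary q 0))"
    unfolding sum by (simp add: scale)
  also have "\<dots> = slope q \<bullet> y"
    unfolding slope_def by (simp add: inner_sum_left inner_commute[of y] mult.commute)
  finally show ?thesis by simp
qed

lemma bary_shift:
  assumes "q \<in> C"
  shows "bary q (x + y) = bary q x + slope q \<bullet> y"
  using bary_affine[OF assms, of "x + y"] bary_affine[OF assms, of x] by (simp add: inner_add_right)

lemma bary_diff:
  assumes "q \<in> C"
  shows "slope q \<bullet> (x - y) = bary q x - bary q y"
  using bary_affine[OF assms, of x] bary_affine[OF assms, of y] by (simp add: inner_diff_right)

lemma bary_continuous:
  assumes "q \<in> C"
  shows "continuous_on S (bary q)"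
proof -
  obtain c where "\<And>y. bary q y = c + slope q \<bullet> y" using bary_affine[OF assms] that by blast
  then have "bary q = (\<lambda>y. c + slope q \<bullet> y)" by (rule ext)
  then show ?thesis by (simp only:) (intro continuous_intros)
qed

lemma bary_vertex:
  assumes "q \<in> C" "p \<in> C"
  shows "bary q p = (if q = p then 1 else 0)"
  using bary_unique[of "\<lambda>q. if q = p then 1 else 0" p q] assms finite_C
  by (simp add: if_distrib[of "\<lambda>c. c *\<^sub>R _"] cong: if_cong)

lemma affine_function_bary: "c + g \<bullet> y = (\<Sum>q\<in>C. bary q y * (c + g \<bullet> q))"
proof -
  have "(\<Sum>q\<in>C. bary q y * (c + g \<bullet> q)) = (\<Sum>q\<in>C. bary q y) * c + g \<bullet> (\<Sum>q\<in>C. bary q y *\<^sub>R q)"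
    by (simp add: distrib_left sum.distrib inner_sum_right sum_distrib_right)
  then show ?thesis by (simp add: sum_bary bary_repr)
qed

lemma C_minus_nonempty: "C - {p} \<noteq> {}"
proof
  assume "C - {p} = {}"
  then have "card C \<le> 1" using card_mono[of "{p}" C] by auto
  then show False using card_C DIM_positive[where 'a='a] by linarith
qed

lemma C_nonempty: "C \<noteq> {}"
  using C_minus_nonempty by auto

lemma slope_nonzero:
  assumes "q \<in> C"
  shows "slope q \<noteq> 0"
proof
  assume "slope q = 0"
  obtain p where "p \<in> C" "p \<noteq> q" using C_minus_nonempty[of q] by auto
  then show False
    using bary_diff[OF assms, of q p] bary_vertex[OF assms] assms \<open>slope q = 0\<close> by simp
qed

lemma T_eq: "T = {y. \<forall>q\<in>C. 0 \<le> bary q y}"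
proof (intro set_eqI iffI)
  fix y assume "y \<in> T"
  then obtain u where u: "\<forall>x\<in>C. 0 \<le> u x" "sum u C = 1" "(\<Sum>x\<in>C. u x *\<^sub>R x) = y"
    unfolding T_def convex_hull_finite[OF finite_C] by auto
  then show "y \<in> {y. \<forall>q\<in>C. 0 \<le> bary q y}" using bary_unique[OF u(2,3)] by auto
next
  fix y assume "y \<in> {y. \<forall>q\<in>C. 0 \<le> bary q y}"
  then show "y \<in> T"
    unfolding T_def convex_hull_finite[OF finite_C] using sum_bary bary_repr
    by (auto intro!: exI[of _ "\<lambda>q. bary q y"])
qed

lemma sum_C_minus:
  fixes f :: "'a \<Rightarrow> 'b::ab_group_add"
  assumes "p \<in> C"
  shows "sum f C = f p + sum f (C - {p})"
  using sum.remove[OF finite_C assms] .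

lemma extend_coefficients:
  assumes p: "p \<in> C" and u: "sum u (C - {p}) = 1" "(\<Sum>x\<in>C - {p}. u x *\<^sub>R x) = y"
  shows "bary p y = 0" "q \<in> C - {p} \<Longrightarrow> bary q y = u q"
proof -
  let ?u = "u(p := 0)"
  have e: "sum ?u C = 1" "(\<Sum>x\<in>C. ?u x *\<^sub>R x) = y"
    using u by (auto simp: sum_C_minus[OF p] intro!: sum.cong)
  show "bary p y = 0" using bary_unique[OF e p] by simp
  show "bary q y = u q" if "q \<in> C - {p}"
  proof -
    have "q \<in> C" "q \<noteq> p" using that by auto
    then show ?thesis using bary_unique[OF e, of q] by simp
  qed
qed

lemma restrict_coefficients:
  assumes p: "p \<in> C" and y: "bary p y = 0"
  shows "(\<Sum>q\<in>C - {p}. bary q y) = 1" "(\<Sum>q\<in>C - {p}. bary q y *\<^sub>R q) = y"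
  using sum_bary[of y] bary_repr[of y] y by (simp_all add: sum_C_minus[OF p])

lemma finite_C_minus: "finite (C - {p})" using finite_C by simp

lemma indep_minus: "\<not> affine_dependent (C - {p})"
  using indep affine_dependent_subset[of "C - {p}" C] by auto

lemma face_eq:
  assumes p: "p \<in> C"
  shows "face p = {y. bary p y = 0 \<and> (\<forall>q\<in>C. 0 \<le> bary q y)}"
proof (intro set_eqI iffI)
  fix y assume "y \<in> face p"
  then obtain u where u: "\<forall>x\<in>C - {p}. 0 \<le> u x" "sum u (C - {p}) = 1" "(\<Sum>x\<in>C - {p}. u x *\<^sub>R x) = y"
    unfolding face_def convex_hull_finite[OF finite_C_minus] by auto
  have "0 \<le> bary q y" if "q \<in> C" for q
    using extend_coefficients(1)[OF p u(2,3)] extend_coefficients(2)[OF p u(2,3), of q] u(1) that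
    by (cases "q = p") auto
  then show "y \<in> {y. bary p y = 0 \<and> (\<forall>q\<in>C. 0 \<le> bary q y)}" using extend_coefficients(1)[OF p u(2,3)] by simp
next
  fix y assume "y \<in> {y. bary p y = 0 \<and> (\<forall>q\<in>C. 0 \<le> bary q y)}"
  then show "y \<in> face p"
    unfolding face_def convex_hull_finite[OF finite_C_minus] using restrict_coefficients[OF p, of y]
    by (auto intro!: exI[of _ "\<lambda>q. bary q y"])
qed

lemma rel_interior_face_eq:
  assumes p: "p \<in> C"
  shows "rel_interior (face p) = {y. bary p y = 0 \<and> (\<forall>q\<in>C - {p}. 0 < bary q y)}"
proof (intro set_eqI iffI)
  fix y assume "y \<in> rel_interior (face p)"
  then obtain u where u: "\<forall>x\<in>C - {p}. 0 < u x" "sum u (C - {p}) = 1" "(\<Sum>x\<in>C - {p}. u x *\<^sub>R x) = y"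
    unfolding face_def rel_interior_convex_hull_explicit[OF indep_minus] by auto
  then show "y \<in> {y. bary p y = 0 \<and> (\<forall>q\<in>C - {p}. 0 < bary q y)}"
    using extend_coefficients(1)[OF p u(2,3)] extend_coefficients(2)[OF p u(2,3)] by simp
next
  fix y assume "y \<in> {y. bary p y = 0 \<and> (\<forall>q\<in>C - {p}. 0 < bary q y)}"
  then show "y \<in> rel_interior (face p)"
    unfolding face_def rel_interior_convex_hull_explicit[OF indep_minus]
    using restrict_coefficients[OF p, of y]
    by (auto intro!: exI[of _ "\<lambda>q. bary q y"])
qed

lemma affine_hull_face:
  assumes p: "p \<in> C"
  shows "affine hull (face p) = {y. bary p y = 0}"
proof -
  have "affine hull (face p) = affine hull (C - {p})" by (simp add: face_def affine_hull_convex_hull)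
  also have "\<dots> = {y. \<exists>u. sum u (C - {p}) = 1 \<and> (\<Sum>v\<in>C - {p}. u v *\<^sub>R v) = y}"
    by (rule affine_hull_finite[OF finite_C_minus])
  also have "\<dots> = {y. bary p y = 0}"
    using extend_coefficients(1)[OF p] restrict_coefficients[OF p]
    by (intro set_eqI iffI) (auto intro!: exI[of _ "\<lambda>q. bary q _"])
  finally show ?thesis .
qed

text \<open>The strict inequalities define an open subset of \<open>T\<close>. Conversely, moving by
  \<open>e\<close> against the slope lowers \<open>bary q\<close> by
  \<open>e * norm (slope q)\<close>, so a small ball inside \<open>T\<close> forces
  \<open>bary q\<close> to be positive at its centre.\<close>

lemma interior_T_eq: "interior T = {y. \<forall>q\<in>C. 0 < bary q y}"
proof (intro set_eqI iffI)
  fix y assume y: "y \<in> interior T"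
  have "0 < bary q y" if q: "q \<in> C" for q
  proof -
    obtain e where e: "e > 0" "cball y e \<subseteq> T"
      using y by (meson interior_subset mem_interior_cball)
    let ?z = "y - (e / norm (slope q)) *\<^sub>R slope q"
    have "?z \<in> cball y e" using e slope_nonzero[OF q] by (simp add: dist_norm)
    then have "?z \<in> T" using e(2) by blast
    then have "0 \<le> bary q ?z" using q unfolding T_eq by blast
    also have "bary q ?z = bary q y - e * norm (slope q)"
      using bary_shift[OF q, of y "- ((e / norm (slope q)) *\<^sub>R slope q)"] slope_nonzero[OF q]
      by (simp add: dot_square_norm power2_eq_square)
    finally have "0 \<le> bary q y - e * norm (slope q)" .
    moreover have "0 < e * norm (slope q)" using e(1) slope_nonzero[OF q] by simp
    ultimately show ?thesis by linarith
  qed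
  then show "y \<in> {y. \<forall>q\<in>C. 0 < bary q y}" by simp
next
  fix y assume y: "y \<in> {y. \<forall>q\<in>C. 0 < bary q y}"
  have eq: "{y. \<forall>q\<in>C. 0 < bary q y} = (\<Inter>q\<in>C. {y. 0 < bary q y})" by auto
  have "open (\<Inter>q\<in>C. {y. 0 < bary q y})"
    by (intro open_INT finite_C ballI open_Collect_less bary_continuous continuous_on_const)
  then have "open {y. \<forall>q\<in>C. 0 < bary q y}" unfolding eq .
  moreover have "{y. \<forall>q\<in>C. 0 < bary q y} \<subseteq> T" by (auto simp: T_eq less_imp_le)
  ultimately show "y \<in> interior T" using y interior_maximal by blast
qed

lemma compact_T: "compact T"
  unfolding T_def using finite_C by (intro compact_convex_hull finite_imp_compact)

lemma convex_T: "convex T" by (simp add: T_def)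

lemma lmeasurable_T: "T \<in> lmeasurable" using compact_T by (rule lmeasurable_compact)

lemma sets_T: "T \<in> sets lebesgue" using lmeasurable_T by auto

lemma bounded_T: "bounded T" using compact_T by (rule compact_imp_bounded)

lemma compact_face: "compact (face p)"
  unfolding face_def using finite_C by (intro compact_convex_hull finite_imp_compact) auto

lemma face_facet: "p \<in> C \<Longrightarrow> face p facet_of T"
  unfolding T_def facet_of_convex_hull_affine_independent[OF indep] face_def
  using C_minus_nonempty by auto

lemma facet_imp_face: "F facet_of T \<Longrightarrow> \<exists>p\<in>C. F = face p"
  unfolding T_def facet_of_convex_hull_affine_independent[OF indep] face_def by auto

lemma face_inject: "p \<in> C \<Longrightarrow> q \<in> C \<Longrightarrow> face p = face q \<Longrightarrow> p = q"
proof (rule ccontr)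
  assume a: "p \<in> C" "q \<in> C" "face p = face q" "p \<noteq> q"
  then have "q \<in> face p" unfolding face_def by (intro hull_inc) auto
  then have "bary q q = 0" using a by (simp add: face_eq)
  then show False using bary_vertex[of q q] a by simp
qed

lemma vertices_T: "vertices T = C"
  unfolding vertices_def T_def extreme_point_of_convex_hull_affine_independent[OF indep] by simp

lemma vertices_face: "vertices (face p) = C - {p}"
  unfolding vertices_def face_def extreme_point_of_convex_hull_affine_independent[OF indep_minus] by auto

lemma mid_T: "mid T = (1 / (real DIM('a) + 1)) *\<^sub>R \<Sum>C"
  unfolding mid_def vertices_T card_C by (simp add: add.commute)

lemma card_C_minus: "p \<in> C \<Longrightarrow> card (C - {p}) = DIM('a)"
  using card_C by simp

lemma mid_face:
  assumes "p \<in> C"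
  shows "mid (face p) = mid T + (1 / real DIM('a)) *\<^sub>R (mid T - p)"
proof -
  let ?n = "real DIM('a)"
  have n: "?n > 0" by simp
  have "mid (face p) = (1 / ?n) *\<^sub>R (\<Sum>C - p)"
    unfolding mid_def vertices_face card_C_minus[OF assms] using sum_C_minus[OF assms, of "\<lambda>x. x"] by simp
  also have "\<Sum>C = (?n + 1) *\<^sub>R mid T" unfolding mid_T by simp
  finally have "mid (face p) = (1 / ?n) *\<^sub>R ((?n + 1) *\<^sub>R mid T - p)" .
  also have "\<dots> = mid T + (1 / ?n) *\<^sub>R (mid T - p)"
    by (simp add: scaleR_diff_right scaleR_add_left scaleR_add_right)
  finally show ?thesis .
qed

lemma bary_mid_face:
  assumes "p \<in> C" "q \<in> C"
  shows "bary q (mid (face p)) = (if q = p then 0 else 1 / real DIM('a))"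
proof (rule bary_unique[OF _ _ assms(2)])
  show "(\<Sum>q\<in>C. if q = p then 0 else 1 / real DIM('a)) = 1"
  proof -
    have "(\<Sum>q\<in>C. if q = p then 0 else 1 / real DIM('a)) = (\<Sum>q\<in>C - {p}. 1 / real DIM('a))"
      by (subst sum_C_minus[OF assms(1)]) (auto intro!: sum.cong)
    then show ?thesis using card_C_minus[OF assms(1)] by simp
  qed
  have "(\<Sum>q\<in>C. (if q = p then 0 else 1 / real DIM('a)) *\<^sub>R q) = (\<Sum>q\<in>C - {p}. (1 / real DIM('a)) *\<^sub>R q)"
    by (subst sum_C_minus[OF assms(1)]) (auto intro!: sum.cong)
  then show "(\<Sum>q\<in>C. (if q = p then 0 else 1 / real DIM('a)) *\<^sub>R q) = mid (face p)"
    unfolding mid_def vertices_face card_C_minus[OF assms(1)] by (simp add: scaleR_sum_right)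
qed

lemma mid_T_interior: "mid T \<in> interior T"
proof -
  have "bary q (mid T) = 1 / (real DIM('a) + 1)" if "q \<in> C" for q
    using that card_C by (intro bary_unique) (auto simp: mid_T scaleR_sum_right)
  then show ?thesis by (simp add: interior_T_eq add_pos_pos)
qed

lemma closure_interior_T: "closure (interior T) = T"
  using convex_closure_interior[OF convex_T] mid_T_interior compact_T
  by (metis closure_closed compact_imp_closed empty_iff)

lemma measure_T_pos: "0 < measure lebesgue T"
proof -
  have "\<not> negligible T" using mid_T_interior open_not_negligible[OF open_interior, of T] negligible_subset[OF _ interior_subset]
    by blast
  then show ?thesis using negligible_iff_measure0[OF lmeasurable_T] measure_nonneg[of lebesgue T] by linarith
qed

lemma diameter_T_pos: "0 < diameter T"
proof -
  obtain p where p: "p \<in> C" using C_nonempty by auto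
  obtain q where q: "q \<in> C" "q \<noteq> p" using C_minus_nonempty[of p] by auto
  have "p \<in> T" "q \<in> T" using p q by (auto simp: T_def hull_inc)
  then have "dist p q \<le> diameter T" using diameter_bounded_bound[OF bounded_T] by blast
  moreover have "0 < dist p q" using q by simp
  ultimately show ?thesis by linarith
qed

lemma negligible_boundary: "negligible (T - interior T)"
proof -
  have "T - interior T = frontier T" using compact_T by (simp add: frontier_def compact_imp_closed)
  then show ?thesis using negligible_convex_frontier[OF convex_T] by simp
qed

text \<open>Near a point of the relative interior of the face all other barycentric coordinates stay
  positive, so the sign of \<open>bary p\<close> alone decides membership.\<close>

lemma local_halfspace:
  assumes p: "p \<in> C" and x: "x \<in> rel_interior (face p)"
  obtains e where "e > 0" "\<And>y. y \<in> ball x e \<Longrightarrow> 0 \<le> bary p y \<Longrightarrow> y \<in> T"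
    "\<And>y. y \<in> ball x e \<Longrightarrow> 0 < bary p y \<Longrightarrow> y \<in> interior T"
proof -
  have eq: "{y. \<forall>q\<in>C - {p}. 0 < bary q y} = (\<Inter>q\<in>C - {p}. {y. 0 < bary q y})" by auto
  have "open (\<Inter>q\<in>C - {p}. {y. 0 < bary q y})"
    by (intro open_INT finite_C_minus ballI open_Collect_less bary_continuous continuous_on_const) auto
  then have "open {y. \<forall>q\<in>C - {p}. 0 < bary q y}" unfolding eq .
  moreover have "x \<in> {y. \<forall>q\<in>C - {p}. 0 < bary q y}" using x p by (simp add: rel_interior_face_eq)
  ultimately obtain e where "e > 0" "ball x e \<subseteq> {y. \<forall>q\<in>C - {p}. 0 < bary q y}"
    unfolding open_contains_ball by blast
  then have e: "e > 0" "\<And>y q. y \<in> ball x e \<Longrightarrow> q \<in> C - {p} \<Longrightarrow> 0 < bary q y" by auto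
  have "y \<in> T" if "y \<in> ball x e" "0 \<le> bary p y" for y
  proof -
    have "0 \<le> bary q y" if "q \<in> C" for q
      using e(2)[OF \<open>y \<in> ball x e\<close>, of q] \<open>0 \<le> bary p y\<close> that by (cases "q = p") auto
    then show ?thesis by (simp add: T_eq)
  qed
  moreover have "y \<in> interior T" if "y \<in> ball x e" "0 < bary p y" for y
  proof -
    have "0 < bary q y" if "q \<in> C" for q
      using e(2)[OF \<open>y \<in> ball x e\<close>, of q] \<open>0 < bary p y\<close> that by (cases "q = p") auto
    then show ?thesis by (simp add: interior_T_eq)
  qed
  ultimately show thesis using that[of e] e(1) by blast
qed

text \<open>Orthogonal projection onto the hyperplane of the face opposite to \<open>p\<close>, in
  closed form; it replaces the abstract closest point in \<open>face_prism\<close> and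
  \<open>face_measure\<close>.\<close>

definition proj :: "'a \<Rightarrow> 'a \<Rightarrow> 'a" where
  "proj p x = x - (bary p x / (norm (slope p))\<^sup>2) *\<^sub>R slope p"

lemma bary_proj:
  assumes "p \<in> C" "q \<in> C"
  shows "bary q (proj p x) = bary q x - bary p x / (norm (slope p))\<^sup>2 * (slope q \<bullet> slope p)"
  unfolding proj_def using bary_shift[OF assms(2), of x "- ((bary p x / (norm (slope p))\<^sup>2) *\<^sub>R slope p)"] by simp

lemma bary_proj_self: "p \<in> C \<Longrightarrow> bary p (proj p x) = 0"
  using bary_proj[of p p x] slope_nonzero[of p] by (simp add: dot_square_norm)

lemma dist_proj: "p \<in> C \<Longrightarrow> dist x (proj p x) = \<bar>bary p x\<bar> / norm (slope p)"
  using slope_nonzero[of p] by (simp add: proj_def dist_norm power2_eq_square)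

lemma closest_point_face:
  assumes p: "p \<in> C"
  shows "closest_point (affine hull (face p)) x = proj p x"
proof (rule closest_point_unique[symmetric])
  show "convex (affine hull (face p))" by (simp add: affine_imp_convex)
  show "closed (affine hull (face p))" by simp
  show "proj p x \<in> affine hull (face p)" using bary_proj_self[OF p] by (simp add: affine_hull_face[OF p])
  show "\<forall>z\<in>affine hull (face p). dist x (proj p x) \<le> dist x z"
  proof
    fix z assume "z \<in> affine hull (face p)"
    then have "bary p z = 0" by (simp add: affine_hull_face[OF p])
    then have "bary p x = slope p \<bullet> (x - z)" using bary_diff[OF p, of x z] by simp
    then have "\<bar>bary p x\<bar> \<le> norm (slope p) * norm (x - z)" by (metis Cauchy_Schwarz_ineq2)
    then show "dist x (proj p x) \<le> dist x z"
      unfolding dist_proj[OF p] using slope_nonzero[OF p] by (simp add: dist_norm pos_divide_le_eq mult.commute)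
  qed
qed

end

lemma simplex_full_simplex:
  fixes T :: "'a::euclidean_space set"
  assumes "int DIM('a) simplex T"
  obtains C where "full_simplex C" "full_simplex.T C = T"
proof -
  obtain C where C: "\<not> affine_dependent C" "int (card C) = int DIM('a) + 1" "T = convex hull C"
    using assms unfolding simplex_def by auto
  then have "full_simplex C" by (intro full_simplex.intro) auto
  then show thesis using that C by (simp add: full_simplex.T_def)
qed

section \<open>The divergence theorem on a simplex\<close>

lemma lborel_integral_affine:
  fixes f :: "'a::euclidean_space \<Rightarrow> real"
  assumes [measurable]: "f \<in> borel_measurable borel" and c: "c > 0"
  shows "(\<integral>x. f x \<partial>lborel) = c ^ DIM('a) * (\<integral>x. f (a + c *\<^sub>R x) \<partial>lborel)"
proof -
  have "(\<integral>x. f x \<partial>lborel) = (\<integral>x. f x \<partial>density (distr lborel borel (\<lambda>x. a + c *\<^sub>R x)) (\<lambda>_. ennreal (c ^ DIM('a))))"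
    using lborel_affine[of c a] c by simp
  also have "\<dots> = (\<integral>x. c ^ DIM('a) *\<^sub>R f x \<partial>distr lborel borel (\<lambda>x. a + c *\<^sub>R x))"
    using c by (intro integral_density) auto
  also have "\<dots> = (\<integral>x. c ^ DIM('a) *\<^sub>R f (a + c *\<^sub>R x) \<partial>lborel)"
    by (intro integral_distr) auto
  finally show ?thesis by simp
qed

lemma lborel_integral_shift:
  fixes f :: "'a::euclidean_space \<Rightarrow> real"
  assumes "f \<in> borel_measurable borel"
  shows "(\<integral>x. f x \<partial>lborel) = (\<integral>x. f (x - a) \<partial>lborel)"
  using lborel_integral_affine[OF assms, of 1 "- a"] by simp

text \<open>Half-open slices tile the unit interval without overlap, which turns the sum into a
  telescoping one.\<close>

lemma sum_unit_partition:
  fixes y :: real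
  assumes "N > 0"
  shows "(\<Sum>j<N. of_bool (real j / real N < y \<and> y \<le> real (Suc j) / real N)) = (of_bool (0 < y \<and> y \<le> 1) :: real)"
proof -
  let ?f = "\<lambda>j. of_bool (y \<le> real j / real N) :: real"
  have "of_bool (real j / real N < y \<and> y \<le> real (Suc j) / real N) = ?f (Suc j) - ?f j" for j
  proof -
    have "real j / real N \<le> real (Suc j) / real N" using assms by (simp add: divide_right_mono)
    then show ?thesis by auto
  qed
  then have "(\<Sum>j<N. of_bool (real j / real N < y \<and> y \<le> real (Suc j) / real N)) = (\<Sum>j<N. ?f (Suc j) - ?f j)"
    by (simp only:)
  also have "\<dots> = ?f N - ?f 0" by (rule sum_lessThan_telescope)
  also have "\<dots> = of_bool (0 < y \<and> y \<le> 1)" using assms by auto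
  finally show ?thesis .
qed

lemma bounded_indicator_integrable:
  fixes f :: "'a::euclidean_space \<Rightarrow> real"
  assumes f: "f \<in> borel_measurable borel" and A: "A \<in> sets borel" "bounded A" and b: "\<And>x. x \<in> A \<Longrightarrow> \<bar>f x\<bar> \<le> M"
  shows "integrable lborel (\<lambda>x. indicator A x * f x)"
proof (rule Bochner_Integration.integrable_bound)
  show "integrable lborel (\<lambda>x. M * indicator A x)"
    using emeasure_bounded_finite[OF A(2)] A(1) by (intro integrable_mult_right integrable_real_indicator) auto
  show "(\<lambda>x. indicator A x * f x) \<in> borel_measurable lborel" using f A by simp
  show "AE x in lborel. norm (indicator A x * f x) \<le> norm (M * indicator A x)"
    using b by (intro AE_I2) (fastforce simp: indicator_def)
qed

context full_simplex
begin

abbreviation slope_norm :: "'a \<Rightarrow> real" where "slope_norm p \<equiv> norm (slope p)"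

text \<open>The slope points towards \<open>p\<close>, so the sign makes this the outer unit normal
  of the face opposite to \<open>p\<close>.\<close>

definition normal :: "'a \<Rightarrow> 'a" where "normal p = (- 1 / slope_norm p) *\<^sub>R slope p"

text \<open>Signed distance from the hyperplane of the face, positive on the side away from
  \<open>p\<close>.\<close>

definition height :: "'a \<Rightarrow> 'a \<Rightarrow> real" where "height p x = - bary p x / slope_norm p"

text \<open>The part of the homothetic image of \<open>T\<close> with centre \<open>p\<close> that lies beyond the face opposite
  to \<open>p\<close>, up to height \<open>1 / N\<close>.\<close>

definition shell :: "'a \<Rightarrow> nat \<Rightarrow> 'a set" where
  "shell p N = {x. 0 < height p x \<and> height p x \<le> 1 / real N \<and> (\<forall>q\<in>C - {p}. 0 \<le> bary q x)}"

definition prism :: "'a \<Rightarrow> 'a set" where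
  "prism p = {x. (\<forall>q\<in>C. 0 \<le> bary q (proj p x)) \<and> \<bar>height p x\<bar> \<le> 1 / 2}"

lemma slope_norm_pos: "p \<in> C \<Longrightarrow> 0 < slope_norm p"
  using slope_nonzero by simp

lemma norm_normal: "p \<in> C \<Longrightarrow> norm (normal p) = 1"
  using slope_norm_pos[of p] by (simp add: normal_def)

lemma height_shift:
  assumes "p \<in> C"
  shows "height p (x - r *\<^sub>R normal p) = height p x - r"
proof -
  have "bary p (x - r *\<^sub>R normal p) = bary p x + r * slope_norm p"
    using bary_shift[OF assms, of x "- (r *\<^sub>R normal p)"] slope_norm_pos[OF assms]
    by (simp add: normal_def dot_square_norm power2_eq_square)
  then show ?thesis using slope_norm_pos[OF assms] by (simp add: height_def field_simps)
qed

lemma proj_height: "p \<in> C \<Longrightarrow> x = proj p x + height p x *\<^sub>R normal p"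
  using slope_norm_pos[of p] by (simp add: proj_def height_def normal_def power2_eq_square)

lemma proj_shift:
  assumes "p \<in> C"
  shows "proj p (x - r *\<^sub>R normal p) = proj p x"
proof -
  have "proj p (x - r *\<^sub>R normal p) = (x - r *\<^sub>R normal p) - (height p x - r) *\<^sub>R normal p"
    using proj_height[OF assms, of "x - r *\<^sub>R normal p"] unfolding height_shift[OF assms]
    by (metis add_diff_cancel_right')
  also have "\<dots> = x - height p x *\<^sub>R normal p" by (simp add: scaleR_diff_left)
  also have "\<dots> = proj p x" using proj_height[OF assms, of x] by (metis add_diff_cancel_right')
  finally show ?thesis .
qed

lemma height_continuous: "p \<in> C \<Longrightarrow> continuous_on S (height p)"
  unfolding height_def divide_inverse
  by (intro continuous_on_mult continuous_on_minus continuous_on_const bary_continuous)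

lemma proj_continuous: "p \<in> C \<Longrightarrow> continuous_on S (proj p)"
  unfolding proj_def divide_inverse
  by (intro continuous_on_diff continuous_on_id continuous_on_scaleR continuous_on_mult
      continuous_on_const bary_continuous)

lemma bary_proj_affine:
  assumes p: "p \<in> C" and q: "q \<in> C"
  obtains c g where "\<And>x. bary q (proj p x) = c + g \<bullet> x"
proof
  fix x
  show "bary q (proj p x) = (bary q 0 - bary p 0 / (slope_norm p)\<^sup>2 * (slope q \<bullet> slope p))
     + (slope q - ((slope q \<bullet> slope p) / (slope_norm p)\<^sup>2) *\<^sub>R slope p) \<bullet> x"
    unfolding bary_proj[OF p q] bary_affine[OF q, of x] bary_affine[OF p, of x]
    by (simp add: inner_diff_left add_divide_distrib algebra_simps)
qed

lemma bary_normal_bound: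
  assumes "p \<in> C" "q \<in> C" "0 \<le> height p x" "height p x \<le> e"
  shows "\<bar>bary q x - bary q (proj p x)\<bar> \<le> slope_norm q * e"
proof -
  have "bary q x = bary q (proj p x + height p x *\<^sub>R normal p)"
    using proj_height[OF assms(1), of x] by simp
  then have "bary q x - bary q (proj p x) = slope q \<bullet> (height p x *\<^sub>R normal p)"
    unfolding bary_shift[OF assms(2)] by simp
  then have "\<bar>bary q x - bary q (proj p x)\<bar> \<le> slope_norm q * norm (height p x *\<^sub>R normal p)"
    by (simp only: Cauchy_Schwarz_ineq2)
  also have "\<dots> \<le> slope_norm q * e" using assms norm_normal[OF assms(1)] by (intro mult_left_mono) auto
  finally show ?thesis .
qed

text \<open>In dimension at least two there is a third vertex \<open>r\<close> besides
  \<open>p\<close> and \<open>q\<close>. The affine function \<open>bary q (proj p x)\<close> is one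
  at \<open>q\<close> and zero at \<open>r\<close>, hence not constant, and its zero set is a
  hyperplane.\<close>

lemma negligible_proj_boundary:
  assumes n: "DIM('a) \<ge> 2" and p: "p \<in> C" and q: "q \<in> C - {p}"
  shows "negligible {x. bary q (proj p x) = 0}"
proof -
  obtain c g where cg: "\<And>x. bary q (proj p x) = c + g \<bullet> x" using bary_proj_affine[OF p] q by blast
  have "card (C - {p} - {q}) \<noteq> 0" using card_C_minus[OF p] q n by simp
  then obtain r where r: "r \<in> C" "r \<noteq> p" "r \<noteq> q" by (metis Diff_iff card.empty ex_in_conv insertI1)
  have "proj p q = q" "proj p r = r" using bary_vertex[OF p] q r by (auto simp: proj_def)
  then have "c + g \<bullet> q = 1" "c + g \<bullet> r = 0"
    using cg[of q] cg[of r] bary_vertex[of q] q r by auto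
  then have "g \<noteq> 0" by auto
  then have "negligible {x. g \<bullet> x = - c}" by (intro negligible_hyperplane) simp
  moreover have "{x. bary q (proj p x) = 0} = {x. g \<bullet> x = - c}" by (auto simp: cg)
  ultimately show ?thesis by simp
qed

lemma negligible_height:
  assumes p: "p \<in> C"
  shows "negligible {x. height p x = c}"
proof -
  have "height p x = c \<longleftrightarrow> slope p \<bullet> x = - c * slope_norm p - bary p 0" for x
  proof -
    have "height p x = c \<longleftrightarrow> bary p x = - c * slope_norm p"
      using slope_nonzero[OF p] by (auto simp: height_def field_simps)
    then show ?thesis using bary_affine[OF p, of x] by linarith
  qed
  then have "{x. height p x = c} = {x. slope p \<bullet> x = - c * slope_norm p - bary p 0}" by simp
  then show ?thesis using slope_nonzero[OF p] by (simp add: negligible_hyperplane)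
qed

section \<open>The surface measure of a face\<close>

lemma face_prism_eq:
  assumes p: "p \<in> C"
  shows "face_prism (face p) = prism p"
proof -
  have "x \<in> face_prism (face p) \<longleftrightarrow> proj p x \<in> face p \<and> \<bar>bary p x\<bar> / slope_norm p \<le> 1 / 2" for x
    unfolding face_prism_def mem_Collect_eq closest_point_face[OF p] dist_proj[OF p] ..
  moreover have "proj p x \<in> face p \<longleftrightarrow> (\<forall>q\<in>C. 0 \<le> bary q (proj p x))" for x
    unfolding face_eq[OF p] mem_Collect_eq using bary_proj_self[OF p] by blast
  moreover have "\<bar>height p x\<bar> = \<bar>bary p x\<bar> / slope_norm p" for x by (simp add: height_def)
  ultimately show ?thesis unfolding prism_def by (intro set_eqI) (simp only: mem_Collect_eq)
qed

lemma closed_prism: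
  assumes p: "p \<in> C"
  shows "closed (prism p)"
proof -
  have "prism p = proj p -` (face p) \<inter> {x. \<bar>height p x\<bar> \<le> 1 / 2}"
    using bary_proj_self[OF p] by (auto simp: prism_def face_eq[OF p])
  moreover have "closed (proj p -` (face p))"
    using compact_face by (intro closed_vimage proj_continuous p compact_imp_closed)
  moreover have "closed {x. \<bar>height p x\<bar> \<le> 1 / 2}"
    by (intro closed_Collect_le continuous_intros height_continuous p)
  ultimately show ?thesis by auto
qed

lemma bounded_prism:
  assumes p: "p \<in> C"
  shows "bounded (prism p)"
proof -
  obtain R where R: "\<And>x. x \<in> face p \<Longrightarrow> norm x \<le> R"
    using compact_imp_bounded[OF compact_face] unfolding bounded_iff by blast
  have "norm x \<le> R + 1 / 2" if x: "x \<in> prism p" for x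
  proof -
    have "proj p x \<in> face p" using x bary_proj_self[OF p] by (simp add: prism_def face_eq[OF p])
    moreover have "norm x \<le> norm (proj p x) + norm (height p x *\<^sub>R normal p)"
      using norm_triangle_ineq proj_height[OF p, of x] by metis
    ultimately show ?thesis using R[of "proj p x"] x norm_normal[OF p] by (simp add: prism_def)
  qed
  then show ?thesis unfolding bounded_iff by blast
qed

lemma face_measure_eq:
  assumes p: "p \<in> C"
  shows "face_measure (face p) = distr (lebesgue_on (prism p)) borel (proj p)"
proof -
  have "closest_point (affine hull (face p)) = proj p" using closest_point_face[OF p] by auto
  then show ?thesis unfolding face_measure_def face_prism_eq[OF p] by simp
qed

lemma proj_measurable: "p \<in> C \<Longrightarrow> proj p \<in> measurable (lebesgue_on S) borel"
  by (rule measurable_restrict_space1, rule measurable_completion)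
     (simp add: borel_measurable_continuous_onI proj_continuous)

lemma prism_lmeasurable: "p \<in> C \<Longrightarrow> prism p \<in> lmeasurable"
  using closed_prism bounded_prism by (intro lmeasurable_compact) (simp add: compact_eq_bounded_closed)

lemma face_measure_finite:
  assumes p: "p \<in> C"
  shows "finite_measure (face_measure (face p))"
  unfolding face_measure_eq[OF p]
  by (intro finite_measure.finite_measure_distr finite_measure_lebesgue_on prism_lmeasurable proj_measurable p)

lemma sets_face_measure: "sets (face_measure F) = sets borel"
  by (simp add: face_measure_def)

lemma face_measure_AE:
  assumes p: "p \<in> C"
  shows "AE x in face_measure (face p). x \<in> face p"
proof -
  have "Measurable.pred borel (\<lambda>x. x \<in> face p)"
    using compact_imp_closed[OF compact_face] by (simp add: pred_def borel_closed)
  then show ?thesis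
    unfolding face_measure_eq[OF p]
    by (subst AE_distr_iff[OF proj_measurable[OF p]])
       (use bary_proj_self[OF p] in \<open>auto simp: prism_def face_eq[OF p] pred_def\<close>)
qed

lemma face_measure_integral:
  fixes f :: "'a \<Rightarrow> real"
  assumes p: "p \<in> C" and f: "f \<in> borel_measurable borel"
  shows "(\<integral>x. f x \<partial>face_measure (face p)) = (\<integral>x. indicator (prism p) x * f (proj p x) \<partial>lborel)"
proof -
  have m: "(\<lambda>x. f (proj p x)) \<in> borel_measurable borel"
    using f borel_measurable_continuous_onI[OF proj_continuous[OF p]] by measurable
  have B: "prism p \<in> sets borel" using closed_prism[OF p] by (rule borel_closed)
  have "(\<integral>x. f x \<partial>face_measure (face p)) = (\<integral>x. f (proj p x) \<partial>lebesgue_on (prism p))"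
    unfolding face_measure_eq[OF p] by (rule integral_distr[OF proj_measurable[OF p] f])
  also have "\<dots> = (\<integral>x. indicator (prism p) x * f (proj p x) \<partial>lebesgue)"
    using B by (subst integral_restrict_space) auto
  also have "\<dots> = (\<integral>x. indicator (prism p) x * f (proj p x) \<partial>lborel)"
    using m B by (intro integral_completion) simp
  finally show ?thesis .
qed

section \<open>Shells beyond a face and the divergence theorem\<close>

lemma shell_measurable: "p \<in> C \<Longrightarrow> shell p N \<in> sets borel"
proof -
  assume p: "p \<in> C"
  have "shell p N = {x. 0 < height p x} \<inter> {x. height p x \<le> 1 / real N} \<inter> (\<Inter>q\<in>C - {p}. {x. 0 \<le> bary q x})"
    by (auto simp: shell_def)
  moreover have "open {x. 0 < height p x}"
    by (intro open_Collect_less continuous_on_const height_continuous p)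
  moreover have "closed {x. height p x \<le> 1 / real N}"
    by (intro closed_Collect_le continuous_on_const height_continuous p)
  moreover have "closed (\<Inter>q\<in>C - {p}. {x. 0 \<le> bary q x})"
    by (intro closed_INT ballI closed_Collect_le continuous_on_const bary_continuous) auto
  ultimately show ?thesis by auto
qed

text \<open>Every point of a shell is the image of a point of \<open>T\<close> under a homothety
  with centre \<open>p\<close> whose ratio is at most \<open>1 + slope_norm p\<close>, and this
  bound does not depend on \<open>N\<close>.\<close>

lemma shell_bounded:
  assumes p: "p \<in> C"
  obtains R where "\<And>N x. N > 0 \<Longrightarrow> x \<in> shell p N \<Longrightarrow> norm x \<le> R" "0 \<le> R"
proof -
  obtain B where B: "\<And>x. x \<in> T \<Longrightarrow> norm x \<le> B" using bounded_T unfolding bounded_iff by blast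
  define R where "R = norm p + (1 + slope_norm p) * (B + norm p)"
  have pT: "p \<in> T" using p by (simp add: T_def hull_inc)
  then have B0: "0 \<le> B" using B[of p] norm_ge_zero[of p] by linarith
  have "norm x \<le> R" if N: "N > 0" and x: "x \<in> shell p N" for N x
  proof -
    \<comment> \<open>With this ratio the preimage \<open>y\<close> has \<open>bary p y = 0\<close>,
      so it lies on the face opposite to \<open>p\<close>.\<close>
    define t where "t = 1 - bary p x"
    have h: "0 < height p x" "height p x \<le> 1 / real N" using x by (auto simp: shell_def)
    have "1 / real N \<le> 1" using N by simp
    then have "height p x \<le> 1" using h(2) by linarith
    then have t: "1 < t" "t \<le> 1 + slope_norm p"
      using h(1) slope_norm_pos[OF p] by (auto simp: t_def height_def field_simps)
    define y where "y = p + (1 / t) *\<^sub>R (x - p)"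
    have ybar: "bary q y = bary q p + (bary q x - bary q p) / t" if "q \<in> C" for q
      unfolding y_def bary_shift[OF that] by (simp add: bary_diff[OF that])
    have "y \<in> T"
      unfolding T_eq
    proof (intro CollectI ballI)
      fix q assume q: "q \<in> C"
      show "0 \<le> bary q y"
      proof (cases "q = p")
        case True
        then show ?thesis using ybar[OF q] bary_vertex[OF p p] t by (simp add: t_def field_simps)
      next
        case False
        then have "0 \<le> bary q x" using x q by (simp add: shell_def)
        then show ?thesis using ybar[OF q] bary_vertex[OF q p] False t by simp
      qed
    qed
    moreover have "x = p + t *\<^sub>R (y - p)" using t by (simp add: y_def)
    then have "norm x \<le> norm p + norm (t *\<^sub>R (y - p))" by (metis norm_triangle_ineq)
    moreover have "norm (t *\<^sub>R (y - p)) \<le> (1 + slope_norm p) * (B + norm p)"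
    proof -
      have "norm (y - p) \<le> B + norm p" using norm_triangle_ineq4[of y p] B[OF \<open>y \<in> T\<close>] by linarith
      then show ?thesis using t by (simp add: mult_mono)
    qed
    ultimately show ?thesis by (simp add: R_def)
  qed
  moreover have "0 \<le> R" using B0 by (simp add: R_def)
  ultimately show thesis using that by blast
qed

text \<open>The face lies at distance \<open>1 / slope_norm p\<close> from \<open>p\<close>, so the
  ratio \<open>t\<close> pushes it outward by exactly \<open>1 / real N\<close>. The dilated simplex
  is the disjoint union of \<open>T\<close> and the shell.\<close>

lemma homothety_indicator:
  assumes p: "p \<in> C" and N: "N > 0"
  defines "t \<equiv> 1 + slope_norm p / real N"
  shows "indicator T (p + (1 / t) *\<^sub>R (x - p)) = (indicator T x + indicator (shell p N) x :: real)"
proof -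
  have t: "t > 0" using slope_norm_pos[OF p] N by (simp add: t_def add_pos_pos)
  have b: "bary q (p + (1 / t) *\<^sub>R (x - p)) = bary q p + (bary q x - bary q p) / t" if "q \<in> C" for q
    unfolding bary_shift[OF that] by (simp add: bary_diff[OF that])
  have 1: "0 \<le> bary q (p + (1 / t) *\<^sub>R (x - p)) \<longleftrightarrow> 0 \<le> bary q x" if "q \<in> C - {p}" for q
    using b[of q] bary_vertex[of q p] p that t by (auto simp: zero_le_divide_iff)
  have 2: "0 \<le> bary p (p + (1 / t) *\<^sub>R (x - p)) \<longleftrightarrow> height p x \<le> 1 / real N"
  proof -
    have "bary p (p + (1 / t) *\<^sub>R (x - p)) = (t - 1 + bary p x) / t"
      unfolding b[OF p] using bary_vertex[OF p p] t by (simp add: field_simps)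
    then have "0 \<le> bary p (p + (1 / t) *\<^sub>R (x - p)) \<longleftrightarrow> 0 \<le> slope_norm p / real N + bary p x"
      using t by (simp add: zero_le_divide_iff t_def)
    also have "\<dots> \<longleftrightarrow> height p x \<le> 1 / real N"
    proof -
      have "slope_norm p / real N + bary p x = slope_norm p * (1 / real N - height p x)"
        using slope_nonzero[OF p] by (simp add: height_def distrib_left)
      then show ?thesis using slope_norm_pos[OF p] by (simp add: zero_le_mult_iff)
    qed
    finally show ?thesis .
  qed
  have 3: "0 \<le> bary p x \<longleftrightarrow> height p x \<le> 0"
    using slope_norm_pos[OF p] by (simp add: height_def field_simps)
  have T: "y \<in> T \<longleftrightarrow> 0 \<le> bary p y \<and> (\<forall>q\<in>C - {p}. 0 \<le> bary q y)" for y
    using p by (auto simp: T_eq)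
  have "height p x \<le> 0 \<Longrightarrow> height p x \<le> 1 / real N" by (rule order_trans[OF _ divide_nonneg_nonneg]) auto
  then show ?thesis
    unfolding indicator_def T shell_def using 1 2 3 by auto
qed

text \<open>The lateral sides of a shell are oblique, but across its thickness a barycentric
  coordinate changes by at most \<open>slope_norm q / real N\<close>. If the projection of
  \<open>x\<close> avoids the boundary of the face, this is eventually too little to change a sign,
  and the shell acts like a slab of a right prism. The threshold is uniform in \<open>r\<close>
  because all translates in a stack are considered at once.\<close>

lemma shell_shift_eventually:
  assumes p: "p \<in> C" and x: "\<And>q. q \<in> C - {p} \<Longrightarrow> bary q (proj p x) \<noteq> 0"
  shows "\<forall>\<^sub>F N in sequentially. \<forall>r. x - r *\<^sub>R normal p \<in> shell p N \<longleftrightarrow>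
     r < height p x \<and> height p x \<le> r + 1 / real N \<and> (\<forall>q\<in>C - {p}. 0 < bary q (proj p x))"
proof -
  have "\<forall>\<^sub>F N in sequentially. slope_norm q * (1 / real N) < \<bar>bary q (proj p x)\<bar>" if "q \<in> C - {p}" for q
  proof -
    have "(\<lambda>N. slope_norm q * (1 / real N)) \<longlonglongrightarrow> slope_norm q * 0"
      by (intro tendsto_mult tendsto_const lim_1_over_n)
    then show ?thesis using x[OF that] by (intro order_tendstoD(2)[of _ 0]) auto
  qed
  then have "\<forall>\<^sub>F N in sequentially. \<forall>q\<in>C - {p}. slope_norm q * (1 / real N) < \<bar>bary q (proj p x)\<bar>"
    by (intro eventually_ball_finite finite_C_minus) auto
  then show ?thesis
  proof eventually_elim
    case (elim N)
    show ?case
    proof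
      fix r
      let ?z = "x - r *\<^sub>R normal p"
      have h: "height p ?z = height p x - r" by (rule height_shift[OF p])
      have "(\<forall>q\<in>C - {p}. 0 \<le> bary q ?z) \<longleftrightarrow> (\<forall>q\<in>C - {p}. 0 < bary q (proj p x))"
        if "0 < height p ?z" "height p ?z \<le> 1 / real N"
      proof (intro ball_cong refl)
        fix q assume q: "q \<in> C - {p}"
        have "\<bar>bary q ?z - bary q (proj p x)\<bar> \<le> slope_norm q * (1 / real N)"
          using bary_normal_bound[OF p, of q ?z "1 / real N"] that q proj_shift[OF p, of x r] by simp
        then show "0 \<le> bary q ?z \<longleftrightarrow> 0 < bary q (proj p x)"
          using elim[rule_format, OF q] by linarith
      qed
      then show "?z \<in> shell p N \<longleftrightarrow> r < height p x \<and> height p x \<le> r + 1 / real N \<and> (\<forall>q\<in>C - {p}. 0 < bary q (proj p x))"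
        unfolding shell_def using h by auto
    qed
  qed
qed

text \<open>Layer \<open>j\<close> starts at height \<open>real j / real N - 1 / 2\<close>, so the
  \<open>N\<close> layers cover the heights from minus one half to one half, the extent of the prism
  in \<open>face_prism\<close>.\<close>

definition stack :: "'a \<Rightarrow> nat \<Rightarrow> 'a \<Rightarrow> real" where
  "stack p N x = (\<Sum>j<N. indicator (shell p N) (x - (real j / real N - 1 / 2) *\<^sub>R normal p))"

lemma stack_bounds:
  assumes p: "p \<in> C" and N: "N > 0"
  shows "0 \<le> stack p N x" "stack p N x \<le> of_bool (\<bar>height p x\<bar> \<le> 1 / 2)"
proof -
  show "0 \<le> stack p N x" by (simp add: stack_def sum_nonneg)
  have "stack p N x \<le> (\<Sum>j<N. of_bool (real j / real N < height p x + 1 / 2 \<and> height p x + 1 / 2 \<le> real (Suc j) / real N))"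
    unfolding stack_def
  proof (rule sum_mono)
    fix j
    have "x - (real j / real N - 1 / 2) *\<^sub>R normal p \<in> shell p N \<Longrightarrow>
      real j / real N < height p x + 1 / 2 \<and> height p x + 1 / 2 \<le> real (Suc j) / real N"
      by (auto simp: shell_def height_shift[OF p] add_divide_distrib)
    then show "indicator (shell p N) (x - (real j / real N - 1 / 2) *\<^sub>R normal p)
       \<le> (of_bool (real j / real N < height p x + 1 / 2 \<and> height p x + 1 / 2 \<le> real (Suc j) / real N) :: real)"
      by (auto simp: indicator_def)
  qed
  also have "\<dots> = of_bool (0 < height p x + 1 / 2 \<and> height p x + 1 / 2 \<le> 1)"
    by (rule sum_unit_partition[OF N])
  also have "\<dots> \<le> of_bool (\<bar>height p x\<bar> \<le> 1 / 2)" by auto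
  finally show "stack p N x \<le> of_bool (\<bar>height p x\<bar> \<le> 1 / 2)" .
qed

lemma stack_tendsto:
  assumes n: "DIM('a) \<ge> 2" and p: "p \<in> C"
  shows "AE x in lborel. (\<lambda>N. stack p N x) \<longlonglongrightarrow> indicator (prism p) x"
proof -
  \<comment> \<open>Only the bottom level is excluded among the heights: the prism is closed there,
    the lowest layer is not. At the top both contain the level one half.\<close>
  have "negligible ({x. height p x = - 1 / 2} \<union> (\<Union>q\<in>C - {p}. {x. bary q (proj p x) = 0}))"
    using negligible_height[OF p] negligible_proj_boundary[OF n p]
    by (intro negligible_Un negligible_Union finite_imageI finite_C_minus) auto
  then have "AE x in lebesgue. x \<notin> {x. height p x = - 1 / 2} \<union> (\<Union>q\<in>C - {p}. {x. bary q (proj p x) = 0})"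
    unfolding negligible_iff_null_sets by (rule AE_not_in)
  then have "AE x in lborel. x \<notin> {x. height p x = - 1 / 2} \<union> (\<Union>q\<in>C - {p}. {x. bary q (proj p x) = 0})"
    by (simp only: AE_completion_iff)
  then show ?thesis
  proof eventually_elim
    case (elim x)
    then have x: "\<And>q. q \<in> C - {p} \<Longrightarrow> bary q (proj p x) \<noteq> 0" "height p x \<noteq> - 1 / 2" by auto
    have pr: "x \<in> prism p \<longleftrightarrow> (\<forall>q\<in>C - {p}. 0 < bary q (proj p x)) \<and> 0 < height p x + 1 / 2 \<and> height p x + 1 / 2 \<le> 1"
    proof -
      have "(\<forall>q\<in>C. 0 \<le> bary q (proj p x)) \<longleftrightarrow> (\<forall>q\<in>C - {p}. 0 < bary q (proj p x))"
        using x(1) bary_proj_self[OF p, of x] by (auto simp: order_less_le)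
      then show ?thesis using x(2) unfolding prism_def by auto
    qed
    have ev: "\<forall>\<^sub>F N in sequentially. \<forall>r. x - r *\<^sub>R normal p \<in> shell p N \<longleftrightarrow>
       r < height p x \<and> height p x \<le> r + 1 / real N \<and> (\<forall>q\<in>C - {p}. 0 < bary q (proj p x))"
      by (rule shell_shift_eventually[OF p]) (rule x(1))
    have "\<forall>\<^sub>F N in sequentially. stack p N x = indicator (prism p) x"
      using ev eventually_gt_at_top[of 0]
    proof eventually_elim
      case (elim N)
      let ?a = "of_bool (\<forall>q\<in>C - {p}. 0 < bary q (proj p x)) :: real"
      have "indicator (shell p N) (x - (real j / real N - 1 / 2) *\<^sub>R normal p) =
        ?a * of_bool (real j / real N < height p x + 1 / 2 \<and> height p x + 1 / 2 \<le> real (Suc j) / real N)" for j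
        using elim(1)[rule_format, of "real j / real N - 1 / 2"] by (simp add: indicator_def add_divide_distrib of_bool_def algebra_simps)
      then have "stack p N x = ?a * of_bool (0 < height p x + 1 / 2 \<and> height p x + 1 / 2 \<le> 1)"
        unfolding stack_def by (simp only: sum_unit_partition[OF elim(2)] flip: sum_distrib_left)
      then show ?case using pr by (simp add: indicator_def)
    qed
    then show ?case by (rule tendsto_eventually)
  qed
qed

lemma stack_supported:
  assumes p: "p \<in> C"
  obtains R where "\<And>N x. N > 0 \<Longrightarrow> stack p N x \<noteq> 0 \<Longrightarrow> norm x \<le> R" "0 \<le> R"
proof -
  obtain R where R: "\<And>N x. N > 0 \<Longrightarrow> x \<in> shell p N \<Longrightarrow> norm x \<le> R" "0 \<le> R"
    by (rule shell_bounded[OF p]) (rule that)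
  have "norm x \<le> R + 1" if N: "N > 0" and x: "stack p N x \<noteq> 0" for N x
  proof -
    obtain j where j: "j < N" "x - (real j / real N - 1 / 2) *\<^sub>R normal p \<in> shell p N"
      using x unfolding stack_def by (force simp: indicator_def sum.neutral)
    let ?r = "real j / real N - 1 / 2"
    have "\<bar>?r\<bar> \<le> 1" using j(1) by (auto simp: abs_le_iff field_simps)
    have "norm x \<le> norm (x - ?r *\<^sub>R normal p) + norm (?r *\<^sub>R normal p)"
      by (metis diff_add_cancel norm_triangle_ineq)
    also have "\<dots> \<le> R + 1"
      using R(1)[OF N j(2)] norm_normal[OF p] \<open>\<bar>?r\<bar> \<le> 1\<close> by simp
    finally show ?thesis .
  qed
  then show thesis using that[of "R + 1"] R(2) by auto
qed

text \<open>The integrand depends on \<open>x\<close> only through its projection, so it is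
  invariant under translation along the normal. Hence \<open>N\<close> times the integral over one
  shell is the integral against the whole stack, to which dominated convergence applies.\<close>

lemma stack_integral_tendsto:
  assumes n: "DIM('a) \<ge> 2" and p: "p \<in> C" and f: "continuous_on UNIV f"
  shows "(\<lambda>N. real N * (\<integral>x. indicator (shell p N) x * f (proj p x) \<partial>lborel)) \<longlonglongrightarrow>
     (\<integral>x. f x \<partial>face_measure (face p))"
proof -
  have fm: "f \<in> borel_measurable borel" using f by (rule borel_measurable_continuous_onI)
  have gc: "continuous_on UNIV (\<lambda>x. f (proj p x))"
    by (rule continuous_on_compose2[OF f proj_continuous[OF p]]) auto
  then have gm[measurable]: "(\<lambda>x. f (proj p x)) \<in> borel_measurable borel" by (rule borel_measurable_continuous_onI)
  note sm[measurable] = shell_measurable[OF p]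
  have stm[measurable]: "stack p N \<in> borel_measurable borel" for N
    unfolding stack_def by measurable
  obtain R where R: "\<And>N x. N > 0 \<Longrightarrow> stack p N x \<noteq> 0 \<Longrightarrow> norm x \<le> R" "0 \<le> R"
    by (rule stack_supported[OF p]) (rule that)
  obtain R' where R': "\<And>N x. N > 0 \<Longrightarrow> x \<in> shell p N \<Longrightarrow> norm x \<le> R'" "0 \<le> R'"
    by (rule shell_bounded[OF p]) (rule that)
  obtain M where M: "\<And>x. norm x \<le> max R R' + 1 \<Longrightarrow> \<bar>f (proj p x)\<bar> \<le> M" "0 \<le> M"
  proof -
    have "compact ((\<lambda>x. f (proj p x)) ` cball 0 (max R R' + 1))"
      by (intro compact_continuous_image continuous_on_subset[OF gc]) auto
    then obtain M where "\<And>y. y \<in> (\<lambda>x. f (proj p x)) ` cball 0 (max R R' + 1) \<Longrightarrow> norm y \<le> M"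
      using compact_imp_bounded bounded_iff by metis
    then show thesis using that[of "max 0 M"] by fastforce
  qed
  have sbound: "norm x \<le> max R R' + 1" if "x - r *\<^sub>R normal p \<in> shell p N" "\<bar>r\<bar> \<le> 1" "N > 0" for x r N
  proof -
    have "norm x \<le> norm (x - r *\<^sub>R normal p) + norm (r *\<^sub>R normal p)"
      by (metis diff_add_cancel norm_triangle_ineq)
    then show ?thesis using R'(1)[OF that(3,1)] that(2) norm_normal[OF p] by simp
  qed
  have eq: "real N * (\<integral>x. indicator (shell p N) x * f (proj p x) \<partial>lborel) = (\<integral>x. stack p N x * f (proj p x) \<partial>lborel)"
    if N: "N > 0" for N
  proof -
    let ?r = "\<lambda>j. real j / real N - 1 / 2"
    have r: "\<bar>?r j\<bar> \<le> 1" if "j < N" for j using that by (auto simp: abs_le_iff field_simps)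
    have i: "integrable lborel (\<lambda>x. indicator (shell p N) (x - ?r j *\<^sub>R normal p) * f (proj p x))" if j: "j < N" for j
    proof -
      let ?A = "(\<lambda>x. x - ?r j *\<^sub>R normal p) -` shell p N"
      have A: "?A \<in> sets borel"
        using measurable_sets[OF _ sm, of "\<lambda>x. x - ?r j *\<^sub>R normal p" borel] by simp
      have b: "norm x \<le> max R R' + 1" if "x \<in> ?A" for x using sbound[OF _ r[OF j] N] that by simp
      then have "bounded ?A" unfolding bounded_iff by blast
      then have "integrable lborel (\<lambda>x. indicator ?A x * f (proj p x))"
        using M(1) b by (intro bounded_indicator_integrable[OF gm A]) auto
      then show ?thesis by (simp add: indicator_def vimage_def)
    qed
    have sh: "(\<integral>x. indicator (shell p N) x * f (proj p x) \<partial>lborel)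
       = (\<integral>x. indicator (shell p N) (x - ?r j *\<^sub>R normal p) * f (proj p x) \<partial>lborel)" for j
      by (subst lborel_integral_shift[where a="?r j *\<^sub>R normal p"]) (simp_all add: proj_shift[OF p])
    have "real N * (\<integral>x. indicator (shell p N) x * f (proj p x) \<partial>lborel)
      = (\<Sum>j<N. \<integral>x. indicator (shell p N) x * f (proj p x) \<partial>lborel)" by simp
    also have "\<dots> = (\<Sum>j<N. \<integral>x. indicator (shell p N) (x - ?r j *\<^sub>R normal p) * f (proj p x) \<partial>lborel)"
      by (intro sum.cong refl sh)
    also have "\<dots> = (\<integral>x. stack p N x * f (proj p x) \<partial>lborel)"
      unfolding stack_def sum_distrib_right using i by (subst Bochner_Integration.integral_sum) auto
    finally show ?thesis .
  qed
  \<comment> \<open>The index is shifted because the bounds on shells and stacks require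
    \<open>N > 0\<close>.\<close>
  have "(\<lambda>N. \<integral>x. stack p (Suc N) x * f (proj p x) \<partial>lborel) \<longlonglongrightarrow> (\<integral>x. indicator (prism p) x * f (proj p x) \<partial>lborel)"
  proof (rule integral_dominated_convergence[where w="\<lambda>x. indicator (cball 0 R) x * M"])
    have Bp: "prism p \<in> sets borel" using closed_prism[OF p] by (rule borel_closed)
    show "(\<lambda>x. indicator (prism p) x * f (proj p x)) \<in> borel_measurable lborel" using Bp gm by simp
    show "(\<lambda>x. stack p (Suc N) x * f (proj p x)) \<in> borel_measurable lborel" for N
      using stm gm by simp
    show "integrable lborel (\<lambda>x. indicator (cball 0 R) x * M)"
      by (rule bounded_indicator_integrable[of "\<lambda>_. M" "cball 0 R" M]) (use M(2) in auto)
    show "AE x in lborel. (\<lambda>N. stack p (Suc N) x * f (proj p x)) \<longlonglongrightarrow> indicator (prism p) x * f (proj p x)"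
      using stack_tendsto[OF n p]
      by eventually_elim (intro tendsto_mult tendsto_const, rule LIMSEQ_Suc)
    show "AE x in lborel. norm (stack p (Suc N) x * f (proj p x)) \<le> indicator (cball 0 R) x * M" for N
    proof (rule AE_I2)
      fix x
      have s: "0 \<le> stack p (Suc N) x" "stack p (Suc N) x \<le> 1"
        using stack_bounds[OF p, of "Suc N" x] by (auto simp: of_bool_def split: if_splits)
      show "norm (stack p (Suc N) x * f (proj p x)) \<le> indicator (cball 0 R) x * M"
      proof (cases "stack p (Suc N) x = 0")
        case False
        then have x: "norm x \<le> R" using R(1)[of "Suc N"] by simp
        then have "\<bar>f (proj p x)\<bar> \<le> M" using M(1) by simp
        then have "stack p (Suc N) x * \<bar>f (proj p x)\<bar> \<le> 1 * M" using s by (intro mult_mono) auto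
        then show ?thesis using x s by (simp add: abs_mult)
      qed (use M(2) in simp)
    qed
  qed
  then have "(\<lambda>N. \<integral>x. stack p N x * f (proj p x) \<partial>lborel) \<longlonglongrightarrow> (\<integral>x. f x \<partial>face_measure (face p))"
    unfolding face_measure_integral[OF p fm] by (rule LIMSEQ_imp_Suc)
  then show ?thesis
    by (rule Lim_transform_eventually) (use eq in \<open>auto intro!: eventually_sequentiallyI[of 1]\<close>)
qed

text \<open>Substitution in the integral over the dilated simplex, which splits into
  \<open>T\<close> and the shell. The power of \<open>t\<close> is the Jacobian of the
  homothety.\<close>

lemma homothety_integral:
  assumes p: "p \<in> C" and N: "N > 0" and f: "continuous_on UNIV f"
  defines "t \<equiv> 1 + slope_norm p / real N"
  shows "t ^ DIM('a) * (\<integral>x. indicator T x * f (p + t *\<^sub>R (x - p)) \<partial>lborel)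
    = (\<integral>x. indicator T x * f x \<partial>lborel) + (\<integral>x. indicator (shell p N) x * f x \<partial>lborel)"
proof -
  have t: "t > 0" using slope_norm_pos[OF p] N by (simp add: t_def add_pos_pos)
  have fm[measurable]: "f \<in> borel_measurable borel" using f by (rule borel_measurable_continuous_onI)
  have TB[measurable]: "T \<in> sets borel" using compact_T by (simp add: compact_imp_closed borel_closed)
  obtain R where R: "\<And>N x. N > 0 \<Longrightarrow> x \<in> shell p N \<Longrightarrow> norm x \<le> R" "0 \<le> R"
    by (rule shell_bounded[OF p]) (rule that)
  have bs: "bounded (shell p N)" using R(1)[OF N] unfolding bounded_iff by blast
  have int: "integrable lborel (\<lambda>x. indicator A x * f x)" if A: "A \<in> sets borel" "bounded A" for A
  proof -
    have "compact (f ` closure A)"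
      using A by (intro compact_continuous_image continuous_on_subset[OF f]) auto
    then obtain M where "\<And>y. y \<in> f ` closure A \<Longrightarrow> norm y \<le> M"
      using compact_imp_bounded bounded_iff by metis
    then show ?thesis using closure_subset[of A] by (intro bounded_indicator_integrable[OF fm A, of M]) auto
  qed
  define g where "g x = indicator T (p + (1 / t) *\<^sub>R (x - p)) * f x" for x
  have "(\<lambda>x. indicator T (p + (1 / t) *\<^sub>R (x - p)) :: real) \<in> borel_measurable borel"
    by (rule measurable_compose[OF _ borel_measurable_indicator[OF TB]]) simp
  then have gm: "g \<in> borel_measurable borel" unfolding g_def using fm by (rule borel_measurable_times)
  have gt: "g (p - t *\<^sub>R p + t *\<^sub>R x) = indicator T x * f (p + t *\<^sub>R (x - p))" for x
  proof -
    have e: "p - t *\<^sub>R p + t *\<^sub>R x = p + t *\<^sub>R (x - p)" by (simp add: scaleR_diff_right)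
    have "(1 / t) *\<^sub>R (p + t *\<^sub>R (x - p) - p) = x - p" using t by simp
    then show ?thesis unfolding g_def e by simp
  qed
  have "(\<integral>x. g x \<partial>lborel) = t ^ DIM('a) * (\<integral>x. g (p - t *\<^sub>R p + t *\<^sub>R x) \<partial>lborel)"
    by (rule lborel_integral_affine[OF gm t])
  then have "(\<integral>x. g x \<partial>lborel) = t ^ DIM('a) * (\<integral>x. indicator T x * f (p + t *\<^sub>R (x - p)) \<partial>lborel)"
    unfolding gt .
  moreover have "(\<integral>x. g x \<partial>lborel) = (\<integral>x. indicator T x * f x + indicator (shell p N) x * f x \<partial>lborel)"
    unfolding g_def t_def homothety_indicator[OF p N] distrib_right ..
  moreover have "\<dots> = (\<integral>x. indicator T x * f x \<partial>lborel) + (\<integral>x. indicator (shell p N) x * f x \<partial>lborel)"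
    using int[OF TB bounded_T] int[OF shell_measurable[OF p] bs] by (rule Bochner_Integration.integral_add)
  ultimately show ?thesis by simp
qed

text \<open>The shells, stacked on top of each other, fill a prism of height one in the limit.\<close>

lemma shell_integral_tendsto:
  assumes n: "DIM('a) \<ge> 2" and p: "p \<in> C" and f: "C1_grad f G"
  shows "(\<lambda>N. real N * (\<integral>x. indicator (shell p N) x * f x \<partial>lborel)) \<longlonglongrightarrow>
     (\<integral>x. f x \<partial>face_measure (face p))"
proof -
  have fc: "continuous_on UNIV f" using f by (rule C1_grad_continuous)
  have fm: "f \<in> borel_measurable borel" using fc by (rule borel_measurable_continuous_onI)
  have gc: "continuous_on UNIV (\<lambda>x. f (proj p x))"
    by (rule continuous_on_compose2[OF fc proj_continuous[OF p]]) auto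
  have gm: "(\<lambda>x. f (proj p x)) \<in> borel_measurable borel" using gc by (rule borel_measurable_continuous_onI)
  obtain R where R: "\<And>N x. N > 0 \<Longrightarrow> x \<in> shell p N \<Longrightarrow> norm x \<le> R" "0 \<le> R"
    by (rule shell_bounded[OF p]) (rule that)
  obtain M where M: "0 \<le> M" "\<And>x. x \<in> cball 0 (R + 1) \<Longrightarrow> norm (G x) \<le> M"
    by (rule C1_grad_bounded_on_compact[OF f, of "cball 0 (R + 1)"]) auto
  \<comment> \<open>The volume of the shell. On the shell \<open>f\<close> differs from its value at
    the projected point by at most \<open>M / real N\<close>, so after multiplication by
    \<open>N\<close> the error is at most \<open>M * v N\<close>, and this tends to zero since
    \<open>real N * v N\<close> converges.\<close>
  define v where "v N = (\<integral>x. indicator (shell p N) x * (1::real) \<partial>lborel)" for N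
  have Nv: "(\<lambda>N. real N * v N) \<longlonglongrightarrow> (\<integral>x. 1 \<partial>face_measure (face p))"
    unfolding v_def by (rule stack_integral_tendsto[OF n p, of "\<lambda>_. 1"]) auto
  have "(\<lambda>N. (real N * v N) * (1 / real N)) \<longlonglongrightarrow> 0"
    using tendsto_mult[OF Nv lim_1_over_n] by (simp only: mult_zero_right)
  then have v0: "v \<longlonglongrightarrow> 0"
    by (rule Lim_transform_eventually) (rule eventually_sequentiallyI[of 1], simp)
  have "(\<lambda>N. real N * (\<integral>x. indicator (shell p N) x * f x \<partial>lborel)
      - real N * (\<integral>x. indicator (shell p N) x * f (proj p x) \<partial>lborel)) \<longlonglongrightarrow> 0"
  proof (rule Lim_null_comparison)
    have "(\<lambda>N. M * v N) \<longlonglongrightarrow> M * 0" by (intro tendsto_mult tendsto_const v0)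
    then show "(\<lambda>N. M * v N) \<longlonglongrightarrow> 0" by simp
    show "\<forall>\<^sub>F N in sequentially. norm (real N * (\<integral>x. indicator (shell p N) x * f x \<partial>lborel)
      - real N * (\<integral>x. indicator (shell p N) x * f (proj p x) \<partial>lborel)) \<le> M * v N"
    proof (rule eventually_sequentiallyI[of 1])
      fix N :: nat assume "1 \<le> N"
      then have N: "N > 0" by simp
      have bs: "bounded (shell p N)" using R(1)[OF N] unfolding bounded_iff by blast
      have int: "integrable lborel (\<lambda>x. indicator (shell p N) x * h x)" if h: "continuous_on UNIV h" for h :: "'a \<Rightarrow> real"
      proof -
        have "compact (h ` cball 0 R)" by (intro compact_continuous_image continuous_on_subset[OF h]) auto
        then obtain B where "\<And>y. y \<in> h ` cball 0 R \<Longrightarrow> norm y \<le> B"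
          using compact_imp_bounded bounded_iff by metis
        then show ?thesis
          using R(1)[OF N] borel_measurable_continuous_onI[OF h]
          by (intro bounded_indicator_integrable[OF _ shell_measurable[OF p] bs, of _ B]) auto
      qed
      have pt: "\<bar>f x - f (proj p x)\<bar> \<le> M / real N" if x: "x \<in> shell p N" for x
      proof -
        have h: "0 < height p x" "height p x \<le> 1 / real N" "1 / real N \<le> 1"
          using x N by (auto simp: shell_def)
        have d: "norm (x - proj p x) = height p x"
        proof -
          have "x - proj p x = height p x *\<^sub>R normal p"
            using proj_height[OF p, of x] by (metis add_diff_cancel_left')
          then show ?thesis using h(1) norm_normal[OF p] by simp
        qed
        have nx: "norm x \<le> R" using R(1)[OF N x] .
        have "norm (proj p x) \<le> norm x + norm (x - proj p x)" by (metis norm_minus_commute norm_triangle_sub)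
        then have c: "x \<in> cball 0 (R + 1)" "proj p x \<in> cball 0 (R + 1)" using nx d h by auto
        have "\<bar>f x - f (proj p x)\<bar> \<le> M * norm (x - proj p x)"
          by (rule C1_grad_lipschitz[OF f convex_cball M(2) M(1) c])
        also have "\<dots> \<le> M * (1 / real N)" unfolding d using h M(1) by (intro mult_left_mono)
        finally show ?thesis by simp
      qed
      have "\<bar>(\<integral>x. indicator (shell p N) x * f x \<partial>lborel) - (\<integral>x. indicator (shell p N) x * f (proj p x) \<partial>lborel)\<bar>
         = \<bar>\<integral>x. indicator (shell p N) x * f x - indicator (shell p N) x * f (proj p x) \<partial>lborel\<bar>"
        using int[OF fc] int[OF gc] by simp
      also have "\<dots> \<le> (\<integral>x. \<bar>indicator (shell p N) x * f x - indicator (shell p N) x * f (proj p x)\<bar> \<partial>lborel)"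
        by (rule integral_abs_bound)
      also have "\<dots> \<le> (\<integral>x. M / real N * (indicator (shell p N) x * 1) \<partial>lborel)"
        using int[OF fc] int[OF gc] int[of "\<lambda>_. 1"] pt M(1)
        by (intro integral_mono integrable_abs Bochner_Integration.integrable_diff integrable_mult_right)
           (auto simp: indicator_def)
      also have "\<dots> = M / real N * v N" unfolding v_def by (rule integral_mult_right_zero)
      finally have "real N * \<bar>(\<integral>x. indicator (shell p N) x * f x \<partial>lborel) - (\<integral>x. indicator (shell p N) x * f (proj p x) \<partial>lborel)\<bar>
         \<le> real N * (M / real N * v N)" by (rule mult_left_mono) simp
      also have "\<dots> = M * v N" using N by simp
      finally show "norm (real N * (\<integral>x. indicator (shell p N) x * f x \<partial>lborel)
        - real N * (\<integral>x. indicator (shell p N) x * f (proj p x) \<partial>lborel)) \<le> M * v N"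
        by (simp add: abs_mult flip: right_diff_distrib)
    qed
  qed
  from tendsto_add[OF this stack_integral_tendsto[OF n p fc]] show ?thesis by simp
qed

text \<open>Both sides are the derivative at \<open>t = 1\<close> of the integral of \<open>f\<close> over the image of \<open>T\<close> under
  the homothety with centre \<open>p\<close> and ratio \<open>t\<close>.\<close>

theorem divergence_theorem:
  assumes n: "DIM('a) \<ge> 2" and p: "p \<in> C" and f: "C1_grad f G"
  shows "real DIM('a) * (\<integral>x. f x \<partial>lebesgue_on T) + (\<integral>x. G x \<bullet> (x - p) \<partial>lebesgue_on T)
     = (\<integral>x. f x \<partial>face_measure (face p)) / slope_norm p"
proof -
  let ?n = "DIM('a)"
  define s where "s = slope_norm p"
  have s: "s > 0" using slope_norm_pos[OF p] by (simp add: s_def)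
  have fc: "continuous_on UNIV f" using f by (rule C1_grad_continuous)
  have fm[measurable]: "f \<in> borel_measurable borel" using fc by (rule borel_measurable_continuous_onI)
  have Gm[measurable]: "G \<in> borel_measurable borel"
    using C1_grad_continuous_grad[OF f] by (rule borel_measurable_continuous_onI)
  have TB[measurable]: "T \<in> sets borel" using compact_T by (simp add: compact_imp_closed borel_closed)
  \<comment> \<open>The growth of the homothety ratio that moves the face outward by
    \<open>1 / real (Suc N)\<close>.\<close>
  define u where "u N = s / real (Suc N)" for N
  have u: "u \<longlonglongrightarrow> 0" "\<And>N. u N \<noteq> 0" "\<And>N. 0 < u N" "\<And>N. u N \<le> s"
  proof -
    have "(\<lambda>N. s * inverse (real (Suc N))) \<longlonglongrightarrow> s * 0"
      by (intro tendsto_mult tendsto_const LIMSEQ_inverse_real_of_nat)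
    then show "u \<longlonglongrightarrow> 0" by (simp add: u_def[abs_def] divide_inverse)
  qed (use s in \<open>auto simp: u_def field_simps\<close>)
  define I where "I r = (\<integral>x. indicator T x * f (p + (1 + r) *\<^sub>R (x - p)) \<partial>lborel)" for r
  define J where "J = (\<integral>x. indicator T x * ((x - p) \<bullet> G x) \<partial>lborel)"
  obtain B where B: "\<And>x. x \<in> T \<Longrightarrow> norm x \<le> B" using bounded_T unfolding bounded_iff by blast
  define R where "R = norm p + (1 + s) * (B + norm p)"
  have pT: "p \<in> T" using p by (simp add: T_def hull_inc)
  have xB: "norm (x - p) \<le> B + norm p" if "x \<in> T" for x
    using norm_triangle_ineq4[of x p] B[OF that] by linarith
  have hom: "p + (1 + r) *\<^sub>R (x - p) \<in> cball 0 R" if "x \<in> T" "0 \<le> r" "r \<le> s" for x r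
  proof -
    have "norm ((1 + r) *\<^sub>R (x - p)) \<le> (1 + s) * (B + norm p)"
      using xB[OF that(1)] that s by (simp add: mult_mono)
    then show ?thesis using norm_triangle_ineq[of p "(1 + r) *\<^sub>R (x - p)"] by (simp add: R_def)
  qed
  obtain M where M: "0 \<le> M" "\<And>x. x \<in> cball 0 R \<Longrightarrow> norm (G x) \<le> M"
    by (rule C1_grad_bounded_on_compact[OF f, of "cball 0 R"]) auto
  have hc: "continuous_on UNIV (\<lambda>x. f (p + (1 + r) *\<^sub>R (x - p)))" for r
    by (rule continuous_on_compose2[OF fc]) (auto intro!: continuous_intros)
  have hint: "integrable lborel (\<lambda>x. indicator T x * f (p + (1 + r) *\<^sub>R (x - p)))" for r
  proof -
    have "compact ((\<lambda>x. f (p + (1 + r) *\<^sub>R (x - p))) ` T)"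
      by (intro compact_continuous_image continuous_on_subset[OF hc] compact_T) auto
    then obtain B where "\<And>y. y \<in> (\<lambda>x. f (p + (1 + r) *\<^sub>R (x - p))) ` T \<Longrightarrow> norm y \<le> B"
      using compact_imp_bounded bounded_iff by metis
    then show ?thesis
      using borel_measurable_continuous_onI[OF hc]
      by (intro bounded_indicator_integrable[OF _ TB bounded_T, of _ B]) auto
  qed
  have dq: "(\<lambda>N. (I (u N) - I 0) / u N) \<longlonglongrightarrow> J"
  proof -
    define q where "q N x = (f (x + u N *\<^sub>R (x - p)) - f x) / u N" for N x
    have eqx: "p + (1 + r) *\<^sub>R (x - p) = x + r *\<^sub>R (x - p)" for r x
      by (simp add: scaleR_add_left)
    have "(\<lambda>N. \<integral>x. indicator T x * q N x \<partial>lborel) \<longlonglongrightarrow> J"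
      unfolding J_def
    proof (rule integral_dominated_convergence[where w="\<lambda>x. indicator T x * (M * (B + norm p))"])
      show "(\<lambda>x. indicator T x * ((x - p) \<bullet> G x)) \<in> borel_measurable lborel" by simp
      show "(\<lambda>x. indicator T x * q N x) \<in> borel_measurable lborel" for N unfolding q_def by simp
      show "integrable lborel (\<lambda>x. indicator T x * (M * (B + norm p)))"
        using emeasure_bounded_finite[OF bounded_T] by (intro integrable_mult_left integrable_real_indicator) auto
      show "AE x in lborel. (\<lambda>N. indicator T x * q N x) \<longlonglongrightarrow> indicator T x * ((x - p) \<bullet> G x)"
        unfolding q_def
        by (intro AE_I2 tendsto_mult tendsto_const C1_grad_difference_quotient[OF f] u)
      show "AE x in lborel. norm (indicator T x * q N x) \<le> indicator T x * (M * (B + norm p))" for N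
      proof (rule AE_I2)
        fix x
        show "norm (indicator T x * q N x) \<le> indicator T x * (M * (B + norm p))"
        proof (cases "x \<in> T")
          case True
          have "x + u N *\<^sub>R (x - p) \<in> cball 0 R" "x \<in> cball 0 R"
            using hom[OF True, of "u N"] hom[OF True, of 0] u(3,4)[of N] s unfolding eqx by auto
          then have "\<bar>f (x + u N *\<^sub>R (x - p)) - f x\<bar> \<le> M * norm (x + u N *\<^sub>R (x - p) - x)"
            by (intro C1_grad_lipschitz[OF f convex_cball M(2) M(1)])
          also have "\<dots> = M * norm (x - p) * u N" using u(3)[of N] by simp
          finally have "\<bar>q N x\<bar> \<le> M * norm (x - p)"
            using u(3)[of N] by (simp add: q_def pos_divide_le_eq abs_divide)
          also have "\<dots> \<le> M * (B + norm p)" using xB[OF True] M(1) by (intro mult_left_mono)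
          finally show ?thesis using True by simp
        qed simp
      qed
    qed
    moreover have "(\<integral>x. indicator T x * q N x \<partial>lborel) = (I (u N) - I 0) / u N" for N
    proof -
      have "(\<integral>x. indicator T x * q N x \<partial>lborel)
        = (\<integral>x. (indicator T x * f (p + (1 + u N) *\<^sub>R (x - p)) - indicator T x * f (p + (1 + 0) *\<^sub>R (x - p))) / u N \<partial>lborel)"
        by (intro Bochner_Integration.integral_cong refl)
           (simp only: q_def eqx, simp add: right_diff_distrib)
      then show ?thesis unfolding I_def using hint[of "u N"] hint[of 0] by simp
    qed
    ultimately show ?thesis by simp
  qed
  have Ilim: "(\<lambda>N. I (u N)) \<longlonglongrightarrow> I 0"
  proof -
    have "(\<lambda>N. (I (u N) - I 0) / u N * u N + I 0) \<longlonglongrightarrow> J * 0 + I 0"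
      by (intro tendsto_add tendsto_mult tendsto_const dq u(1))
    then show ?thesis using u(2) by simp
  qed
  have pw: "(\<lambda>N. ((1 + u N) ^ ?n - 1) / u N) \<longlonglongrightarrow> real ?n"
  proof -
    have "((\<lambda>x. x ^ ?n) has_field_derivative real ?n * 1 ^ (?n - 1)) (at (1::real))"
      by (auto intro!: derivative_eq_intros)
    then have "((\<lambda>h. ((1 + h) ^ ?n - 1 ^ ?n) / h) \<longlongrightarrow> real ?n) (at (0::real))" by (simp add: DERIV_def)
    moreover have "filterlim u (at 0) sequentially" using u(1,2) by (auto simp: filterlim_at)
    ultimately have "(\<lambda>N. ((1 + u N) ^ ?n - 1 ^ ?n) / u N) \<longlonglongrightarrow> real ?n" by (rule filterlim_compose)
    then show ?thesis by simp
  qed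
  have "(\<lambda>N. ((1 + u N) ^ ?n - 1) / u N * I (u N) + (I (u N) - I 0) / u N) \<longlonglongrightarrow> real ?n * I 0 + J"
    by (intro tendsto_add tendsto_mult pw Ilim dq)
  then have L1: "(\<lambda>N. s * (((1 + u N) ^ ?n - 1) / u N * I (u N) + (I (u N) - I 0) / u N)) \<longlonglongrightarrow> s * (real ?n * I 0 + J)"
    by (intro tendsto_mult tendsto_const)
  have L2: "(\<lambda>N. real (Suc N) * (\<integral>x. indicator (shell p (Suc N)) x * f x \<partial>lborel)) \<longlonglongrightarrow>
     (\<integral>x. f x \<partial>face_measure (face p))"
    by (rule LIMSEQ_Suc[OF shell_integral_tendsto[OF n p f]])
  \<comment> \<open>The difference quotient at zero of the Jacobian times \<open>I\<close>, already
    expanded by the product rule. The homothety identity evaluates it as the scaled shell integral,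
    so the two limits agree.\<close>
  have "s * (((1 + u N) ^ ?n - 1) / u N * I (u N) + (I (u N) - I 0) / u N)
      = real (Suc N) * (\<integral>x. indicator (shell p (Suc N)) x * f x \<partial>lborel)" for N
  proof -
    have "(1 + u N) ^ ?n * I (u N) = I 0 + (\<integral>x. indicator (shell p (Suc N)) x * f x \<partial>lborel)"
      using homothety_integral[OF p, of "Suc N" f] fc by (simp add: I_def u_def s_def)
    moreover have "s * (((1 + u N) ^ ?n - 1) / u N * I (u N) + (I (u N) - I 0) / u N)
      = s / u N * ((1 + u N) ^ ?n * I (u N) - I 0)"
      using u(2)[of N] by (simp add: field_simps)
    moreover have "s / u N = real (Suc N)" using s by (simp add: u_def)
    ultimately show ?thesis by simp
  qed
  then have eq: "s * (real ?n * I 0 + J) = (\<integral>x. f x \<partial>face_measure (face p))"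
    using LIMSEQ_unique[OF L1] L2 by simp
  have T: "(\<integral>x. h x \<partial>lebesgue_on T) = (\<integral>x. indicator T x * h x \<partial>lborel)" if h: "h \<in> borel_measurable borel" for h :: "'a \<Rightarrow> real"
  proof -
    have "(\<integral>x. h x \<partial>lebesgue_on T) = (\<integral>x. indicator T x * h x \<partial>lebesgue)"
      using sets_T by (subst integral_restrict_space) auto
    also have "\<dots> = (\<integral>x. indicator T x * h x \<partial>lborel)" using h by (intro integral_completion) simp
    finally show ?thesis .
  qed
  have "(\<integral>x. f x \<partial>lebesgue_on T) = I 0" unfolding I_def T[OF fm] by simp
  moreover have "(\<integral>x. G x \<bullet> (x - p) \<partial>lebesgue_on T) = J"
    unfolding J_def by (subst T) (auto simp: inner_commute)
  ultimately show ?thesis using eq s unfolding s_def[symmetric] by (simp add: field_simps)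
qed

end

section \<open>Moments of a simplex and the bubble function\<close>

context full_simplex
begin

lemma continuous_integrable_T:
  fixes f :: "'a \<Rightarrow> 'b::euclidean_space"
  shows "continuous_on UNIV f \<Longrightarrow> integrable (lebesgue_on T) f"
  by (intro L2_integrable lmeasurable_T L2_continuous bounded_T sets_T)

lemma measure_lebesgue_on_T [simp]: "measure (lebesgue_on T) T = measure lebesgue T"
  using sets_T by (simp add: measure_restrict_space)

lemma const_integral_T: "(\<integral>x. c \<partial>lebesgue_on T) = measure lebesgue T * (c::real)"
  by simp

lemma bary_C1:
  assumes "q \<in> C"
  shows "C1_grad (bary q) (\<lambda>_. slope q)"
proof -
  have eq: "bary q = (\<lambda>x. bary q 0 + slope q \<bullet> x)" by (rule ext) (rule bary_affine[OF assms])
  show ?thesis by (subst eq) (rule C1_grad_affine)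
qed

text \<open>Without the boundary term the divergence identity becomes a relation between volume
  integrals; applied to products containing \<open>bary p\<close> it yields linear equations for the
  moments.\<close>

lemma divergence_vanishing:
  assumes n: "DIM('a) \<ge> 2" and p: "p \<in> C" and f: "C1_grad f G" and z: "\<And>x. x \<in> face p \<Longrightarrow> f x = 0"
  shows "real DIM('a) * (\<integral>x. f x \<partial>lebesgue_on T) + (\<integral>x. G x \<bullet> (x - p) \<partial>lebesgue_on T) = 0"
proof -
  have "(\<integral>x. f x \<partial>face_measure (face p)) = 0"
    by (rule integral_eq_zero_AE) (use face_measure_AE[OF p] z in \<open>auto elim!: eventually_mono\<close>)
  then show ?thesis using divergence_theorem[OF n p f] by simp
qed

text \<open>The derivative of \<open>bary p\<close> in direction \<open>x - p\<close> is
  \<open>bary p x - 1\<close>, so the identity closes up to an equation for the single unknown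
  integral.\<close>

lemma integral_bary:
  assumes n: "DIM('a) \<ge> 2" and p: "p \<in> C"
  shows "(\<integral>x. bary p x \<partial>lebesgue_on T) = measure lebesgue T / (real DIM('a) + 1)"
proof -
  have "real DIM('a) * (\<integral>x. bary p x \<partial>lebesgue_on T) + (\<integral>x. slope p \<bullet> (x - p) \<partial>lebesgue_on T) = 0"
    by (rule divergence_vanishing[OF n p bary_C1[OF p]]) (simp add: face_eq[OF p])
  moreover have "(\<integral>x. slope p \<bullet> (x - p) \<partial>lebesgue_on T) = (\<integral>x. bary p x - 1 \<partial>lebesgue_on T)"
    by (simp add: bary_diff[OF p] bary_vertex[OF p p])
  moreover have "\<dots> = (\<integral>x. bary p x \<partial>lebesgue_on T) - measure lebesgue T"
    using continuous_integrable_T[OF bary_continuous[OF p]] continuous_integrable_T[of "\<lambda>_. 1::real"]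
    by (subst Bochner_Integration.integral_diff) (simp_all add: const_integral_T)
  ultimately have "(real DIM('a) + 1) * (\<integral>x. bary p x \<partial>lebesgue_on T) = measure lebesgue T"
    by (simp add: distrib_right)
  then show ?thesis by (simp add: nonzero_eq_divide_eq mult.commute add_eq_0_iff)
qed

text \<open>The product vanishes on the face opposite to \<open>p\<close>, and its derivative in
  direction \<open>x - p\<close> is twice the product minus \<open>bary q\<close>. The remaining
  integral is known.\<close>

lemma integral_bary_bary:
  assumes n: "DIM('a) \<ge> 2" and p: "p \<in> C" and q: "q \<in> C" "q \<noteq> p"
  shows "(\<integral>x. bary p x * bary q x \<partial>lebesgue_on T) = measure lebesgue T / ((real DIM('a) + 1) * (real DIM('a) + 2))"
proof -
  let ?n = "real DIM('a)"
  have c: "continuous_on UNIV (\<lambda>x. bary p x * bary q x)" "continuous_on UNIV (bary q)"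
    using bary_continuous[OF p] bary_continuous[OF q(1)] by (auto intro: continuous_intros)
  have "?n * (\<integral>x. bary p x * bary q x \<partial>lebesgue_on T)
     + (\<integral>x. (bary p x *\<^sub>R slope q + bary q x *\<^sub>R slope p) \<bullet> (x - p) \<partial>lebesgue_on T) = 0"
    by (rule divergence_vanishing[OF n p C1_grad_mult[OF bary_C1[OF p] bary_C1[OF q(1)]]]) (simp add: face_eq[OF p])
  moreover have "(bary p x *\<^sub>R slope q + bary q x *\<^sub>R slope p) \<bullet> (x - p) = 2 * (bary p x * bary q x) - bary q x" for x
    using bary_vertex[OF p p] bary_vertex[OF q(1) p] q(2)
    unfolding inner_add_left inner_scaleR_left bary_diff[OF p] bary_diff[OF q(1)] by (simp add: algebra_simps)
  ultimately have "?n * (\<integral>x. bary p x * bary q x \<partial>lebesgue_on T)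
     + (\<integral>x. 2 * (bary p x * bary q x) - bary q x \<partial>lebesgue_on T) = 0" by simp
  moreover have "(\<integral>x. 2 * (bary p x * bary q x) - bary q x \<partial>lebesgue_on T)
     = 2 * (\<integral>x. bary p x * bary q x \<partial>lebesgue_on T) - (\<integral>x. bary q x \<partial>lebesgue_on T)"
    using c[THEN continuous_integrable_T] by simp
  ultimately have "(?n + 2) * (\<integral>x. bary p x * bary q x \<partial>lebesgue_on T) = measure lebesgue T / (?n + 1)"
    unfolding integral_bary[OF n q(1)] by (simp add: distrib_right)
  moreover have "?n + 2 \<noteq> 0" "?n + 1 \<noteq> 0" by (simp_all add: add_eq_0_iff)
  ultimately have "(\<integral>x. bary p x * bary q x \<partial>lebesgue_on T) = measure lebesgue T / (?n + 1) / (?n + 2)"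
    by (simp add: eq_divide_eq mult.commute)
  then show ?thesis by simp
qed

lemma integral_centered:
  assumes n: "DIM('a) \<ge> 2"
  shows "(\<integral>x. g \<bullet> (x - mid T) \<partial>lebesgue_on T) = 0"
proof -
  let ?n = "real DIM('a)"
  define h where "h q = g \<bullet> (q - mid T)" for q
  have eq: "h x = (\<Sum>q\<in>C. bary q x * h q)" for x
    using affine_function_bary[of "- (g \<bullet> mid T)" g x] by (simp add: h_def inner_diff_right)
  have "(\<integral>x. h x \<partial>lebesgue_on T) = (\<integral>x. (\<Sum>q\<in>C. bary q x * h q) \<partial>lebesgue_on T)"
    by (intro Bochner_Integration.integral_cong refl eq)
  also have "\<dots> = (\<Sum>q\<in>C. (\<integral>x. bary q x \<partial>lebesgue_on T) * h q)"
    using continuous_integrable_T[OF bary_continuous]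
    by (subst Bochner_Integration.integral_sum) auto
  also have "\<dots> = (\<Sum>q\<in>C. measure lebesgue T / (?n + 1) * h q)"
    by (intro sum.cong refl) (simp add: integral_bary[OF n])
  also have "\<dots> = measure lebesgue T / (?n + 1) * (g \<bullet> (\<Sum>q\<in>C. q - mid T))"
    by (simp add: h_def inner_sum_right sum_distrib_left)
  also have "(\<Sum>q\<in>C. q - mid T) = \<Sum>C - (?n + 1) *\<^sub>R mid T"
    using card_C by (simp add: sum_subtractf sum_constant_scaleR add.commute)
  also have "\<dots> = 0" by (simp add: mid_T)
  finally show ?thesis by (simp add: h_def)
qed

definition edge_sum :: real where "edge_sum = (\<Sum>P\<in>C. \<Sum>Q\<in>C - {P}. (norm (P - Q))\<^sup>2)"

lemma edge_sum_pos: "edge_sum > 0"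
proof -
  obtain p where p: "p \<in> C" using C_nonempty by auto
  obtain q where q: "q \<in> C - {p}" using C_minus_nonempty[of p] by auto
  have "0 < (\<Sum>Q\<in>C - {p}. (norm (p - Q))\<^sup>2)"
    using q finite_C by (intro sum_pos2[of _ q]) auto
  then show ?thesis
    unfolding edge_sum_def by (rule sum_pos2[OF finite_C p]) (simp add: sum_nonneg)
qed

text \<open>Expanding the squared distances, the terms with a single squared norm carry the factor
  \<open>sum c C\<close> and drop out; the mixed terms give the square of the sum. This is how the
  sum of squared edge lengths enters the bubble.\<close>

lemma norm_square_zero_sum:
  fixes c :: "'a \<Rightarrow> real"
  assumes c: "sum c C = 0"
  shows "(norm (\<Sum>q\<in>C. c q *\<^sub>R q))\<^sup>2 = - (\<Sum>P\<in>C. \<Sum>Q\<in>C - {P}. c P * c Q * (norm (P - Q))\<^sup>2) / 2"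
proof -
  have "(\<Sum>P\<in>C. \<Sum>Q\<in>C - {P}. c P * c Q * (norm (P - Q))\<^sup>2) = (\<Sum>P\<in>C. \<Sum>Q\<in>C. c P * c Q * (norm (P - Q))\<^sup>2)"
    by (intro sum.cong refl sum.mono_neutral_left finite_C) auto
  also have "\<dots> = (\<Sum>P\<in>C. \<Sum>Q\<in>C. c P * (P \<bullet> P) * c Q + c P * (c Q * (Q \<bullet> Q)) - 2 * (c P * c Q * (P \<bullet> Q)))"
    by (intro sum.cong refl)
       (simp only: power2_norm_eq_inner, simp add: inner_diff_left inner_diff_right inner_commute algebra_simps)
  also have "\<dots> = (\<Sum>P\<in>C. \<Sum>Q\<in>C. c P * (P \<bullet> P) * c Q) + (\<Sum>P\<in>C. \<Sum>Q\<in>C. c P * (c Q * (Q \<bullet> Q)))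
      - 2 * (\<Sum>P\<in>C. \<Sum>Q\<in>C. c P * c Q * (P \<bullet> Q))"
    by (simp only: sum.distrib sum_subtractf sum_distrib_left)
  also have "(\<Sum>P\<in>C. \<Sum>Q\<in>C. c P * (P \<bullet> P) * c Q) = (\<Sum>P\<in>C. c P * (P \<bullet> P)) * sum c C"
    by (simp only: sum_product)
  also have "(\<Sum>P\<in>C. \<Sum>Q\<in>C. c P * (c Q * (Q \<bullet> Q))) = sum c C * (\<Sum>Q\<in>C. c Q * (Q \<bullet> Q))"
    by (simp only: sum_product)
  also have "(\<Sum>P\<in>C. \<Sum>Q\<in>C. c P * c Q * (P \<bullet> Q)) = (\<Sum>q\<in>C. c q *\<^sub>R q) \<bullet> (\<Sum>q\<in>C. c q *\<^sub>R q)"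
    unfolding inner_sum_left inner_sum_right
    by (intro sum.cong refl) (simp add: inner_commute)
  finally show ?thesis using c by (simp add: power2_norm_eq_inner)
qed

text \<open>The centred barycentric coordinates of \<open>x - mid T\<close> sum to zero, so its
  square is a combination of products of two different coordinates. All these products have the same
  integral, which leaves the factor \<open>edge_sum\<close>.\<close>

lemma integral_square_centered:
  assumes n: "DIM('a) \<ge> 2"
  shows "(\<integral>x. (norm (x - mid T))\<^sup>2 \<partial>lebesgue_on T)
    = edge_sum * measure lebesgue T / (2 * (real DIM('a) + 1)\<^sup>2 * (real DIM('a) + 2))"
proof -
  let ?n = "real DIM('a)"
  define c where "c q x = bary q x - 1 / (?n + 1)" for q x
  have n0: "?n + 1 > 0" "?n + 2 > 0" by (simp_all add: add_pos_pos)
  have sc: "(\<Sum>q\<in>C. c q x) = 0" for x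
    using n0 by (simp add: c_def sum_subtractf sum_bary card_C add.commute)
  have xc: "x - mid T = (\<Sum>q\<in>C. c q x *\<^sub>R q)" for x
    by (simp add: c_def scaleR_diff_left sum_subtractf bary_repr mid_T scaleR_sum_right)
  have cc: "continuous_on UNIV (c q)" if "q \<in> C" for q
    unfolding c_def using bary_continuous[OF that] by (intro continuous_intros) auto
  have int: "integrable (lebesgue_on T) (\<lambda>x. c P x * c Q x)" if "P \<in> C" "Q \<in> C" for P Q
    using cc that by (intro continuous_integrable_T continuous_intros)
  have cPQ: "(\<integral>x. c P x * c Q x \<partial>lebesgue_on T) = - measure lebesgue T / ((?n + 1)\<^sup>2 * (?n + 2))"
    if P: "P \<in> C" and Q: "Q \<in> C - {P}" for P Q
  proof -
    have Q': "Q \<in> C" "Q \<noteq> P" using Q by auto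
    define a where "a = 1 / (?n + 1)"
    have i: "integrable (lebesgue_on T) (bary P)" "integrable (lebesgue_on T) (bary Q)"
      "integrable (lebesgue_on T) (\<lambda>x. bary P x * bary Q x)" "integrable (lebesgue_on T) (\<lambda>x. a * a)"
      using bary_continuous[OF P] bary_continuous[OF Q'(1)]
      by (auto intro!: continuous_integrable_T continuous_intros)
    have "(\<integral>x. c P x * c Q x \<partial>lebesgue_on T)
      = (\<integral>x. bary P x * bary Q x - a * bary P x - a * bary Q x + a * a \<partial>lebesgue_on T)"
      by (intro Bochner_Integration.integral_cong refl) (simp add: c_def a_def[symmetric] left_diff_distrib right_diff_distrib)
    also have "\<dots> = (\<integral>x. bary P x * bary Q x \<partial>lebesgue_on T) - a * (\<integral>x. bary P x \<partial>lebesgue_on T)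
       - a * (\<integral>x. bary Q x \<partial>lebesgue_on T) + measure lebesgue T * (a * a)"
      using i const_integral_T[of "a * a"] by simp
    also have "\<dots> = measure lebesgue T * (1 / ((?n + 1) * (?n + 2)) - 1 / (?n + 1)\<^sup>2)"
      unfolding integral_bary_bary[OF n P Q'] integral_bary[OF n P] integral_bary[OF n Q'(1)]
      unfolding a_def by (simp add: power2_eq_square right_diff_distrib)
    also have "1 / ((?n + 1) * (?n + 2)) - 1 / (?n + 1)\<^sup>2 = - 1 / ((?n + 1)\<^sup>2 * (?n + 2))"
    proof -
      have "1 / ((a + 1) * (a + 2)) - 1 / (a + 1)\<^sup>2 = - 1 / ((a + 1)\<^sup>2 * (a + 2))" if "a + 1 > 0" "a + 2 > 0" for a :: real
        using that by (simp add: divide_simps power2_eq_square)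
      then show ?thesis using n0 by blast
    qed
    finally show ?thesis by simp
  qed
  have sq: "(norm (x - mid T))\<^sup>2 = - (\<Sum>P\<in>C. \<Sum>Q\<in>C - {P}. (norm (P - Q))\<^sup>2 * (c P x * c Q x)) / 2" for x
    unfolding xc using norm_square_zero_sum[of "\<lambda>q. c q x", OF sc] by (simp add: mult.commute)
  have "(\<integral>x. (norm (x - mid T))\<^sup>2 \<partial>lebesgue_on T)
      = - (\<Sum>P\<in>C. \<Sum>Q\<in>C - {P}. (norm (P - Q))\<^sup>2 * (\<integral>x. c P x * c Q x \<partial>lebesgue_on T)) / 2"
  proof -
    have i: "integrable (lebesgue_on T) (\<lambda>x. (norm (P - Q))\<^sup>2 * (c P x * c Q x))" if "P \<in> C" "Q \<in> C - {P}" for P Q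
      using int[of P Q] that by simp
    have "(\<integral>x. (\<Sum>P\<in>C. \<Sum>Q\<in>C - {P}. (norm (P - Q))\<^sup>2 * (c P x * c Q x)) \<partial>lebesgue_on T)
      = (\<Sum>P\<in>C. \<integral>x. (\<Sum>Q\<in>C - {P}. (norm (P - Q))\<^sup>2 * (c P x * c Q x)) \<partial>lebesgue_on T)"
      using i by (intro Bochner_Integration.integral_sum Bochner_Integration.integrable_sum)
    also have "\<dots> = (\<Sum>P\<in>C. \<Sum>Q\<in>C - {P}. (norm (P - Q))\<^sup>2 * (\<integral>x. c P x * c Q x \<partial>lebesgue_on T))"
      using i by (intro sum.cong refl) (subst Bochner_Integration.integral_sum, auto)
    finally show ?thesis unfolding sq by simp
  qed
  also have "\<dots> = - (\<Sum>P\<in>C. \<Sum>Q\<in>C - {P}. (norm (P - Q))\<^sup>2 * (- measure lebesgue T / ((?n + 1)\<^sup>2 * (?n + 2)))) / 2"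
    using cPQ by (intro arg_cong[where f="\<lambda>s. - s / 2"] sum.cong refl) simp
  also have "\<dots> = - (edge_sum * (- measure lebesgue T / ((?n + 1)\<^sup>2 * (?n + 2)))) / 2"
    unfolding edge_sum_def sum_distrib_right ..
  also have "\<dots> = edge_sum * measure lebesgue T / (2 * (?n + 1)\<^sup>2 * (?n + 2))"
    by (simp add: mult_ac)
  finally show ?thesis .
qed

definition bubble_coeff :: real where
  "bubble_coeff = real DIM('a) * (real DIM('a) + 1)\<^sup>2 * (real DIM('a) + 2) / edge_sum"

lemma bubble_coeff_pos: "bubble_coeff > 0"
  unfolding bubble_coeff_def using edge_sum_pos
  by (intro divide_pos_pos mult_pos_pos zero_less_power add_pos_pos) auto

lemma bubble_T: "x \<in> T \<Longrightarrow> bubble T x = (real DIM('a) + 2) / 2 + (- bubble_coeff) * (norm (x - mid T))\<^sup>2"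
  unfolding bubble_def Let_def vertices_T bubble_coeff_def edge_sum_def by simp

text \<open>Equivalent to the normalisation of the bubble to mean value one: its constant term is
  n/2 + 1, and the quadratic term removes n/2.\<close>

lemma bubble_coeff_integral:
  assumes n: "DIM('a) \<ge> 2"
  shows "bubble_coeff * (\<integral>x. (norm (x - mid T))\<^sup>2 \<partial>lebesgue_on T) = real DIM('a) / 2 * measure lebesgue T"
proof -
  have "a * A * B / E * (E * v / (2 * A * B)) = a / 2 * v" if "A > 0" "B > 0" "E > 0" for a A B E v :: real
    using that by simp
  note * = this[OF _ _ edge_sum_pos]
  show ?thesis
    unfolding bubble_coeff_def integral_square_centered[OF n] by (rule *) (simp_all add: add_pos_pos)
qed

text \<open>The functional that, by the divergence theorem, is a multiple of the mean over the face
  opposite to \<open>p\<close>; it is defined for functions without traces.\<close>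

definition face_functional :: "'a \<Rightarrow> ('a \<Rightarrow> real) \<Rightarrow> ('a \<Rightarrow> 'a) \<Rightarrow> real" where
  "face_functional p f G = real DIM('a) * (\<integral>x. f x \<partial>lebesgue_on T) + (\<integral>x. G x \<bullet> (x - p) \<partial>lebesgue_on T)"

lemma integral_quadratic:
  assumes n: "DIM('a) \<ge> 2"
  shows "(\<integral>x. c + g \<bullet> x + d * (norm (x - mid T))\<^sup>2 \<partial>lebesgue_on T)
    = measure lebesgue T * (c + g \<bullet> mid T) + d * (\<integral>x. (norm (x - mid T))\<^sup>2 \<partial>lebesgue_on T)"
proof -
  have "integrable (lebesgue_on T) (\<lambda>x. c + g \<bullet> mid T)" "integrable (lebesgue_on T) (\<lambda>x. g \<bullet> (x - mid T))"
     "integrable (lebesgue_on T) (\<lambda>x. d * (norm (x - mid T))\<^sup>2)"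
    by (intro continuous_integrable_T continuous_intros)+
  moreover have "(\<integral>x. c + g \<bullet> x + d * (norm (x - mid T))\<^sup>2 \<partial>lebesgue_on T)
    = (\<integral>x. ((c + g \<bullet> mid T) + g \<bullet> (x - mid T)) + d * (norm (x - mid T))\<^sup>2 \<partial>lebesgue_on T)"
    by (simp add: inner_diff_right)
  ultimately show ?thesis
    using integral_centered[OF n, of g] const_integral_T[of "c + g \<bullet> mid T"] by simp
qed

text \<open>Splitting \<open>x - p\<close> at the barycentre leaves only the constant and the second
  moment after integration. For the coefficients of the bubble the two contributions cancel, which
  expresses its zero mean on every face.\<close>

lemma face_functional_quadratic:
  assumes n: "DIM('a) \<ge> 2" and p: "p \<in> C"
  shows "face_functional p (\<lambda>x. c + g \<bullet> x + d * (norm (x - mid T))\<^sup>2) (\<lambda>x. g + (2 * d) *\<^sub>R (x - mid T))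
    = real DIM('a) * measure lebesgue T * (c + g \<bullet> mid (face p))
      + (real DIM('a) + 2) * d * (\<integral>x. (norm (x - mid T))\<^sup>2 \<partial>lebesgue_on T)"
proof -
  let ?m = "mid T"
  let ?J = "\<integral>x. (norm (x - ?m))\<^sup>2 \<partial>lebesgue_on T"
  have pt: "(g + (2 * d) *\<^sub>R (x - ?m)) \<bullet> (x - p)
    = (g \<bullet> (?m - p) - (g + (2 * d) *\<^sub>R (?m - p)) \<bullet> ?m) + (g + (2 * d) *\<^sub>R (?m - p)) \<bullet> x + 2 * d * (norm (x - ?m))\<^sup>2" for x
  proof -
    have "(g + (2 * d) *\<^sub>R y) \<bullet> (y + w) = g \<bullet> w + (g + (2 * d) *\<^sub>R w) \<bullet> y + 2 * d * (y \<bullet> y)" for y w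
      by (simp add: inner_add_left inner_add_right inner_commute distrib_left)
    from this[of "x - ?m" "?m - p"] show ?thesis
      unfolding power2_norm_eq_inner by (simp add: inner_diff_right[of "g + _" x ?m])
  qed
  have "(\<integral>x. (g + (2 * d) *\<^sub>R (x - ?m)) \<bullet> (x - p) \<partial>lebesgue_on T)
    = (\<integral>x. (g \<bullet> (?m - p) - (g + (2 * d) *\<^sub>R (?m - p)) \<bullet> ?m) + (g + (2 * d) *\<^sub>R (?m - p)) \<bullet> x + 2 * d * (norm (x - ?m))\<^sup>2 \<partial>lebesgue_on T)"
    by (intro Bochner_Integration.integral_cong refl pt)
  also have "\<dots> = measure lebesgue T * (g \<bullet> (?m - p)) + 2 * d * ?J"
    unfolding integral_quadratic[OF n] by simp
  finally have F: "face_functional p (\<lambda>x. c + g \<bullet> x + d * (norm (x - ?m))\<^sup>2) (\<lambda>x. g + (2 * d) *\<^sub>R (x - ?m))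
     = real DIM('a) * (measure lebesgue T * (c + g \<bullet> ?m) + d * ?J) + (measure lebesgue T * (g \<bullet> (?m - p)) + 2 * d * ?J)"
    unfolding face_functional_def integral_quadratic[OF n] by simp
  have gm: "g \<bullet> (?m - p) = real DIM('a) * (g \<bullet> mid (face p) - g \<bullet> ?m)"
    unfolding mid_face[OF p] by (simp add: inner_add_right)
  show ?thesis unfolding F gm by (simp add: algebra_simps)
qed

text \<open>As \<open>E\<close> has zero mean, the functionals reduce to the moments of
  \<open>H\<close> against \<open>x - p\<close> for all vertices. Differences show that the integral
  of \<open>H\<close> is orthogonal to all edges and so vanishes, and then the centre of the linear
  moment may be moved to the barycentre. The gradients of quadratics of the present form are exactly
  of the type tested.\<close>

lemma orthogonal_to_gradients:
  assumes H: "H \<in> L2_functions T" and E: "(\<integral>x. E x \<partial>lebesgue_on T) = 0"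
    and F: "\<And>p. p \<in> C \<Longrightarrow> face_functional p E H = 0"
  shows "(\<integral>x. H x \<bullet> (g + d *\<^sub>R (x - mid T)) \<partial>lebesgue_on T) = 0"
proof -
  have iH: "integrable (lebesgue_on T) H" by (rule L2_integrable[OF lmeasurable_T H])
  have iHx: "integrable (lebesgue_on T) (\<lambda>x. H x \<bullet> (x - p))" for p
    by (intro L2_inner_integrable H L2_continuous continuous_intros bounded_T sets_T)
  have z: "(\<integral>x. H x \<bullet> (x - p) \<partial>lebesgue_on T) = 0" if "p \<in> C" for p
    using F[OF that] E by (simp add: face_functional_def)
  define h where "h = (\<integral>x. H x \<partial>lebesgue_on T)"
  have ih: "(\<integral>x. H x \<bullet> v \<partial>lebesgue_on T) = h \<bullet> v" for v
    unfolding h_def using iH by (rule integral_inner_left)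
  have iv: "integrable (lebesgue_on T) (\<lambda>x. H x \<bullet> v)" for v using iH by simp
  obtain p where p: "p \<in> C" using C_nonempty by auto
  have shift: "(\<integral>x. H x \<bullet> (x - y) \<partial>lebesgue_on T) = h \<bullet> (p - y)" for y
  proof -
    have "(\<integral>x. H x \<bullet> (x - y) \<partial>lebesgue_on T) = (\<integral>x. H x \<bullet> (x - p) + H x \<bullet> (p - y) \<partial>lebesgue_on T)"
      by (intro Bochner_Integration.integral_cong refl) (simp flip: inner_add_right)
    then show ?thesis using iHx[of p] iv[of "p - y"] z[OF p] ih[of "p - y"] by simp
  qed
  have hq: "h \<bullet> (p - q) = 0" if "q \<in> C" for q using shift[of q] z[OF that] by simp
  have "h \<bullet> (p - y) = 0" for y
  proof -
    have "h \<bullet> p + (- h) \<bullet> y = (\<Sum>q\<in>C. bary q y * (h \<bullet> p + (- h) \<bullet> q))" by (rule affine_function_bary)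
    also have "\<dots> = (\<Sum>q\<in>C. bary q y * (h \<bullet> (p - q)))" by (simp add: inner_diff_right)
    finally show ?thesis using hq by (simp add: inner_diff_right)
  qed
  \<comment> \<open>With this choice of \<open>y\<close> the vanishing product is
    \<open>h \<bullet> h\<close>.\<close>
  from this[of "p - h"] have h0: "h = 0" by simp
  have "(\<integral>x. H x \<bullet> (g + d *\<^sub>R (x - mid T)) \<partial>lebesgue_on T)
    = (\<integral>x. H x \<bullet> g + d * (H x \<bullet> (x - mid T)) \<partial>lebesgue_on T)"
    by (simp add: inner_add_right)
  also have "\<dots> = 0" using iv[of g] iHx[of "mid T"] ih[of g] shift[of "mid T"] h0 by simp
  finally show ?thesis .
qed

end

section \<open>Completeness of square integrable functions\<close>

text \<open>Riesz-Fischer on a finite measure space: a square-mean Cauchy sequence is Cauchy in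
  mean, a subsequence converges almost everywhere, and Fatou's lemma turns the Cauchy estimate into
  convergence of the full sequence.\<close>

lemma (in finite_measure) L2_Cauchy_limit:
  fixes f :: "nat \<Rightarrow> 'a \<Rightarrow> real"
  assumes f: "\<And>j. f j \<in> borel_measurable M" "\<And>j. integrable M (\<lambda>x. (f j x)\<^sup>2)"
    and Cauchy: "\<And>e. e > 0 \<Longrightarrow> \<exists>N. \<forall>i\<ge>N. \<forall>j\<ge>N. (\<integral>x. (f i x - f j x)\<^sup>2 \<partial>M) < e"
  obtains t where "t \<in> borel_measurable M" "integrable M (\<lambda>x. (t x)\<^sup>2)"
    "(\<lambda>j. \<integral>x. (f j x - t x)\<^sup>2 \<partial>M) \<longlonglongrightarrow> 0"
proof -
  note [measurable] = f(1)
  have sq: "integrable M (\<lambda>x. (f i x - f j x)\<^sup>2)" for i j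
  proof (rule Bochner_Integration.integrable_bound)
    show "integrable M (\<lambda>x. 2 * (f i x)\<^sup>2 + 2 * (f j x)\<^sup>2)" using f(2) by simp
    show "AE x in M. norm ((f i x - f j x)\<^sup>2) \<le> norm (2 * (f i x)\<^sup>2 + 2 * (f j x)\<^sup>2)"
      using norm_add_square_le[of "f i x" "- f j x" for x] by (intro AE_I2) simp
  qed simp
  have i1: "integrable M (f j)" for j
  proof (rule Bochner_Integration.integrable_bound)
    show "integrable M (\<lambda>x. 1 + (f j x)\<^sup>2)" using f(2) by simp
    show "AE x in M. norm (f j x) \<le> norm (1 + (f j x)\<^sup>2)"
      using norm_product_le[of "1::real" "f j x" for x] by (intro AE_I2) simp
  qed simp
  have "\<exists>N. \<forall>i\<ge>N. \<forall>j\<ge>N. (\<integral>x. norm (f i x - f j x) \<partial>M) < e" if e: "e > 0" for e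
  proof -
    define \<mu> where "\<mu> = measure M (space M)"
    define d where "d = e / (2 * (\<mu> + 1))"
    have \<mu>: "0 \<le> \<mu>" by (simp add: \<mu>_def)
    then have d: "d > 0" using e by (simp add: d_def)
    have d\<mu>: "d * \<mu> \<le> e / 2" using \<mu> e by (simp add: d_def field_simps)
    obtain N where N: "\<And>i j. N \<le> i \<Longrightarrow> N \<le> j \<Longrightarrow> (\<integral>x. (f i x - f j x)\<^sup>2 \<partial>M) < d * e / 2"
      using Cauchy[of "d * e / 2"] d e by auto
    have "(\<integral>x. norm (f i x - f j x) \<partial>M) < e" if "N \<le> i" "N \<le> j" for i j
    proof -
      \<comment> \<open>Either the modulus is at most \<open>d\<close>, or it is dominated by the
        quadratic term. Integration bounds the mean by \<open>d * \<mu>\<close> plus the squared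
        distance over \<open>d\<close>, and \<open>d\<close> is chosen to make the first part at
        most \<open>e / 2\<close>.\<close>
      have pt: "norm a \<le> d + a\<^sup>2 / d" for a :: real
      proof (cases "\<bar>a\<bar> \<le> d")
        case True
        then show ?thesis using d by (simp add: add_increasing2)
      next
        case False
        then have "\<bar>a\<bar> * d \<le> \<bar>a\<bar> * \<bar>a\<bar>" by (intro mult_left_mono) auto
        then show ?thesis using d by (simp add: pos_le_divide_eq power2_eq_square add_increasing)
      qed
      have "(\<integral>x. norm (f i x - f j x) \<partial>M) \<le> (\<integral>x. d + (f i x - f j x)\<^sup>2 / d \<partial>M)"
        using i1 sq pt by (intro integral_mono integrable_norm Bochner_Integration.integrable_add Bochner_Integration.integrable_diff) auto
      also have "\<dots> = d * \<mu> + (\<integral>x. (f i x - f j x)\<^sup>2 \<partial>M) / d"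
        using sq by (simp add: \<mu>_def mult.commute)
      also have "\<dots> < e / 2 + (d * e / 2) / d"
        using d\<mu> N[OF that] d by (intro add_le_less_mono divide_strict_right_mono)
      also have "\<dots> = e" using d by simp
      finally show ?thesis .
    qed
    then show ?thesis by blast
  qed
  then obtain r where r: "strict_mono r" "AE x in M. Cauchy (\<lambda>i. f (r i) x)"
    using cauchy_L1_AE_cauchy_subseq[of M f, OF i1] by blast
  define t where "t x = lim (\<lambda>i. f (r i) x)" for x
  have tm[measurable]: "t \<in> borel_measurable M" unfolding t_def by measurable
  have lim: "AE x in M. (\<lambda>i. f (r i) x) \<longlonglongrightarrow> t x"
    using r(2) by eventually_elim (simp add: t_def Cauchy_convergent_iff convergent_LIMSEQ_iff)
  have est: "integrable M (\<lambda>x. (f j x - t x)\<^sup>2) \<and> (\<integral>x. (f j x - t x)\<^sup>2 \<partial>M) \<le> e"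
    if e: "e > 0" and N: "\<And>i. N \<le> i \<Longrightarrow> (\<integral>x. (f j x - f i x)\<^sup>2 \<partial>M) < e" for e N j
  proof -
    \<comment> \<open>The pointwise limit along the subsequence is written as a lower limit so that
      Fatou's lemma applies.\<close>
    have "(\<integral>\<^sup>+x. ennreal ((f j x - t x)\<^sup>2) \<partial>M) = (\<integral>\<^sup>+x. liminf (\<lambda>i. ennreal ((f j x - f (r i) x)\<^sup>2)) \<partial>M)"
    proof (rule nn_integral_cong_AE)
      show "AE x in M. ennreal ((f j x - t x)\<^sup>2) = liminf (\<lambda>i. ennreal ((f j x - f (r i) x)\<^sup>2))"
        using lim
      proof eventually_elim
        case (elim x)
        have "(\<lambda>i. ennreal ((f j x - f (r i) x)\<^sup>2)) \<longlonglongrightarrow> ennreal ((f j x - t x)\<^sup>2)"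
          by (intro tendsto_ennrealI tendsto_power tendsto_diff tendsto_const elim)
        then show ?case by (intro lim_imp_Liminf[symmetric]) auto
      qed
    qed
    also have "\<dots> \<le> liminf (\<lambda>i. \<integral>\<^sup>+x. ennreal ((f j x - f (r i) x)\<^sup>2) \<partial>M)"
      by (rule nn_integral_liminf) simp
    also have "\<dots> \<le> ennreal e"
    proof (rule Liminf_le)
      have "(\<integral>\<^sup>+x. ennreal ((f j x - f (r i) x)\<^sup>2) \<partial>M) \<le> ennreal e" if "N \<le> i" for i
      proof -
        have "N \<le> r i" using that seq_suble[OF r(1), of i] by simp
        then have "(\<integral>x. (f j x - f (r i) x)\<^sup>2 \<partial>M) \<le> e" using N[of "r i"] by simp
        then show ?thesis using sq[of j "r i"] by (subst nn_integral_eq_integral) (auto simp: ennreal_leI)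
      qed
      then show "\<forall>\<^sub>F i in sequentially. (\<integral>\<^sup>+x. ennreal ((f j x - f (r i) x)\<^sup>2) \<partial>M) \<le> ennreal e"
        by (auto simp: eventually_sequentially)
    qed simp
    finally have nn: "(\<integral>\<^sup>+x. ennreal ((f j x - t x)\<^sup>2) \<partial>M) \<le> ennreal e" .
    have i: "integrable M (\<lambda>x. (f j x - t x)\<^sup>2)"
    proof (rule integrableI_nonneg)
      show "(\<integral>\<^sup>+x. ennreal ((f j x - t x)\<^sup>2) \<partial>M) < \<infinity>" using nn by (simp add: le_less_trans)
    qed auto
    then have "ennreal (\<integral>x. (f j x - t x)\<^sup>2 \<partial>M) \<le> ennreal e"
      using nn by (subst (asm) nn_integral_eq_integral) auto
    then show ?thesis using i e by simp
  qed
  have est2: "\<exists>N. \<forall>j\<ge>N. integrable M (\<lambda>x. (f j x - t x)\<^sup>2) \<and> (\<integral>x. (f j x - t x)\<^sup>2 \<partial>M) \<le> e" if e: "e > 0" for e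
    using Cauchy[OF e] est[OF e] by meson
  have L: "(\<lambda>j. \<integral>x. (f j x - t x)\<^sup>2 \<partial>M) \<longlonglongrightarrow> 0"
  proof (rule LIMSEQ_I)
    fix e :: real assume "e > 0"
    then obtain N where "\<forall>j\<ge>N. (\<integral>x. (f j x - t x)\<^sup>2 \<partial>M) \<le> e / 2" using est2[of "e / 2"] by auto
    then show "\<exists>N. \<forall>j\<ge>N. norm ((\<integral>x. (f j x - t x)\<^sup>2 \<partial>M) - 0) < e"
      using \<open>e > 0\<close> by (intro exI[of _ N]) (force simp: integral_nonneg_AE)
  qed
  obtain j where j: "integrable M (\<lambda>x. (f j x - t x)\<^sup>2)" using est2[of 1] by auto
  have "integrable M (\<lambda>x. (t x)\<^sup>2)"
  proof (rule Bochner_Integration.integrable_bound)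
    show "integrable M (\<lambda>x. 2 * (f j x - t x)\<^sup>2 + 2 * (f j x)\<^sup>2)" using f(2) j by simp
    show "AE x in M. norm ((t x)\<^sup>2) \<le> norm (2 * (f j x - t x)\<^sup>2 + 2 * (f j x)\<^sup>2)"
      using norm_add_square_le[of "t x - f j x" "f j x" for x] by (intro AE_I2) (simp add: power2_commute)
  qed simp
  then show thesis using that tm L by blast
qed

section \<open>Null sets in domains of integration\<close>

lemma AE_lebesgue_on_null_diff:
  assumes "W \<in> sets lebesgue" "S \<in> sets lebesgue" "negligible (S - W)" "AE x in lebesgue_on W. P x"
  shows "AE x in lebesgue_on S. P x"
proof -
  have "AE x in lebesgue. x \<notin> S - W" using assms(3) unfolding negligible_iff_null_sets by (rule AE_not_in)
  moreover have "AE x in lebesgue. x \<in> W \<longrightarrow> P x" using assms by (simp add: AE_restrict_space_iff)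
  ultimately have "AE x in lebesgue. x \<in> S \<longrightarrow> P x" by eventually_elim auto
  then show ?thesis using assms by (simp add: AE_restrict_space_iff)
qed

lemma AE_lebesgue_on_subset:
  assumes "W \<subseteq> S" "W \<in> sets lebesgue" "S \<in> sets lebesgue" "AE x in lebesgue_on S. P x"
  shows "AE x in lebesgue_on W. P x"
proof -
  have "AE x in lebesgue. x \<in> S \<longrightarrow> P x" using assms by (simp add: AE_restrict_space_iff)
  then have "AE x in lebesgue. x \<in> W \<longrightarrow> P x" by eventually_elim (use assms(1) in auto)
  then show ?thesis using assms by (simp add: AE_restrict_space_iff)
qed

context
  fixes W S :: "'a::euclidean_space set"
  assumes WS: "W \<subseteq> S" and W: "W \<in> sets lebesgue" and S: "S \<in> sets lebesgue" and N: "negligible (S - W)"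
begin

lemma AE_indicator_null_diff: "AE x in lebesgue. indicator S x *\<^sub>R f x = indicator W x *\<^sub>R (f x :: 'b::euclidean_space)"
proof -
  have "AE x in lebesgue. x \<notin> S - W" using N unfolding negligible_iff_null_sets by (rule AE_not_in)
  then show ?thesis by eventually_elim (use WS in \<open>auto simp: indicator_def\<close>)
qed

lemma measurable_null_diff:
  fixes f :: "'a \<Rightarrow> 'b::euclidean_space"
  shows "f \<in> borel_measurable (lebesgue_on S) \<longleftrightarrow> f \<in> borel_measurable (lebesgue_on W)"
proof -
  have "(\<lambda>x. indicator S x *\<^sub>R f x) \<in> borel_measurable (lebesgue_on UNIV) \<longleftrightarrow>
    (\<lambda>x. indicator W x *\<^sub>R f x) \<in> borel_measurable (lebesgue_on UNIV)"
  proof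
    have U: "(UNIV :: 'a set) \<in> sets lebesgue" by simp
    have A: "AE x in lebesgue_on UNIV. indicator S x *\<^sub>R f x = indicator W x *\<^sub>R f x"
      unfolding lebesgue_on_UNIV_eq by (rule AE_indicator_null_diff)
    then have A': "AE x in lebesgue_on UNIV. indicator W x *\<^sub>R f x = indicator S x *\<^sub>R f x"
      by eventually_elim (rule sym)
    show "(\<lambda>x. indicator W x *\<^sub>R f x) \<in> borel_measurable (lebesgue_on UNIV)"
      if "(\<lambda>x. indicator S x *\<^sub>R f x) \<in> borel_measurable (lebesgue_on UNIV)"
      by (rule borel_measurable_lebesgue_on_AE[OF U that A])
    show "(\<lambda>x. indicator S x *\<^sub>R f x) \<in> borel_measurable (lebesgue_on UNIV)"
      if "(\<lambda>x. indicator W x *\<^sub>R f x) \<in> borel_measurable (lebesgue_on UNIV)"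
      by (rule borel_measurable_lebesgue_on_AE[OF U that A'])
  qed
  then show ?thesis using W S by (simp add: borel_measurable_restrict_space_iff lebesgue_on_UNIV_eq)
qed

text \<open>Valid for arbitrary \<open>f\<close>: measurability on the two sets is equivalent, and
  for a non-integrable function both integrals are zero by convention.\<close>

lemma integral_null_diff:
  fixes f :: "'a \<Rightarrow> 'b::euclidean_space"
  shows "integral\<^sup>L (lebesgue_on S) f = integral\<^sup>L (lebesgue_on W) f"
proof (cases "f \<in> borel_measurable (lebesgue_on S)")
  case True
  then have "f \<in> borel_measurable (lebesgue_on W)" by (simp add: measurable_null_diff)
  with True have "(\<lambda>x. indicator S x *\<^sub>R f x) \<in> borel_measurable lebesgue" "(\<lambda>x. indicator W x *\<^sub>R f x) \<in> borel_measurable lebesgue"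
    using W S by (simp_all add: borel_measurable_restrict_space_iff)
  then have "integral\<^sup>L lebesgue (\<lambda>x. indicator S x *\<^sub>R f x) = integral\<^sup>L lebesgue (\<lambda>x. indicator W x *\<^sub>R f x)"
    by (intro integral_cong_AE AE_indicator_null_diff)
  then show ?thesis using W S by (simp add: integral_restrict_space)
next
  case False
  then have "\<not> integrable (lebesgue_on S) f" "\<not> integrable (lebesgue_on W) f"
    using measurable_null_diff[of f] by auto
  then show ?thesis by (simp add: not_integrable_integral_eq)
qed

lemma integrable_null_diff:
  fixes f :: "'a \<Rightarrow> 'b::euclidean_space"
  shows "integrable (lebesgue_on S) f \<longleftrightarrow> integrable (lebesgue_on W) f"
proof (cases "f \<in> borel_measurable (lebesgue_on S)")
  case True
  then have "f \<in> borel_measurable (lebesgue_on W)" by (simp add: measurable_null_diff)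
  with True have "(\<lambda>x. indicator S x *\<^sub>R f x) \<in> borel_measurable lebesgue" "(\<lambda>x. indicator W x *\<^sub>R f x) \<in> borel_measurable lebesgue"
    using W S by (simp_all add: borel_measurable_restrict_space_iff)
  then have "integrable lebesgue (\<lambda>x. indicator S x *\<^sub>R f x) \<longleftrightarrow> integrable lebesgue (\<lambda>x. indicator W x *\<^sub>R f x)"
    by (intro integrable_cong_AE AE_indicator_null_diff)
  then show ?thesis using W S by (simp add: integrable_restrict_space)
next
  case False
  then show ?thesis using measurable_null_diff[of f] by auto
qed

lemma L2_null_diff: "f \<in> L2_functions S \<longleftrightarrow> (f :: 'a \<Rightarrow> 'b::euclidean_space) \<in> L2_functions W"
  unfolding L2_functions_def by (simp add: measurable_null_diff integrable_null_diff)

end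

section \<open>The space of functions with zero boundary values\<close>

lemma frechet_derivative_add_fun:
  assumes "f differentiable at x" "g differentiable at x"
  shows "frechet_derivative (\<lambda>x. f x + g x) (at x) h = frechet_derivative f (at x) h + frechet_derivative g (at x) h"
proof -
  have "((\<lambda>x. f x + g x) has_derivative (\<lambda>h. frechet_derivative f (at x) h + frechet_derivative g (at x) h)) (at x)"
    using assms by (intro has_derivative_add) (simp_all flip: frechet_derivative_works)
  from frechet_derivative_at[OF this] show ?thesis by metis
qed

lemma frechet_derivative_scale_fun:
  fixes f :: "'a::euclidean_space \<Rightarrow> real"
  assumes "f differentiable at x"
  shows "frechet_derivative (\<lambda>x. c * f x) (at x) h = c * frechet_derivative f (at x) h"
proof -
  have "((\<lambda>x. c * f x) has_derivative (\<lambda>h. c * frechet_derivative f (at x) h)) (at x)"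
    using assms by (intro has_derivative_mult_right) (simp flip: frechet_derivative_works)
  from frechet_derivative_at[OF this] show ?thesis by metis
qed

lemma C_k_add: "C_k k f \<Longrightarrow> C_k k g \<Longrightarrow> C_k k (\<lambda>x. f x + g x)"
proof (induction k arbitrary: f g)
  case 0
  then show ?case by (auto intro: continuous_intros)
next
  case (Suc k)
  then have d: "\<And>x. f differentiable at x" "\<And>x. g differentiable at x" by auto
  have "C_k k (\<lambda>x. frechet_derivative (\<lambda>x. f x + g x) (at x) b)" if "b \<in> Basis" for b
    unfolding frechet_derivative_add_fun[OF d] using Suc that by auto
  then show ?case using d by (auto intro: differentiable_add)
qed

lemma C_k_scale: "C_k k f \<Longrightarrow> C_k k (\<lambda>x. c * f x)"
proof (induction k arbitrary: f)
  case 0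
  then show ?case by (auto intro: continuous_intros)
next
  case (Suc k)
  then have d: "\<And>x. f differentiable at x" by auto
  have "C_k k (\<lambda>x. frechet_derivative (\<lambda>x. c * f x) (at x) b)" if "b \<in> Basis" for b
    unfolding frechet_derivative_scale_fun[OF d] using Suc that by auto
  then show ?case using d by (auto intro: differentiable_mult)
qed

lemma test_functionsI:
  assumes "\<And>k. C_k k \<phi>" "compact K" "K \<subseteq> U" "\<And>x. \<phi> x \<noteq> 0 \<Longrightarrow> x \<in> K"
  shows "\<phi> \<in> test_functions U"
proof -
  have "closure {x. \<phi> x \<noteq> 0} \<subseteq> K"
    using assms(4) by (intro closure_minimal compact_imp_closed[OF assms(2)]) auto
  moreover from this have "compact (closure {x. \<phi> x \<noteq> 0})"
    using compact_imp_bounded[OF assms(2)] bounded_subset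
    by (simp add: compact_eq_bounded_closed)
  ultimately show ?thesis using assms(1,3) unfolding test_functions_def by blast
qed

lemma test_functions_C_k: "\<phi> \<in> test_functions U \<Longrightarrow> C_k k \<phi>"
  by (simp add: test_functions_def)

lemma test_functions_add:
  assumes "\<phi> \<in> test_functions U" "\<psi> \<in> test_functions U"
  shows "(\<lambda>x. \<phi> x + \<psi> x) \<in> test_functions U"
proof -
  obtain K where K: "compact K" "K \<subseteq> U" "\<And>x. x \<notin> K \<Longrightarrow> \<phi> x = 0"
    by (rule test_function_support[OF assms(1)]) (rule that)
  obtain L where L: "compact L" "L \<subseteq> U" "\<And>x. x \<notin> L \<Longrightarrow> \<psi> x = 0"
    by (rule test_function_support[OF assms(2)]) (rule that)
  show ?thesis
  proof (rule test_functionsI)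
    show "compact (K \<union> L)" using K L by (intro compact_Un)
    show "K \<union> L \<subseteq> U" using K L by auto
    show "x \<in> K \<union> L" if "\<phi> x + \<psi> x \<noteq> 0" for x using K(3)[of x] L(3)[of x] that by (cases "x \<in> K"; cases "x \<in> L") auto
  qed (intro C_k_add test_functions_C_k[OF assms(1)] test_functions_C_k[OF assms(2)])
qed

lemma test_functions_scale:
  assumes "\<phi> \<in> test_functions U"
  shows "(\<lambda>x. c * \<phi> x) \<in> test_functions U"
proof -
  obtain K where K: "compact K" "K \<subseteq> U" "\<And>x. x \<notin> K \<Longrightarrow> \<phi> x = 0"
    by (rule test_function_support[OF assms]) (rule that)
  show ?thesis
  proof (rule test_functionsI)
    show "x \<in> K" if "c * \<phi> x \<noteq> 0" for x using K(3)[of x] that by auto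
  qed (use K in \<open>auto intro: C_k_scale test_functions_C_k[OF assms]\<close>)
qed

definition H1_error :: "'a::euclidean_space set \<Rightarrow> ('a \<Rightarrow> real) \<Rightarrow> ('a \<Rightarrow> real) \<Rightarrow> ('a \<Rightarrow> 'a) \<Rightarrow> real" where
  "H1_error U \<phi> u g = (\<integral>x. (\<phi> x - u x)\<^sup>2 \<partial>lebesgue_on U) + (\<integral>x. (norm (grad \<phi> x - g x))\<^sup>2 \<partial>lebesgue_on U)"

lemma H1_error_parts:
  "0 \<le> (\<integral>x. (\<phi> x - u x)\<^sup>2 \<partial>lebesgue_on U)" "0 \<le> (\<integral>x. (norm (grad \<phi> x - g x))\<^sup>2 \<partial>lebesgue_on U)"
  by (auto intro: integral_nonneg_AE)

lemma H1_approx_iff: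
  "H1_approx U \<phi> u \<longleftrightarrow> (\<forall>j. \<phi> j \<in> test_functions U) \<and> (\<lambda>j. H1_error U (\<phi> j) u (weak_grad U u)) \<longlonglongrightarrow> 0"
proof -
  have "(\<lambda>j. H1_error U (\<phi> j) u (weak_grad U u)) \<longlonglongrightarrow> 0 \<longleftrightarrow>
    (\<lambda>j. \<integral>x. (\<phi> j x - u x)\<^sup>2 \<partial>lebesgue_on U) \<longlonglongrightarrow> 0 \<and>
    (\<lambda>j. \<integral>x. (norm (grad (\<phi> j) x - weak_grad U u x))\<^sup>2 \<partial>lebesgue_on U) \<longlonglongrightarrow> 0"
  proof
    assume L: "(\<lambda>j. H1_error U (\<phi> j) u (weak_grad U u)) \<longlonglongrightarrow> 0"
    have "(\<lambda>j. \<integral>x. (\<phi> j x - u x)\<^sup>2 \<partial>lebesgue_on U) \<longlonglongrightarrow> 0"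
      by (rule Lim_null_comparison[OF _ L])
         (intro always_eventually allI, use H1_error_parts in \<open>simp add: H1_error_def\<close>)
    moreover have "(\<lambda>j. \<integral>x. (norm (grad (\<phi> j) x - weak_grad U u x))\<^sup>2 \<partial>lebesgue_on U) \<longlonglongrightarrow> 0"
      by (rule Lim_null_comparison[OF _ L])
         (intro always_eventually allI, use H1_error_parts in \<open>simp add: H1_error_def\<close>)
    ultimately show "(\<lambda>j. \<integral>x. (\<phi> j x - u x)\<^sup>2 \<partial>lebesgue_on U) \<longlonglongrightarrow> 0 \<and>
      (\<lambda>j. \<integral>x. (norm (grad (\<phi> j) x - weak_grad U u x))\<^sup>2 \<partial>lebesgue_on U) \<longlonglongrightarrow> 0" ..
  next
    assume "(\<lambda>j. \<integral>x. (\<phi> j x - u x)\<^sup>2 \<partial>lebesgue_on U) \<longlonglongrightarrow> 0 \<and>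
      (\<lambda>j. \<integral>x. (norm (grad (\<phi> j) x - weak_grad U u x))\<^sup>2 \<partial>lebesgue_on U) \<longlonglongrightarrow> 0"
    then show "(\<lambda>j. H1_error U (\<phi> j) u (weak_grad U u)) \<longlonglongrightarrow> 0"
      unfolding H1_error_def using tendsto_add_zero by blast
  qed
  then show ?thesis by (simp add: H1_approx_def L2_norm_tendsto_iff fun_diff_def)
qed

lemma H1_error_AE_cong:
  assumes U: "U \<in> sets lebesgue" and g: "g \<in> L2_functions U" and ae: "AE x in lebesgue_on U. g x = h x"
    and p: "grad \<phi> \<in> L2_functions U"
  shows "H1_error U \<phi> u g = H1_error U \<phi> u h"
proof -
  have "h \<in> L2_functions U" by (rule L2_AE_cong[OF U g ae])
  note m = this[THEN L2_measurable] g[THEN L2_measurable] p[THEN L2_measurable]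
  have "(\<integral>x. (norm (grad \<phi> x - g x))\<^sup>2 \<partial>lebesgue_on U) = (\<integral>x. (norm (grad \<phi> x - h x))\<^sup>2 \<partial>lebesgue_on U)"
    using ae m by (intro integral_cong_AE) auto
  then show ?thesis by (simp add: H1_error_def)
qed

locale bounded_open =
  fixes \<Omega> :: "'a::euclidean_space set"
  assumes open_\<Omega>: "open \<Omega>" and bounded_\<Omega>: "bounded \<Omega>"
begin

lemma sets_\<Omega>: "\<Omega> \<in> sets lebesgue" using open_\<Omega> by simp

lemma H10_weak_gradient: "u \<in> H10 \<Omega> \<Longrightarrow> has_weak_gradient \<Omega> u (weak_grad \<Omega> u)"
  by (rule weak_grad_works) (simp add: H10_def)

lemma H10_L2: "u \<in> H10 \<Omega> \<Longrightarrow> u \<in> L2_functions \<Omega>" "u \<in> H10 \<Omega> \<Longrightarrow> weak_grad \<Omega> u \<in> L2_functions \<Omega>"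
  using H10_weak_gradient by (auto simp: has_weak_gradient_def)

text \<open>Lets a membership proof work with any concrete weak gradient instead of the chosen one;
  the error depends only on its class.\<close>

lemma H10I:
  assumes u: "has_weak_gradient \<Omega> u g" and \<phi>: "\<And>j. \<phi> j \<in> test_functions \<Omega>"
    and lim: "(\<lambda>j. H1_error \<Omega> (\<phi> j) u g) \<longlonglongrightarrow> 0"
  shows "u \<in> H10 \<Omega>"
proof -
  have ae: "AE x in lebesgue_on \<Omega>. weak_grad \<Omega> u x = g x"
    by (rule weak_grad_AE[OF open_\<Omega> bounded_\<Omega> u])
  have H1: "u \<in> H1 \<Omega>" using u by (auto simp: H1_def)
  have "H1_error \<Omega> (\<phi> j) u (weak_grad \<Omega> u) = H1_error \<Omega> (\<phi> j) u g" for j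
    using weak_grad_works[OF H1] test_function_L2(2)[OF \<phi> bounded_\<Omega> sets_\<Omega>]
    by (intro H1_error_AE_cong[OF sets_\<Omega> _ ae]) (auto simp: has_weak_gradient_def)
  then have "H1_approx \<Omega> \<phi> u" using lim \<phi> by (simp add: H1_approx_iff)
  then show ?thesis using H1 by (auto simp: H10_def)
qed

lemma grad_test_add:
  assumes "\<phi> \<in> test_functions U" "\<psi> \<in> test_functions U"
  shows "grad (\<lambda>x. \<phi> x + \<psi> x) x = grad \<phi> x + grad \<psi> x"
  by (intro grad_eq GDERIV_add C1_grad_GDERIV[OF test_function_C1[OF assms(1)]]
      C1_grad_GDERIV[OF test_function_C1[OF assms(2)]])

lemma grad_test_scale:
  assumes "\<phi> \<in> test_functions U"
  shows "grad (\<lambda>x. c * \<phi> x) x = c *\<^sub>R grad \<phi> x"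
  using GDERIV_mult[OF GDERIV_const[of c] C1_grad_GDERIV[OF test_function_C1[OF assms]], of x]
  by (intro grad_eq) simp

lemma integral_norm_add_square_le:
  fixes f g :: "'a \<Rightarrow> 'b::euclidean_space"
  assumes "f \<in> L2_functions S" "g \<in> L2_functions S"
  shows "(\<integral>x. (norm (f x + g x))\<^sup>2 \<partial>lebesgue_on S)
     \<le> 2 * (\<integral>x. (norm (f x))\<^sup>2 \<partial>lebesgue_on S) + 2 * (\<integral>x. (norm (g x))\<^sup>2 \<partial>lebesgue_on S)"
proof -
  have "(\<integral>x. (norm (f x + g x))\<^sup>2 \<partial>lebesgue_on S) \<le> (\<integral>x. 2 * (norm (f x))\<^sup>2 + 2 * (norm (g x))\<^sup>2 \<partial>lebesgue_on S)"
    using assms[THEN L2_square_integrable] L2_square_integrable[OF L2_add[OF assms]]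
    by (intro integral_mono norm_add_square_le) auto
  then show ?thesis using assms[THEN L2_square_integrable] by simp
qed

lemma H10_add:
  assumes u: "u \<in> H10 \<Omega>" and v: "v \<in> H10 \<Omega>"
  shows "u + v \<in> H10 \<Omega>"
proof -
  obtain \<phi> \<psi> where a: "H1_approx \<Omega> \<phi> u" "H1_approx \<Omega> \<psi> v" using u v by (auto simp: H10_def)
  then have \<phi>: "\<And>j. \<phi> j \<in> test_functions \<Omega>" and \<psi>: "\<And>j. \<psi> j \<in> test_functions \<Omega>" by (auto simp: H1_approx_def)
  let ?g = "weak_grad \<Omega> u" and ?h = "weak_grad \<Omega> v"
  have "(\<lambda>x. u x + v x) \<in> H10 \<Omega>"
  proof (rule H10I)
    show "has_weak_gradient \<Omega> (\<lambda>x. u x + v x) (\<lambda>x. ?g x + ?h x)"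
      by (rule has_weak_gradient_add[OF open_\<Omega> bounded_\<Omega> H10_weak_gradient[OF u] H10_weak_gradient[OF v]])
    show "(\<lambda>x. \<phi> j x + \<psi> j x) \<in> test_functions \<Omega>" for j by (rule test_functions_add[OF \<phi> \<psi>])
    show "(\<lambda>j. H1_error \<Omega> (\<lambda>x. \<phi> j x + \<psi> j x) (\<lambda>x. u x + v x) (\<lambda>x. ?g x + ?h x)) \<longlonglongrightarrow> 0"
    proof (rule Lim_null_comparison)
      have "(\<lambda>j. 2 * H1_error \<Omega> (\<phi> j) u ?g + 2 * H1_error \<Omega> (\<psi> j) v ?h) \<longlonglongrightarrow> 2 * 0 + 2 * 0"
        using a by (intro tendsto_add tendsto_mult tendsto_const) (auto simp: H1_approx_iff)
      then show "(\<lambda>j. 2 * H1_error \<Omega> (\<phi> j) u ?g + 2 * H1_error \<Omega> (\<psi> j) v ?h) \<longlonglongrightarrow> 0" by simp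
      show "\<forall>\<^sub>F j in sequentially. norm (H1_error \<Omega> (\<lambda>x. \<phi> j x + \<psi> j x) (\<lambda>x. u x + v x) (\<lambda>x. ?g x + ?h x))
         \<le> 2 * H1_error \<Omega> (\<phi> j) u ?g + 2 * H1_error \<Omega> (\<psi> j) v ?h"
      proof (intro always_eventually allI)
        fix j
        note L = test_function_L2[OF \<phi>[of j] bounded_\<Omega> sets_\<Omega>] test_function_L2[OF \<psi>[of j] bounded_\<Omega> sets_\<Omega>]
          H10_L2[OF u] H10_L2[OF v]
        have 1: "(\<integral>x. (\<phi> j x + \<psi> j x - (u x + v x))\<^sup>2 \<partial>lebesgue_on \<Omega>)
           \<le> 2 * (\<integral>x. (\<phi> j x - u x)\<^sup>2 \<partial>lebesgue_on \<Omega>) + 2 * (\<integral>x. (\<psi> j x - v x)\<^sup>2 \<partial>lebesgue_on \<Omega>)"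
          using integral_norm_add_square_le[OF L2_diff[OF L(1) L(5)] L2_diff[OF L(3) L(7)]] by (simp add: algebra_simps)
        have e: "grad (\<lambda>x. \<phi> j x + \<psi> j x) x - (?g x + ?h x) = (grad (\<phi> j) x - ?g x) + (grad (\<psi> j) x - ?h x)" for x
          by (simp add: grad_test_add[OF \<phi> \<psi>])
        have 2: "(\<integral>x. (norm (grad (\<lambda>x. \<phi> j x + \<psi> j x) x - (?g x + ?h x)))\<^sup>2 \<partial>lebesgue_on \<Omega>)
           \<le> 2 * (\<integral>x. (norm (grad (\<phi> j) x - ?g x))\<^sup>2 \<partial>lebesgue_on \<Omega>) + 2 * (\<integral>x. (norm (grad (\<psi> j) x - ?h x))\<^sup>2 \<partial>lebesgue_on \<Omega>)"
          unfolding e using integral_norm_add_square_le[OF L2_diff[OF L(2) L(6)] L2_diff[OF L(4) L(8)]] .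
        have "0 \<le> H1_error \<Omega> (\<lambda>x. \<phi> j x + \<psi> j x) (\<lambda>x. u x + v x) (\<lambda>x. ?g x + ?h x)"
          unfolding H1_error_def by (intro add_nonneg_nonneg H1_error_parts)
        then show "norm (H1_error \<Omega> (\<lambda>x. \<phi> j x + \<psi> j x) (\<lambda>x. u x + v x) (\<lambda>x. ?g x + ?h x))
         \<le> 2 * H1_error \<Omega> (\<phi> j) u ?g + 2 * H1_error \<Omega> (\<psi> j) v ?h"
          using 1 2 by (simp add: H1_error_def)
      qed
    qed
  qed
  then show ?thesis by (simp add: plus_fun_def)
qed

lemma H10_scale:
  assumes u: "u \<in> H10 \<Omega>"
  shows "c *\<^sub>R u \<in> H10 \<Omega>"
proof -
  obtain \<phi> where a: "H1_approx \<Omega> \<phi> u" using u by (auto simp: H10_def)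
  then have \<phi>: "\<And>j. \<phi> j \<in> test_functions \<Omega>" by (auto simp: H1_approx_def)
  let ?g = "weak_grad \<Omega> u"
  have "(\<lambda>x. c * u x) \<in> H10 \<Omega>"
  proof (rule H10I)
    show "has_weak_gradient \<Omega> (\<lambda>x. c * u x) (\<lambda>x. c *\<^sub>R ?g x)"
      by (rule has_weak_gradient_scale[OF H10_weak_gradient[OF u]])
    show "(\<lambda>x. c * \<phi> j x) \<in> test_functions \<Omega>" for j by (rule test_functions_scale[OF \<phi>])
    have "H1_error \<Omega> (\<lambda>x. c * \<phi> j x) (\<lambda>x. c * u x) (\<lambda>x. c *\<^sub>R ?g x) = c\<^sup>2 * H1_error \<Omega> (\<phi> j) u ?g" for j
      unfolding H1_error_def grad_test_scale[OF \<phi>]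
      by (simp add: power_mult_distrib distrib_left flip: right_diff_distrib scaleR_diff_right)
    moreover have "(\<lambda>j. c\<^sup>2 * H1_error \<Omega> (\<phi> j) u ?g) \<longlonglongrightarrow> c\<^sup>2 * 0"
      using a by (intro tendsto_mult tendsto_const) (auto simp: H1_approx_iff)
    ultimately show "(\<lambda>j. H1_error \<Omega> (\<lambda>x. c * \<phi> j x) (\<lambda>x. c * u x) (\<lambda>x. c *\<^sub>R ?g x)) \<longlonglongrightarrow> 0" by simp
  qed
  then show ?thesis by (simp add: scaleR_fun_def)
qed

lemma H10_zero: "0 \<in> H10 \<Omega>"
proof -
  have C: "C1_grad (\<lambda>_::'a. 0::real) (\<lambda>_. 0)" by (rule C1_grad_const)
  have t: "(\<lambda>_. 0) \<in> test_functions \<Omega>"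
    by (rule test_functionsI[of _ "{}"]) (use smooth_algebra_C_k[OF smooth_algebra.const[of 0]] in auto)
  have "(\<lambda>_. 0) \<in> H10 \<Omega>"
  proof (rule H10I[OF C1_has_weak_gradient[OF C open_\<Omega> bounded_\<Omega>] t])
    show "(\<lambda>j. H1_error \<Omega> (\<lambda>_. 0) (\<lambda>_. 0) (\<lambda>_. 0)) \<longlonglongrightarrow> 0"
      using grad_eq[OF C1_grad_GDERIV[OF C]] by (simp add: H1_error_def)
  qed
  then show ?thesis by (simp add: zero_fun_def)
qed

lemma subspace_H10: "subspace (H10 \<Omega>)"
  unfolding subspace_def using H10_zero H10_add H10_scale by blast

lemma weak_grad_add_AE:
  assumes "u \<in> H10 \<Omega>" "v \<in> H10 \<Omega>"
  shows "AE x in lebesgue_on \<Omega>. weak_grad \<Omega> (u + v) x = weak_grad \<Omega> u x + weak_grad \<Omega> v x"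
  using weak_grad_AE[OF open_\<Omega> bounded_\<Omega> has_weak_gradient_add[OF open_\<Omega> bounded_\<Omega> assms[THEN H10_weak_gradient]]]
  by (simp add: plus_fun_def)

lemma weak_grad_scale_AE:
  assumes "u \<in> H10 \<Omega>"
  shows "AE x in lebesgue_on \<Omega>. weak_grad \<Omega> (c *\<^sub>R u) x = c *\<^sub>R weak_grad \<Omega> u x"
  using weak_grad_AE[OF open_\<Omega> bounded_\<Omega> has_weak_gradient_scale[OF assms[THEN H10_weak_gradient]]]
  by (simp add: scaleR_fun_def)

end

section \<open>Traces on the faces of a simplex\<close>

locale simplex_in_domain = full_simplex C + bounded_open \<Omega>
  for C :: "'a::euclidean_space set" and \<Omega> :: "'a set" +
  assumes dim2: "DIM('a) \<ge> 2" and interior_subset_\<Omega>: "interior T \<subseteq> \<Omega>"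
begin

lemma sets_interior_T: "interior T \<in> sets lebesgue" by simp

lemmas null_diff_T = interior_subset[of T] sets_interior_T sets_T negligible_boundary

lemmas integral_T_interior = integral_null_diff[OF null_diff_T]
lemmas L2_T_interior = L2_null_diff[OF null_diff_T]
lemma L2_\<Omega>_T: "f \<in> L2_functions \<Omega> \<Longrightarrow> f \<in> L2_functions T"
  unfolding L2_T_interior by (rule L2_subset[OF interior_subset_\<Omega> sets_interior_T sets_\<Omega>])

lemma integral_T_le_\<Omega>:
  fixes f :: "'a \<Rightarrow> real"
  assumes f: "integrable (lebesgue_on \<Omega>) f" and nn: "\<And>x. 0 \<le> f x"
  shows "(\<integral>x. f x \<partial>lebesgue_on T) \<le> (\<integral>x. f x \<partial>lebesgue_on \<Omega>)"
proof -
  have i: "integrable lebesgue (\<lambda>x. indicator \<Omega> x *\<^sub>R f x)"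
    using f sets_\<Omega> by (simp add: integrable_restrict_space)
  have e: "indicator (interior T) x *\<^sub>R f x = indicator (interior T) x *\<^sub>R (indicator \<Omega> x *\<^sub>R f x)" for x
    using interior_subset_\<Omega> by (auto simp: indicator_def)
  have "integral\<^sup>L lebesgue (\<lambda>x. indicator (interior T) x *\<^sub>R f x) \<le> integral\<^sup>L lebesgue (\<lambda>x. indicator \<Omega> x *\<^sub>R f x)"
  proof (rule integral_mono)
    show "integrable lebesgue (\<lambda>x. indicator (interior T) x *\<^sub>R f x)"
      unfolding e by (rule integrable_mult_indicator[OF sets_interior_T i])
    show "indicator (interior T) x *\<^sub>R f x \<le> indicator \<Omega> x *\<^sub>R f x" for x
      using nn[of x] interior_subset_\<Omega> by (auto simp: indicator_def)
  qed (rule i)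
  then show ?thesis unfolding integral_T_interior using sets_\<Omega> by (simp add: integral_restrict_space)
qed

lemma continuous_face_integrable:
  fixes f :: "'a \<Rightarrow> real"
  assumes p: "p \<in> C" and f: "continuous_on UNIV f"
  shows "integrable (face_measure (face p)) f"
proof -
  interpret finite_measure "face_measure (face p)" by (rule face_measure_finite[OF p])
  have "compact (f ` face p)"
    by (intro compact_continuous_image continuous_on_subset[OF f] compact_face) auto
  then obtain B where B: "\<And>y. y \<in> f ` face p \<Longrightarrow> norm y \<le> B"
    using compact_imp_bounded bounded_iff by metis
  show ?thesis
  proof (rule integrable_const_bound)
    show "AE x in face_measure (face p). norm (f x) \<le> B"
      using face_measure_AE[OF p] by eventually_elim (use B in auto)
    show "f \<in> borel_measurable (face_measure (face p))"
      using borel_measurable_continuous_onI[OF f] by (simp add: measurable_cong_sets[OF sets_face_measure refl])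
  qed
qed

definition trace_constant :: "'a \<Rightarrow> real" where
  "trace_constant p = slope_norm p * (real DIM('a) + diameter T)"

lemma trace_constant_nonneg: "0 \<le> trace_constant p"
  unfolding trace_constant_def using diameter_T_pos by simp

text \<open>The divergence theorem for the square of \<open>f\<close>. The factor
  \<open>x - p\<close> is at most the diameter, and the mixed term is absorbed by the
  arithmetic-geometric inequality, which explains \<open>trace_constant\<close>.\<close>

lemma trace_inequality:
  assumes p: "p \<in> C" and f: "C1_grad f G"
  shows "(\<integral>x. (f x)\<^sup>2 \<partial>face_measure (face p))
    \<le> trace_constant p * ((\<integral>x. (f x)\<^sup>2 \<partial>lebesgue_on T) + (\<integral>x. (norm (G x))\<^sup>2 \<partial>lebesgue_on T))"
proof -
  define D where "D = diameter T"
  let ?n = "real DIM('a)"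
  have D: "D > 0" unfolding D_def by (rule diameter_T_pos)
  have pT: "p \<in> T" using p by (simp add: T_def hull_inc)
  have fc: "continuous_on UNIV f" and Gc: "continuous_on UNIV G"
    using C1_grad_continuous[OF f] C1_grad_continuous_grad[OF f] by auto
  have i: "integrable (lebesgue_on T) (\<lambda>x. (f x)\<^sup>2)" "integrable (lebesgue_on T) (\<lambda>x. (norm (G x))\<^sup>2)"
    "integrable (lebesgue_on T) (\<lambda>x. (f x *\<^sub>R G x + f x *\<^sub>R G x) \<bullet> (x - p))"
    using fc Gc by (intro continuous_integrable_T continuous_intros; simp)+
  have "C1_grad (\<lambda>x. f x * f x) (\<lambda>x. f x *\<^sub>R G x + f x *\<^sub>R G x)" by (rule C1_grad_mult[OF f f])
  from divergence_theorem[OF dim2 p this]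
  have "(\<integral>x. (f x)\<^sup>2 \<partial>face_measure (face p)) = slope_norm p * (?n * (\<integral>x. (f x)\<^sup>2 \<partial>lebesgue_on T)
     + (\<integral>x. (f x *\<^sub>R G x + f x *\<^sub>R G x) \<bullet> (x - p) \<partial>lebesgue_on T))"
    using slope_norm_pos[OF p] by (simp add: power2_eq_square)
  also have "(\<integral>x. (f x *\<^sub>R G x + f x *\<^sub>R G x) \<bullet> (x - p) \<partial>lebesgue_on T)
     \<le> (\<integral>x. D * ((f x)\<^sup>2 + (norm (G x))\<^sup>2) \<partial>lebesgue_on T)"
  proof (rule integral_mono)
    fix x assume "x \<in> space (lebesgue_on T)"
    then have x: "norm (x - p) \<le> D"
      using diameter_bounded_bound[OF bounded_T _ pT, of x] by (simp add: D_def dist_norm)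
    have "(f x *\<^sub>R G x + f x *\<^sub>R G x) \<bullet> (x - p) = (2 * f x) * (G x \<bullet> (x - p))" by (simp add: inner_add_left)
    also have "\<dots> \<le> \<bar>(2 * f x) * (G x \<bullet> (x - p))\<bar>" by (rule abs_ge_self)
    also have "\<dots> = \<bar>2 * f x\<bar> * \<bar>G x \<bullet> (x - p)\<bar>" by (rule abs_mult)
    also have "\<dots> \<le> \<bar>2 * f x\<bar> * (norm (G x) * norm (x - p))"
      by (intro mult_left_mono Cauchy_Schwarz_ineq2) auto
    also have "\<dots> \<le> \<bar>2 * f x\<bar> * (norm (G x) * D)" using x by (intro mult_left_mono) auto
    also have "\<dots> = D * (2 * \<bar>f x\<bar> * norm (G x))" by (simp add: abs_mult)
    also have "\<dots> \<le> D * (\<bar>f x\<bar>\<^sup>2 + (norm (G x))\<^sup>2)"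
      using D by (intro mult_left_mono sum_squares_bound) auto
    finally show "(f x *\<^sub>R G x + f x *\<^sub>R G x) \<bullet> (x - p) \<le> D * ((f x)\<^sup>2 + (norm (G x))\<^sup>2)" by simp
  qed (use i in auto)
  also have "(\<integral>x. D * ((f x)\<^sup>2 + (norm (G x))\<^sup>2) \<partial>lebesgue_on T)
     = D * ((\<integral>x. (f x)\<^sup>2 \<partial>lebesgue_on T) + (\<integral>x. (norm (G x))\<^sup>2 \<partial>lebesgue_on T))" using i by simp
  finally have "(\<integral>x. (f x)\<^sup>2 \<partial>face_measure (face p)) \<le> slope_norm p * (?n * (\<integral>x. (f x)\<^sup>2 \<partial>lebesgue_on T)
     + D * ((\<integral>x. (f x)\<^sup>2 \<partial>lebesgue_on T) + (\<integral>x. (norm (G x))\<^sup>2 \<partial>lebesgue_on T)))"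
    using slope_norm_pos[OF p] by (simp add: mult_left_mono)
  also have "\<dots> \<le> slope_norm p * ((?n + D) * ((\<integral>x. (f x)\<^sup>2 \<partial>lebesgue_on T) + (\<integral>x. (norm (G x))\<^sup>2 \<partial>lebesgue_on T)))"
    using slope_norm_pos[OF p] by (intro mult_left_mono) (auto simp: distrib_right distrib_left integral_nonneg_AE)
  finally show ?thesis by (simp add: trace_constant_def D_def mult.assoc)
qed

text \<open>Compares both functions with the same \<open>u\<close>, so that approximating sequences
  are Cauchy on the face.\<close>

lemma trace_test_difference:
  assumes p: "p \<in> C" and u: "u \<in> H10 \<Omega>" and \<phi>: "\<phi> \<in> test_functions \<Omega>" and \<psi>: "\<psi> \<in> test_functions \<Omega>"
  shows "(\<integral>x. (\<phi> x - \<psi> x)\<^sup>2 \<partial>face_measure (face p))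
    \<le> 2 * trace_constant p * (H1_error \<Omega> \<phi> u (weak_grad \<Omega> u) + H1_error \<Omega> \<psi> u (weak_grad \<Omega> u))"
proof -
  note L = test_function_L2[OF \<phi> bounded_\<Omega> sets_\<Omega>] test_function_L2[OF \<psi> bounded_\<Omega> sets_\<Omega>] H10_L2[OF u]
  let ?g = "weak_grad \<Omega> u"
  have C: "C1_grad (\<lambda>x. \<phi> x - \<psi> x) (\<lambda>x. grad \<phi> x - grad \<psi> x)"
    by (rule C1_grad_diff[OF test_function_C1[OF \<phi>] test_function_C1[OF \<psi>]])
  have 1: "(\<integral>x. (\<phi> x - \<psi> x)\<^sup>2 \<partial>lebesgue_on T)
     \<le> 2 * (\<integral>x. (\<phi> x - u x)\<^sup>2 \<partial>lebesgue_on \<Omega>) + 2 * (\<integral>x. (\<psi> x - u x)\<^sup>2 \<partial>lebesgue_on \<Omega>)"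
  proof -
    have "(\<integral>x. (\<phi> x - \<psi> x)\<^sup>2 \<partial>lebesgue_on T) \<le> (\<integral>x. (\<phi> x - \<psi> x)\<^sup>2 \<partial>lebesgue_on \<Omega>)"
      using L2_square_integrable[OF L2_diff[OF L(1) L(3)]] by (intro integral_T_le_\<Omega>) auto
    also have "\<dots> \<le> 2 * (\<integral>x. (\<phi> x - u x)\<^sup>2 \<partial>lebesgue_on \<Omega>) + 2 * (\<integral>x. (u x - \<psi> x)\<^sup>2 \<partial>lebesgue_on \<Omega>)"
      using integral_norm_add_square_le[OF L2_diff[OF L(1) L(5)] L2_diff[OF L(5) L(3)]] by simp
    finally show ?thesis by (simp add: power2_commute[of "u _"])
  qed
  have 2: "(\<integral>x. (norm (grad \<phi> x - grad \<psi> x))\<^sup>2 \<partial>lebesgue_on T)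
     \<le> 2 * (\<integral>x. (norm (grad \<phi> x - ?g x))\<^sup>2 \<partial>lebesgue_on \<Omega>) + 2 * (\<integral>x. (norm (grad \<psi> x - ?g x))\<^sup>2 \<partial>lebesgue_on \<Omega>)"
  proof -
    have "(\<integral>x. (norm (grad \<phi> x - grad \<psi> x))\<^sup>2 \<partial>lebesgue_on T) \<le> (\<integral>x. (norm (grad \<phi> x - grad \<psi> x))\<^sup>2 \<partial>lebesgue_on \<Omega>)"
      using L2_square_integrable[OF L2_diff[OF L(2) L(4)]] by (intro integral_T_le_\<Omega>) auto
    also have "\<dots> \<le> 2 * (\<integral>x. (norm (grad \<phi> x - ?g x))\<^sup>2 \<partial>lebesgue_on \<Omega>) + 2 * (\<integral>x. (norm (?g x - grad \<psi> x))\<^sup>2 \<partial>lebesgue_on \<Omega>)"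
      using integral_norm_add_square_le[OF L2_diff[OF L(2) L(6)] L2_diff[OF L(6) L(4)]] by simp
    finally show ?thesis by (simp add: norm_minus_commute[of "?g _"])
  qed
  have "(\<integral>x. (\<phi> x - \<psi> x)\<^sup>2 \<partial>face_measure (face p))
    \<le> trace_constant p * ((\<integral>x. (\<phi> x - \<psi> x)\<^sup>2 \<partial>lebesgue_on T) + (\<integral>x. (norm (grad \<phi> x - grad \<psi> x))\<^sup>2 \<partial>lebesgue_on T))"
    by (rule trace_inequality[OF p C])
  also have "\<dots> \<le> trace_constant p * (2 * (H1_error \<Omega> \<phi> u ?g + H1_error \<Omega> \<psi> u ?g))"
    using 1 2 trace_constant_nonneg by (intro mult_left_mono) (auto simp: H1_error_def)
  finally show ?thesis by (simp only: mult.assoc mult.left_commute)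
qed

text \<open>One approximating sequence produces the limit \<open>t\<close>. Since
  \<open>has_trace\<close> quantifies over all approximating sequences, any other one is then
  compared with the first through the trace inequality.\<close>

lemma trace_exists:
  assumes p: "p \<in> C" and u: "u \<in> H10 \<Omega>"
  shows "\<exists>t. has_trace \<Omega> (face p) u t"
proof -
  interpret F: finite_measure "face_measure (face p)" by (rule face_measure_finite[OF p])
  let ?F = "face_measure (face p)" and ?e = "\<lambda>\<phi>. H1_error \<Omega> \<phi> u (weak_grad \<Omega> u)"
  let ?K = "2 * trace_constant p"
  have bm: "borel_measurable ?F = (borel_measurable borel :: ('a \<Rightarrow> real) set)" by (intro measurable_cong_sets sets_face_measure refl)
  have cont: "continuous_on UNIV \<phi>" if "\<phi> \<in> test_functions \<Omega>" for \<phi>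
    by (rule C1_grad_continuous[OF test_function_C1[OF that]])
  obtain \<phi> where a: "H1_approx \<Omega> \<phi> u" using u by (auto simp: H10_def)
  then have \<phi>: "\<And>j. \<phi> j \<in> test_functions \<Omega>" and e0: "(\<lambda>j. ?e (\<phi> j)) \<longlonglongrightarrow> 0" by (auto simp: H1_approx_iff)
  have Cy: "\<exists>N. \<forall>i\<ge>N. \<forall>j\<ge>N. (\<integral>x. (\<phi> i x - \<phi> j x)\<^sup>2 \<partial>?F) < r" if r: "r > 0" for r
  proof -
    have "(\<lambda>j. ?K * ?e (\<phi> j)) \<longlonglongrightarrow> ?K * 0" by (intro tendsto_mult tendsto_const e0)
    then have "\<forall>\<^sub>F j in sequentially. ?K * ?e (\<phi> j) < r / 2" using r by (intro order_tendstoD(2)) auto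
    then obtain N where N: "\<And>j. N \<le> j \<Longrightarrow> ?K * ?e (\<phi> j) < r / 2" by (auto simp: eventually_sequentially)
    have "(\<integral>x. (\<phi> i x - \<phi> j x)\<^sup>2 \<partial>?F) < r" if "N \<le> i" "N \<le> j" for i j
      using trace_test_difference[OF p u \<phi>[of i] \<phi>[of j]] N[OF that(1)] N[OF that(2)] by (simp only: distrib_left)
    then show ?thesis by blast
  qed
  have m: "\<phi> j \<in> borel_measurable ?F" for j
    unfolding bm by (rule borel_measurable_continuous_onI[OF cont[OF \<phi>]])
  have i: "integrable ?F (\<lambda>x. (\<phi> j x)\<^sup>2)" for j
    by (intro continuous_face_integrable[OF p] continuous_intros cont[OF \<phi>])
  obtain t where t: "t \<in> borel_measurable ?F" "integrable ?F (\<lambda>x. (t x)\<^sup>2)"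
    "(\<lambda>j. \<integral>x. (\<phi> j x - t x)\<^sup>2 \<partial>?F) \<longlonglongrightarrow> 0"
    by (rule F.L2_Cauchy_limit[OF m i Cy]) (assumption | rule that)+
  have "(\<lambda>j. \<integral>x. (\<psi> j x - t x)\<^sup>2 \<partial>?F) \<longlonglongrightarrow> 0" if b: "H1_approx \<Omega> \<psi> u" for \<psi>
  proof (rule Lim_null_comparison)
    have \<psi>: "\<And>j. \<psi> j \<in> test_functions \<Omega>" and f0: "(\<lambda>j. ?e (\<psi> j)) \<longlonglongrightarrow> 0" using b by (auto simp: H1_approx_iff)
    have "(\<lambda>j. 2 * (?K * (?e (\<psi> j) + ?e (\<phi> j))) + 2 * (\<integral>x. (\<phi> j x - t x)\<^sup>2 \<partial>?F)) \<longlonglongrightarrow> 2 * (?K * (0 + 0)) + 2 * 0"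
      by (intro tendsto_add tendsto_mult tendsto_const e0 f0 t)
    then show "(\<lambda>j. 2 * (?K * (?e (\<psi> j) + ?e (\<phi> j))) + 2 * (\<integral>x. (\<phi> j x - t x)\<^sup>2 \<partial>?F)) \<longlonglongrightarrow> 0" by simp
    show "\<forall>\<^sub>F j in sequentially. norm (\<integral>x. (\<psi> j x - t x)\<^sup>2 \<partial>?F)
       \<le> 2 * (?K * (?e (\<psi> j) + ?e (\<phi> j))) + 2 * (\<integral>x. (\<phi> j x - t x)\<^sup>2 \<partial>?F)"
    proof (intro always_eventually allI)
      fix j
      have tm: "t \<in> borel_measurable borel" using t(1) bm by simp
      have i1: "integrable ?F (\<lambda>x. (\<psi> j x - \<phi> j x)\<^sup>2)"
        by (intro continuous_face_integrable[OF p] continuous_intros cont \<phi> \<psi>)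
      have i2: "integrable ?F (\<lambda>x. (f x - t x)\<^sup>2)" if f: "continuous_on UNIV f" for f
      proof (rule Bochner_Integration.integrable_bound)
        have "integrable ?F (\<lambda>x. (f x)\<^sup>2)" by (intro continuous_face_integrable[OF p] continuous_intros f)
        then show "integrable ?F (\<lambda>x. 2 * (f x)\<^sup>2 + 2 * (t x)\<^sup>2)" using t(2) by simp
        show "AE x in ?F. norm ((f x - t x)\<^sup>2) \<le> norm (2 * (f x)\<^sup>2 + 2 * (t x)\<^sup>2)"
          using norm_add_square_le[of "f x" "- t x" for x] by (intro AE_I2) simp
        show "(\<lambda>x. (f x - t x)\<^sup>2) \<in> borel_measurable ?F"
          unfolding bm using borel_measurable_continuous_onI[OF f] tm by measurable
      qed
      have "(\<integral>x. (\<psi> j x - t x)\<^sup>2 \<partial>?F) \<le> (\<integral>x. 2 * (\<psi> j x - \<phi> j x)\<^sup>2 + 2 * (\<phi> j x - t x)\<^sup>2 \<partial>?F)"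
        using i1 i2[OF cont[OF \<phi>]] i2[OF cont[OF \<psi>]] norm_add_square_le[of "\<psi> j x - \<phi> j x" "\<phi> j x - t x" for x]
        by (intro integral_mono) auto
      also have "\<dots> = 2 * (\<integral>x. (\<psi> j x - \<phi> j x)\<^sup>2 \<partial>?F) + 2 * (\<integral>x. (\<phi> j x - t x)\<^sup>2 \<partial>?F)"
        using i1 i2[OF cont[OF \<phi>]] by simp
      also have "\<dots> \<le> 2 * (?K * (?e (\<psi> j) + ?e (\<phi> j))) + 2 * (\<integral>x. (\<phi> j x - t x)\<^sup>2 \<partial>?F)"
        using trace_test_difference[OF p u \<psi>[of j] \<phi>[of j]] by simp
      finally show "norm (\<integral>x. (\<psi> j x - t x)\<^sup>2 \<partial>?F)
         \<le> 2 * (?K * (?e (\<psi> j) + ?e (\<phi> j))) + 2 * (\<integral>x. (\<phi> j x - t x)\<^sup>2 \<partial>?F)"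
        by (simp add: integral_nonneg_AE)
    qed
  qed
  then show ?thesis using t bm unfolding has_trace_def by blast
qed

text \<open>The functional contains only integrals over \<open>T\<close>, hence is continuous with
  respect to the convergence that defines \<open>H10\<close>.\<close>

lemma face_functional_tendsto:
  assumes u: "u \<in> H10 \<Omega>" and a: "H1_approx \<Omega> \<phi> u"
  shows "(\<lambda>j. face_functional p (\<phi> j) (grad (\<phi> j))) \<longlonglongrightarrow> face_functional p u (weak_grad \<Omega> u)"
proof -
  have \<phi>: "\<And>j. \<phi> j \<in> test_functions \<Omega>" using a by (auto simp: H1_approx_def)
  let ?g = "weak_grad \<Omega> u"
  note Lu = H10_L2[OF u, THEN L2_\<Omega>_T]
  note L\<phi> = test_function_L2[OF \<phi> bounded_T sets_T]
  have sq: "(\<lambda>j. \<integral>x. (norm (\<phi> j x - u x))\<^sup>2 \<partial>lebesgue_on \<Omega>) \<longlonglongrightarrow> 0"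
    "(\<lambda>j. \<integral>x. (norm (grad (\<phi> j) x - ?g x))\<^sup>2 \<partial>lebesgue_on \<Omega>) \<longlonglongrightarrow> 0"
    using a by (auto simp: H1_approx_def L2_norm_tendsto_iff fun_diff_def)
  have sqT: "(\<lambda>j. \<integral>x. (norm (\<phi> j x - u x))\<^sup>2 \<partial>lebesgue_on T) \<longlonglongrightarrow> 0"
    "(\<lambda>j. \<integral>x. (norm (grad (\<phi> j) x - ?g x))\<^sup>2 \<partial>lebesgue_on T) \<longlonglongrightarrow> 0"
  proof -
    show "(\<lambda>j. \<integral>x. (norm (\<phi> j x - u x))\<^sup>2 \<partial>lebesgue_on T) \<longlonglongrightarrow> 0"
    proof (rule Lim_null_comparison[OF always_eventually[OF allI] sq(1)])
      show "norm (\<integral>x. (norm (\<phi> j x - u x))\<^sup>2 \<partial>lebesgue_on T) \<le> (\<integral>x. (norm (\<phi> j x - u x))\<^sup>2 \<partial>lebesgue_on \<Omega>)" for j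
        using integral_T_le_\<Omega>[OF L2_square_integrable[OF L2_diff[OF test_function_L2(1)[OF \<phi> bounded_\<Omega> sets_\<Omega>] H10_L2(1)[OF u]]]]
        by (simp add: integral_nonneg_AE)
    qed
    show "(\<lambda>j. \<integral>x. (norm (grad (\<phi> j) x - ?g x))\<^sup>2 \<partial>lebesgue_on T) \<longlonglongrightarrow> 0"
    proof (rule Lim_null_comparison[OF always_eventually[OF allI] sq(2)])
      show "norm (\<integral>x. (norm (grad (\<phi> j) x - ?g x))\<^sup>2 \<partial>lebesgue_on T) \<le> (\<integral>x. (norm (grad (\<phi> j) x - ?g x))\<^sup>2 \<partial>lebesgue_on \<Omega>)" for j
        using integral_T_le_\<Omega>[OF L2_square_integrable[OF L2_diff[OF test_function_L2(2)[OF \<phi> bounded_\<Omega> sets_\<Omega>] H10_L2(2)[OF u]]]]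
        by (simp add: integral_nonneg_AE)
    qed
  qed
  have one: "(\<lambda>_. 1) \<in> L2_functions T" "(\<lambda>x. x - p) \<in> L2_functions T"
    by (intro L2_continuous continuous_intros bounded_T sets_T)+
  have "(\<lambda>j. \<integral>x. (\<phi> j x - u x) \<bullet> (1::real) \<partial>lebesgue_on T) \<longlonglongrightarrow> 0"
    by (rule L2_inner_tendsto_0[OF L2_diff[OF L\<phi>(1) Lu(1)] one(1) sqT(1)])
  then have 1: "(\<lambda>j. (\<integral>x. \<phi> j x \<partial>lebesgue_on T) - (\<integral>x. u x \<partial>lebesgue_on T)) \<longlonglongrightarrow> 0"
    using L2_integrable[OF lmeasurable_T L\<phi>(1)] L2_integrable[OF lmeasurable_T Lu(1)] by simp
  have "(\<lambda>j. \<integral>x. (grad (\<phi> j) x - ?g x) \<bullet> (x - p) \<partial>lebesgue_on T) \<longlonglongrightarrow> 0"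
    by (rule L2_inner_tendsto_0[OF L2_diff[OF L\<phi>(2) Lu(2)] one(2) sqT(2)])
  then have 2: "(\<lambda>j. (\<integral>x. grad (\<phi> j) x \<bullet> (x - p) \<partial>lebesgue_on T) - (\<integral>x. ?g x \<bullet> (x - p) \<partial>lebesgue_on T)) \<longlonglongrightarrow> 0"
    using L2_inner_integrable[OF L\<phi>(2) one(2)] L2_inner_integrable[OF Lu(2) one(2)]
    by (simp only: inner_diff_left Bochner_Integration.integral_diff)
  show ?thesis
    unfolding face_functional_def using 1 2
    by (intro tendsto_add tendsto_mult tendsto_const) (simp_all add: LIM_zero_cancel)
qed

lemma face_functional_test:
  assumes p: "p \<in> C" and \<phi>: "\<phi> \<in> test_functions U"
  shows "face_functional p \<phi> (grad \<phi>) = (\<integral>x. \<phi> x \<partial>face_measure (face p)) / slope_norm p"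
  unfolding face_functional_def by (rule divergence_theorem[OF dim2 p test_function_C1[OF \<phi>]])

text \<open>The divergence theorem for the constant one.\<close>

lemma measure_face: 
  assumes p: "p \<in> C"
  shows "measure (face_measure (face p)) (face p) = slope_norm p * real DIM('a) * measure lebesgue T"
proof -
  interpret F: finite_measure "face_measure (face p)" by (rule face_measure_finite[OF p])
  have sp: "space (face_measure (face p)) = UNIV" using sets_eq_imp_space_eq[OF sets_face_measure[of "face p"]] by simp
  have "face p \<in> sets (face_measure (face p))" unfolding sets_face_measure using compact_face by (simp add: compact_imp_closed borel_closed)
  moreover have "AE x in face_measure (face p). (x \<in> face p) = (x \<in> UNIV)" using face_measure_AE[OF p] by simp
  ultimately have "measure (face_measure (face p)) (face p) = measure (face_measure (face p)) UNIV"
    using sp by (intro F.finite_measure_eq_AE) (auto simp: sets_face_measure)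
  also have "\<dots> = (\<integral>x. 1 \<partial>face_measure (face p))" using sp by simp
  also have "\<dots> = slope_norm p * (real DIM('a) * measure lebesgue T)"
    using divergence_theorem[OF dim2 p C1_grad_const[of 1]] slope_norm_pos[OF p]
    by (simp add: field_simps)
  finally show ?thesis by simp
qed

text \<open>For test functions this is the divergence theorem divided by the area of the face. On
  one side the volume integrals pass to the limit, on the other the integrals over the face converge
  to that of the trace.\<close>

lemma face_functional_face_mean:
  assumes p: "p \<in> C" and u: "u \<in> H10 \<Omega>"
  shows "face_functional p u (weak_grad \<Omega> u) = real DIM('a) * measure lebesgue T * face_mean \<Omega> (face p) u"
proof -
  interpret F: finite_measure "face_measure (face p)" by (rule face_measure_finite[OF p])
  let ?F = "face_measure (face p)"
  have bm: "borel_measurable ?F = (borel_measurable borel :: ('a \<Rightarrow> real) set)" by (intro measurable_cong_sets sets_face_measure refl)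
  define t where "t = face_trace \<Omega> (face p) u"
  have t: "has_trace \<Omega> (face p) u t"
    unfolding t_def face_trace_def by (rule someI_ex[OF trace_exists[OF p u]])
  obtain \<phi> where a: "H1_approx \<Omega> \<phi> u" using u by (auto simp: H10_def)
  then have \<phi>: "\<And>j. \<phi> j \<in> test_functions \<Omega>" by (auto simp: H1_approx_def)
  have cont: "continuous_on UNIV (\<phi> j)" for j by (rule C1_grad_continuous[OF test_function_C1[OF \<phi>]])
  have tm: "t \<in> borel_measurable ?F" and t2: "integrable ?F (\<lambda>x. (t x)\<^sup>2)"
    and lim: "(\<lambda>j. \<integral>x. (\<phi> j x - t x)\<^sup>2 \<partial>?F) \<longlonglongrightarrow> 0"
    using t a bm by (auto simp: has_trace_def)
  have it: "integrable ?F t"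
  proof (rule Bochner_Integration.integrable_bound)
    show "integrable ?F (\<lambda>x. 1 + (t x)\<^sup>2)" using t2 by simp
    show "AE x in ?F. norm (t x) \<le> norm (1 + (t x)\<^sup>2)"
      using norm_product_le[of "1::real" "t x" for x] by (intro AE_I2) simp
  qed (rule tm)
  have i\<phi>: "integrable ?F (\<phi> j)" for j by (rule continuous_face_integrable[OF p cont])
  have i2: "integrable ?F (\<lambda>x. (\<phi> j x - t x)\<^sup>2)" for j
  proof (rule Bochner_Integration.integrable_bound)
    have "integrable ?F (\<lambda>x. (\<phi> j x)\<^sup>2)" by (intro continuous_face_integrable[OF p] continuous_intros cont)
    then show "integrable ?F (\<lambda>x. 2 * (\<phi> j x)\<^sup>2 + 2 * (t x)\<^sup>2)" using t2 by simp
    show "AE x in ?F. norm ((\<phi> j x - t x)\<^sup>2) \<le> norm (2 * (\<phi> j x)\<^sup>2 + 2 * (t x)\<^sup>2)"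
      using norm_add_square_le[of "\<phi> j x" "- t x" for x] by (intro AE_I2) simp
    show "(\<lambda>x. (\<phi> j x - t x)\<^sup>2) \<in> borel_measurable ?F"
      using i\<phi> tm by (intro borel_measurable_power borel_measurable_diff) auto
  qed
  have "(\<lambda>j. (\<integral>x. \<phi> j x \<partial>?F) - (\<integral>x. t x \<partial>?F)) \<longlonglongrightarrow> 0"
  proof (rule Lim_null_comparison)
    have "(\<lambda>j. sqrt ((\<integral>x. (\<phi> j x - t x)\<^sup>2 \<partial>?F) * measure ?F (space ?F))) \<longlonglongrightarrow> sqrt (0 * measure ?F (space ?F))"
      by (intro tendsto_real_sqrt tendsto_mult tendsto_const lim)
    then show "(\<lambda>j. sqrt ((\<integral>x. (\<phi> j x - t x)\<^sup>2 \<partial>?F) * measure ?F (space ?F))) \<longlonglongrightarrow> 0" by simp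
    show "\<forall>\<^sub>F j in sequentially. norm ((\<integral>x. \<phi> j x \<partial>?F) - (\<integral>x. t x \<partial>?F))
       \<le> sqrt ((\<integral>x. (\<phi> j x - t x)\<^sup>2 \<partial>?F) * measure ?F (space ?F))"
    proof (intro always_eventually allI)
      fix j
      \<comment> \<open>Cauchy-Schwarz against the constant one on the face, whose measure is
        finite.\<close>
      have "((\<integral>x. \<phi> j x \<partial>?F) - (\<integral>x. t x \<partial>?F))\<^sup>2 \<le> (\<integral>x. (\<phi> j x - t x)\<^sup>2 \<partial>?F) * measure ?F (space ?F)"
      proof (rule discriminant_nonneg)
        fix s :: real
        have "0 \<le> (\<integral>x. (s * (\<phi> j x - t x) + 1)\<^sup>2 \<partial>?F)" by (intro integral_nonneg_AE AE_I2) simp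
        also have "\<dots> = (\<integral>x. s\<^sup>2 * (\<phi> j x - t x)\<^sup>2 + 2 * s * (\<phi> j x - t x) + 1 \<partial>?F)"
          by (intro Bochner_Integration.integral_cong refl) (simp add: power2_sum power_mult_distrib)
        also have "\<dots> = s\<^sup>2 * (\<integral>x. (\<phi> j x - t x)\<^sup>2 \<partial>?F) + 2 * s * ((\<integral>x. \<phi> j x \<partial>?F) - (\<integral>x. t x \<partial>?F)) + measure ?F (space ?F)"
          using i2[of j] i\<phi>[of j] it by simp
        finally show "0 \<le> (\<integral>x. (\<phi> j x - t x)\<^sup>2 \<partial>?F) * s\<^sup>2 + 2 * ((\<integral>x. \<phi> j x \<partial>?F) - (\<integral>x. t x \<partial>?F)) * s + measure ?F (space ?F)"
          by (simp add: mult_ac)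
      qed (intro integral_nonneg_AE AE_I2, simp)
      then show "norm ((\<integral>x. \<phi> j x \<partial>?F) - (\<integral>x. t x \<partial>?F)) \<le> sqrt ((\<integral>x. (\<phi> j x - t x)\<^sup>2 \<partial>?F) * measure ?F (space ?F))"
        using real_le_rsqrt real_sqrt_le_iff by (metis real_norm_def real_sqrt_abs)
    qed
  qed
  then have "(\<lambda>j. (\<integral>x. \<phi> j x \<partial>?F) / slope_norm p) \<longlonglongrightarrow> (\<integral>x. t x \<partial>?F) / slope_norm p"
    using slope_nonzero[OF p] by (intro tendsto_divide tendsto_const) (simp_all add: LIM_zero_cancel)
  moreover have "(\<lambda>j. (\<integral>x. \<phi> j x \<partial>?F) / slope_norm p) \<longlonglongrightarrow> face_functional p u (weak_grad \<Omega> u)"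
    using face_functional_tendsto[OF u a, of p] unfolding face_functional_test[OF p \<phi>] .
  ultimately have "face_functional p u (weak_grad \<Omega> u) = (\<integral>x. t x \<partial>?F) / slope_norm p" by (rule LIMSEQ_unique[rotated])
  then show ?thesis
    unfolding face_mean_def t_def[symmetric] measure_face[OF p] using slope_nonzero[OF p] measure_T_pos by simp
qed

text \<open>The support of a test function misses the frontier, so every approximant has zero
  integral over the face.\<close>

lemma face_functional_boundary:
  assumes p: "p \<in> C" and u: "u \<in> H10 \<Omega>" and F: "face p \<subseteq> frontier \<Omega>"
  shows "face_functional p u (weak_grad \<Omega> u) = 0"
proof -
  obtain \<phi> where a: "H1_approx \<Omega> \<phi> u" using u by (auto simp: H10_def)
  then have \<phi>: "\<And>j. \<phi> j \<in> test_functions \<Omega>" by (auto simp: H1_approx_def)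
  have "(\<integral>x. \<phi> j x \<partial>face_measure (face p)) = 0" for j
  proof (rule integral_eq_zero_AE)
    obtain K where K: "K \<subseteq> \<Omega>" "\<And>x. x \<notin> K \<Longrightarrow> \<phi> j x = 0"
      by (rule test_function_support[OF \<phi>[of j]]) (rule that)
    have "face p \<inter> \<Omega> = {}" using F open_\<Omega> by (auto simp: frontier_def interior_open)
    with K have z: "\<phi> j x = 0" if "x \<in> face p" for x using that by blast
    show "AE x in face_measure (face p). \<phi> j x = 0"
      using face_measure_AE[OF p] by eventually_elim (rule z)
  qed
  then have "(\<lambda>j::nat. 0) \<longlonglongrightarrow> face_functional p u (weak_grad \<Omega> u)"
    using face_functional_tendsto[OF u a, of p] unfolding face_functional_test[OF p \<phi>] by simp
  then show ?thesis by (simp add: LIMSEQ_const_iff)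
qed

end

section \<open>Geometry of the triangulation\<close>

text \<open>Excludes slits: a boundary point has points strictly below the graph arbitrarily near,
  and these have a neighbourhood disjoint from the domain. It follows that interiors of simplices
  lie in the domain and that a face between two simplices is not on the boundary.\<close>

lemma lipschitz_domain_interior_closure:
  fixes \<Omega> :: "'a::euclidean_space set"
  assumes "lipschitz_domain \<Omega>"
  shows "interior (closure \<Omega>) = \<Omega>"
proof
  have op: "open \<Omega>" using assms by (simp add: lipschitz_domain_def)
  show "\<Omega> \<subseteq> interior (closure \<Omega>)" using op closure_subset by (rule interior_maximal[rotated])
  show "interior (closure \<Omega>) \<subseteq> \<Omega>"
  proof
    fix x assume x: "x \<in> interior (closure \<Omega>)"
    show "x \<in> \<Omega>"
    proof (rule ccontr)
      assume nx: "x \<notin> \<Omega>"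
      then have "x \<in> frontier \<Omega>" using x interior_subset op by (auto simp: frontier_def interior_open)
      then have "\<exists>U e \<phi> L. open U \<and> x \<in> U \<and> norm e = 1 \<and> L-lipschitz_on {z. z \<bullet> e = 0} \<phi> \<and>
          \<Omega> \<inter> U = {y\<in>U. \<phi> (y - (y \<bullet> e) *\<^sub>R e) < y \<bullet> e}"
        using assms unfolding lipschitz_domain_def by (elim conjE) (erule bspec)
      then obtain U e \<phi> L where U: "open U" "x \<in> U" and e: "norm e = 1"
        and \<phi>: "L-lipschitz_on {z. z \<bullet> e = 0} \<phi>" and graph: "\<Omega> \<inter> U = {y\<in>U. \<phi> (y - (y \<bullet> e) *\<^sub>R e) < y \<bullet> e}"
        by (elim exE conjE) (rule that)
      have ee: "e \<bullet> e = 1" using e by (simp add: dot_square_norm)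
      define r where "r z = z - (z \<bullet> e) *\<^sub>R e" for z
      have mem: "z \<in> \<Omega> \<longleftrightarrow> \<phi> (r z) < z \<bullet> e" if "z \<in> U" for z
        using that graph unfolding r_def by blast
      have cr: "continuous_on UNIV (\<lambda>z. \<phi> (r z))"
      proof (rule continuous_on_compose2[OF lipschitz_on_continuous_on[OF \<phi>]])
        show "continuous_on UNIV r" unfolding r_def by (intro continuous_intros)
        show "range r \<subseteq> {z. z \<bullet> e = 0}" by (auto simp: r_def inner_diff_left ee)
      qed
      have "open (U \<inter> interior (closure \<Omega>))" using U by auto
      then obtain d where d: "d > 0" "ball x d \<subseteq> U \<inter> interior (closure \<Omega>)"
        using U(2) x unfolding open_contains_ball by blast
      \<comment> \<open>Moving down along \<open>e\<close> keeps the component orthogonal to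
        \<open>e\<close>, so \<open>y\<close> lies strictly below the graph, but it stays in the
        ball contained in the closure of the domain.\<close>
      define y where "y = x - (d / 2) *\<^sub>R e"
      have y: "y \<in> ball x d" using d e by (simp add: y_def dist_norm)
      have "r y = r x" by (simp add: r_def y_def inner_diff_left ee scaleR_diff_left)
      moreover have "x \<bullet> e \<le> \<phi> (r x)" using mem[OF U(2)] nx by simp
      moreover have "y \<bullet> e < x \<bullet> e" using d by (simp add: y_def inner_diff_left ee)
      ultimately have "y \<bullet> e < \<phi> (r y)" by simp
      moreover have "open {z. z \<bullet> e < \<phi> (r z)}" by (intro open_Collect_less continuous_intros cr)
      ultimately have O: "open ({z. z \<bullet> e < \<phi> (r z)} \<inter> U)" "y \<in> {z. z \<bullet> e < \<phi> (r z)} \<inter> U"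
        using U y d by auto
      have "y \<in> closure \<Omega>" using y d interior_subset by blast
      then obtain z where "z \<in> \<Omega>" "z \<in> {z. z \<bullet> e < \<phi> (r z)} \<inter> U"
        using open_Int_closure_eq_empty[OF O(1), of \<Omega>] O(2) by blast
      then show False using mem[of z] by simp
    qed
  qed
qed

locale mesh =
  fixes \<Omega> :: "'a::euclidean_space set" and \<T> :: "'a set set"
  assumes dim2: "DIM('a) \<ge> 2" and bounded: "bounded \<Omega>" and lipschitz: "lipschitz_domain \<Omega>"
    and triangulation: "regular_triangulation \<T> \<Omega>"
begin

lemma open_domain: "open \<Omega>" using lipschitz by (simp add: lipschitz_domain_def)

sublocale bounded_open \<Omega> by unfold_locales (rule open_domain, rule bounded)

lemma finite_\<T>: "finite \<T>"
  and simplex_\<T>: "T \<in> \<T> \<Longrightarrow> int DIM('a) simplex T"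
  and Union_\<T>: "\<Union>\<T> = closure \<Omega>"
  and Int_face: "T \<in> \<T> \<Longrightarrow> T' \<in> \<T> \<Longrightarrow> (T \<inter> T') face_of T"
  using triangulation by (auto simp: regular_triangulation_def triangulation_def)

lemma vertices_simplex:
  assumes "T \<in> \<T>"
  shows "full_simplex (vertices T)" "full_simplex.T (vertices T) = T"
proof -
  obtain C where C: "full_simplex C" "full_simplex.T C = T"
    by (rule simplex_full_simplex[OF simplex_\<T>[OF assms]]) (rule that)
  have "vertices T = C" using full_simplex.vertices_T[OF C(1)] C(2) by simp
  then show "full_simplex (vertices T)" "full_simplex.T (vertices T) = T" using C by auto
qed

lemma interior_T_subset: "T \<in> \<T> \<Longrightarrow> interior T \<subseteq> \<Omega>"
  using Union_\<T> interior_mono[of T "closure \<Omega>"] lipschitz_domain_interior_closure[OF lipschitz] by auto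

lemma simplex_in_domain: "T \<in> \<T> \<Longrightarrow> simplex_in_domain (vertices T) \<Omega>"
  using vertices_simplex[of T] interior_T_subset[of T] dim2 open_domain bounded
  by (intro simplex_in_domain.intro bounded_open.intro simplex_in_domain_axioms.intro) auto

lemma T_props:
  assumes T: "T \<in> \<T>"
  shows "compact T" "convex T" "closed T" "T \<in> sets lebesgue" "T \<in> lmeasurable" "bounded T" "interior T \<noteq> {}"
    "aff_dim T = int DIM('a)" "closure (interior T) = T" "negligible (T - interior T)"
    "0 < measure lebesgue T" "0 < diameter T"
proof -
  interpret S: simplex_in_domain "vertices T" \<Omega> by (rule simplex_in_domain[OF T])
  note eq = vertices_simplex(2)[OF T]
  show "compact T" "convex T" "T \<in> sets lebesgue" "T \<in> lmeasurable" "bounded T" "interior T \<noteq> {}"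
    "closure (interior T) = T" "negligible (T - interior T)" "0 < measure lebesgue T" "0 < diameter T"
    using S.compact_T S.convex_T S.sets_T S.lmeasurable_T S.bounded_T S.mid_T_interior S.closure_interior_T
      S.negligible_boundary S.measure_T_pos S.diameter_T_pos unfolding eq by auto
  then show "closed T" by (simp add: compact_imp_closed)
  show "aff_dim T = int DIM('a)" using \<open>interior T \<noteq> {}\<close> by (rule aff_dim_nonempty_interior)
qed

lemma Int_dim:
  assumes T: "T \<in> \<T>" "T' \<in> \<T>" "T \<noteq> T'"
  shows "aff_dim (T \<inter> T') < int DIM('a)"
proof -
  have "T \<inter> T' \<noteq> T"
  proof
    assume eq: "T \<inter> T' = T"
    then have f: "T face_of T'" using Int_face[OF T(2,1)] by (simp add: Int_commute)
    then show False using face_of_aff_dim_lt[OF T_props(2)[OF T(2)] f T(3)] T_props(8) T by simp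
  qed
  then show ?thesis using face_of_aff_dim_lt[OF T_props(2)[OF T(1)] Int_face[OF T(1,2)]] T_props(8)[OF T(1)] by simp
qed

text \<open>A face that contains a relative interior point of a convex set is the whole set, which
  the dimension of the intersection forbids.\<close>

lemma interior_disjoint:
  assumes T: "T \<in> \<T>" "T' \<in> \<T>" "T \<noteq> T'"
  shows "interior T \<inter> T' = {}"
proof (rule ccontr)
  assume "interior T \<inter> T' \<noteq> {}"
  moreover have "rel_interior T = interior T"
    using T_props(7)[OF T(1)] by (simp add: rel_interior_nonempty_interior)
  ultimately have "(T \<inter> T') \<inter> rel_interior T \<noteq> {}"
    using interior_subset[of T] by auto
  then have "T \<subseteq> T \<inter> T'" by (rule subset_of_face_of[OF Int_face[OF T(1,2)] order_refl])
  then have "T \<inter> T' = T" by auto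
  then show False using Int_dim[OF T] T_props(8)[OF T(1)] by simp
qed

definition mesh_interior :: "'a set" where "mesh_interior = (\<Union>T\<in>\<T>. interior T)"

lemma mesh_interior_props:
  "mesh_interior \<subseteq> \<Omega>" "mesh_interior \<in> sets lebesgue" "negligible (\<Omega> - mesh_interior)"
proof -
  show "mesh_interior \<subseteq> \<Omega>" unfolding mesh_interior_def using interior_T_subset by auto
  have "open mesh_interior" unfolding mesh_interior_def by auto
  then show "mesh_interior \<in> sets lebesgue" by simp
  have "\<Omega> - mesh_interior \<subseteq> (\<Union>T\<in>\<T>. T - interior T)"
    using closure_subset[of \<Omega>] unfolding Union_\<T>[symmetric] mesh_interior_def by blast
  moreover have "negligible (\<Union>T\<in>\<T>. T - interior T)"
    using finite_\<T> T_props(10) by (intro negligible_Union) auto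
  ultimately show "negligible (\<Omega> - mesh_interior)" using negligible_subset by blast
qed

lemma indicator_mesh_interior: "(indicator mesh_interior x :: real) = (\<Sum>T\<in>\<T>. indicator (interior T) x)"
  unfolding mesh_interior_def
proof (rule indicator_UN_disjoint[OF finite_\<T>])
  show "disjoint_family_on interior \<T>"
    unfolding disjoint_family_on_def
  proof (intro ballI impI)
    fix T T' assume "T \<in> \<T>" "T' \<in> \<T>" "T \<noteq> T'"
    then show "interior T \<inter> interior T' = {}" using interior_disjoint[of T T'] interior_subset[of T'] by blast
  qed
qed

lemma null_diff_T: "T \<in> \<T> \<Longrightarrow> integral\<^sup>L (lebesgue_on T) f = integral\<^sup>L (lebesgue_on (interior T)) (f :: 'a \<Rightarrow> 'b::euclidean_space)"
  using T_props by (intro integral_null_diff interior_subset) auto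

lemma L2_T:
  assumes T: "T \<in> \<T>" and f: "f \<in> L2_functions \<Omega>"
  shows "f \<in> L2_functions T"
  using simplex_in_domain.L2_\<Omega>_T[OF simplex_in_domain[OF T] f] vertices_simplex(2)[OF T] by simp

lemma integral_split:
  fixes f :: "'a \<Rightarrow> 'b::euclidean_space"
  assumes f: "integrable (lebesgue_on \<Omega>) f"
  shows "(\<integral>x. f x \<partial>lebesgue_on \<Omega>) = (\<Sum>T\<in>\<T>. \<integral>x. f x \<partial>lebesgue_on T)"
proof -
  note n = mesh_interior_props(1,2) sets_\<Omega> mesh_interior_props(3)
  have i: "integrable lebesgue (\<lambda>x. indicator \<Omega> x *\<^sub>R f x)" using f sets_\<Omega> by (simp add: integrable_restrict_space)
  have iT: "integrable lebesgue (\<lambda>x. indicator (interior T) x *\<^sub>R f x)" if "T \<in> \<T>" for T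
  proof -
    have eq: "(\<lambda>x. indicator (interior T) x *\<^sub>R f x) = (\<lambda>x. indicator (interior T) x *\<^sub>R (indicator \<Omega> x *\<^sub>R f x))"
      using interior_T_subset[OF that] by (auto simp: indicator_def fun_eq_iff)
    show ?thesis by (subst eq) (rule integrable_mult_indicator[OF _ i], simp)
  qed
  have "(\<integral>x. f x \<partial>lebesgue_on \<Omega>) = (\<integral>x. f x \<partial>lebesgue_on mesh_interior)" by (rule integral_null_diff[OF n])
  also have "\<dots> = (\<integral>x. (\<Sum>T\<in>\<T>. indicator (interior T) x *\<^sub>R f x) \<partial>lebesgue)"
    using n(2) by (simp add: integral_restrict_space indicator_mesh_interior scaleR_sum_left)
  also have "\<dots> = (\<Sum>T\<in>\<T>. \<integral>x. indicator (interior T) x *\<^sub>R f x \<partial>lebesgue)"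
    using iT by (rule Bochner_Integration.integral_sum)
  also have "\<dots> = (\<Sum>T\<in>\<T>. \<integral>x. f x \<partial>lebesgue_on T)"
    by (intro sum.cong refl) (simp add: null_diff_T integral_restrict_space)
  finally show ?thesis .
qed

lemma AE_mesh:
  assumes "\<And>T. T \<in> \<T> \<Longrightarrow> AE x in lebesgue_on (interior T). P x"
  shows "AE x in lebesgue_on \<Omega>. P x"
proof (rule AE_lebesgue_on_null_diff[OF mesh_interior_props(2) sets_\<Omega> mesh_interior_props(3)])
  have "AE x in lebesgue. \<forall>T\<in>\<T>. x \<in> interior T \<longrightarrow> P x"
    using assms finite_\<T> by (intro AE_finite_allI) (simp_all add: AE_restrict_space_iff)
  then have "AE x in lebesgue. x \<in> mesh_interior \<longrightarrow> P x"
    by eventually_elim (auto simp: mesh_interior_def)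
  then show "AE x in lebesgue_on mesh_interior. P x"
    using mesh_interior_props(2) by (simp add: AE_restrict_space_iff)
qed

lemma AE_interior_T:
  assumes T: "T \<in> \<T>" and ae: "AE x in lebesgue_on \<Omega>. P x"
  shows "AE x in lebesgue_on (interior T). P x" "AE x in lebesgue_on T. P x"
proof -
  show 1: "AE x in lebesgue_on (interior T). P x"
    by (rule AE_lebesgue_on_subset[OF interior_T_subset[OF T] _ sets_\<Omega> ae]) simp
  show "AE x in lebesgue_on T. P x"
    by (rule AE_lebesgue_on_null_diff[OF _ T_props(4)[OF T] T_props(10)[OF T] 1]) simp
qed

lemma mesh_size_interior:
  assumes T: "T \<in> \<T>" "x \<in> interior T"
  shows "mesh_size \<T> x = diameter T"
proof -
  have "(THE T. T \<in> \<T> \<and> x \<in> interior T) = T"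
  proof (rule the_equality)
    fix T' assume "T' \<in> \<T> \<and> x \<in> interior T'"
    then show "T' = T" using interior_disjoint[of T T'] interior_subset[of T'] T by blast
  qed (use T in simp)
  then show ?thesis by (simp add: mesh_size_def)
qed

section \<open>Simplices that share a face\<close>

text \<open>The coordinate of the second simplex is affine and vanishes on the common face, so it is
  a multiple of the first. A positive factor would put both simplices on the same side of the face,
  and they would overlap near its midpoint.\<close>

lemma opposite_sides:
  assumes T: "T1 \<in> \<T>" "T2 \<in> \<T>" "T1 \<noteq> T2" and p: "p1 \<in> vertices T1" "p2 \<in> vertices T2"
    and eq: "full_simplex.face (vertices T1) p1 = full_simplex.face (vertices T2) p2"
  obtains s where "s < 0" "\<And>y. full_simplex.bary (vertices T2) p2 y = s * full_simplex.bary (vertices T1) p1 y"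
proof -
  interpret S1: full_simplex "vertices T1" by (rule vertices_simplex(1)[OF T(1)])
  interpret S2: full_simplex "vertices T2" by (rule vertices_simplex(1)[OF T(2)])
  note e1 = vertices_simplex(2)[OF T(1)] and e2 = vertices_simplex(2)[OF T(2)]
  define s where "s = S2.bary p2 p1"
  have z: "S2.bary p2 q = 0" if "q \<in> vertices T1 - {p1}" for q
  proof -
    have "q \<in> S1.face p1" unfolding S1.face_def using that by (rule hull_inc)
    then show ?thesis unfolding eq using p by (simp add: S2.face_eq)
  qed
  have prp: "S2.bary p2 y = s * S1.bary p1 y" for y
  proof -
    have a: "S2.bary p2 y = S2.bary p2 0 + S2.slope p2 \<bullet> y" for y by (rule S2.bary_affine[OF p(2)])
    have "S2.bary p2 y = S2.bary p2 0 + S2.slope p2 \<bullet> y" by (rule a)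
    also have "\<dots> = (\<Sum>q\<in>vertices T1. S1.bary q y * (S2.bary p2 0 + S2.slope p2 \<bullet> q))"
      by (rule S1.affine_function_bary)
    also have "\<dots> = (\<Sum>q\<in>vertices T1. S1.bary q y * S2.bary p2 q)" by (simp only: a[symmetric])
    also have "\<dots> = S1.bary p1 y * S2.bary p2 p1"
      using z by (simp add: S1.sum_C_minus[OF p(1)])
    finally show ?thesis by (simp add: s_def)
  qed
  have s0: "s \<noteq> 0" using prp[of p2] S2.bary_vertex[OF p(2) p(2)] by auto
  have "\<not> s > 0"
  proof
    assume s: "s > 0"
    define x where "x = mid (S1.face p1)"
    have x1: "x \<in> rel_interior (S1.face p1)"
      using S1.bary_mid_face[OF p(1)] p(1) by (auto simp: S1.rel_interior_face_eq x_def)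
    obtain d1 where d1: "d1 > 0" "\<And>y. y \<in> ball x d1 \<Longrightarrow> 0 < S1.bary p1 y \<Longrightarrow> y \<in> interior S1.T"
      by (rule S1.local_halfspace[OF p(1) x1]) (rule that)
    obtain d2 where d2: "d2 > 0" "\<And>y. y \<in> ball x d2 \<Longrightarrow> 0 < S2.bary p2 y \<Longrightarrow> y \<in> interior S2.T"
      by (rule S2.local_halfspace[OF p(2) x1[unfolded eq]]) (rule that)
    \<comment> \<open>A point pushed from the face midpoint into the first simplex, by half the
      smaller radius of the two local half-balls.\<close>
    define y where "y = x + (min d1 d2 / 2 / norm (S1.slope p1)) *\<^sub>R S1.slope p1"
    have sl: "norm (S1.slope p1) > 0" using S1.slope_nonzero[OF p(1)] by simp
    have "y \<in> ball x d1" "y \<in> ball x d2" using d1 d2 sl by (auto simp: y_def dist_norm)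
    moreover have "S1.bary p1 y > 0"
    proof -
      have "S1.bary p1 x = 0" using S1.bary_mid_face[OF p(1) p(1)] by (simp add: x_def)
      then have "S1.bary p1 y = (min d1 d2 / 2 / norm (S1.slope p1)) * (S1.slope p1 \<bullet> S1.slope p1)"
        unfolding y_def S1.bary_shift[OF p(1)] by simp
      then show ?thesis using d1 d2 S1.slope_nonzero[OF p(1)] by simp
    qed
    ultimately have "y \<in> interior T1" "y \<in> interior T2"
      using d1(2)[of y] d2(2)[of y] prp[of y] s unfolding e1 e2 by auto
    then show False using interior_disjoint[OF T] interior_subset[of T2] by auto
  qed
  then show thesis using that[of s] s0 prp by auto
qed

lemma facet_face:
  assumes "T \<in> \<T>" "F facet_of T"
  obtains p where "p \<in> vertices T" "F = full_simplex.face (vertices T) p"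
  using full_simplex.facet_imp_face[OF vertices_simplex(1)[OF assms(1)]] assms(2) that
  unfolding vertices_simplex(2)[OF assms(1)] by blast

text \<open>Near the point each simplex fills one of the two half-balls cut off by the hyperplane of
  the face.\<close>

lemma rel_interior_shared_facet:
  assumes T: "T1 \<in> \<T>" "T2 \<in> \<T>" "T1 \<noteq> T2" and F: "F facet_of T1" "F facet_of T2"
    and x: "x \<in> rel_interior F"
  shows "x \<in> interior (T1 \<union> T2)"
proof -
  obtain p1 where p1: "p1 \<in> vertices T1" "F = full_simplex.face (vertices T1) p1" by (rule facet_face[OF T(1) F(1)])
  obtain p2 where p2: "p2 \<in> vertices T2" "F = full_simplex.face (vertices T2) p2" by (rule facet_face[OF T(2) F(2)])
  interpret S1: full_simplex "vertices T1" by (rule vertices_simplex(1)[OF T(1)])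
  interpret S2: full_simplex "vertices T2" by (rule vertices_simplex(1)[OF T(2)])
  note e1 = vertices_simplex(2)[OF T(1)] and e2 = vertices_simplex(2)[OF T(2)]
  obtain s where s: "s < 0" "\<And>y. S2.bary p2 y = s * S1.bary p1 y"
    by (rule opposite_sides[OF T p1(1) p2(1)]) (use p1 p2 in auto)
  obtain d1 where d1: "d1 > 0" "\<And>y. y \<in> ball x d1 \<Longrightarrow> 0 \<le> S1.bary p1 y \<Longrightarrow> y \<in> S1.T"
    by (rule S1.local_halfspace[OF p1(1) x[unfolded p1(2)]]) (rule that)
  obtain d2 where d2: "d2 > 0" "\<And>y. y \<in> ball x d2 \<Longrightarrow> 0 \<le> S2.bary p2 y \<Longrightarrow> y \<in> S2.T"
    by (rule S2.local_halfspace[OF p2(1) x[unfolded p2(2)]]) (rule that)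
  have "y \<in> T1 \<union> T2" if y: "y \<in> ball x (min d1 d2)" for y
  proof (cases "0 \<le> S1.bary p1 y")
    case True
    then show ?thesis using d1(2)[of y] y unfolding e1 by auto
  next
    case False
    then have "0 \<le> S2.bary p2 y" using s by (simp add: mult_nonpos_nonpos)
    then show ?thesis using d2(2)[of y] y unfolding e2 by auto
  qed
  then have "ball x (min d1 d2) \<subseteq> interior (T1 \<union> T2)" by (intro interior_maximal open_ball) blast
  moreover have "x \<in> ball x (min d1 d2)" using d1(1) d2(1) by simp
  ultimately show ?thesis by blast
qed

lemma facet_props:
  assumes "T \<in> \<T>" "F facet_of T"
  shows "convex F" "compact F" "F \<noteq> {}" "F \<subseteq> T" "mid F \<in> rel_interior F" "mid F \<in> F"
proof -
  obtain p where p: "p \<in> vertices T" "F = full_simplex.face (vertices T) p" by (rule facet_face[OF assms])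
  interpret S: full_simplex "vertices T" by (rule vertices_simplex(1)[OF assms(1)])
  show "mid F \<in> rel_interior F"
    using S.bary_mid_face[OF p(1)] p(1) by (auto simp: S.rel_interior_face_eq p(2))
  then show "mid F \<in> F" using rel_interior_subset by auto
  then show "F \<noteq> {}" by auto
  show "compact F" unfolding p(2) by (rule S.compact_face)
  show "convex F" unfolding p(2) S.face_def by simp
  show "F \<subseteq> T" using assms(2) by (rule facet_of_imp_subset)
qed

text \<open>Otherwise the face midpoint would be interior to the closure of the domain, hence in the
  domain itself.\<close>

lemma boundary_facet_unique:
  assumes T: "T1 \<in> \<T>" "T2 \<in> \<T>" and F: "F facet_of T1" "F facet_of T2" "F \<subseteq> frontier \<Omega>"
  shows "T1 = T2"
proof (rule ccontr)
  assume neq: "T1 \<noteq> T2"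
  have "mid F \<in> interior (T1 \<union> T2)"
    by (rule rel_interior_shared_facet[OF T neq F(1,2) facet_props(5)[OF T(1) F(1)]])
  also have "\<dots> \<subseteq> interior (closure \<Omega>)" using T Union_\<T> by (intro interior_mono) auto
  also have "\<dots> = \<Omega>" by (rule lipschitz_domain_interior_closure[OF lipschitz])
  finally have "mid F \<in> \<Omega>" .
  then show False using F(3) facet_props(6)[OF T(1) F(1)] open_domain by (auto simp: frontier_def interior_open)
qed

text \<open>The other simplices form a closed set. If it missed a point of the face inside the
  domain, points just beyond the face would be covered by no simplex. The face-to-face condition
  then identifies the face with the whole intersection.\<close>

lemma interior_facet_neighbour:
  assumes T: "T1 \<in> \<T>" and F: "F facet_of T1" "\<not> F \<subseteq> frontier \<Omega>"
  obtains T2 where "T2 \<in> \<T>" "T2 \<noteq> T1" "F facet_of T2"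
proof -
  obtain p where p: "p \<in> vertices T1" "F = full_simplex.face (vertices T1) p" by (rule facet_face[OF T F(1)])
  interpret S: full_simplex "vertices T1" by (rule vertices_simplex(1)[OF T])
  note e = vertices_simplex(2)[OF T]
  note FP = facet_props[OF T F(1)]
  have "F \<subseteq> closure \<Omega>" using FP(4) T Union_\<T> by auto
  then obtain z where z: "z \<in> F" "z \<in> \<Omega>" using F(2) open_domain by (auto simp: frontier_def interior_open)
  \<comment> \<open>The point of the face found in the domain may lie on the relative boundary of
    the face; openness of the domain moves it into the relative interior.\<close>
  have "z \<in> closure (rel_interior F)"
    using z(1) convex_closure_rel_interior[OF FP(1)] closure_subset by auto
  then have "\<Omega> \<inter> rel_interior F \<noteq> {}" using z(2) open_domain by (auto simp: closure_iff_nhds_not_empty)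
  then obtain x where x: "x \<in> \<Omega>" "x \<in> rel_interior F" by auto
  have bx: "S.bary p x = 0" using x(2) p by (simp add: S.rel_interior_face_eq)
  have "\<exists>T2\<in>\<T> - {T1}. x \<in> T2"
  proof (rule ccontr)
    assume no: "\<not> ?thesis"
    have "closed (\<Union>(\<T> - {T1}))" using finite_\<T> T_props(3) by (intro closed_Union) auto
    then have "open (\<Omega> - \<Union>(\<T> - {T1}))" using open_domain by auto
    moreover have "x \<in> \<Omega> - \<Union>(\<T> - {T1})" using x no by auto
    ultimately obtain d where d: "d > 0" "ball x d \<subseteq> \<Omega> - \<Union>(\<T> - {T1})"
      unfolding open_contains_ball by blast
    \<comment> \<open>A point just across the face, where the coordinate \<open>S.bary p\<close> is
      negative.\<close>
    define y where "y = x + (- (d / 2 / norm (S.slope p))) *\<^sub>R S.slope p"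
    have sl: "norm (S.slope p) > 0" using S.slope_nonzero[OF p(1)] by simp
    have "y \<in> ball x d" using d sl by (simp add: y_def dist_norm)
    then have y: "y \<in> \<Omega>" "y \<notin> \<Union>(\<T> - {T1})" using d by auto
    then have "y \<in> T1" using closure_subset[of \<Omega>] unfolding Union_\<T>[symmetric] by blast
    then have "y \<in> S.T" unfolding e .
    then have "0 \<le> S.bary p y" using p(1) unfolding S.T_eq by blast
    moreover have "S.bary p y < 0"
    proof -
      have "S.bary p y = - (d / 2 / norm (S.slope p)) * (S.slope p \<bullet> S.slope p)"
        unfolding y_def S.bary_shift[OF p(1)] using bx by simp
      then show ?thesis using d S.slope_nonzero[OF p(1)] by simp
    qed
    ultimately show False by simp
  qed
  then obtain T2 where T2: "T2 \<in> \<T>" "T2 \<noteq> T1" "x \<in> T2" by auto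
  \<comment> \<open>The intersection is a face of \<open>T1\<close>, and a face that meets the
    relative interior of \<open>F\<close> contains \<open>F\<close>. Equality then follows by
    comparing dimensions.\<close>
  have "(T1 \<inter> T2) \<inter> rel_interior F \<noteq> {}"
    using x(2) T2(3) FP(4) rel_interior_subset[of F] by auto
  then have sub: "F \<subseteq> T1 \<inter> T2" by (rule subset_of_face_of[OF Int_face[OF T T2(1)] FP(4)])
  have Ff: "F face_of T1" and Fd: "aff_dim F = int DIM('a) - 1"
    using F(1) T_props(8)[OF T] by (auto simp: facet_of_def)
  have "F face_of (T1 \<inter> T2)" using face_of_subset[OF Ff sub] by auto
  moreover have "convex (T1 \<inter> T2)" using T_props(2) T T2(1) by (simp add: convex_Int)
  ultimately have "F = T1 \<inter> T2"
    using face_of_aff_dim_lt[of "T1 \<inter> T2" F] Int_dim[OF T T2(1)] T2(2) Fd by force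
  then have "F face_of T2" using Int_face[OF T2(1) T] by (simp add: Int_commute)
  then have "F facet_of T2" using FP(3) Fd T_props(8)[OF T2(1)] by (simp add: facet_of_def)
  then show thesis using that T2 by blast
qed

text \<open>Three simplices at one face would give three pairwise negative proportionality factors,
  one of which is the product of the other two.\<close>

lemma facet_at_most_two:
  assumes T: "T1 \<in> \<T>" "T2 \<in> \<T>" "T3 \<in> \<T>" and F: "F facet_of T1" "F facet_of T2" "F facet_of T3"
    and neq: "T1 \<noteq> T2" "T1 \<noteq> T3"
  shows "T2 = T3"
proof (rule ccontr)
  assume neq3: "T2 \<noteq> T3"
  obtain p1 where p1: "p1 \<in> vertices T1" "F = full_simplex.face (vertices T1) p1" by (rule facet_face[OF T(1) F(1)])
  obtain p2 where p2: "p2 \<in> vertices T2" "F = full_simplex.face (vertices T2) p2" by (rule facet_face[OF T(2) F(2)])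
  obtain p3 where p3: "p3 \<in> vertices T3" "F = full_simplex.face (vertices T3) p3" by (rule facet_face[OF T(3) F(3)])
  obtain s where s: "s < 0" "\<And>y. full_simplex.bary (vertices T2) p2 y = s * full_simplex.bary (vertices T1) p1 y"
    by (rule opposite_sides[OF T(1,2) neq(1) p1(1) p2(1)]) (use p1 p2 in auto)
  obtain t where t: "t < 0" "\<And>y. full_simplex.bary (vertices T3) p3 y = t * full_simplex.bary (vertices T1) p1 y"
    by (rule opposite_sides[OF T(1,3) neq(2) p1(1) p3(1)]) (use p1 p3 in auto)
  obtain r where r: "r < 0" "\<And>y. full_simplex.bary (vertices T3) p3 y = r * full_simplex.bary (vertices T2) p2 y"
    by (rule opposite_sides[OF T(2,3) neq3 p2(1) p3(1)]) (use p2 p3 in auto)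
  have "full_simplex.bary (vertices T1) p1 p1 = 1"
    using full_simplex.bary_vertex[OF vertices_simplex(1)[OF T(1)] p1(1) p1(1)] by simp
  then have "t = r * s" using s(2)[of p1] t(2)[of p1] r(2)[of p1] by simp
  then show False using s(1) t(1) r(1) mult_neg_neg[of r s] by simp
qed

text \<open>A segment in general position joins a simplex to the outside of the domain without meeting
  the skeleton of codimension two, so the value is transported across faces to the boundary.\<close>

lemma facewise_constant_eq_0:
  fixes c :: "'a set \<Rightarrow> real"
  assumes bd: "\<And>T F. \<lbrakk>T \<in> \<T>; F facet_of T; F \<subseteq> frontier \<Omega>\<rbrakk> \<Longrightarrow> c T = 0"
    and nb: "\<And>T T' F. \<lbrakk>T \<in> \<T>; T' \<in> \<T>; T \<noteq> T'; F facet_of T; F facet_of T'\<rbrakk> \<Longrightarrow> c T = c T'"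
    and T0: "T0 \<in> \<T>"
  shows "c T0 = 0"
proof (rule ccontr)
  assume ne: "c T0 \<noteq> 0"
  \<comment> \<open>The union of the simplices that carry the same value as \<open>T0\<close>. A
    face at which the segment leaves \<open>S\<close> leads to a contradiction, both on the boundary
    and inside the domain.\<close>
  define S where "S = \<Union>{T\<in>\<T>. c T = c T0}"
  have cS: "compact S" unfolding S_def using finite_\<T> T_props(1) by (intro compact_Union) auto
  define bary where "bary T = full_simplex.bary (vertices T)" for T :: "'a set"
  define slope where "slope T = full_simplex.slope (vertices T)" for T :: "'a set"
  have aff: "bary T p y = bary T p 0 + slope T p \<bullet> y" if "T \<in> \<T>" "p \<in> vertices T" for T p y
    unfolding bary_def slope_def by (rule full_simplex.bary_affine[OF vertices_simplex(1)[OF that(1)] that(2)])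
  have vert: "bary T p q = (if p = q then 1 else 0)" if "T \<in> \<T>" "p \<in> vertices T" "q \<in> vertices T" for T p q
    unfolding bary_def by (rule full_simplex.bary_vertex[OF vertices_simplex(1)[OF that(1)] that(2,3)])
  have fv: "finite (vertices T)" "card (vertices T) = DIM('a) + 1" if "T \<in> \<T>" for T
    using full_simplex.finite_C[OF vertices_simplex(1)[OF that]] full_simplex.card_C[OF vertices_simplex(1)[OF that]] by auto
  have hyper: "negligible {y. a + g \<bullet> y = 0}" if "g \<noteq> 0" for a and g :: 'a
  proof -
    have "{y. a + g \<bullet> y = 0} = {y. g \<bullet> y = - a}" by auto
    then show ?thesis using that by (simp add: negligible_hyperplane)
  qed
  have hyperb: "negligible {y. bary T p y = 0}" if "T \<in> \<T>" "p \<in> vertices T" for T p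
  proof -
    have "slope T p \<noteq> 0" unfolding slope_def
      by (rule full_simplex.slope_nonzero[OF vertices_simplex(1)[OF that(1)] that(2)])
    from hyper[OF this, of "bary T p 0"] show ?thesis unfolding aff[OF that, symmetric] .
  qed
  \<comment> \<open>The far endpoint is chosen off all hyperplanes spanned by faces; the complement
    of \<open>S\<close> is open and nonempty, so a null set cannot exhaust it.\<close>
  obtain q0 where q0: "q0 \<notin> S" "\<And>T p. T \<in> \<T> \<Longrightarrow> p \<in> vertices T \<Longrightarrow> bary T p q0 \<noteq> 0"
  proof -
    have "negligible (\<Union>T\<in>\<T>. \<Union>p\<in>vertices T. {y. bary T p y = 0})"
      using hyperb finite_\<T> fv by (intro negligible_Union) (auto intro!: negligible_Union)
    moreover have "open (- S)" using cS by (simp add: compact_imp_closed open_Compl)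
    moreover have "- S \<noteq> {}" using cS not_compact_UNIV by (metis Compl_eq_Diff_UNIV Diff_eq_empty_iff top.extremum_uniqueI)
    ultimately have "\<not> - S \<subseteq> (\<Union>T\<in>\<T>. \<Union>p\<in>vertices T. {y. bary T p y = 0})"
      using open_not_negligible negligible_subset by blast
    then show thesis using that by blast
  qed
  \<comment> \<open>The hyperplane through \<open>q0\<close> and the intersection of the hyperplanes
    of the two faces opposite to \<open>p\<close> and \<open>q\<close>. A starting point off all
    these sets gives a segment on which two barycentric coordinates of one simplex never vanish
    together.\<close>
  define N where "N T p q = {y. bary T p y * bary T q q0 = bary T q y * bary T p q0}" for T p q
  have negN: "negligible (N T p q)" if T: "T \<in> \<T>" and p: "p \<in> vertices T" and q: "q \<in> vertices T" "q \<noteq> p" for T p q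
  proof -
    \<comment> \<open>Dimension at least two provides a third vertex \<open>r\<close>. The affine
      function defining the set differs at \<open>p\<close> and \<open>r\<close> by
      \<open>bary T q q0\<close>, which is nonzero, so the set is a true hyperplane.\<close>
    have "card (vertices T - {p} - {q}) \<noteq> 0" using fv[OF T] p q dim2 by simp
    then obtain r where r: "r \<in> vertices T" "r \<noteq> p" "r \<noteq> q" by (metis Diff_iff card.empty ex_in_conv insertI1)
    define g where "g = bary T q q0 *\<^sub>R slope T p - bary T p q0 *\<^sub>R slope T q"
    have e: "bary T p y * bary T q q0 - bary T q y * bary T p q0
        = (bary T p 0 * bary T q q0 - bary T q 0 * bary T p q0) + g \<bullet> y" for y
      unfolding aff[OF T p, of y] aff[OF T q(1), of y] by (simp add: g_def inner_diff_left algebra_simps)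
    have "bary T q q0 = (bary T p p * bary T q q0 - bary T q p * bary T p q0) - (bary T p r * bary T q q0 - bary T q r * bary T p q0)"
      using vert[OF T p p] vert[OF T q(1) p] vert[OF T p r(1)] vert[OF T q(1) r(1)] q r by auto
    also have "\<dots> = g \<bullet> (p - r)" using e[of p] e[of r] by (simp add: inner_diff_right)
    finally have "g \<noteq> 0" using q0(2)[OF T q(1)] by auto
    from hyper[OF this, of "bary T p 0 * bary T q q0 - bary T q 0 * bary T p q0"]
    show ?thesis unfolding e[symmetric] N_def by simp
  qed
  have "negligible (\<Union>T\<in>\<T>. \<Union>p\<in>vertices T. \<Union>q\<in>vertices T - {p}. N T p q)"
    using negN finite_\<T> fv by (intro negligible_Union) (auto intro!: negligible_Union)
  then have "\<not> interior T0 \<subseteq> (\<Union>T\<in>\<T>. \<Union>p\<in>vertices T. \<Union>q\<in>vertices T - {p}. N T p q)"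
    using open_not_negligible[OF open_interior T_props(7)[OF T0]] negligible_subset by blast
  then obtain p0 where p0: "p0 \<in> interior T0" "\<And>T p q. T \<in> \<T> \<Longrightarrow> p \<in> vertices T \<Longrightarrow> q \<in> vertices T \<Longrightarrow> q \<noteq> p \<Longrightarrow> p0 \<notin> N T p q"
    by blast
  have "p0 \<in> S" using p0(1) interior_subset T0 by (auto simp: S_def)
  \<comment> \<open>The segment starts in \<open>S\<close> and ends outside, so it meets the
    frontier. General position places the meeting point in the relative interior of a single
    face.\<close>
  then have "closed_segment p0 q0 \<inter> frontier S \<noteq> {}"
    using q0(1) by (intro connected_Int_frontier connected_segment) auto
  then obtain x where x: "x \<in> closed_segment p0 q0" "x \<in> frontier S" by auto
  have xS: "x \<in> S" "x \<notin> interior S" using x(2) cS by (auto simp: frontier_def compact_imp_closed)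
  obtain u where u: "x = (1 - u) *\<^sub>R p0 + u *\<^sub>R q0" using x(1) by (auto simp: closed_segment_def)
  have u1: "u \<noteq> 1" using u xS(1) q0(1) by auto
  have comb: "bary T p x = (1 - u) * bary T p p0 + u * bary T p q0" if "T \<in> \<T>" "p \<in> vertices T" for T p
    unfolding u aff[OF that, of "_ + _"] aff[OF that, of p0] aff[OF that, of q0]
    by (simp add: inner_add_right algebra_simps)
  obtain T where T: "T \<in> \<T>" "c T = c T0" "x \<in> T" using xS(1) by (auto simp: S_def)
  interpret F: full_simplex "vertices T" by (rule vertices_simplex(1)[OF T(1)])
  note e = vertices_simplex(2)[OF T(1)]
  have "interior T \<subseteq> interior S" using T by (intro interior_mono) (auto simp: S_def)
  then have xnT: "x \<notin> interior F.T" using xS(2) unfolding e by auto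
  have "x \<in> F.T" using T(3) unfolding e .
  then have xT: "\<forall>q\<in>vertices T. 0 \<le> bary T q x" unfolding F.T_eq bary_def[symmetric] by simp
  obtain p where "p \<in> vertices T" "\<not> 0 < bary T p x"
    using xnT unfolding F.interior_T_eq bary_def[symmetric] by blast
  with xT have p: "p \<in> vertices T" "bary T p x = 0" by force+
  have nz: "bary T q x \<noteq> 0" if q: "q \<in> vertices T" "q \<noteq> p" for q
  proof
    assume "bary T q x = 0"
    then have "(1 - u) * bary T p p0 = - (u * bary T p q0)" "(1 - u) * bary T q p0 = - (u * bary T q q0)"
      using p comb[OF T(1) p(1)] comb[OF T(1) q(1)] by linarith+
    then have "(1 - u) * (bary T p p0 * bary T q q0) = (1 - u) * (bary T q p0 * bary T p q0)"
      by (simp add: mult.assoc[symmetric])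
    then show False using u1 p0(2)[OF T(1) p(1) q] by (simp add: N_def)
  qed
  define F where "F = F.face p"
  have Ff: "F facet_of T" using F.face_facet[OF p(1)] unfolding e F_def .
  have xF: "x \<in> rel_interior F"
    unfolding F_def F.rel_interior_face_eq[OF p(1)] bary_def[symmetric]
    using p nz xT by (auto simp: order_less_le)
  show False
  proof (cases "F \<subseteq> frontier \<Omega>")
    case True
    then show False using bd[OF T(1) Ff] T(2) ne by simp
  next
    case False
    obtain T2 where T2: "T2 \<in> \<T>" "T2 \<noteq> T" "F facet_of T2" by (rule interior_facet_neighbour[OF T(1) Ff False])
    have "c T2 = c T0" using nb[OF T(1) T2(1) _ Ff T2(3)] T2(2) T(2) by auto
    then have "T \<union> T2 \<subseteq> S" using T T2 by (auto simp: S_def)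
    moreover have "x \<in> interior (T \<union> T2)"
      by (rule rel_interior_shared_facet[OF T(1) T2(1) T2(2)[symmetric] Ff T2(3) xF])
    ultimately show False using xS(2) interior_mono by blast
  qed
qed

end

section \<open>Piecewise polynomials\<close>

lemma sum_fun_apply: "(\<Sum>i\<in>A. f i) x = (\<Sum>i\<in>A. f i x :: 'b::comm_monoid_add)"
  by (induction A rule: infinite_finite_induct) auto

lemma scaleR_fun_apply: "(c *\<^sub>R f) x = c *\<^sub>R f x"
  by (simp add: scaleR_fun_def)

lemma integral_lebesgue_on_cong_AE:
  fixes f h :: "'a::euclidean_space \<Rightarrow> 'b::euclidean_space"
  assumes "f \<in> borel_measurable (lebesgue_on S)" "S \<in> sets lebesgue" "AE x in lebesgue_on S. f x = h x"
  shows "(\<integral>x. f x \<partial>lebesgue_on S) = (\<integral>x. h x \<partial>lebesgue_on S)"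
  using borel_measurable_lebesgue_on_AE[OF assms(2,1,3)] assms by (intro integral_cong_AE) auto

text \<open>The normal form of a discrete function on one simplex: affine plus a multiple of the
  square that occurs in the bubble. The gradient is
  \<open>g + (2 * d) *\<^sub>R (x - mid T)\<close>, and \<open>d = 0\<close> singles out the affine
  functions.\<close>

definition quadratic_on :: "'a::euclidean_space set \<Rightarrow> ('a \<Rightarrow> real) \<Rightarrow> real \<Rightarrow> 'a \<Rightarrow> real \<Rightarrow> bool" where
  "quadratic_on T v c g d \<longleftrightarrow> (\<forall>x\<in>interior T. v x = c + g \<bullet> x + d * (norm (x - mid T))\<^sup>2)"

lemma quadratic_on_add:
  "quadratic_on T u c g d \<Longrightarrow> quadratic_on T v c' g' d' \<Longrightarrow> quadratic_on T (u + v) (c + c') (g + g') (d + d')"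
  by (simp add: quadratic_on_def inner_add_left distrib_right)

lemma quadratic_on_scale: "quadratic_on T u c g d \<Longrightarrow> quadratic_on T (r *\<^sub>R u) (r * c) (r *\<^sub>R g) (r * d)"
  by (simp add: quadratic_on_def scaleR_fun_apply distrib_left mult.assoc)

context mesh
begin

lemma integrable_mesh:
  fixes f :: "'a \<Rightarrow> 'b::euclidean_space"
  assumes f: "\<And>T. T \<in> \<T> \<Longrightarrow> integrable (lebesgue_on (interior T)) f"
  shows "integrable (lebesgue_on \<Omega>) f"
proof -
  note n = mesh_interior_props(1,2) sets_\<Omega> mesh_interior_props(3)
  have "integrable lebesgue (\<lambda>x. indicator (interior T) x *\<^sub>R f x)" if "T \<in> \<T>" for T
    using f[OF that] by (simp add: integrable_restrict_space)
  then have "integrable lebesgue (\<lambda>x. \<Sum>T\<in>\<T>. indicator (interior T) x *\<^sub>R f x)"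
    by (rule Bochner_Integration.integrable_sum)
  then have "integrable (lebesgue_on mesh_interior) f"
    using n(2) by (simp add: integrable_restrict_space indicator_mesh_interior scaleR_sum_left)
  then show ?thesis unfolding integrable_null_diff[OF n] .
qed

lemma interior_lmeasurable: "T \<in> \<T> \<Longrightarrow> interior T \<in> lmeasurable"
  using T_props(6) by (simp add: lmeasurable_interior)

lemma L2_interior_T: "T \<in> \<T> \<Longrightarrow> f \<in> L2_functions (interior T) \<longleftrightarrow> (f :: 'a \<Rightarrow> 'b::euclidean_space) \<in> L2_functions T"
  using T_props by (intro L2_null_diff[symmetric] interior_subset) auto

lemma L2_mesh:
  fixes f :: "'a \<Rightarrow> 'b::euclidean_space"
  assumes f: "\<And>T. T \<in> \<T> \<Longrightarrow> f \<in> L2_functions (interior T)"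
  shows "f \<in> L2_functions \<Omega>"
proof (rule L2_functionsI)
  have "integrable (lebesgue_on \<Omega>) f"
    using f interior_lmeasurable by (intro integrable_mesh L2_integrable)
  then show "f \<in> borel_measurable (lebesgue_on \<Omega>)" by simp
  show "integrable (lebesgue_on \<Omega>) (\<lambda>x. (norm (f x))\<^sup>2)"
    using f by (intro integrable_mesh L2_square_integrable)
qed

text \<open>Assembles a function from independent local pieces; on the skeleton, a null set, it is
  zero.\<close>

definition glue :: "('a set \<Rightarrow> 'a \<Rightarrow> real) \<Rightarrow> 'a \<Rightarrow> real" where
  "glue f x = (\<Sum>T\<in>\<T>. indicator (interior T) x * f T x)"

lemma glue_interior:
  assumes T: "T \<in> \<T>" and x: "x \<in> interior T"
  shows "glue f x = f T x"
proof -
  have "x \<notin> interior T'" if "T' \<in> \<T>" "T' \<noteq> T" for T'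
    using interior_disjoint[OF T that(1)] that x interior_subset[of T'] by blast
  then have "glue f x = (\<Sum>T'\<in>\<T>. if T' = T then f T x else 0)"
    unfolding glue_def using x by (intro sum.cong) (auto simp: indicator_def)
  then show ?thesis using T finite_\<T> by simp
qed

lemma C1_quadratic_gradient:
  assumes T: "T \<in> \<T>" and v: "quadratic_on T v c g d"
  shows "has_weak_gradient (interior T) v (\<lambda>x. g + (2 * d) *\<^sub>R (x - mid T))"
proof (rule has_weak_gradient_AE_cong[OF open_interior C1_has_weak_gradient[OF C1_grad_quadratic open_interior]])
  show "bounded (interior T)" using bounded_subset[OF T_props(6)[OF T] interior_subset] .
  show "AE x in lebesgue_on (interior T). c + g \<bullet> x + d * (norm (x - mid T))\<^sup>2 = v x"
    using v by (intro AE_I2) (simp add: quadratic_on_def)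
qed simp

lemma quadratic_L2:
  assumes T: "T \<in> \<T>" and v: "quadratic_on T v c g d"
  shows "v \<in> L2_functions T"
  using C1_quadratic_gradient[OF T v] unfolding has_weak_gradient_def L2_interior_T[OF T] by blast

lemma trace_from_affine:
  assumes T: "T \<in> \<T>" and x: "x \<in> T" and v: "quadratic_on T v c g 0"
  shows "trace_from T v x = c + g \<bullet> x"
proof -
  have "x islimpt interior T"
  proof (cases "x \<in> interior T")
    case True
    then show ?thesis by (simp add: interior_limit_point)
  next
    case False
    then show ?thesis using x T_props(9)[OF T] unfolding closure_def by auto
  qed
  then have nt: "\<not> trivial_limit (at x within interior T)" by (simp add: trivial_limit_within)
  have "((\<lambda>y. c + g \<bullet> y) \<longlongrightarrow> c + g \<bullet> x) (at x within interior T)" by (intro tendsto_intros)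
  then have "(v \<longlongrightarrow> c + g \<bullet> x) (at x within interior T)"
    by (rule Lim_transform_eventually) (use v in \<open>auto simp: quadratic_on_def eventually_at_filter\<close>)
  then show ?thesis unfolding trace_from_def by (rule tendsto_Lim[OF nt])
qed

lemma P1_affine:
  assumes "v \<in> P1 \<T>" "T \<in> \<T>"
  obtains c g where "quadratic_on T v c g 0"
proof -
  have "\<exists>c g. \<forall>x\<in>interior T. v x = c + g \<bullet> x" using assms unfolding P1_def by blast
  then obtain c g where "\<forall>x\<in>interior T. v x = c + g \<bullet> x" by blast
  then have "quadratic_on T v c g 0" by (simp add: quadratic_on_def)
  then show thesis by (rule that)
qed

lemma P1I: "(\<And>T. T \<in> \<T> \<Longrightarrow> \<exists>c g. quadratic_on T v c g 0) \<Longrightarrow> v \<in> P1 \<T>"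
  unfolding P1_def quadratic_on_def by simp

section \<open>Jumps and the Crouzeix-Raviart space\<close>

lemma jump_boundary:
  assumes T: "T \<in> \<T>" and F: "F facet_of T" "F \<subseteq> frontier \<Omega>"
  shows "jump \<Omega> \<T> v F x = trace_from T v x"
proof -
  have "(THE T. T \<in> \<T> \<and> F facet_of T) = T"
  proof (rule the_equality)
    show "T \<in> \<T> \<and> F facet_of T" using T F(1) by (rule conjI)
    show "T' = T" if "T' \<in> \<T> \<and> F facet_of T'" for T'
      by (rule boundary_facet_unique[OF conjunct1[OF that] T conjunct2[OF that] F])
  qed
  then show ?thesis using F(2) unfolding jump_def by (simp only: if_True)
qed

text \<open>The jump uses an arbitrary ordered pair of adjacent simplices. As at most two simplices
  share the face, that pair is the given one up to order, and order does not affect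
  vanishing.\<close>

lemma jump_interior:
  assumes T: "T \<in> \<T>" "T' \<in> \<T>" "T \<noteq> T'" and F: "F facet_of T" "F facet_of T'"
  shows "jump \<Omega> \<T> v F x = 0 \<longleftrightarrow> trace_from T v x = trace_from T' v x"
proof -
  define Q where "Q = (\<lambda>(T1, T2). T1 \<in> \<T> \<and> T2 \<in> \<T> \<and> T1 \<noteq> T2 \<and> F facet_of T1 \<and> F facet_of T2)"
  have "Q (T, T')" using T F by (simp add: Q_def)
  then have "Q (Eps Q)" by (rule someI)
  moreover obtain A B where AB: "Eps Q = (A, B)" by fastforce
  ultimately have P: "A \<in> \<T>" "B \<in> \<T>" "A \<noteq> B" "F facet_of A" "F facet_of B" by (auto simp: Q_def)
  have "T = A \<or> T = B" using facet_at_most_two[OF P(1,2) T(1) P(4,5) F(1) P(3)] by auto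
  moreover have "T' = A \<or> T' = B" using facet_at_most_two[OF P(1,2) T(2) P(4,5) F(2) P(3)] by auto
  moreover have "\<not> F \<subseteq> frontier \<Omega>" using boundary_facet_unique[OF T(1,2) F] T(3) by auto
  then have "jump \<Omega> \<T> v F x = trace_from A v x - trace_from B v x"
    using AB by (simp add: jump_def Q_def)
  ultimately show ?thesis using T(3) by auto
qed

lemma CR10_iff:
  "v \<in> CR10 \<Omega> \<T> \<longleftrightarrow> v \<in> P1 \<T> \<and>
    (\<forall>T\<in>\<T>. \<forall>F. F facet_of T \<longrightarrow> F \<subseteq> frontier \<Omega> \<longrightarrow> trace_from T v (mid F) = 0) \<and>
    (\<forall>T\<in>\<T>. \<forall>T'\<in>\<T>. \<forall>F. T \<noteq> T' \<longrightarrow> F facet_of T \<longrightarrow> F facet_of T' \<longrightarrow>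
       trace_from T v (mid F) = trace_from T' v (mid F))" (is "_ \<longleftrightarrow> ?R")
proof
  assume "v \<in> CR10 \<Omega> \<T>"
  then have v: "v \<in> P1 \<T>" "\<And>F. F \<in> faces \<T> \<Longrightarrow> jump \<Omega> \<T> v F (mid F) = 0" by (auto simp: CR10_def)
  have "trace_from T v (mid F) = 0" if "T \<in> \<T>" "F facet_of T" "F \<subseteq> frontier \<Omega>" for T F
  proof -
    have "F \<in> faces \<T>" using that(1,2) unfolding faces_def by blast
    then show ?thesis using v(2)[of F] jump_boundary[OF that, of v "mid F"] by simp
  qed
  moreover have "trace_from T v (mid F) = trace_from T' v (mid F)"
    if "T \<in> \<T>" "T' \<in> \<T>" "T \<noteq> T'" "F facet_of T" "F facet_of T'" for T T' F
  proof -
    have "F \<in> faces \<T>" using that(1,4) unfolding faces_def by blast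
    then show ?thesis using v(2)[of F] jump_interior[OF that, of v "mid F"] by simp
  qed
  ultimately show ?R using v(1) by (intro conjI ballI allI impI)
next
  assume R: ?R
  have "jump \<Omega> \<T> v F (mid F) = 0" if F: "F \<in> faces \<T>" for F
  proof -
    obtain T where T: "T \<in> \<T>" "F facet_of T" using F unfolding faces_def by blast
    show ?thesis
    proof (cases "F \<subseteq> frontier \<Omega>")
      case True
      have "trace_from T v (mid F) = 0" using R T True by blast
      then show ?thesis unfolding jump_boundary[OF T True] .
    next
      case False
      obtain T' where T': "T' \<in> \<T>" "T' \<noteq> T" "F facet_of T'" by (rule interior_facet_neighbour[OF T False])
      have "trace_from T v (mid F) = trace_from T' v (mid F)"
        using R[THEN conjunct2, THEN conjunct2, rule_format, OF T(1) T'(1) T'(2)[symmetric] T(2) T'(3)] .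
      then show ?thesis unfolding jump_interior[OF T(1) T'(1) T'(2)[symmetric] T(2) T'(3)] .
    qed
  qed
  then show "v \<in> CR10 \<Omega> \<T>" using R by (simp add: CR10_def)
qed

lemma CR10D:
  assumes "v \<in> CR10 \<Omega> \<T>"
  shows "v \<in> P1 \<T>"
    "T \<in> \<T> \<Longrightarrow> F facet_of T \<Longrightarrow> F \<subseteq> frontier \<Omega> \<Longrightarrow> trace_from T v (mid F) = 0"
    "T \<in> \<T> \<Longrightarrow> T' \<in> \<T> \<Longrightarrow> T \<noteq> T' \<Longrightarrow> F facet_of T \<Longrightarrow> F facet_of T' \<Longrightarrow>
       trace_from T v (mid F) = trace_from T' v (mid F)"
proof -
  note P = assms[unfolded CR10_iff]
  show "v \<in> P1 \<T>" by (rule conjunct1[OF P])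
  show "trace_from T v (mid F) = 0" if "T \<in> \<T>" "F facet_of T" "F \<subseteq> frontier \<Omega>"
    by (rule P[THEN conjunct2, THEN conjunct1, rule_format, OF that])
  show "trace_from T v (mid F) = trace_from T' v (mid F)"
    if "T \<in> \<T>" "T' \<in> \<T>" "T \<noteq> T'" "F facet_of T" "F facet_of T'"
    by (rule P[THEN conjunct2, THEN conjunct2, rule_format, OF that])
qed

lemma trace_from_P1:
  assumes u: "u \<in> P1 \<T>" and v: "v \<in> P1 \<T>" and T: "T \<in> \<T>" and x: "x \<in> T"
  shows "trace_from T (u + v) x = trace_from T u x + trace_from T v x"
    "trace_from T (r *\<^sub>R u) x = r * trace_from T u x"
proof -
  obtain c g where a: "quadratic_on T u c g 0" by (rule P1_affine[OF u T])
  obtain c' g' where b: "quadratic_on T v c' g' 0" by (rule P1_affine[OF v T])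
  have 1: "quadratic_on T (u + v) (c + c') (g + g') 0" using quadratic_on_add[OF a b] by simp
  have 2: "quadratic_on T (r *\<^sub>R u) (r * c) (r *\<^sub>R g) 0" using quadratic_on_scale[OF a, of r] by simp
  show "trace_from T (u + v) x = trace_from T u x + trace_from T v x"
    unfolding trace_from_affine[OF T x 1] trace_from_affine[OF T x a] trace_from_affine[OF T x b]
    by (simp add: inner_add_left)
  show "trace_from T (r *\<^sub>R u) x = r * trace_from T u x"
    unfolding trace_from_affine[OF T x 2] trace_from_affine[OF T x a] by (simp add: distrib_left)
qed

lemma subspace_P1: "subspace (P1 \<T>)"
  unfolding subspace_def
proof (intro conjI ballI allI)
  show "0 \<in> P1 \<T>" by (rule P1I) (auto simp: quadratic_on_def intro!: exI[of _ 0])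
  show "u + v \<in> P1 \<T>" if uv: "u \<in> P1 \<T>" "v \<in> P1 \<T>" for u v
  proof (rule P1I)
    fix T assume T: "T \<in> \<T>"
    obtain c g where a: "quadratic_on T u c g 0" by (rule P1_affine[OF uv(1) T])
    obtain c' g' where b: "quadratic_on T v c' g' 0" by (rule P1_affine[OF uv(2) T])
    from quadratic_on_add[OF a b] have "quadratic_on T (u + v) (c + c') (g + g') 0" by simp
    then show "\<exists>c g. quadratic_on T (u + v) c g 0" by blast
  qed
  show "r *\<^sub>R u \<in> P1 \<T>" if u: "u \<in> P1 \<T>" for r u
  proof (rule P1I)
    fix T assume T: "T \<in> \<T>"
    obtain c g where a: "quadratic_on T u c g 0" by (rule P1_affine[OF u T])
    from quadratic_on_scale[OF a, of r] have "quadratic_on T (r *\<^sub>R u) (r * c) (r *\<^sub>R g) 0" by simp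
    then show "\<exists>c g. quadratic_on T (r *\<^sub>R u) c g 0" by blast
  qed
qed

lemma facet_mid_in: "T \<in> \<T> \<Longrightarrow> F facet_of T \<Longrightarrow> mid F \<in> T"
  using facet_props(4,6) by blast

lemma subspace_CR10: "subspace (CR10 \<Omega> \<T>)"
  unfolding subspace_def
proof (intro conjI ballI allI)
  have z: "trace_from T 0 x = 0" if "T \<in> \<T>" "x \<in> T" for T x
    using trace_from_affine[OF that, of 0 0 0] by (simp add: quadratic_on_def)
  show "0 \<in> CR10 \<Omega> \<T>"
    unfolding CR10_iff using subspace_0[OF subspace_P1] z facet_mid_in by simp
  show "u + v \<in> CR10 \<Omega> \<T>" if "u \<in> CR10 \<Omega> \<T>" "v \<in> CR10 \<Omega> \<T>" for u v
  proof -
    have P: "u \<in> P1 \<T>" "v \<in> P1 \<T>" using that by (auto simp: CR10_def)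
    note tr = trace_from_P1(1)[OF P]
    show ?thesis
      unfolding CR10_iff
    proof (intro conjI ballI allI impI)
      show "u + v \<in> P1 \<T>" by (rule subspace_add[OF subspace_P1 P])
      show "trace_from T (u + v) (mid F) = 0" if T: "T \<in> \<T>" "F facet_of T" "F \<subseteq> frontier \<Omega>" for T F
        using CR10D(2)[OF \<open>u \<in> CR10 \<Omega> \<T>\<close> T] CR10D(2)[OF \<open>v \<in> CR10 \<Omega> \<T>\<close> T] tr[OF T(1) facet_mid_in[OF T(1,2)]] by simp
      show "trace_from T (u + v) (mid F) = trace_from T' (u + v) (mid F)"
        if T: "T \<in> \<T>" "T' \<in> \<T>" "T \<noteq> T'" "F facet_of T" "F facet_of T'" for T T' F
        unfolding tr[OF T(1) facet_mid_in[OF T(1,4)]] tr[OF T(2) facet_mid_in[OF T(2,5)]]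
          CR10D(3)[OF \<open>u \<in> CR10 \<Omega> \<T>\<close> T] CR10D(3)[OF \<open>v \<in> CR10 \<Omega> \<T>\<close> T] ..
    qed
  qed
  show "r *\<^sub>R u \<in> CR10 \<Omega> \<T>" if "u \<in> CR10 \<Omega> \<T>" for r u
  proof -
    have P: "u \<in> P1 \<T>" using that by (auto simp: CR10_def)
    note tr = trace_from_P1(2)[OF P P]
    show ?thesis
      unfolding CR10_iff
    proof (intro conjI ballI allI impI)
      show "r *\<^sub>R u \<in> P1 \<T>" by (rule subspace_scale[OF subspace_P1 P])
      show "trace_from T (r *\<^sub>R u) (mid F) = 0" if T: "T \<in> \<T>" "F facet_of T" "F \<subseteq> frontier \<Omega>" for T F
        using CR10D(2)[OF \<open>u \<in> CR10 \<Omega> \<T>\<close> T] tr[OF T(1) facet_mid_in[OF T(1,2)]] by simp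
      show "trace_from T (r *\<^sub>R u) (mid F) = trace_from T' (r *\<^sub>R u) (mid F)"
        if T: "T \<in> \<T>" "T' \<in> \<T>" "T \<noteq> T'" "F facet_of T" "F facet_of T'" for T T' F
        unfolding tr[OF T(1) facet_mid_in[OF T(1,4)]] tr[OF T(2) facet_mid_in[OF T(2,5)]]
          CR10D(3)[OF \<open>u \<in> CR10 \<Omega> \<T>\<close> T] ..
    qed
  qed
qed

text \<open>At face midpoints \<open>S.bary p\<close> is zero on the face opposite to
  \<open>p\<close> and one over the dimension on all others, so the local function is one minus the
  dimension times \<open>S.bary p\<close>. Gluing matches the values at shared midpoints.\<close>

lemma CR_basis_exists:
  assumes F: "F \<in> interior_faces \<Omega> \<T>"
  shows "\<exists>\<psi>. \<psi> \<in> CR10 \<Omega> \<T> \<and>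
    (\<forall>T\<in>\<T>. \<forall>F'. F' facet_of T \<longrightarrow> trace_from T \<psi> (mid F') = (if F' = F then 1 else 0))"
proof -
  let ?n = "real DIM('a)"
  have Fi: "\<not> F \<subseteq> frontier \<Omega>" using F by (auto simp: interior_faces_def)
  have "\<exists>c g. \<forall>F'. F' facet_of T \<longrightarrow> c + g \<bullet> mid F' = (if F' = F then 1 else 0 :: real)" if T: "T \<in> \<T>" for T
  proof (cases "F facet_of T")
    case False
    then have "\<forall>F'. F' facet_of T \<longrightarrow> 0 + 0 \<bullet> mid F' = (if F' = F then 1 else 0 :: real)" by auto
    then show ?thesis by blast
  next
    case True
    interpret S: full_simplex "vertices T" by (rule vertices_simplex(1)[OF T])
    obtain p where p: "p \<in> vertices T" "F = S.face p" by (rule facet_face[OF T True])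
    have "(1 - ?n * S.bary p 0) + (- (?n *\<^sub>R S.slope p)) \<bullet> mid F' = (if F' = F then 1 else 0)"
      if F': "F' facet_of T" for F'
    proof -
      obtain q where q: "q \<in> vertices T" "F' = S.face q" by (rule facet_face[OF T F'])
      have "(1 - ?n * S.bary p 0) + (- (?n *\<^sub>R S.slope p)) \<bullet> mid F' = 1 - ?n * S.bary p (mid F')"
        unfolding S.bary_affine[OF p(1), of "mid F'"] by (simp add: algebra_simps)
      also have "\<dots> = (if p = q then 1 else 0)"
        unfolding q(2) S.bary_mid_face[OF q(1) p(1)] by simp
      also have "p = q \<longleftrightarrow> F' = F" using p q S.face_inject[OF p(1) q(1)] by auto
      finally show ?thesis .
    qed
    then show ?thesis by blast
  qed
  then obtain c g where cg: "\<And>T F'. T \<in> \<T> \<Longrightarrow> F' facet_of T \<Longrightarrow> c T + g T \<bullet> mid F' = (if F' = F then 1 else 0 :: real)"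
    by metis
  define \<psi> where "\<psi> = glue (\<lambda>T x. c T + g T \<bullet> x)"
  have aff: "quadratic_on T \<psi> (c T) (g T) 0" if "T \<in> \<T>" for T
    using glue_interior[OF that] by (simp add: quadratic_on_def \<psi>_def)
  have tr: "trace_from T \<psi> (mid F') = (if F' = F then 1 else 0)" if T: "T \<in> \<T>" "F' facet_of T" for T F'
    using trace_from_affine[OF T(1) facet_mid_in[OF T] aff[OF T(1)]] cg[OF T] by simp
  have "\<psi> \<in> CR10 \<Omega> \<T>"
    unfolding CR10_iff
  proof (intro conjI ballI allI impI)
    show "\<psi> \<in> P1 \<T>" using aff by (intro P1I) blast
    show "trace_from T \<psi> (mid F') = 0" if "T \<in> \<T>" "F' facet_of T" "F' \<subseteq> frontier \<Omega>" for T F'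
      using tr[OF that(1,2)] that(3) Fi by auto
    show "trace_from T \<psi> (mid F') = trace_from T' \<psi> (mid F')"
      if "T \<in> \<T>" "T' \<in> \<T>" "T \<noteq> T'" "F' facet_of T" "F' facet_of T'" for T T' F'
      using tr[OF that(1,4)] tr[OF that(2,5)] by simp
  qed
  then show ?thesis using tr by blast
qed

lemma CR_basis_props:
  assumes F: "F \<in> interior_faces \<Omega> \<T>"
  shows "CR_basis \<Omega> \<T> F \<in> CR10 \<Omega> \<T>"
    "T \<in> \<T> \<Longrightarrow> F' facet_of T \<Longrightarrow> trace_from T (CR_basis \<Omega> \<T> F) (mid F') = (if F' = F then 1 else 0)"
  using someI_ex[OF CR_basis_exists[OF F]] unfolding CR_basis_def by blast+

lemma finite_faces: "finite (faces \<T>)"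
proof -
  have "faces \<T> \<subseteq> (\<Union>T\<in>\<T>. full_simplex.face (vertices T) ` vertices T)"
  proof
    fix F assume "F \<in> faces \<T>"
    then obtain T where T: "T \<in> \<T>" "F facet_of T" by (auto simp: faces_def)
    obtain p where "p \<in> vertices T" "F = full_simplex.face (vertices T) p" by (rule facet_face[OF T])
    then show "F \<in> (\<Union>T\<in>\<T>. full_simplex.face (vertices T) ` vertices T)" using T by blast
  qed
  moreover have "finite (\<Union>T\<in>\<T>. full_simplex.face (vertices T) ` vertices T)"
    using finite_\<T> full_simplex.finite_C[OF vertices_simplex(1)] by blast
  ultimately show ?thesis by (rule finite_subset)
qed

lemma I_CR_props:
  shows "I_CR \<Omega> \<T> v \<in> CR10 \<Omega> \<T>"
    "T \<in> \<T> \<Longrightarrow> F facet_of T \<Longrightarrow>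
       trace_from T (I_CR \<Omega> \<T> v) (mid F) = (if F \<subseteq> frontier \<Omega> then 0 else face_mean \<Omega> F v)"
proof -
  let ?I = "interior_faces \<Omega> \<T>"
  have fin: "finite ?I" using finite_faces by (rule finite_subset[rotated]) (auto simp: interior_faces_def)
  have in_CR: "(\<Sum>F\<in>A. face_mean \<Omega> F v *\<^sub>R CR_basis \<Omega> \<T> F) \<in> CR10 \<Omega> \<T>" if "A \<subseteq> ?I" for A
    using that CR_basis_props(1) by (intro subspace_sum subspace_scale subspace_CR10) auto
  then show "I_CR \<Omega> \<T> v \<in> CR10 \<Omega> \<T>" unfolding I_CR_def by auto
  show "trace_from T (I_CR \<Omega> \<T> v) (mid F) = (if F \<subseteq> frontier \<Omega> then 0 else face_mean \<Omega> F v)"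
    if T: "T \<in> \<T>" "F facet_of T"
  proof -
    have "trace_from T (\<Sum>F'\<in>A. face_mean \<Omega> F' v *\<^sub>R CR_basis \<Omega> \<T> F') (mid F)
       = (\<Sum>F'\<in>A. face_mean \<Omega> F' v * (if F = F' then 1 else 0))" if "finite A" "A \<subseteq> ?I" for A
      using that
    proof (induction A rule: finite_induct)
      case empty
      have "quadratic_on T 0 0 0 0" by (simp add: quadratic_on_def)
      from trace_from_affine[OF T(1) facet_mid_in[OF T] this] show ?case by (simp only: sum.empty) simp
    next
      case (insert F' A)
      have P: "CR_basis \<Omega> \<T> F' \<in> P1 \<T>" using CR_basis_props(1)[of F'] insert.prems by (auto simp: CR10_def)
      have P': "(\<Sum>F'\<in>A. face_mean \<Omega> F' v *\<^sub>R CR_basis \<Omega> \<T> F') \<in> P1 \<T>"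
        using in_CR[of A] insert.prems by (auto simp: CR10_def)
      have "trace_from T (\<Sum>F'\<in>insert F' A. face_mean \<Omega> F' v *\<^sub>R CR_basis \<Omega> \<T> F') (mid F)
        = trace_from T (face_mean \<Omega> F' v *\<^sub>R CR_basis \<Omega> \<T> F') (mid F)
          + trace_from T (\<Sum>F'\<in>A. face_mean \<Omega> F' v *\<^sub>R CR_basis \<Omega> \<T> F') (mid F)"
        using insert.hyps
        by (simp add: trace_from_P1(1)[OF subspace_scale[OF subspace_P1 P] P' T(1) facet_mid_in[OF T]])
      also have "trace_from T (face_mean \<Omega> F' v *\<^sub>R CR_basis \<Omega> \<T> F') (mid F) = face_mean \<Omega> F' v * (if F = F' then 1 else 0)"
        unfolding trace_from_P1(2)[OF P P T(1) facet_mid_in[OF T]]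
        using CR_basis_props(2)[OF _ T, of F'] insert.prems by simp
      finally show ?case using insert by simp
    qed
    from this[OF fin order_refl] have "trace_from T (I_CR \<Omega> \<T> v) (mid F)
       = (\<Sum>F'\<in>?I. if F = F' then face_mean \<Omega> F' v else 0)"
      unfolding I_CR_def by (simp add: if_distrib cong: if_cong)
    also have "\<dots> = (if F \<in> ?I then face_mean \<Omega> F v else 0)" using fin by simp
    finally show ?thesis using T by (auto simp: interior_faces_def faces_def)
  qed
qed

section \<open>Bubbles and the enriched spaces\<close>

lemma bubble_quadratic:
  assumes T: "T \<in> \<T>"
  shows "quadratic_on T (bubble T) ((real DIM('a) + 2) / 2) 0 (- full_simplex.bubble_coeff (vertices T))"
proof -
  interpret S: full_simplex "vertices T" by (rule vertices_simplex(1)[OF T])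
  show ?thesis
    using S.bubble_T interior_subset[of T] unfolding vertices_simplex(2)[OF T] quadratic_on_def by auto
qed

lemma bubble_other: "T \<in> \<T> \<Longrightarrow> T' \<in> \<T> \<Longrightarrow> T' \<noteq> T \<Longrightarrow> x \<in> interior T \<Longrightarrow> bubble T' x = 0"
  using interior_disjoint[of T T'] by (auto simp: bubble_def Let_def)

lemma sum_bubbles_interior:
  assumes T: "T \<in> \<T>" and x: "x \<in> interior T"
  shows "(\<Sum>T\<in>\<T>. \<beta> T *\<^sub>R bubble T) x = \<beta> T * bubble T x"
proof -
  have "(\<Sum>T\<in>\<T>. \<beta> T *\<^sub>R bubble T) x = (\<Sum>T'\<in>\<T>. if T' = T then \<beta> T * bubble T x else 0)"
    unfolding sum_fun_apply scaleR_fun_apply using bubble_other[OF T _ _ x] by (intro sum.cong) auto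
  then show ?thesis using T finite_\<T> by simp
qed

lemma bubbles_combination:
  assumes "w \<in> bubbles \<T>"
  obtains \<beta> where "w = (\<Sum>T\<in>\<T>. \<beta> T *\<^sub>R bubble T)"
proof -
  have "\<exists>\<beta>. w = (\<Sum>T\<in>\<T>. \<beta> T *\<^sub>R bubble T)"
    using assms unfolding bubbles_def
  proof (induction rule: span_induct_alt)
    case base
    show ?case by (intro exI[of _ "\<lambda>_. 0"]) simp
  next
    case (step c x y)
    then obtain T \<beta> where T: "T \<in> \<T>" "x = bubble T" "y = (\<Sum>T\<in>\<T>. \<beta> T *\<^sub>R bubble T)" by auto
    have "(\<Sum>T'\<in>\<T>. (\<beta> T' + (if T' = T then c else 0)) *\<^sub>R bubble T') = y + (\<Sum>T'\<in>\<T>. if T' = T then c *\<^sub>R bubble T' else 0)"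
      unfolding T(3) sum.distrib[symmetric] by (intro sum.cong) (auto simp: scaleR_add_left)
    then have "c *\<^sub>R x + y = (\<Sum>T'\<in>\<T>. (\<beta> T' + (if T' = T then c else 0)) *\<^sub>R bubble T')"
      using T finite_\<T> by (simp add: add.commute)
    then show ?case by (rule exI[of _ "\<lambda>T'. \<beta> T' + (if T' = T then c else 0)"])
  qed
  then show thesis using that by blast
qed

lemma bubbles_combination_in: "(\<Sum>T\<in>\<T>. \<beta> T *\<^sub>R bubble T) \<in> bubbles \<T>"
  unfolding bubbles_def by (intro span_sum span_scale span_base) auto

lemma quadratic_bubble_sum:
  assumes T: "T \<in> \<T>" and v: "quadratic_on T v c g 0"
  shows "quadratic_on T (v + (\<Sum>T\<in>\<T>. \<beta> T *\<^sub>R bubble T)) (c + \<beta> T * ((real DIM('a) + 2) / 2)) g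
    (- (\<beta> T * full_simplex.bubble_coeff (vertices T)))"
proof -
  have "v x + (\<Sum>T\<in>\<T>. \<beta> T *\<^sub>R bubble T) x = c + \<beta> T * ((real DIM('a) + 2) / 2) + g \<bullet> x
    + - (\<beta> T * full_simplex.bubble_coeff (vertices T)) * (norm (x - mid T))\<^sup>2" if x: "x \<in> interior T" for x
  proof -
    have b: "bubble T x = (real DIM('a) + 2) / 2 + 0 \<bullet> x + - full_simplex.bubble_coeff (vertices T) * (norm (x - mid T))\<^sup>2"
      using bubble_quadratic[OF T] x unfolding quadratic_on_def by blast
    have a: "v x = c + g \<bullet> x + 0 * (norm (x - mid T))\<^sup>2" using v x unfolding quadratic_on_def by blast
    show ?thesis unfolding sum_bubbles_interior[OF T x] a b by (simp add: algebra_simps)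
  qed
  then show ?thesis by (simp add: quadratic_on_def)
qed

text \<open>The space has no conditions across faces, and the nonzero coefficient of the bubble lets
  a bubble absorb any quadratic term.\<close>

lemma V_pw_iff: "v \<in> V_pw \<T> \<longleftrightarrow> (\<forall>T\<in>\<T>. \<exists>c g d. quadratic_on T v c g d)"
proof
  assume "v \<in> V_pw \<T>"
  then obtain p w where pw: "v = p + w" "p \<in> P1 \<T>" "w \<in> bubbles \<T>" by (auto simp: V_pw_def)
  obtain \<beta> where \<beta>: "w = (\<Sum>T\<in>\<T>. \<beta> T *\<^sub>R bubble T)" by (rule bubbles_combination[OF pw(3)])
  show "\<forall>T\<in>\<T>. \<exists>c g d. quadratic_on T v c g d"
  proof
    fix T assume T: "T \<in> \<T>"
    obtain c g where "quadratic_on T p c g 0" by (rule P1_affine[OF pw(2) T])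
    from quadratic_bubble_sum[OF T this, of \<beta>] show "\<exists>c g d. quadratic_on T v c g d" unfolding pw(1) \<beta> by blast
  qed
next
  assume "\<forall>T\<in>\<T>. \<exists>c g d. quadratic_on T v c g d"
  then obtain c g d where q: "\<And>T. T \<in> \<T> \<Longrightarrow> quadratic_on T v (c T) (g T) (d T)" by metis
  define \<beta> where "\<beta> T = - d T / full_simplex.bubble_coeff (vertices T)" for T
  define w where "w = (\<Sum>T\<in>\<T>. \<beta> T *\<^sub>R bubble T)"
  have "v - w \<in> P1 \<T>"
  proof (rule P1I)
    fix T assume T: "T \<in> \<T>"
    have k: "full_simplex.bubble_coeff (vertices T) > 0"
      by (rule full_simplex.bubble_coeff_pos[OF vertices_simplex(1)[OF T]])
    have "quadratic_on T (v - w) (c T - \<beta> T * ((real DIM('a) + 2) / 2)) (g T) 0"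
      unfolding quadratic_on_def
    proof
      fix x assume x: "x \<in> interior T"
      have b: "bubble T x = (real DIM('a) + 2) / 2 + 0 \<bullet> x + - full_simplex.bubble_coeff (vertices T) * (norm (x - mid T))\<^sup>2"
        using bubble_quadratic[OF T] x unfolding quadratic_on_def by blast
      have d: "d T = - (\<beta> T * full_simplex.bubble_coeff (vertices T))" using k by (simp add: \<beta>_def)
      have "w x = \<beta> T * ((real DIM('a) + 2) / 2) + d T * (norm (x - mid T))\<^sup>2"
        unfolding w_def sum_bubbles_interior[OF T x] b d by (simp add: algebra_simps)
      then show "(v - w) x = c T - \<beta> T * ((real DIM('a) + 2) / 2) + g T \<bullet> x + 0 * (norm (x - mid T))\<^sup>2"
        using q[OF T] x by (simp add: quadratic_on_def)
    qed
    then show "\<exists>c g. quadratic_on T (v - w) c g 0" by blast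
  qed
  moreover have "v = (v - w) + w" by simp
  moreover have "w \<in> bubbles \<T>" unfolding w_def by (rule bubbles_combination_in)
  ultimately show "v \<in> V_pw \<T>" unfolding V_pw_def by blast
qed

lemma V_pw_quadratic:
  assumes "v \<in> V_pw \<T>" "T \<in> \<T>"
  obtains c g d where "quadratic_on T v c g d"
  using assms V_pw_iff that by blast

lemma subspace_V_pw: "subspace (V_pw \<T>)"
proof -
  have "V_pw \<T> = {x + y |x y. x \<in> P1 \<T> \<and> y \<in> bubbles \<T>}" by (simp add: V_pw_def)
  then show ?thesis using subspace_sums[OF subspace_P1, of "bubbles \<T>"] by (simp add: bubbles_def)
qed

lemma subspace_V_nc: "subspace (V_nc \<Omega> \<T>)"
proof -
  have "V_nc \<Omega> \<T> = {x + y |x y. x \<in> CR10 \<Omega> \<T> \<and> y \<in> bubbles \<T>}" by (simp add: V_nc_def)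
  then show ?thesis using subspace_sums[OF subspace_CR10, of "bubbles \<T>"] by (simp add: bubbles_def)
qed

lemma V_nc_subset_V_pw: "V_nc \<Omega> \<T> \<subseteq> V_pw \<T>"
  unfolding V_nc_def V_pw_def CR10_def by blast

section \<open>The interpolation operator\<close>

definition bubble_weight :: "('a \<Rightarrow> real) \<Rightarrow> 'a set \<Rightarrow> real" where
  "bubble_weight v T = (\<integral>x. v x - I_CR \<Omega> \<T> v x \<partial>lebesgue_on T) / measure lebesgue T"

lemma I_eCR_eq: "I_eCR \<Omega> \<T> v = I_CR \<Omega> \<T> v + (\<Sum>T\<in>\<T>. bubble_weight v T *\<^sub>R bubble T)"
  by (simp add: I_eCR_def bubble_weight_def)

lemma I_eCR_in_V_nc: "I_eCR \<Omega> \<T> v \<in> V_nc \<Omega> \<T>"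
  unfolding V_nc_def I_eCR_eq using I_CR_props(1) bubbles_combination_in by blast

lemma integral_T_cong:
  fixes f h :: "'a \<Rightarrow> 'b::euclidean_space"
  assumes T: "T \<in> \<T>" and eq: "\<And>x. x \<in> interior T \<Longrightarrow> f x = h x"
  shows "(\<integral>x. f x \<partial>lebesgue_on T) = (\<integral>x. h x \<partial>lebesgue_on T)"
  unfolding null_diff_T[OF T] using eq by (intro Bochner_Integration.integral_cong) auto

lemma L2_continuous_T: "T \<in> \<T> \<Longrightarrow> continuous_on UNIV f \<Longrightarrow> (f :: 'a \<Rightarrow> 'b::euclidean_space) \<in> L2_functions T"
  using T_props by (intro L2_continuous) auto

text \<open>The affine part matches the face means of \<open>u\<close>, and the bubble, which has
  zero mean on the faces, corrects the mean over the simplex. The error therefore has zero mean and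
  zero face functionals. Boundary faces need separate mention, because there the interpolant is zero
  by definition and \<open>u\<close> by its boundary values.\<close>

lemma I_eCR_local:
  assumes u: "u \<in> H10 \<Omega>" and T: "T \<in> \<T>"
  obtains c g d where "quadratic_on T (I_eCR \<Omega> \<T> u) c g d"
    "(\<integral>x. u x - I_eCR \<Omega> \<T> u x \<partial>lebesgue_on T) = 0"
    "\<And>p. p \<in> vertices T \<Longrightarrow> full_simplex.face_functional (vertices T) p (\<lambda>x. u x - I_eCR \<Omega> \<T> u x)
       (\<lambda>x. weak_grad \<Omega> u x - (g + (2 * d) *\<^sub>R (x - mid T))) = 0"
proof -
  interpret S: simplex_in_domain "vertices T" \<Omega> by (rule simplex_in_domain[OF T])
  note eq = vertices_simplex(2)[OF T]
  let ?n = "real DIM('a)" and ?m = "mid T" and ?v = "measure lebesgue T"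
  let ?J = "\<integral>x. (norm (x - mid T))\<^sup>2 \<partial>lebesgue_on T"
  note uL = L2_T[OF T H10_L2(1)[OF u]] L2_T[OF T H10_L2(2)[OF u]]
  define \<beta> where "\<beta> = bubble_weight u T"
  have P: "I_CR \<Omega> \<T> u \<in> P1 \<T>" using I_CR_props(1) by (simp add: CR10_def)
  obtain a g where aff: "quadratic_on T (I_CR \<Omega> \<T> u) a g 0" by (rule P1_affine[OF P T])
  define c where "c = a + \<beta> * ((?n + 2) / 2)"
  define d where "d = - (\<beta> * S.bubble_coeff)"
  have q: "quadratic_on T (I_eCR \<Omega> \<T> u) c g d"
    unfolding I_eCR_eq c_def d_def \<beta>_def by (rule quadratic_bubble_sum[OF T aff])
  have KJ: "S.bubble_coeff * ?J = ?n / 2 * ?v" using S.bubble_coeff_integral[OF S.dim2] unfolding eq .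
  have dJ: "d * ?J = - \<beta> * (?n / 2 * ?v)" unfolding d_def KJ[symmetric] by simp
  have iu: "integrable (lebesgue_on T) u" by (rule L2_integrable[OF T_props(5)[OF T] uL(1)])
  have iq: "integrable (lebesgue_on T) (\<lambda>x. c + g \<bullet> x + d * (norm (x - ?m))\<^sup>2)" for c g d
    using T_props(5)[OF T] by (intro L2_integrable L2_continuous_T[OF T] continuous_intros)
  have Iq: "(\<integral>x. c + g \<bullet> x + d * (norm (x - ?m))\<^sup>2 \<partial>lebesgue_on T) = ?v * (c + g \<bullet> ?m) + d * ?J" for c g d
    using S.integral_quadratic[OF S.dim2, of c g d] unfolding eq .
  have bw: "\<beta> * ?v = (\<integral>x. u x \<partial>lebesgue_on T) - ?v * (a + g \<bullet> ?m)"
  proof -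
    have "(\<integral>x. u x - I_CR \<Omega> \<T> u x \<partial>lebesgue_on T) = (\<integral>x. u x - (a + g \<bullet> x + 0 * (norm (x - ?m))\<^sup>2) \<partial>lebesgue_on T)"
      using aff by (intro integral_T_cong[OF T]) (simp add: quadratic_on_def)
    also have "\<dots> = (\<integral>x. u x \<partial>lebesgue_on T) - ?v * (a + g \<bullet> ?m)"
      using iu iq[of a g 0] Iq[of a g 0] by simp
    finally show ?thesis unfolding \<beta>_def bubble_weight_def using T_props(11)[OF T] by simp
  qed
  have E: "(\<integral>x. u x - I_eCR \<Omega> \<T> u x \<partial>lebesgue_on T) = (\<integral>x. u x - (c + g \<bullet> x + d * (norm (x - ?m))\<^sup>2) \<partial>lebesgue_on T)"
    using q by (intro integral_T_cong[OF T]) (simp add: quadratic_on_def)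
  have E': "\<dots> = (\<integral>x. u x \<partial>lebesgue_on T) - (\<integral>x. c + g \<bullet> x + d * (norm (x - ?m))\<^sup>2 \<partial>lebesgue_on T)"
    using iu iq by (rule Bochner_Integration.integral_diff)
  have mean: "(\<integral>x. u x - I_eCR \<Omega> \<T> u x \<partial>lebesgue_on T) = 0"
  proof -
    have "?v * (c + g \<bullet> ?m) + d * ?J = (\<integral>x. u x \<partial>lebesgue_on T)"
      unfolding dJ unfolding c_def using bw by (simp add: field_simps)
    then show ?thesis unfolding E E' Iq by simp
  qed
  have ff: "S.face_functional p (\<lambda>x. u x - I_eCR \<Omega> \<T> u x) (\<lambda>x. weak_grad \<Omega> u x - (g + (2 * d) *\<^sub>R (x - ?m))) = 0"
    if p: "p \<in> vertices T" for p
  proof -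
    let ?F = "S.face p"
    have F: "?F facet_of T" using S.face_facet[OF p] unfolding eq .
    have iH: "integrable (lebesgue_on T) (\<lambda>x. weak_grad \<Omega> u x \<bullet> (x - p))"
      by (intro L2_inner_integrable uL L2_continuous_T[OF T] continuous_intros)
    have iG: "integrable (lebesgue_on T) (\<lambda>x. (g + (2 * d) *\<^sub>R (x - ?m)) \<bullet> (x - p))"
      by (intro L2_inner_integrable L2_continuous_T[OF T] continuous_intros)
    have "S.face_functional p (\<lambda>x. u x - I_eCR \<Omega> \<T> u x) (\<lambda>x. weak_grad \<Omega> u x - (g + (2 * d) *\<^sub>R (x - ?m)))
      = S.face_functional p u (weak_grad \<Omega> u)
        - S.face_functional p (\<lambda>x. c + g \<bullet> x + d * (norm (x - ?m))\<^sup>2) (\<lambda>x. g + (2 * d) *\<^sub>R (x - ?m))"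
      unfolding S.face_functional_def eq E E' using iH iG
      by (simp add: inner_diff_left right_diff_distrib)
    also have "S.face_functional p (\<lambda>x. c + g \<bullet> x + d * (norm (x - ?m))\<^sup>2) (\<lambda>x. g + (2 * d) *\<^sub>R (x - ?m))
      = ?n * ?v * (c + g \<bullet> mid ?F) + (?n + 2) * (d * ?J)"
      using S.face_functional_quadratic[OF S.dim2 p, of c g d] unfolding eq by (simp add: mult.assoc)
    \<comment> \<open>The bubble contributions cancel, so only the affine interpolant is left at the
      face midpoint.\<close>
    also have "\<dots> = ?n * ?v * (a + g \<bullet> mid ?F)" unfolding dJ c_def by (simp add: algebra_simps)
    also have "a + g \<bullet> mid ?F = trace_from T (I_CR \<Omega> \<T> u) (mid ?F)"
      by (rule trace_from_affine[OF T facet_mid_in[OF T F] aff, symmetric])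
    also have "?n * ?v * trace_from T (I_CR \<Omega> \<T> u) (mid ?F) = S.face_functional p u (weak_grad \<Omega> u)"
      unfolding I_CR_props(2)[OF T F]
      using S.face_functional_boundary[OF p u] S.face_functional_face_mean[OF p u] unfolding eq by simp
    finally show ?thesis by simp
  qed
  show thesis by (rule that[OF q mean ff])
qed

text \<open>Traces are arbitrary choices, so linearity is not visible on the face. It is read off
  from the face functional, where only volume integrals and weak gradients occur.\<close>

lemma face_mean_linear:
  assumes F: "F \<in> interior_faces \<Omega> \<T>" and u: "u \<in> H10 \<Omega>" and v: "v \<in> H10 \<Omega>"
  shows "face_mean \<Omega> F (u + v) = face_mean \<Omega> F u + face_mean \<Omega> F v"
    "face_mean \<Omega> F (r *\<^sub>R u) = r * face_mean \<Omega> F u"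
proof -
  obtain T where T: "T \<in> \<T>" "F facet_of T" using F by (auto simp: interior_faces_def faces_def)
  interpret S: simplex_in_domain "vertices T" \<Omega> by (rule simplex_in_domain[OF T(1)])
  note eq = vertices_simplex(2)[OF T(1)]
  obtain p where p: "p \<in> vertices T" "F = S.face p" by (rule facet_face[OF T])
  let ?k = "real DIM('a) * measure lebesgue T"
  have fm: "face_mean \<Omega> F w = S.face_functional p w (weak_grad \<Omega> w) / ?k" if "w \<in> H10 \<Omega>" for w
    using S.face_functional_face_mean[OF p(1) that] T_props(11)[OF T(1)] unfolding eq p(2) by (simp add: field_simps)
  have L: "w \<in> L2_functions T" "weak_grad \<Omega> w \<in> L2_functions T" if "w \<in> H10 \<Omega>" for w
    using L2_T[OF T(1)] H10_L2[OF that] by auto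
  have i: "integrable (lebesgue_on T) w" "integrable (lebesgue_on T) (\<lambda>x. weak_grad \<Omega> w x \<bullet> (x - p))" if "w \<in> H10 \<Omega>" for w
    using L[OF that] T_props(5)[OF T(1)]
    by (auto intro!: L2_integrable L2_inner_integrable L2_continuous_T[OF T(1)] continuous_intros)
  have uv: "u + v \<in> H10 \<Omega>" "r *\<^sub>R u \<in> H10 \<Omega>" using H10_add[OF u v] H10_scale[OF u] by auto
  have "(\<integral>x. weak_grad \<Omega> (u + v) x \<bullet> (x - p) \<partial>lebesgue_on T)
     = (\<integral>x. weak_grad \<Omega> u x \<bullet> (x - p) + weak_grad \<Omega> v x \<bullet> (x - p) \<partial>lebesgue_on T)"
    using AE_interior_T(2)[OF T(1) weak_grad_add_AE[OF u v]] i[OF uv(1)] T_props(4)[OF T(1)]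
    by (intro integral_lebesgue_on_cong_AE) (auto simp: inner_add_left elim: eventually_mono)
  then show "face_mean \<Omega> F (u + v) = face_mean \<Omega> F u + face_mean \<Omega> F v"
    unfolding fm[OF uv(1)] fm[OF u] fm[OF v] add_divide_distrib[symmetric] S.face_functional_def eq
    using i[OF u] i[OF v] by (simp add: distrib_left plus_fun_def)
  have "(\<integral>x. weak_grad \<Omega> (r *\<^sub>R u) x \<bullet> (x - p) \<partial>lebesgue_on T)
     = (\<integral>x. r * (weak_grad \<Omega> u x \<bullet> (x - p)) \<partial>lebesgue_on T)"
    using AE_interior_T(2)[OF T(1) weak_grad_scale_AE[OF u, of r]] i[OF uv(2)] T_props(4)[OF T(1)]
    by (intro integral_lebesgue_on_cong_AE) (auto elim: eventually_mono)
  then show "face_mean \<Omega> F (r *\<^sub>R u) = r * face_mean \<Omega> F u"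
    unfolding fm[OF uv(2)] fm[OF u] S.face_functional_def eq
    using i[OF u] by (simp add: scaleR_fun_def distrib_left)
qed

lemma I_CR_linear:
  assumes u: "u \<in> H10 \<Omega>" and v: "v \<in> H10 \<Omega>"
  shows "I_CR \<Omega> \<T> (u + v) = I_CR \<Omega> \<T> u + I_CR \<Omega> \<T> v" "I_CR \<Omega> \<T> (r *\<^sub>R u) = r *\<^sub>R I_CR \<Omega> \<T> u"
  unfolding I_CR_def
  by (simp_all add: face_mean_linear[OF _ u v] scaleR_add_left sum.distrib scaleR_sum_right cong: sum.cong)

lemma bubble_weight_linear:
  assumes u: "u \<in> H10 \<Omega>" and v: "v \<in> H10 \<Omega>" and T: "T \<in> \<T>"
  shows "bubble_weight (u + v) T = bubble_weight u T + bubble_weight v T"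
    "bubble_weight (r *\<^sub>R u) T = r * bubble_weight u T"
proof -
  have i: "integrable (lebesgue_on T) (\<lambda>x. w x - I_CR \<Omega> \<T> w x)" if "w \<in> H10 \<Omega>" for w
  proof -
    have P: "I_CR \<Omega> \<T> w \<in> P1 \<T>" using I_CR_props(1) by (simp add: CR10_def)
    obtain a g where aff: "quadratic_on T (I_CR \<Omega> \<T> w) a g 0" by (rule P1_affine[OF P T])
    show ?thesis
      using L2_diff[OF L2_T[OF T H10_L2(1)[OF that]] quadratic_L2[OF T aff]] T_props(5)[OF T] by (intro L2_integrable)
  qed
  have "(\<integral>x. (u + v) x - I_CR \<Omega> \<T> (u + v) x \<partial>lebesgue_on T)
     = (\<integral>x. (u x - I_CR \<Omega> \<T> u x) + (v x - I_CR \<Omega> \<T> v x) \<partial>lebesgue_on T)"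
    unfolding I_CR_linear(1)[OF u v] by (intro Bochner_Integration.integral_cong refl) simp
  then show "bubble_weight (u + v) T = bubble_weight u T + bubble_weight v T"
    unfolding bubble_weight_def using i[OF u] i[OF v] by (simp add: add_divide_distrib)
  have "(\<integral>x. (r *\<^sub>R u) x - I_CR \<Omega> \<T> (r *\<^sub>R u) x \<partial>lebesgue_on T) = (\<integral>x. r * (u x - I_CR \<Omega> \<T> u x) \<partial>lebesgue_on T)"
    unfolding I_CR_linear(2)[OF u u] by (intro Bochner_Integration.integral_cong refl) (simp add: scaleR_fun_apply right_diff_distrib)
  then show "bubble_weight (r *\<^sub>R u) T = r * bubble_weight u T"
    unfolding bubble_weight_def by simp
qed

lemma I_eCR_linear:
  assumes u: "u \<in> H10 \<Omega>" and v: "v \<in> H10 \<Omega>"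
  shows "I_eCR \<Omega> \<T> (u + v) = I_eCR \<Omega> \<T> u + I_eCR \<Omega> \<T> v" "I_eCR \<Omega> \<T> (r *\<^sub>R u) = r *\<^sub>R I_eCR \<Omega> \<T> u"
proof -
  have "(\<Sum>T\<in>\<T>. bubble_weight (u + v) T *\<^sub>R bubble T)
     = (\<Sum>T\<in>\<T>. bubble_weight u T *\<^sub>R bubble T) + (\<Sum>T\<in>\<T>. bubble_weight v T *\<^sub>R bubble T)"
    unfolding sum.distrib[symmetric]
    by (intro sum.cong refl) (simp add: bubble_weight_linear(1)[OF u v] scaleR_add_left)
  then show "I_eCR \<Omega> \<T> (u + v) = I_eCR \<Omega> \<T> u + I_eCR \<Omega> \<T> v"
    unfolding I_eCR_eq I_CR_linear(1)[OF u v] by (simp only: ac_simps)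
  have "(\<Sum>T\<in>\<T>. bubble_weight (r *\<^sub>R u) T *\<^sub>R bubble T) = r *\<^sub>R (\<Sum>T\<in>\<T>. bubble_weight u T *\<^sub>R bubble T)"
    unfolding scaleR_sum_right by (intro sum.cong refl) (simp add: bubble_weight_linear(2)[OF u u])
  then show "I_eCR \<Omega> \<T> (r *\<^sub>R u) = r *\<^sub>R I_eCR \<Omega> \<T> u"
    unfolding I_eCR_eq I_CR_linear(2)[OF u u] by (simp only: scaleR_add_right)
qed

lemma I_eCR_sum:
  assumes "\<And>j. j < (k::nat) \<Longrightarrow> u j \<in> H10 \<Omega>"
  shows "I_eCR \<Omega> \<T> (\<Sum>j<k. c j *\<^sub>R u j) = (\<Sum>j<k. c j *\<^sub>R I_eCR \<Omega> \<T> (u j))"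
  using assms
proof (induction k)
  case 0
  show ?case unfolding lessThan_0 sum.empty using I_eCR_linear(2)[OF H10_zero H10_zero, of 0] unfolding scaleR_zero_left .
next
  case (Suc k)
  have s: "(\<Sum>j<k. c j *\<^sub>R u j) \<in> H10 \<Omega>"
    using Suc.prems by (intro subspace_sum subspace_H10 H10_scale) auto
  show ?case
    unfolding sum.lessThan_Suc I_eCR_linear(1)[OF s H10_scale[OF Suc.prems[OF lessI]]]
      I_eCR_linear(2)[OF Suc.prems[OF lessI] Suc.prems[OF lessI]]
    using Suc by (simp only: less_Suc_eq simp_thms)
qed

end

section \<open>The bilinear forms on the mesh\<close>

lemma psd_form_add:
  assumes "psd_form X a" "psd_form X b"
  shows "psd_form X (\<lambda>u v. a u v + b u v)"
proof -
  interpret a: psd_form X a by fact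
  interpret b: psd_form X b by fact
  show ?thesis
    by unfold_locales
      (simp_all add: a.subspace a.add_left b.add_left a.scale_left b.scale_left a.nonneg b.nonneg distrib_left,
        metis a.sym b.sym)
qed

lemma psd_form_sum:
  assumes X: "subspace X" and a: "\<And>i. i \<in> A \<Longrightarrow> psd_form X (a i)" and c: "\<And>i. i \<in> A \<Longrightarrow> 0 \<le> c i"
  shows "psd_form X (\<lambda>u v. \<Sum>i\<in>A. c i * a i u v)"
proof
  note b = psd_form.axioms(1)[OF a]
  show "(\<Sum>i\<in>A. c i * a i (u + v) w) = (\<Sum>i\<in>A. c i * a i u w) + (\<Sum>i\<in>A. c i * a i v w)"
    if "u \<in> X" "v \<in> X" "w \<in> X" for u v w
    unfolding sum.distrib[symmetric]
    by (intro sum.cong refl) (simp add: bilinear_form.add_left[OF b that] distrib_left)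
  show "(\<Sum>i\<in>A. c i * a i (r *\<^sub>R u) w) = r * (\<Sum>i\<in>A. c i * a i u w)" if "u \<in> X" "w \<in> X" for u w r
    unfolding sum_distrib_left
    by (intro sum.cong refl) (simp add: bilinear_form.scale_left[OF b that])
  show "(\<Sum>i\<in>A. c i * a i u v) = (\<Sum>i\<in>A. c i * a i v u)" if "u \<in> X" "v \<in> X" for u v
    by (intro sum.cong refl arg_cong2[where f="(*)"] bilinear_form.sym[OF b that])
  show "0 \<le> (\<Sum>i\<in>A. c i * a i u u)" if "u \<in> X" for u
    by (intro sum_nonneg mult_nonneg_nonneg c psd_form.nonneg[OF a that])
qed (rule X)

lemma psd_form_cong:
  assumes "psd_form X b" and eq: "\<And>u v. u \<in> X \<Longrightarrow> v \<in> X \<Longrightarrow> a u v = b u v"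
  shows "psd_form X a"
proof -
  interpret b: psd_form X b by fact
  show ?thesis
  proof
    show "a u v = a v u" if "u \<in> X" "v \<in> X" for u v
      unfolding eq[OF that] eq[OF that(2,1)] by (rule b.sym[OF that])
  qed (simp_all add: b.subspace eq b.closed b.add_left b.scale_left b.nonneg)
qed

text \<open>The map \<open>D\<close> is linear only almost everywhere, because weak gradients are
  chosen representatives. All gradient, mean and stabilisation terms are instances.\<close>

lemma L2_psd_form:
  fixes D :: "'v::real_vector \<Rightarrow> 'a::euclidean_space \<Rightarrow> 'b::euclidean_space"
  assumes X: "subspace X" and S: "S \<in> sets lebesgue"
    and L: "\<And>u. u \<in> X \<Longrightarrow> D u \<in> L2_functions S"
    and add: "\<And>u v. u \<in> X \<Longrightarrow> v \<in> X \<Longrightarrow> AE x in lebesgue_on S. D (u + v) x = D u x + D v x"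
    and scale: "\<And>u c. u \<in> X \<Longrightarrow> AE x in lebesgue_on S. D (c *\<^sub>R u) x = c *\<^sub>R D u x"
  shows "psd_form X (\<lambda>u v. \<integral>x. D u x \<bullet> D v x \<partial>lebesgue_on S)"
proof
  note i = L2_inner_integrable[OF L L]
  show "(\<integral>x. D (u + v) x \<bullet> D w x \<partial>lebesgue_on S)
      = (\<integral>x. D u x \<bullet> D w x \<partial>lebesgue_on S) + (\<integral>x. D v x \<bullet> D w x \<partial>lebesgue_on S)"
    if u: "u \<in> X" "v \<in> X" "w \<in> X" for u v w
  proof -
    have "(\<integral>x. D (u + v) x \<bullet> D w x \<partial>lebesgue_on S) = (\<integral>x. D u x \<bullet> D w x + D v x \<bullet> D w x \<partial>lebesgue_on S)"
      by (rule integral_lebesgue_on_cong_AE[OF borel_measurable_integrable[OF i] S])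
        (use u add[OF u(1,2)] subspace_add[OF X] in \<open>auto simp: inner_add_left elim: eventually_mono\<close>)
    then show ?thesis using i[OF u(1,3)] i[OF u(2,3)] by simp
  qed
  show "(\<integral>x. D (c *\<^sub>R u) x \<bullet> D w x \<partial>lebesgue_on S) = c * (\<integral>x. D u x \<bullet> D w x \<partial>lebesgue_on S)"
    if u: "u \<in> X" "w \<in> X" for u w c
  proof -
    have "(\<integral>x. D (c *\<^sub>R u) x \<bullet> D w x \<partial>lebesgue_on S) = (\<integral>x. c * (D u x \<bullet> D w x) \<partial>lebesgue_on S)"
      by (rule integral_lebesgue_on_cong_AE[OF borel_measurable_integrable[OF i] S])
        (use u subspace_scale[OF X] eventually_mono[OF scale[OF u(1), of c]] in \<open>auto\<close>)
    then show ?thesis by simp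
  qed
  show "(\<integral>x. D u x \<bullet> D v x \<partial>lebesgue_on S) = (\<integral>x. D v x \<bullet> D u x \<partial>lebesgue_on S)" for u v
    by (simp add: inner_commute)
  show "0 \<le> (\<integral>x. D u x \<bullet> D u x \<partial>lebesgue_on S)" for u
    by (intro Bochner_Integration.integral_nonneg) simp
qed (rule X)

lemma L2_inner_eq_0_AE:
  assumes "f \<in> L2_functions S" "(\<integral>x. f x \<bullet> f x \<partial>lebesgue_on S) = 0"
  shows "AE x in lebesgue_on S. f x = 0"
proof -
  have "AE x in lebesgue_on S. f x \<bullet> f x = 0"
    using assms integral_nonneg_eq_0_iff_AE[OF L2_inner_integrable[OF assms(1,1)]] by simp
  then show ?thesis by simp
qed

text \<open>The induction carries membership in \<open>X\<close> along, since the form is linear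
  only there.\<close>

lemma (in bilinear_form) orthogonal_span:
  assumes v: "v \<in> X" and B: "B \<subseteq> X" and z: "\<And>z. z \<in> B \<Longrightarrow> a v z = 0" and x: "x \<in> span B"
  shows "a v x = 0"
proof -
  have "x \<in> X \<and> a v x = 0" using x
  proof (induction rule: span_induct_alt)
    case base
    show ?case using closed(3) zero_left[OF v] sym[OF v closed(3)] by simp
  next
    case (step c y w)
    then have "y \<in> X" "a v y = 0" using B z by auto
    then show ?case using step add_right[of "c *\<^sub>R y" w v] scale_right[of y v c] v closed by simp
  qed
  then show ?thesis by simp
qed

context mesh
begin

lemma AE_T: "T \<in> \<T> \<Longrightarrow> AE x in lebesgue_on (interior T). P x \<Longrightarrow> AE x in lebesgue_on T. P x"
  by (rule AE_lebesgue_on_null_diff[OF _ T_props(4) T_props(10)]) simp_all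

lemma AE_T_I: "T \<in> \<T> \<Longrightarrow> (\<And>x. x \<in> interior T \<Longrightarrow> P x) \<Longrightarrow> AE x in lebesgue_on T. P x"
  by (rule AE_T) (auto intro!: AE_I2)

lemma AE_mesh_T: "(\<And>T. T \<in> \<T> \<Longrightarrow> AE x in lebesgue_on T. P x) \<Longrightarrow> AE x in lebesgue_on \<Omega>. P x"
  by (rule AE_mesh) (rule AE_lebesgue_on_subset[OF interior_subset _ T_props(4)], simp_all)

text \<open>Coefficients that are constant on each simplex leave the integral over the domain; only
  values in the interiors of the simplices are consulted.\<close>

lemma weighted_integral:
  fixes a :: "'a \<Rightarrow> real" and f :: "'a set \<Rightarrow> 'a \<Rightarrow> real"
  assumes a: "\<And>T x. T \<in> \<T> \<Longrightarrow> x \<in> interior T \<Longrightarrow> a x = A T * f T x"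
    and i: "\<And>T. T \<in> \<T> \<Longrightarrow> integrable (lebesgue_on T) (f T)"
  shows "(\<integral>x. a x \<partial>lebesgue_on \<Omega>) = (\<Sum>T\<in>\<T>. A T * (\<integral>x. f T x \<partial>lebesgue_on T))"
proof -
  have "integrable (lebesgue_on (interior T)) a" if T: "T \<in> \<T>" for T
  proof -
    have "integrable (lebesgue_on (interior T)) (\<lambda>x. A T * f T x)"
      using i[OF T] integrable_null_diff[OF interior_subset[of T] _ T_props(4,10)[OF T], of "f T"] by simp
    then show ?thesis by (rule Bochner_Integration.integrable_cong[THEN iffD1, rotated -1]) (auto simp: a[OF T])
  qed
  then have "(\<integral>x. a x \<partial>lebesgue_on \<Omega>) = (\<Sum>T\<in>\<T>. \<integral>x. a x \<partial>lebesgue_on T)"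
    by (intro integral_split integrable_mesh)
  also have "\<dots> = (\<Sum>T\<in>\<T>. A T * (\<integral>x. f T x \<partial>lebesgue_on T))"
  proof (rule sum.cong[OF refl])
    fix T assume T: "T \<in> \<T>"
    have "(\<integral>x. a x \<partial>lebesgue_on T) = (\<integral>x. A T * f T x \<partial>lebesgue_on T)"
      by (rule integral_T_cong[OF T a[OF T]])
    then show "(\<integral>x. a x \<partial>lebesgue_on T) = A T * (\<integral>x. f T x \<partial>lebesgue_on T)" by simp
  qed
  finally show ?thesis .
qed

definition mean_on :: "'a set \<Rightarrow> ('a \<Rightarrow> real) \<Rightarrow> real" where
  "mean_on T v = (\<integral>x. v x \<partial>lebesgue_on T) / measure lebesgue T"

lemma V_pw_L2: "v \<in> V_pw \<T> \<Longrightarrow> T \<in> \<T> \<Longrightarrow> v \<in> L2_functions T"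
  by (rule V_pw_quadratic) (auto intro: quadratic_L2)

text \<open>The projection is a choice among functions that agree in the interiors of the simplices
  but are free on the skeleton, so existence and local uniqueness are both established.\<close>

lemma L2_proj0_interior:
  assumes v: "\<And>T. T \<in> \<T> \<Longrightarrow> v \<in> L2_functions T" and T: "T \<in> \<T>" and x: "x \<in> interior T"
  shows "L2_proj0 \<Omega> \<T> v x = mean_on T v"
proof -
  define Q where "Q p \<longleftrightarrow> p \<in> P0 \<T> \<and> (\<forall>q\<in>P0 \<T>. (\<integral>x. (v x - p x) * q x \<partial>lebesgue_on \<Omega>) = 0)" for p
  have iv: "integrable (lebesgue_on T) v" if "T \<in> \<T>" for T by (rule L2_integrable[OF T_props(5)[OF that] v[OF that]])
  have ic: "integrable (lebesgue_on T) (\<lambda>x. v x - c)" "(\<integral>x. v x - c \<partial>lebesgue_on T) = (\<integral>x. v x \<partial>lebesgue_on T) - c * measure lebesgue T"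
    if T: "T \<in> \<T>" for T c
  proof -
    have c: "integrable (lebesgue_on T) (\<lambda>x. c)"
      by (intro L2_integrable T_props(5)[OF T] L2_continuous_T[OF T] continuous_intros)
    then show "integrable (lebesgue_on T) (\<lambda>x. v x - c)" using iv[OF T] by simp
    show "(\<integral>x. v x - c \<partial>lebesgue_on T) = (\<integral>x. v x \<partial>lebesgue_on T) - c * measure lebesgue T"
      using iv[OF T] c T_props(4)[OF T] by (simp add: measure_restrict_space)
  qed
  have int: "(\<integral>x. (v x - p x) * q x \<partial>lebesgue_on \<Omega>)
      = (\<Sum>T\<in>\<T>. cq T * ((\<integral>x. v x \<partial>lebesgue_on T) - cp T * measure lebesgue T))"
    if "\<And>T x. T \<in> \<T> \<Longrightarrow> x \<in> interior T \<Longrightarrow> p x = cp T" "\<And>T x. T \<in> \<T> \<Longrightarrow> x \<in> interior T \<Longrightarrow> q x = cq T"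
    for p q cp cq
    using weighted_integral[where a="\<lambda>x. (v x - p x) * q x" and A=cq and f="\<lambda>T x. v x - cp T"] that ic by simp
  have P0_coeff: "\<exists>cp. \<forall>T\<in>\<T>. \<forall>x\<in>interior T. p x = cp T" if "p \<in> P0 \<T>" for p
    using that unfolding P0_def by (intro bchoice) blast
  have P0_glue: "glue (\<lambda>T x. c T) \<in> P0 \<T>" for c
    unfolding P0_def using glue_interior by blast
  \<comment> \<open>Existence: the piecewise means satisfy the defining equations.\<close>
  have "Q (glue (\<lambda>T x. mean_on T v))"
    unfolding Q_def
  proof (intro conjI ballI P0_glue)
    fix q assume "q \<in> P0 \<T>"
    then obtain cq where cq: "\<forall>T\<in>\<T>. \<forall>x\<in>interior T. q x = cq T" using P0_coeff by blast
    have "(\<integral>x. (v x - glue (\<lambda>T x. mean_on T v) x) * q x \<partial>lebesgue_on \<Omega>)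
      = (\<Sum>T\<in>\<T>. cq T * ((\<integral>x. v x \<partial>lebesgue_on T) - mean_on T v * measure lebesgue T))"
      by (rule int) (simp_all add: glue_interior cq)
    also have "\<dots> = 0"
    proof (intro sum.neutral ballI)
      show "cq T * ((\<integral>x. v x \<partial>lebesgue_on T) - mean_on T v * measure lebesgue T) = 0" if "T \<in> \<T>" for T
        using T_props(11)[OF that] by (simp add: mean_on_def)
    qed
    finally show "(\<integral>x. (v x - glue (\<lambda>T x. mean_on T v) x) * q x \<partial>lebesgue_on \<Omega>) = 0" .
  qed
  then have "Q (L2_proj0 \<Omega> \<T> v)" unfolding L2_proj0_def Q_def[symmetric] by (rule someI[of Q])
  then have p: "L2_proj0 \<Omega> \<T> v \<in> P0 \<T>" "\<And>q. q \<in> P0 \<T> \<Longrightarrow> (\<integral>x. (v x - L2_proj0 \<Omega> \<T> v x) * q x \<partial>lebesgue_on \<Omega>) = 0"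
    by (auto simp: Q_def)
  obtain cp where cp: "\<forall>T\<in>\<T>. \<forall>x\<in>interior T. L2_proj0 \<Omega> \<T> v x = cp T" using P0_coeff[OF p(1)] by blast
  \<comment> \<open>Uniqueness: testing with the indicator of the interior of \<open>T\<close>
    determines the constant there.\<close>
  have "0 = (\<integral>x. (v x - L2_proj0 \<Omega> \<T> v x) * glue (\<lambda>T' x. if T' = T then 1 else 0) x \<partial>lebesgue_on \<Omega>)"
    by (rule p(2)[OF P0_glue, symmetric])
  also have "\<dots> = (\<Sum>T'\<in>\<T>. (if T' = T then 1 else 0) * ((\<integral>x. v x \<partial>lebesgue_on T') - cp T' * measure lebesgue T'))"
    by (rule int) (simp_all add: glue_interior cp)
  also have "\<dots> = (\<Sum>T'\<in>\<T>. if T' = T then (\<integral>x. v x \<partial>lebesgue_on T) - cp T * measure lebesgue T else 0)"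
    by (intro sum.cong) auto
  also have "\<dots> = (\<integral>x. v x \<partial>lebesgue_on T) - cp T * measure lebesgue T" using T finite_\<T> by simp
  finally show ?thesis using cp T x T_props(11)[OF T] by (simp add: mean_on_def field_simps)
qed

lemma quadratic_weak_grad:
  assumes T: "T \<in> \<T>" and v: "quadratic_on T v c g d"
  shows "AE x in lebesgue_on T. weak_grad (interior T) v x = g + (2 * d) *\<^sub>R (x - mid T)"
  using T_props(6)[OF T] bounded_subset[OF _ interior_subset]
  by (intro AE_T[OF T] weak_grad_AE[OF open_interior _ C1_quadratic_gradient[OF T v]])

lemma V_pw_weak_grad:
  assumes T: "T \<in> \<T>" and u: "u \<in> V_pw \<T>"
  shows "weak_grad (interior T) u \<in> L2_functions T"
    "v \<in> V_pw \<T> \<Longrightarrow> AE x in lebesgue_on T. weak_grad (interior T) (u + v) x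
       = weak_grad (interior T) u x + weak_grad (interior T) v x"
    "AE x in lebesgue_on T. weak_grad (interior T) (r *\<^sub>R u) x = r *\<^sub>R weak_grad (interior T) u x"
proof -
  obtain c g d where q: "quadratic_on T u c g d" by (rule V_pw_quadratic[OF u T])
  have "weak_grad (interior T) u \<in> L2_functions (interior T)"
    using weak_grad_works[of u "interior T"] C1_quadratic_gradient[OF T q]
    unfolding H1_def has_weak_gradient_def by blast
  then show "weak_grad (interior T) u \<in> L2_functions T" using L2_interior_T[OF T] by blast
  show "AE x in lebesgue_on T. weak_grad (interior T) (u + v) x
       = weak_grad (interior T) u x + weak_grad (interior T) v x" if v: "v \<in> V_pw \<T>"
  proof -
    obtain c' g' d' where q': "quadratic_on T v c' g' d'" by (rule V_pw_quadratic[OF v T])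
    show ?thesis
      using quadratic_weak_grad[OF T q] quadratic_weak_grad[OF T q'] quadratic_weak_grad[OF T quadratic_on_add[OF q q']]
      by eventually_elim (simp add: scaleR_add_left distrib_left)
  qed
  show "AE x in lebesgue_on T. weak_grad (interior T) (r *\<^sub>R u) x = r *\<^sub>R weak_grad (interior T) u x"
    using quadratic_weak_grad[OF T q] quadratic_weak_grad[OF T quadratic_on_scale[OF q, of r]]
    by eventually_elim (simp add: scaleR_add_right mult.left_commute)
qed

lemma mean_on_linear:
  assumes "T \<in> \<T>" "u \<in> L2_functions T"
  shows "v \<in> L2_functions T \<Longrightarrow> mean_on T (u + v) = mean_on T u + mean_on T v"
    "mean_on T (r *\<^sub>R u) = r * mean_on T u"
proof -
  note i = L2_integrable[OF T_props(5)[OF assms(1)]]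
  show "mean_on T (u + v) = mean_on T u + mean_on T v" if "v \<in> L2_functions T"
    unfolding mean_on_def plus_fun_def Bochner_Integration.integral_add[OF i[OF assms(2)] i[OF that]]
    by (rule add_divide_distrib)
  show "mean_on T (r *\<^sub>R u) = r * mean_on T u"
    by (simp add: mean_on_def scaleR_fun_def)
qed

lemma weak_grad_null:
  assumes T: "T \<in> \<T>" and v: "AE x in lebesgue_on T. v x = 0"
  shows "AE x in lebesgue_on T. weak_grad (interior T) v x = 0"
proof -
  have b: "bounded (interior T)" using bounded_subset[OF T_props(6)[OF T] interior_subset] .
  have "quadratic_on T (\<lambda>_. 0) 0 0 0" by (simp add: quadratic_on_def)
  then have "has_weak_gradient (interior T) (\<lambda>_. 0) (\<lambda>x. 0)" using C1_quadratic_gradient[OF T, of "\<lambda>_. 0" 0 0 0] by simp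
  moreover have "AE x in lebesgue_on (interior T). 0 = v x"
    using AE_lebesgue_on_subset[OF interior_subset _ T_props(4)[OF T] v] by (auto elim: eventually_mono)
  ultimately have "has_weak_gradient (interior T) v (\<lambda>x. 0)"
    by (rule has_weak_gradient_AE_cong[OF open_interior]) simp
  then show ?thesis by (intro AE_T[OF T] weak_grad_AE[OF open_interior b])
qed

text \<open>Integrating the square, the mixed term vanishes because the field is centred at the
  barycentre, and two nonnegative terms with positive weights remain.\<close>

lemma quadratic_gradient_null:
  assumes T: "T \<in> \<T>" and z: "AE x in lebesgue_on T. g + (2 * d) *\<^sub>R (x - mid T) = 0"
  shows "g = 0" "d = 0"
proof -
  interpret S: simplex_in_domain "vertices T" \<Omega> by (rule simplex_in_domain[OF T])
  note eq = vertices_simplex(2)[OF T]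
  let ?J = "\<integral>x. (norm (x - mid T))\<^sup>2 \<partial>lebesgue_on T"
  have "S.bubble_coeff * ?J > 0"
    unfolding S.bubble_coeff_integral[OF S.dim2, unfolded eq] using T_props(11)[OF T] by simp
  then have J: "?J > 0" using S.bubble_coeff_pos by (simp add: zero_less_mult_iff)
  have "(norm (g + (2 * d) *\<^sub>R (x - mid T)))\<^sup>2
      = (g \<bullet> g - (4 * d) * (g \<bullet> mid T)) + ((4 * d) *\<^sub>R g) \<bullet> x + (4 * d\<^sup>2) * (norm (x - mid T))\<^sup>2" for x
    unfolding power2_norm_eq_inner by (simp add: algebra_simps inner_commute power2_eq_square)
  then have "(\<integral>x. (norm (g + (2 * d) *\<^sub>R (x - mid T)))\<^sup>2 \<partial>lebesgue_on T)
      = measure lebesgue T * (g \<bullet> g - (4 * d) * (g \<bullet> mid T) + ((4 * d) *\<^sub>R g) \<bullet> mid T) + 4 * d\<^sup>2 * ?J"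
    using S.integral_quadratic[OF S.dim2, unfolded eq] by (simp only:)
  also have "(\<integral>x. (norm (g + (2 * d) *\<^sub>R (x - mid T)))\<^sup>2 \<partial>lebesgue_on T) = 0"
    using z by (intro integral_eq_zero_AE) (auto elim: eventually_mono)
  finally have "measure lebesgue T * (g \<bullet> g) + 4 * d\<^sup>2 * ?J = 0" by simp
  moreover have "measure lebesgue T * (g \<bullet> g) \<ge> 0" "4 * d\<^sup>2 * ?J \<ge> 0" using J by simp_all
  ultimately have "measure lebesgue T * (g \<bullet> g) = 0" "4 * d\<^sup>2 * ?J = 0" by linarith+
  then show "g = 0" "d = 0" using J T_props(11)[OF T] by simp_all
qed

text \<open>Vanishing gradients remove the linear parts and the bubbles. The remaining constants
  agree across faces by continuity at midpoints and vanish at boundary faces, so they are all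
  zero.\<close>

lemma V_nc_weak_grad_0:
  assumes u: "u \<in> V_nc \<Omega> \<T>" and z: "\<And>T. T \<in> \<T> \<Longrightarrow> AE x in lebesgue_on T. weak_grad (interior T) u x = 0"
    and T: "T \<in> \<T>"
  shows "AE x in lebesgue_on T. u x = 0"
proof -
  obtain v w where vw: "u = v + w" "v \<in> CR10 \<Omega> \<T>" "w \<in> bubbles \<T>" using u unfolding V_nc_def by blast
  obtain \<beta> where \<beta>: "w = (\<Sum>T\<in>\<T>. \<beta> T *\<^sub>R bubble T)" by (rule bubbles_combination[OF vw(3)])
  have "\<exists>c. quadratic_on T v c 0 0 \<and> \<beta> T = 0" if T: "T \<in> \<T>" for T
  proof -
    obtain c g where v: "quadratic_on T v c g 0" by (rule P1_affine[OF CR10D(1)[OF vw(2)] T])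
    let ?k = "full_simplex.bubble_coeff (vertices T)"
    have "AE x in lebesgue_on T. g + (2 * - (\<beta> T * ?k)) *\<^sub>R (x - mid T) = 0"
      using quadratic_weak_grad[OF T quadratic_bubble_sum[OF T v, of \<beta>, folded \<beta> vw(1)]] z[OF T]
      by eventually_elim simp
    from quadratic_gradient_null[OF T this] have "g = 0" "\<beta> T * ?k = 0" by simp_all
    moreover have "?k > 0" by (rule full_simplex.bubble_coeff_pos[OF vertices_simplex(1)[OF T]])
    ultimately show ?thesis using v by auto
  qed
  then obtain c where c: "\<And>T. T \<in> \<T> \<Longrightarrow> quadratic_on T v (c T) 0 0" "\<And>T. T \<in> \<T> \<Longrightarrow> \<beta> T = 0" by metis
  have tr: "trace_from T v (mid F) = c T" if "T \<in> \<T>" "F facet_of T" for T F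
    using trace_from_affine[OF that(1) facet_mid_in[OF that] c(1)[OF that(1)]] by simp
  have c0: "c T = 0"
  proof (rule facewise_constant_eq_0[OF _ _ T])
    show "c T = 0" if "T \<in> \<T>" "F facet_of T" "F \<subseteq> frontier \<Omega>" for T F
      unfolding tr[OF that(1,2), symmetric] by (rule CR10D(2)[OF vw(2) that])
    show "c T = c T'" if "T \<in> \<T>" "T' \<in> \<T>" "T \<noteq> T'" "F facet_of T" "F facet_of T'" for T T' F
      unfolding tr[OF that(1,4), symmetric] tr[OF that(2,5), symmetric] by (rule CR10D(3)[OF vw(2) that])
  qed
  show ?thesis
  proof (rule AE_T_I[OF T])
    fix x assume x: "x \<in> interior T"
    have "v x = c T + 0 \<bullet> x + 0 * (norm (x - mid T))\<^sup>2" using c(1)[OF T] x unfolding quadratic_on_def by blast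
    then show "u x = 0" unfolding vw(1) \<beta> plus_fun_apply sum_bubbles_interior[OF T x] c(2)[OF T] c0 by simp
  qed
qed

end

section \<open>Local projection onto quadratics\<close>

context mesh
begin

text \<open>A spanning set of the local quadratics. It serves both as the target of the local
  projection and as a finite family of functionals separating discrete functions.\<close>

definition moments :: "'a set \<Rightarrow> ('a \<Rightarrow> real) set" where
  "moments T = insert (\<lambda>x. 1) (insert (\<lambda>x. (norm (x - mid T))\<^sup>2) ((\<lambda>b x. x \<bullet> b) ` Basis))"

lemma finite_moments: "finite (moments T)" by (simp add: moments_def)

lemma span_moments:
  assumes "v \<in> span (moments T)"
  obtains c g d where "quadratic_on T v c g d"
proof -
  have "\<exists>c g d. quadratic_on T v c g d"
    using assms
  proof (induction rule: span_induct_alt)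
    case base
    have "quadratic_on T 0 0 0 0" by (simp add: quadratic_on_def)
    then show ?case by blast
  next
    case (step r m v)
    from step(1) have "\<exists>c g d. quadratic_on T m c g d"
    proof (unfold moments_def, elim insertE imageE)
      show "\<exists>c g d. quadratic_on T m c g d" if "m = (\<lambda>x. 1)"
        by (intro exI[of _ 1] exI[of _ "0::'a"] exI[of _ "0::real"]) (simp add: quadratic_on_def that)
      show "\<exists>c g d. quadratic_on T m c g d" if "m = (\<lambda>x. (norm (x - mid T))\<^sup>2)"
        by (intro exI[of _ "0::real"] exI[of _ "0::'a"] exI[of _ "1::real"]) (simp add: quadratic_on_def that)
      show "\<exists>c g d. quadratic_on T m c g d" if "m = (\<lambda>x. x \<bullet> b)" for b
        by (intro exI[of _ "0::real"] exI[of _ b] exI[of _ "0::real"]) (simp add: quadratic_on_def that inner_commute)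
    qed
    then obtain c g d where m: "quadratic_on T m c g d" by blast
    obtain c' g' d' where v: "quadratic_on T v c' g' d'" using step.IH by blast
    from quadratic_on_add[OF quadratic_on_scale[OF m, of r] v] show ?case by blast
  qed
  then show thesis using that by blast
qed

lemma quadratic_in_span_moments: "(\<lambda>x. c + g \<bullet> x + d * (norm (x - mid T))\<^sup>2) \<in> span (moments T)"
proof -
  have "c *\<^sub>R (\<lambda>x. 1) + (\<Sum>b\<in>Basis. (g \<bullet> b) *\<^sub>R (\<lambda>x. x \<bullet> b)) + d *\<^sub>R (\<lambda>x. (norm (x - mid T))\<^sup>2) \<in> span (moments T)"
    by (intro span_add span_scale span_sum) (auto intro: span_base simp: moments_def)
  also have "c *\<^sub>R (\<lambda>x. 1) + (\<Sum>b\<in>Basis. (g \<bullet> b) *\<^sub>R (\<lambda>x. x \<bullet> b)) + d *\<^sub>R (\<lambda>x. (norm (x - mid T))\<^sup>2)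
      = (\<lambda>x. c + g \<bullet> x + d * (norm (x - mid T))\<^sup>2)"
    by (rule ext) (simp add: scaleR_fun_apply sum_fun_apply euclidean_inner[symmetric])
  finally show ?thesis .
qed

lemma moments_L2:
  assumes T: "T \<in> \<T>"
  shows "moments T \<subseteq> L2_functions T"
proof
  fix m assume "m \<in> moments T"
  then have "m \<in> span (moments T)" by (rule span_base)
  then obtain c g d where "quadratic_on T m c g d" by (rule span_moments)
  then show "m \<in> L2_functions T" by (rule quadratic_L2[OF T])
qed

abbreviation inner_T :: "'a set \<Rightarrow> ('a \<Rightarrow> real) \<Rightarrow> ('a \<Rightarrow> real) \<Rightarrow> real" where
  "inner_T T u v \<equiv> \<integral>x. u x \<bullet> v x \<partial>lebesgue_on T"

lemma subspace_L2: "subspace (L2_functions S :: ('a \<Rightarrow> real) set)"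
  unfolding subspace_def
proof (intro conjI ballI allI)
  show "0 \<in> L2_functions S" by (simp add: L2_functions_def zero_fun_def)
  show "u + v \<in> L2_functions S" if "u \<in> L2_functions S" "v \<in> L2_functions S" for u v
    unfolding plus_fun_def by (rule L2_add[OF that])
  show "r *\<^sub>R u \<in> L2_functions S" if "u \<in> L2_functions S" for r u
    unfolding scaleR_fun_def by (rule L2_scale[OF that])
qed

lemma inner_T_psd_form: "T \<in> \<T> \<Longrightarrow> psd_form (L2_functions T) (inner_T T)"
  by (rule L2_psd_form[where D="\<lambda>u. u", OF subspace_L2 T_props(4)]) (auto simp: scaleR_fun_apply)

lemma V_pw_moments_0:
  assumes T: "T \<in> \<T>" and v: "v \<in> V_pw \<T>" and z: "\<And>m. m \<in> moments T \<Longrightarrow> inner_T T v m = 0"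
  shows "AE x in lebesgue_on T. v x = 0"
proof -
  interpret psd_form "L2_functions T" "inner_T T" by (rule inner_T_psd_form[OF T])
  obtain c g d where q: "quadratic_on T v c g d" by (rule V_pw_quadratic[OF v T])
  have "inner_T T v v = inner_T T v (\<lambda>x. c + g \<bullet> x + d * (norm (x - mid T))\<^sup>2)"
    using q by (intro integral_T_cong[OF T]) (simp add: quadratic_on_def)
  also have "\<dots> = 0" by (rule orthogonal_span[OF V_pw_L2[OF v T] moments_L2[OF T] z quadratic_in_span_moments])
  finally show ?thesis by (intro L2_inner_eq_0_AE V_pw_L2[OF v T])
qed

text \<open>Without conditions across faces the local projections can be glued, and orthogonality
  holds on every simplex separately.\<close>

lemma V_pw_projection:
  assumes u: "u \<in> L2_functions \<Omega>"
  obtains y where "y \<in> V_pw \<T>" "\<And>T z. T \<in> \<T> \<Longrightarrow> z \<in> V_pw \<T> \<Longrightarrow> inner_T T (u - y) z = 0"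
proof -
  have "\<exists>p. p \<in> span (moments T) \<and> (\<forall>z\<in>span (moments T). inner_T T (u - p) z = 0)" if T: "T \<in> \<T>" for T
    using psd_form.projection_exists[OF inner_T_psd_form[OF T] finite_moments moments_L2[OF T] L2_T[OF T u]] by blast
  then obtain p where p: "\<And>T. T \<in> \<T> \<Longrightarrow> p T \<in> span (moments T)"
    "\<And>T z. T \<in> \<T> \<Longrightarrow> z \<in> span (moments T) \<Longrightarrow> inner_T T (u - p T) z = 0" by metis
  define y where "y = glue p"
  have y: "y x = p T x" if "T \<in> \<T>" "x \<in> interior T" for T x unfolding y_def by (rule glue_interior[OF that])
  show thesis
  proof
    show "y \<in> V_pw \<T>"
      unfolding V_pw_iff
    proof
      fix T assume T: "T \<in> \<T>"
      obtain c g d where "quadratic_on T (p T) c g d" by (rule span_moments[OF p(1)[OF T]])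
      then have "quadratic_on T y c g d" using y[OF T] by (simp add: quadratic_on_def)
      then show "\<exists>c g d. quadratic_on T y c g d" by blast
    qed
    fix T z assume T: "T \<in> \<T>" and z: "z \<in> V_pw \<T>"
    obtain c g d where q: "quadratic_on T z c g d" by (rule V_pw_quadratic[OF z T])
    have "inner_T T (u - y) z = inner_T T (u - p T) (\<lambda>x. c + g \<bullet> x + d * (norm (x - mid T))\<^sup>2)"
      using q y[OF T] by (intro integral_T_cong[OF T]) (simp add: quadratic_on_def)
    also have "\<dots> = 0" by (rule p(2)[OF T quadratic_in_span_moments])
    finally show "inner_T T (u - y) z = 0" .
  qed
qed

end

section \<open>The stabilised eigenvalue problem\<close>

locale sCR_problem = mesh \<Omega> \<T> for \<Omega> :: "'a::euclidean_space set" and \<T> +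
  fixes \<alpha> V :: "'a \<Rightarrow> real" and \<alpha>lo \<kappa> :: real and A W :: "'a set \<Rightarrow> real"
  assumes \<alpha>lo: "0 < \<alpha>lo"
    and A: "\<And>T x. T \<in> \<T> \<Longrightarrow> x \<in> interior T \<Longrightarrow> \<alpha> x = A T" and A_lo: "\<And>T. T \<in> \<T> \<Longrightarrow> \<alpha>lo \<le> A T"
    and W: "\<And>T x. T \<in> \<T> \<Longrightarrow> x \<in> interior T \<Longrightarrow> V x = W T" and W_nonneg: "\<And>T. T \<in> \<T> \<Longrightarrow> 0 \<le> W T"
    and \<kappa>: "eCR_constant \<Omega> \<T> \<kappa>"
begin

abbreviation "exact \<equiv> exact_a \<Omega> \<alpha> V"
abbreviation "stab \<equiv> a_es \<Omega> \<T> \<alpha> V \<alpha>lo \<kappa>"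

lemma A_pos: "T \<in> \<T> \<Longrightarrow> 0 < A T" using A_lo \<alpha>lo by force

lemma \<kappa>_pos: "0 < \<kappa>" using \<kappa> by (simp add: eCR_constant_def)

lemma exact_a_eq:
  assumes u: "u \<in> H10 \<Omega>" and v: "v \<in> H10 \<Omega>"
  shows "exact u v = (\<Sum>T\<in>\<T>. A T * (\<integral>x. weak_grad \<Omega> u x \<bullet> weak_grad \<Omega> v x \<partial>lebesgue_on T))
    + (\<Sum>T\<in>\<T>. W T * inner_T T u v)"
proof -
  have "(\<integral>x. \<alpha> x * (weak_grad \<Omega> u x \<bullet> weak_grad \<Omega> v x) \<partial>lebesgue_on \<Omega>)
      = (\<Sum>T\<in>\<T>. A T * (\<integral>x. weak_grad \<Omega> u x \<bullet> weak_grad \<Omega> v x \<partial>lebesgue_on T))"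
  proof (rule weighted_integral)
    show "\<alpha> x * (weak_grad \<Omega> u x \<bullet> weak_grad \<Omega> v x) = A T * (weak_grad \<Omega> u x \<bullet> weak_grad \<Omega> v x)"
      if "T \<in> \<T>" "x \<in> interior T" for T x unfolding A[OF that] ..
    show "integrable (lebesgue_on T) (\<lambda>x. weak_grad \<Omega> u x \<bullet> weak_grad \<Omega> v x)" if "T \<in> \<T>" for T
      by (rule L2_inner_integrable[OF L2_T[OF that H10_L2(2)[OF u]] L2_T[OF that H10_L2(2)[OF v]]])
  qed
  moreover have "inner_V \<Omega> V u v = (\<Sum>T\<in>\<T>. W T * inner_T T u v)"
    unfolding inner_V_def
  proof (rule weighted_integral)
    show "V x * u x * v x = W T * (u x \<bullet> v x)" if "T \<in> \<T>" "x \<in> interior T" for T x unfolding W[OF that] by simp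
    show "integrable (lebesgue_on T) (\<lambda>x. u x \<bullet> v x)" if "T \<in> \<T>" for T
      by (rule L2_inner_integrable[OF L2_T[OF that H10_L2(1)[OF u]] L2_T[OF that H10_L2(1)[OF v]]])
  qed
  ultimately show ?thesis by (simp add: exact_a_def)
qed

lemma exact_psd_form: "psd_form (H10 \<Omega>) exact"
proof (rule psd_form_cong[OF psd_form_add exact_a_eq])
  show "psd_form (H10 \<Omega>) (\<lambda>u v. \<Sum>T\<in>\<T>. A T * (\<integral>x. weak_grad \<Omega> u x \<bullet> weak_grad \<Omega> v x \<partial>lebesgue_on T))"
  proof (rule psd_form_sum[OF subspace_H10])
    fix T assume T: "T \<in> \<T>"
    show "psd_form (H10 \<Omega>) (\<lambda>u v. \<integral>x. weak_grad \<Omega> u x \<bullet> weak_grad \<Omega> v x \<partial>lebesgue_on T)"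
      by (rule L2_psd_form[where D="weak_grad \<Omega>", OF subspace_H10 T_props(4)[OF T] L2_T[OF T H10_L2(2)]
            AE_interior_T(2)[OF T weak_grad_add_AE] AE_interior_T(2)[OF T weak_grad_scale_AE]])
    show "0 \<le> A T" by (rule less_imp_le[OF A_pos[OF T]])
  qed
  show "psd_form (H10 \<Omega>) (\<lambda>u v. \<Sum>T\<in>\<T>. W T * inner_T T u v)"
  proof (rule psd_form_sum[OF subspace_H10 _ W_nonneg])
    fix T assume T: "T \<in> \<T>"
    show "psd_form (H10 \<Omega>) (inner_T T)"
      by (rule L2_psd_form[where D="\<lambda>u. u", OF subspace_H10 T_props(4)[OF T] L2_T[OF T H10_L2(1)]])
        (simp_all add: scaleR_fun_apply)
  qed
qed

lemma exact_b_psd_form: "psd_form (H10 \<Omega>) (exact_b \<Omega>)"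
  unfolding exact_b_def inner_real_def[symmetric]
  by (rule L2_psd_form[where D="\<lambda>u. u", OF subspace_H10 sets_\<Omega> H10_L2(1)]) (simp_all add: scaleR_fun_apply)

lemma exact_b_null: "u \<in> H10 \<Omega> \<Longrightarrow> exact_b \<Omega> u u = 0 \<Longrightarrow> u \<in> null_functions \<Omega>"
  unfolding exact_b_def inner_real_def[symmetric] null_functions_def
  using L2_inner_eq_0_AE[OF H10_L2(1)] by blast

text \<open>The local stabilisation factor: multiplied by the squared interpolation constant on
  \<open>T\<close>, it leaves just \<open>\<alpha>lo\<close>.\<close>

definition stab_weight :: "'a set \<Rightarrow> real" where
  "stab_weight T = \<alpha>lo / (\<kappa>\<^sup>2 * (diameter T)\<^sup>2)"

lemma stab_weight_pos: "T \<in> \<T> \<Longrightarrow> 0 < stab_weight T"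
  unfolding stab_weight_def using \<alpha>lo \<kappa>_pos T_props(12) by (intro divide_pos_pos mult_pos_pos zero_less_power)

lemma V_esD: "x \<in> V_es \<Omega> \<T> \<Longrightarrow> fst x \<in> V_pw \<T>" "x \<in> V_es \<Omega> \<T> \<Longrightarrow> snd x \<in> V_nc \<Omega> \<T>" "x \<in> V_es \<Omega> \<T> \<Longrightarrow> snd x \<in> V_pw \<T>"
  using V_nc_subset_V_pw by (auto simp: V_es_def)

lemma subspace_V_es: "subspace (V_es \<Omega> \<T>)"
  unfolding V_es_def by (intro subspace_Times subspace_V_pw subspace_V_nc)

lemma a_es_eq:
  assumes x: "x \<in> V_es \<Omega> \<T>" and y: "y \<in> V_es \<Omega> \<T>"
  shows "stab x y = (\<Sum>T\<in>\<T>. A T * (\<integral>z. weak_grad (interior T) (snd x) z \<bullet> weak_grad (interior T) (snd y) z \<partial>lebesgue_on T))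
    + (\<Sum>T\<in>\<T>. W T * inner_T T (\<lambda>z. mean_on T (snd x)) (\<lambda>z. mean_on T (snd y)))
    + (\<Sum>T\<in>\<T>. stab_weight T * inner_T T (fst x - snd x) (fst y - snd y))"
proof -
  note xy = V_esD[OF x] V_esD[OF y]
  have "a_pw \<T> \<alpha> (snd x) (snd y)
      = (\<Sum>T\<in>\<T>. A T * (\<integral>z. weak_grad (interior T) (snd x) z \<bullet> weak_grad (interior T) (snd y) z \<partial>lebesgue_on T))"
    unfolding a_pw_def
  proof (rule sum.cong[OF refl])
    fix T assume T: "T \<in> \<T>"
    have "(\<integral>z. \<alpha> z * (weak_grad (interior T) (snd x) z \<bullet> weak_grad (interior T) (snd y) z) \<partial>lebesgue_on T)
      = (\<integral>z. A T * (weak_grad (interior T) (snd x) z \<bullet> weak_grad (interior T) (snd y) z) \<partial>lebesgue_on T)"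
      by (rule integral_T_cong[OF T]) (simp add: A[OF T])
    then show "(\<integral>z. \<alpha> z * (weak_grad (interior T) (snd x) z \<bullet> weak_grad (interior T) (snd y) z) \<partial>lebesgue_on T)
      = A T * (\<integral>z. weak_grad (interior T) (snd x) z \<bullet> weak_grad (interior T) (snd y) z \<partial>lebesgue_on T)" by simp
  qed
  moreover have "inner_V \<Omega> V (L2_proj0 \<Omega> \<T> (snd x)) (L2_proj0 \<Omega> \<T> (snd y))
      = (\<Sum>T\<in>\<T>. W T * inner_T T (\<lambda>z. mean_on T (snd x)) (\<lambda>z. mean_on T (snd y)))"
    unfolding inner_V_def
  proof (rule weighted_integral)
    fix T assume T: "T \<in> \<T>"
    show "V z * L2_proj0 \<Omega> \<T> (snd x) z * L2_proj0 \<Omega> \<T> (snd y) z = W T * (mean_on T (snd x) \<bullet> mean_on T (snd y))"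
      if "z \<in> interior T" for z
      using L2_proj0_interior[OF V_pw_L2 T that] xy W[OF T that] by simp
    show "integrable (lebesgue_on T) (\<lambda>z. mean_on T (snd x) \<bullet> mean_on T (snd y))"
      by (intro L2_inner_integrable L2_continuous_T[OF T] continuous_intros)
  qed
  moreover have "\<alpha>lo / \<kappa>\<^sup>2 * (\<integral>z. (fst x z - snd x z) * (fst y z - snd y z) / (mesh_size \<T> z)\<^sup>2 \<partial>lebesgue_on \<Omega>)
      = (\<Sum>T\<in>\<T>. stab_weight T * inner_T T (fst x - snd x) (fst y - snd y))"
  proof -
    have "(\<integral>z. (fst x z - snd x z) * (fst y z - snd y z) / (mesh_size \<T> z)\<^sup>2 \<partial>lebesgue_on \<Omega>)
      = (\<Sum>T\<in>\<T>. 1 / (diameter T)\<^sup>2 * inner_T T (fst x - snd x) (fst y - snd y))"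
    proof (rule weighted_integral)
      fix T assume T: "T \<in> \<T>"
      show "(fst x z - snd x z) * (fst y z - snd y z) / (mesh_size \<T> z)\<^sup>2
        = 1 / (diameter T)\<^sup>2 * ((fst x - snd x) z \<bullet> (fst y - snd y) z)" if "z \<in> interior T" for z
        by (simp add: mesh_size_interior[OF T that])
      show "integrable (lebesgue_on T) (\<lambda>z. (fst x - snd x) z \<bullet> (fst y - snd y) z)"
        by (intro L2_inner_integrable V_pw_L2 subspace_diff subspace_V_pw xy T)
    qed
    then show ?thesis by (simp add: stab_weight_def sum_distrib_left)
  qed
  ultimately show ?thesis by (simp add: a_es_def case_prod_beta)
qed

lemma stab_psd_form: "psd_form (V_es \<Omega> \<T>) stab"
proof (rule psd_form_cong[OF psd_form_add[OF psd_form_add] a_es_eq])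
  show "psd_form (V_es \<Omega> \<T>) (\<lambda>x y. \<Sum>T\<in>\<T>. A T *
      (\<integral>z. weak_grad (interior T) (snd x) z \<bullet> weak_grad (interior T) (snd y) z \<partial>lebesgue_on T))"
  proof (rule psd_form_sum[OF subspace_V_es])
    fix T assume T: "T \<in> \<T>"
    show "psd_form (V_es \<Omega> \<T>) (\<lambda>x y.
        \<integral>z. weak_grad (interior T) (snd x) z \<bullet> weak_grad (interior T) (snd y) z \<partial>lebesgue_on T)"
      by (rule L2_psd_form[where D="\<lambda>x. weak_grad (interior T) (snd x)", OF subspace_V_es T_props(4)[OF T]
            V_pw_weak_grad(1)[OF T V_esD(3)]])
        (simp_all add: V_pw_weak_grad(2,3)[OF T] V_esD(3))
    show "0 \<le> A T" by (rule less_imp_le[OF A_pos[OF T]])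
  qed
  show "psd_form (V_es \<Omega> \<T>) (\<lambda>x y. \<Sum>T\<in>\<T>. W T * inner_T T (\<lambda>z. mean_on T (snd x)) (\<lambda>z. mean_on T (snd y)))"
  proof (rule psd_form_sum[OF subspace_V_es _ W_nonneg])
    fix T assume T: "T \<in> \<T>"
    show "psd_form (V_es \<Omega> \<T>) (\<lambda>x y. inner_T T (\<lambda>z. mean_on T (snd x)) (\<lambda>z. mean_on T (snd y)))"
    proof (rule L2_psd_form[where D="\<lambda>x z. mean_on T (snd x)", OF subspace_V_es T_props(4)[OF T]])
      show "(\<lambda>z. mean_on T (snd x)) \<in> L2_functions T" for x
        by (rule L2_continuous_T[OF T]) (intro continuous_intros)
      fix x y r assume x: "x \<in> V_es \<Omega> \<T>"
      note L = V_pw_L2[OF V_esD(3) T]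
      show "AE z in lebesgue_on T. mean_on T (snd (x + y)) = mean_on T (snd x) + mean_on T (snd y)" if "y \<in> V_es \<Omega> \<T>"
        using mean_on_linear(1)[OF T L[OF x] L[OF that]] by simp
      show "AE z in lebesgue_on T. mean_on T (snd (r *\<^sub>R x)) = r *\<^sub>R mean_on T (snd x)"
        using mean_on_linear(2)[OF T L[OF x]] by simp
    qed
  qed
  show "psd_form (V_es \<Omega> \<T>) (\<lambda>x y. \<Sum>T\<in>\<T>. stab_weight T * inner_T T (fst x - snd x) (fst y - snd y))"
  proof (rule psd_form_sum[OF subspace_V_es _ less_imp_le[OF stab_weight_pos]])
    fix T assume T: "T \<in> \<T>"
    show "psd_form (V_es \<Omega> \<T>) (\<lambda>x y. inner_T T (fst x - snd x) (fst y - snd y))"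
      by (rule L2_psd_form[where D="\<lambda>x. fst x - snd x", OF subspace_V_es T_props(4)[OF T]
            V_pw_L2[OF subspace_diff[OF subspace_V_pw V_esD(1) V_esD(3)] T]])
        (simp_all add: scaleR_fun_apply right_diff_distrib)
  qed
qed

lemma b_es_psd_form: "psd_form (V_es \<Omega> \<T>) (b_es \<Omega>)"
proof (rule psd_form_cong)
  show "psd_form (V_es \<Omega> \<T>) (\<lambda>x y. \<integral>z. fst x z \<bullet> fst y z \<partial>lebesgue_on \<Omega>)"
  proof (rule L2_psd_form[where D=fst, OF subspace_V_es sets_\<Omega>])
    show "fst x \<in> L2_functions \<Omega>" if "x \<in> V_es \<Omega> \<T>" for x
      using V_esD(1)[OF that] L2_interior_T V_pw_L2 by (intro L2_mesh) blast
  qed (simp_all add: scaleR_fun_apply)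
qed (simp add: b_es_def case_prod_beta)

end

section \<open>Comparison of the two problems\<close>

text \<open>The denominator is the larger of one and \<open>\<epsilon> * l / \<alpha>lo\<close>, so
  the bound is the smaller of \<open>l\<close> and \<open>\<alpha>lo / \<epsilon>\<close>.\<close>

lemma GLB_le:
  assumes \<epsilon>: "0 < \<epsilon>" and \<alpha>lo: "0 < \<alpha>lo" and l: "0 \<le> l"
  shows "GLB \<epsilon> \<alpha>lo l \<le> l" "GLB \<epsilon> \<alpha>lo l \<le> ereal (\<alpha>lo / \<epsilon>)"
proof -
  have "GLB \<epsilon> \<alpha>lo l \<le> l \<and> GLB \<epsilon> \<alpha>lo l \<le> ereal (\<alpha>lo / \<epsilon>)"
  proof (cases l)
    case (real r)
    then have r: "0 \<le> r" using l by simp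
    define m where "m = 1 + max 0 (\<epsilon> * r / \<alpha>lo - 1)"
    have m: "1 \<le> m" "\<epsilon> * r / \<alpha>lo \<le> m" by (simp_all add: m_def)
    have "ereal \<epsilon> * l / ereal \<alpha>lo - 1 = ereal (\<epsilon> * r / \<alpha>lo - 1)"
      using \<alpha>lo real by (simp add: one_ereal_def)
    then have "1 + max 0 (ereal \<epsilon> * l / ereal \<alpha>lo - 1) = ereal m"
      by (simp only: m_def one_ereal_def zero_ereal_def ereal_max[symmetric] plus_ereal.simps)
    then have "GLB \<epsilon> \<alpha>lo l = ereal (r / m)"
      using m real unfolding GLB_def by simp
    moreover have "r / m \<le> r" using m r by (simp add: divide_le_eq mult_left_le_one_le mult_le_cancel_left1)
    moreover have "r / m \<le> \<alpha>lo / \<epsilon>" using m \<epsilon> \<alpha>lo by (simp add: field_simps)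
    ultimately show ?thesis using real by simp
  qed (use l in \<open>simp_all add: GLB_def\<close>)
  then show "GLB \<epsilon> \<alpha>lo l \<le> l" "GLB \<epsilon> \<alpha>lo l \<le> ereal (\<alpha>lo / \<epsilon>)" by auto
qed

lemma (in mesh) integral_const_T:
  assumes "T \<in> \<T>"
  shows "(\<integral>x. c \<partial>lebesgue_on T) = measure lebesgue T * (c::real)"
  using T_props(4)[OF assms] by (simp add: measure_restrict_space)

context sCR_problem
begin

lemma stab_null:
  assumes x: "x \<in> V_es \<Omega> \<T>"
    and z: "\<And>T. T \<in> \<T> \<Longrightarrow> AE z in lebesgue_on T. fst x z = 0" "\<And>T. T \<in> \<T> \<Longrightarrow> AE z in lebesgue_on T. snd x z = 0"
  shows "stab x x = 0"
proof -
  have "(\<integral>z. weak_grad (interior T) (snd x) z \<bullet> weak_grad (interior T) (snd x) z \<partial>lebesgue_on T) = 0"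
    if "T \<in> \<T>" for T
    using weak_grad_null[OF that z(2)[OF that]] by (intro integral_eq_zero_AE) (auto elim: eventually_mono)
  moreover have "mean_on T (snd x) = 0" if "T \<in> \<T>" for T
    using integral_eq_zero_AE[OF z(2)[OF that]] by (simp add: mean_on_def)
  moreover have "inner_T T (fst x - snd x) (fst x - snd x) = 0" if "T \<in> \<T>" for T
  proof (rule integral_eq_zero_AE)
    show "AE z in lebesgue_on T. (fst x - snd x) z \<bullet> (fst x - snd x) z = 0"
      using z(1)[OF that] z(2)[OF that] by eventually_elim simp
  qed
  ultimately show ?thesis unfolding a_es_eq[OF x x] by simp
qed

text \<open>All three contributions are nonnegative, so each vanishes. Zero gradients make the
  nonconforming component null, and then the stabilisation does the same for the piecewise
  component.\<close>

lemma stab_definite: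
  assumes x: "x \<in> V_es \<Omega> \<T>" and z: "stab x x = 0"
  shows "b_es \<Omega> x x = 0"
proof -
  let ?G = "\<lambda>T. \<integral>z. weak_grad (interior T) (snd x) z \<bullet> weak_grad (interior T) (snd x) z \<partial>lebesgue_on T"
  let ?M = "\<lambda>T. inner_T T (\<lambda>z. mean_on T (snd x)) (\<lambda>z. mean_on T (snd x))"
  let ?S = "\<lambda>T. inner_T T (fst x - snd x) (fst x - snd x)"
  have nn: "0 \<le> A T * ?G T" "0 \<le> W T * ?M T" "0 \<le> stab_weight T * ?S T" if "T \<in> \<T>" for T
    by (rule mult_nonneg_nonneg[OF less_imp_le[OF A_pos[OF that]] Bochner_Integration.integral_nonneg], simp,
      rule mult_nonneg_nonneg[OF W_nonneg[OF that] Bochner_Integration.integral_nonneg], simp,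
      rule mult_nonneg_nonneg[OF less_imp_le[OF stab_weight_pos[OF that]] Bochner_Integration.integral_nonneg], simp)
  have s: "(\<Sum>T\<in>\<T>. A T * ?G T) + (\<Sum>T\<in>\<T>. W T * ?M T) + (\<Sum>T\<in>\<T>. stab_weight T * ?S T) = 0"
    using z unfolding a_es_eq[OF x x] .
  have "0 \<le> (\<Sum>T\<in>\<T>. A T * ?G T)" "0 \<le> (\<Sum>T\<in>\<T>. W T * ?M T)" "0 \<le> (\<Sum>T\<in>\<T>. stab_weight T * ?S T)"
    by (rule sum_nonneg[OF nn(1)], assumption, rule sum_nonneg[OF nn(2)], assumption, rule sum_nonneg[OF nn(3)], assumption)
  then have "(\<Sum>T\<in>\<T>. A T * ?G T) = 0" "(\<Sum>T\<in>\<T>. stab_weight T * ?S T) = 0" using s by linarith+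
  then have "\<forall>T\<in>\<T>. A T * ?G T = 0" "\<forall>T\<in>\<T>. stab_weight T * ?S T = 0"
    using sum_nonneg_eq_0_iff[OF finite_\<T> nn(1)] sum_nonneg_eq_0_iff[OF finite_\<T> nn(3)] by simp_all
  then have G: "?G T = 0" and S: "?S T = 0" if "T \<in> \<T>" for T
    using that A_pos[OF that] stab_weight_pos[OF that] by auto
  have G0: "AE z in lebesgue_on T. weak_grad (interior T) (snd x) z = 0" if "T \<in> \<T>" for T
    by (rule L2_inner_eq_0_AE[OF V_pw_weak_grad(1)[OF that V_esD(3)[OF x]] G[OF that]])
  have n: "AE z in lebesgue_on T. snd x z = 0" if "T \<in> \<T>" for T
    by (rule V_nc_weak_grad_0[OF V_esD(2)[OF x] _ that]) (rule G0)
  have "AE z in lebesgue_on T. fst x z = 0" if T: "T \<in> \<T>" for T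
  proof -
    have "AE z in lebesgue_on T. (fst x - snd x) z = 0"
      by (rule L2_inner_eq_0_AE[OF V_pw_L2[OF subspace_diff[OF subspace_V_pw V_esD(1)[OF x] V_esD(3)[OF x]] T] S[OF T]])
    then show ?thesis using n[OF T] by eventually_elim simp
  qed
  from AE_mesh_T[OF this] have "AE z in lebesgue_on \<Omega>. fst x z = 0" .
  then show ?thesis
    unfolding b_es_def by (auto simp: case_prod_beta intro!: integral_eq_zero_AE elim: eventually_mono)
qed

lemma h_max_ge: "T \<in> \<T> \<Longrightarrow> diameter T \<le> h_max \<T>"
  unfolding h_max_def using finite_\<T> by simp

lemma h_max_pos: "0 < h_max \<T>"
proof -
  have "\<Omega> \<noteq> {}" using lipschitz by (simp add: lipschitz_domain_def)
  then have "\<T> \<noteq> {}" using Union_\<T> closure_subset[of \<Omega>] by auto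
  then obtain T where T: "T \<in> \<T>" by blast
  show ?thesis using T_props(12)[OF T] h_max_ge[OF T] by simp
qed

abbreviation "weight \<equiv> \<alpha>lo / ((h_max \<T>)\<^sup>2 * \<kappa>\<^sup>2)"

text \<open>A uniform constant over all simplices is required to sum the local estimates into global
  norms; the largest diameter gives the smallest weight.\<close>

lemma weight_le: "T \<in> \<T> \<Longrightarrow> weight \<le> stab_weight T"
  unfolding stab_weight_def using \<alpha>lo \<kappa>_pos T_props(12)[of T] h_max_ge[of T]
  by (intro divide_left_mono) (auto simp: mult.commute intro!: mult_mono power_mono mult_pos_pos)

lemma inner_T_Pythagoras:
  assumes T: "T \<in> \<T>" and u: "u \<in> L2_functions T" and v: "v \<in> L2_functions T" and z: "inner_T T (u - v) v = 0"
  shows "inner_T T u u = inner_T T (u - v) (u - v) + inner_T T v v"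
proof -
  interpret psd_form "L2_functions T" "inner_T T" by (rule inner_T_psd_form[OF T])
  have d: "u - v \<in> L2_functions T" using u v closed by simp
  have "inner_T T (u - v) u = inner_T T (u - v) (u - v)" using diff_right[OF u v d] z by simp
  moreover have "inner_T T u v = inner_T T v v" using diff_left[OF u v v] z by simp
  moreover have "inner_T T (u - v) u = inner_T T u u - inner_T T v u" by (rule diff_left[OF u v u])
  moreover have "inner_T T v u = inner_T T u v" by (rule sym[OF v u])
  ultimately show ?thesis by simp
qed

text \<open>On one simplex: the gradient of the interpolation error \<open>u - w\<close> is orthogonal to the gradient of
  \<open>w\<close>, and its norm dominates the stabilisation, in which the error splits at the projection \<open>y\<close>.\<close>

lemma local_estimate:
  assumes u: "u \<in> H10 \<Omega>" and y: "y \<in> V_pw \<T>" and T: "T \<in> \<T>"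
    and orth: "\<And>z. z \<in> V_pw \<T> \<Longrightarrow> inner_T T (u - y) z = 0"
  defines "w \<equiv> I_eCR \<Omega> \<T> u"
  shows "A T * (\<integral>x. weak_grad (interior T) w x \<bullet> weak_grad (interior T) w x \<partial>lebesgue_on T)
      + W T * inner_T T (\<lambda>x. mean_on T w) (\<lambda>x. mean_on T w) + stab_weight T * inner_T T (y - w) (y - w)
    \<le> A T * (\<integral>x. weak_grad \<Omega> u x \<bullet> weak_grad \<Omega> u x \<partial>lebesgue_on T) + W T * inner_T T u u
      - weight * (inner_T T u u - inner_T T y y)"
    "inner_T T y y \<le> inner_T T u u"
proof -
  interpret S: simplex_in_domain "vertices T" \<Omega> by (rule simplex_in_domain[OF T])
  note eq = vertices_simplex(2)[OF T]
  obtain c g d where q: "quadratic_on T w c g d"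
    and mean: "(\<integral>x. u x - w x \<partial>lebesgue_on T) = 0"
    and ff: "\<And>p. p \<in> vertices T \<Longrightarrow> S.face_functional p (\<lambda>x. u x - w x) (\<lambda>x. weak_grad \<Omega> u x - (g + (2 * d) *\<^sub>R (x - mid T))) = 0"
    unfolding w_def by (rule I_eCR_local[OF u T]) (rule that[unfolded w_def])
  let ?G = "\<lambda>x. g + (2 * d) *\<^sub>R (x - mid T)"
  let ?E = "\<lambda>x. weak_grad \<Omega> u x - ?G x"
  have w: "w \<in> V_pw \<T>" unfolding w_def using I_eCR_in_V_nc V_nc_subset_V_pw by blast
  note uL = L2_T[OF T H10_L2(1)[OF u]] and yL = V_pw_L2[OF y T] and wL = V_pw_L2[OF w T]
  have GL: "?G \<in> L2_functions T" by (intro L2_continuous_T[OF T] continuous_intros)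
  have EL: "?E \<in> L2_functions T" by (rule L2_diff[OF L2_T[OF T H10_L2(2)[OF u]] GL])
  have EG: "(\<integral>x. ?E x \<bullet> ?G x \<partial>lebesgue_on T) = 0"
    by (rule S.orthogonal_to_gradients[unfolded eq, OF EL mean ff])
  have grad_u: "(\<integral>x. weak_grad \<Omega> u x \<bullet> weak_grad \<Omega> u x \<partial>lebesgue_on T)
      = (\<integral>x. ?E x \<bullet> ?E x \<partial>lebesgue_on T) + (\<integral>x. ?G x \<bullet> ?G x \<partial>lebesgue_on T)"
  proof -
    have "weak_grad \<Omega> u x \<bullet> weak_grad \<Omega> u x = ?E x \<bullet> ?E x + 2 * (?E x \<bullet> ?G x) + ?G x \<bullet> ?G x" for x
      by (simp add: inner_diff_left inner_diff_right inner_commute[of "weak_grad \<Omega> u x" "?G x"])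
    then have "(\<integral>x. weak_grad \<Omega> u x \<bullet> weak_grad \<Omega> u x \<partial>lebesgue_on T)
      = (\<integral>x. ?E x \<bullet> ?E x + 2 * (?E x \<bullet> ?G x) + ?G x \<bullet> ?G x \<partial>lebesgue_on T)" by (simp only:)
    also have "\<dots> = (\<integral>x. ?E x \<bullet> ?E x \<partial>lebesgue_on T) + 2 * (\<integral>x. ?E x \<bullet> ?G x \<partial>lebesgue_on T)
        + (\<integral>x. ?G x \<bullet> ?G x \<partial>lebesgue_on T)"
      by (subst Bochner_Integration.integral_add Bochner_Integration.integral_mult_right_zero |
          intro Bochner_Integration.integrable_add integrable_mult_right L2_inner_integrable EL GL | rule refl)+
    finally show ?thesis using EG by simp
  qed
  have grad_w: "(\<integral>x. weak_grad (interior T) w x \<bullet> weak_grad (interior T) w x \<partial>lebesgue_on T)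
      = (\<integral>x. ?G x \<bullet> ?G x \<partial>lebesgue_on T)"
  proof (rule integral_lebesgue_on_cong_AE[OF _ T_props(4)[OF T]])
    show "(\<lambda>x. weak_grad (interior T) w x \<bullet> weak_grad (interior T) w x) \<in> borel_measurable (lebesgue_on T)"
      by (rule borel_measurable_integrable[OF L2_inner_integrable[OF V_pw_weak_grad(1)[OF T w] V_pw_weak_grad(1)[OF T w]]])
    show "AE x in lebesgue_on T. weak_grad (interior T) w x \<bullet> weak_grad (interior T) w x = ?G x \<bullet> ?G x"
      using quadratic_weak_grad[OF T q] by eventually_elim (simp only:)
  qed
  have b: "bounded (interior T)" using bounded_subset[OF T_props(6)[OF T] interior_subset] .
  have err: "inner_T T (u - w) (u - w) \<le> \<kappa>\<^sup>2 * (diameter T)\<^sup>2 * (\<integral>x. ?E x \<bullet> ?E x \<partial>lebesgue_on T)"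
  proof -
    have "has_weak_gradient (interior T) (u - w) ?E"
      unfolding fun_diff_def
      by (rule has_weak_gradient_diff[OF open_interior b has_weak_gradient_restrict[OF open_interior
              interior_T_subset[OF T] open_domain H10_weak_gradient[OF u]] C1_quadratic_gradient[OF T q]])
    from AE_T[OF T weak_grad_AE[OF open_interior b this]]
    have ae: "AE x in lebesgue_on T. ?E x = weak_grad (interior T) (u - w) x" by eventually_elim simp
    have "(L2_norm T (weak_grad (interior T) (u - w)))\<^sup>2 = (\<integral>x. ?E x \<bullet> ?E x \<partial>lebesgue_on T)"
      unfolding L2_norm_square power2_norm_eq_inner
    proof (rule integral_lebesgue_on_cong_AE[OF _ T_props(4)[OF T], symmetric])
      show "(\<lambda>x. ?E x \<bullet> ?E x) \<in> borel_measurable (lebesgue_on T)"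
        by (rule borel_measurable_integrable[OF L2_inner_integrable[OF EL EL]])
      show "AE x in lebesgue_on T. ?E x \<bullet> ?E x = weak_grad (interior T) (u - w) x \<bullet> weak_grad (interior T) (u - w) x"
        using ae by eventually_elim (simp only:)
    qed
    moreover have "L2_norm T (u - w) \<le> \<kappa> * diameter T * L2_norm T (weak_grad (interior T) (u - w))"
      using \<kappa> u T unfolding eCR_constant_def w_def by blast
    then have "(L2_norm T (u - w))\<^sup>2 \<le> (\<kappa> * diameter T * L2_norm T (weak_grad (interior T) (u - w)))\<^sup>2"
      by (rule power_mono) (simp add: L2_norm_def)
    then have "inner_T T (u - w) (u - w) \<le> \<kappa>\<^sup>2 * (diameter T)\<^sup>2 * (L2_norm T (weak_grad (interior T) (u - w)))\<^sup>2"
      unfolding L2_norm_square[of T "u - w"] power2_norm_eq_inner by (simp add: power_mult_distrib)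
    ultimately show ?thesis by simp
  qed
  have yw: "y - w \<in> V_pw \<T>" by (rule subspace_diff[OF subspace_V_pw y w])
  have uwL: "u - w \<in> L2_functions T" by (rule subspace_diff[OF subspace_L2 uL wL])
  have split_u: "inner_T T u u = inner_T T (u - y) (u - y) + inner_T T y y"
    by (rule inner_T_Pythagoras[OF T uL yL orth[OF y]])
  \<comment> \<open>The difference \<open>y - w\<close> is itself a discrete function, so the
    projection error \<open>u - y\<close> is orthogonal to it.\<close>
  have "u - w - (y - w) = u - y" by simp
  from inner_T_Pythagoras[OF T uwL V_pw_L2[OF yw T], unfolded this, OF orth[OF yw]]
  have split_uw: "inner_T T (u - w) (u - w) = inner_T T (u - y) (u - y) + inner_T T (y - w) (y - w)" .
  have uy: "0 \<le> inner_T T (u - y) (u - y)" by (intro Bochner_Integration.integral_nonneg) simp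
  show "inner_T T y y \<le> inner_T T u u" using split_u uy by simp
  have E0: "0 \<le> (\<integral>x. ?E x \<bullet> ?E x \<partial>lebesgue_on T)" by (intro Bochner_Integration.integral_nonneg) simp
  have "stab_weight T * inner_T T (u - w) (u - w)
      \<le> stab_weight T * (\<kappa>\<^sup>2 * (diameter T)\<^sup>2 * (\<integral>x. ?E x \<bullet> ?E x \<partial>lebesgue_on T))"
    by (rule mult_left_mono[OF err less_imp_le[OF stab_weight_pos[OF T]]])
  also have "\<dots> = \<alpha>lo * (\<integral>x. ?E x \<bullet> ?E x \<partial>lebesgue_on T)"
    using \<kappa>_pos T_props(12)[OF T] by (simp add: stab_weight_def)
  also have "\<dots> \<le> A T * (\<integral>x. ?E x \<bullet> ?E x \<partial>lebesgue_on T)" by (rule mult_right_mono[OF A_lo[OF T] E0])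
  finally have stab1: "stab_weight T * inner_T T (u - y) (u - y) + stab_weight T * inner_T T (y - w) (y - w)
      \<le> A T * (\<integral>x. ?E x \<bullet> ?E x \<partial>lebesgue_on T)"
    unfolding split_uw by (simp add: distrib_left)
  have stab2: "weight * inner_T T (u - y) (u - y) \<le> stab_weight T * inner_T T (u - y) (u - y)"
    by (rule mult_right_mono[OF weight_le[OF T] uy])
  \<comment> \<open>The interpolation preserves the mean over \<open>T\<close>, so the mean of
    \<open>w\<close> is that of \<open>u\<close>, and Cauchy-Schwarz against the constant one bounds
    it.\<close>
  have "inner_T T (\<lambda>x. mean_on T w) (\<lambda>x. mean_on T w) \<le> inner_T T u u"
  proof -
    let ?v = "measure lebesgue T"
    have "mean_on T w * ?v = (\<integral>x. u x \<partial>lebesgue_on T)"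
      using mean Bochner_Integration.integral_diff[OF L2_integrable[OF T_props(5)[OF T] uL] L2_integrable[OF T_props(5)[OF T] wL]]
        T_props(11)[OF T] by (simp add: mean_on_def)
    moreover have "(\<integral>x. u x \<bullet> 1 \<partial>lebesgue_on T)\<^sup>2 \<le> (\<integral>x. (norm (u x))\<^sup>2 \<partial>lebesgue_on T) * (\<integral>x. (norm (1::real))\<^sup>2 \<partial>lebesgue_on T)"
      by (rule L2_Cauchy_Schwarz[OF uL]) (intro L2_continuous_T[OF T] continuous_intros)
    moreover have "(\<integral>x. (norm (1::real))\<^sup>2 \<partial>lebesgue_on T) = ?v" using integral_const_T[OF T, of 1] by simp
    ultimately have "(mean_on T w * ?v)\<^sup>2 \<le> inner_T T u u * ?v"
      by (simp add: power2_eq_square)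
    then have "(mean_on T w)\<^sup>2 * ?v * ?v \<le> inner_T T u u * ?v" by (simp add: power2_eq_square ac_simps)
    then have "(mean_on T w)\<^sup>2 * ?v \<le> inner_T T u u" using T_props(11)[OF T] by simp
    then show ?thesis unfolding integral_const_T[OF T] by (simp add: power2_eq_square mult.commute)
  qed
  from mult_left_mono[OF this W_nonneg[OF T]]
  show "A T * (\<integral>x. weak_grad (interior T) w x \<bullet> weak_grad (interior T) w x \<partial>lebesgue_on T)
      + W T * inner_T T (\<lambda>x. mean_on T w) (\<lambda>x. mean_on T w) + stab_weight T * inner_T T (y - w) (y - w)
    \<le> A T * (\<integral>x. weak_grad \<Omega> u x \<bullet> weak_grad \<Omega> u x \<partial>lebesgue_on T) + W T * inner_T T u u
      - weight * (inner_T T u u - inner_T T y y)"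
    unfolding grad_w grad_u using split_u stab1 stab2 by (simp add: distrib_left)
qed

lemma global_estimate:
  assumes u: "u \<in> H10 \<Omega>" and y: "y \<in> V_pw \<T>"
    and orth: "\<And>T z. T \<in> \<T> \<Longrightarrow> z \<in> V_pw \<T> \<Longrightarrow> inner_T T (u - y) z = 0"
  defines "x \<equiv> (y, I_eCR \<Omega> \<T> u)"
  shows "stab x x \<le> exact u u - weight * (exact_b \<Omega> u u - b_es \<Omega> x x)" "b_es \<Omega> x x \<le> exact_b \<Omega> u u"
proof -
  have x: "x \<in> V_es \<Omega> \<T>" using y I_eCR_in_V_nc by (simp add: x_def V_es_def)
  have b: "exact_b \<Omega> u u = (\<Sum>T\<in>\<T>. inner_T T u u)"
    unfolding exact_b_def inner_real_def[symmetric]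
    by (rule integral_split[OF L2_inner_integrable[OF H10_L2(1)[OF u] H10_L2(1)[OF u]]])
  have yL: "y \<in> L2_functions \<Omega>" using V_pw_L2[OF y] L2_interior_T by (intro L2_mesh) blast
  have b': "b_es \<Omega> x x = (\<Sum>T\<in>\<T>. inner_T T y y)"
    using integral_split[OF L2_inner_integrable[OF yL yL]] by (simp add: b_es_def x_def)
  note loc = local_estimate[OF u y _ orth]
  show "b_es \<Omega> x x \<le> exact_b \<Omega> u u" unfolding b b' by (rule sum_mono) (rule loc(2))
  have "weight * (exact_b \<Omega> u u - b_es \<Omega> x x) = (\<Sum>T\<in>\<T>. weight * (inner_T T u u - inner_T T y y))"
    unfolding b b' sum_subtractf[symmetric] sum_distrib_left ..
  then show "stab x x \<le> exact u u - weight * (exact_b \<Omega> u u - b_es \<Omega> x x)"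
    unfolding a_es_eq[OF x x] exact_a_eq[OF u u] sum.distrib[symmetric]
    by (simp only: sum_subtractf[symmetric]) (rule sum_mono, simp only: x_def fst_conv snd_conv, rule loc(1))
qed

text \<open>The projections are chosen only for the \<open>k\<close> given functions and then
  combined linearly. Orthogonality and interpolation are linear, so each combination of pairs is the
  pair of projection and interpolant of the combined function, and the estimate applies to
  it.\<close>

lemma count_le:
  assumes k: "k > 0" and \<mu>: "0 < \<mu>" "\<mu> < weight"
    and count: "enat k \<le> eigenvalue_count (null_functions \<Omega>) (H10 \<Omega>) exact (exact_b \<Omega>) \<mu>"
  shows "enat k \<le> eigenvalue_count (null_functions \<Omega> \<times> null_functions \<Omega>) (V_es \<Omega> \<T>) stab (b_es \<Omega>) \<mu>"
proof -
  obtain u where u: "\<And>j. j < k \<Longrightarrow> u j \<in> H10 \<Omega>"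
    and u_bound: "\<And>c. \<exists>j<k. c j \<noteq> 0 \<Longrightarrow>
       0 < exact_b \<Omega> (\<Sum>j<k. c j *\<^sub>R u j) (\<Sum>j<k. c j *\<^sub>R u j) \<and>
       exact (\<Sum>j<k. c j *\<^sub>R u j) (\<Sum>j<k. c j *\<^sub>R u j) \<le> \<mu> * exact_b \<Omega> (\<Sum>j<k. c j *\<^sub>R u j) (\<Sum>j<k. c j *\<^sub>R u j)"
    by (rule eigenvalue_count_family[OF psd_form.axioms(1)[OF exact_psd_form] exact_b_psd_form _ count k])
      (erule (1) exact_b_null, rule that)
  have "\<exists>y. y \<in> V_pw \<T> \<and> (\<forall>T\<in>\<T>. \<forall>z\<in>V_pw \<T>. inner_T T (u j - y) z = 0)" if "j < k" for j
    using V_pw_projection[OF H10_L2(1)[OF u[OF that]]] by metis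
  then obtain y where y: "\<And>j. j < k \<Longrightarrow> y j \<in> V_pw \<T>"
    "\<And>j T z. j < k \<Longrightarrow> T \<in> \<T> \<Longrightarrow> z \<in> V_pw \<T> \<Longrightarrow> inner_T T (u j - y j) z = 0" by metis
  define w where "w j = (y j, I_eCR \<Omega> \<T> (u j))" for j
  \<comment> \<open>Moments of one component on one simplex, the flag \<open>s\<close> selecting the
    component. A pair for which all of them vanish is null, so these are the separating functionals
    of the greedy construction.\<close>
  define f where "f = (\<lambda>(T, m, s) x. inner_T T (if s then fst x else snd x) m)"
  define I where "I = (SIGMA T:\<T>. moments T \<times> (UNIV :: bool set))"
  note lin = bilinear_form.add_left[OF psd_form.axioms(1)[OF inner_T_psd_form]]
    bilinear_form.scale_left[OF psd_form.axioms(1)[OF inner_T_psd_form]]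
  show ?thesis
  proof (rule eigenvalue_count_ge[where f=f and I=I and w=w])
    show "psd_form (V_es \<Omega> \<T>) stab" "psd_form (V_es \<Omega> \<T>) (b_es \<Omega>)" by (rule stab_psd_form, rule b_es_psd_form)
    show "b_es \<Omega> x x = 0" if "x \<in> V_es \<Omega> \<T>" "stab x x = 0" for x by (rule stab_definite[OF that])
    show "stab x x = 0" if "x \<in> V_es \<Omega> \<T>" "x \<in> null_functions \<Omega> \<times> null_functions \<Omega>" for x
    proof (rule stab_null[OF that(1)])
      have "fst x \<in> null_functions \<Omega>" "snd x \<in> null_functions \<Omega>" using that(2) by auto
      then have n: "AE z in lebesgue_on \<Omega>. fst x z = 0" "AE z in lebesgue_on \<Omega>. snd x z = 0"
        by (auto simp: null_functions_def)
      show "AE z in lebesgue_on T. fst x z = 0" if "T \<in> \<T>" for T by (rule AE_interior_T(2)[OF that n(1)])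
      show "AE z in lebesgue_on T. snd x z = 0" if "T \<in> \<T>" for T by (rule AE_interior_T(2)[OF that n(2)])
    qed
    show "finite I" unfolding I_def using finite_\<T> finite_moments by (intro finite_SigmaI finite_cartesian_product) auto
    show "f i (x + x') = f i x + f i x'" if i: "i \<in> I" and x: "x \<in> V_es \<Omega> \<T>" "x' \<in> V_es \<Omega> \<T>" for i x x'
    proof -
      obtain T m s where i': "i = (T, m, s)" "T \<in> \<T>" "m \<in> moments T" using i by (auto simp: I_def)
      note L = V_pw_L2[OF V_esD(1) i'(2)] V_pw_L2[OF V_esD(3) i'(2)] and m = subsetD[OF moments_L2[OF i'(2)] i'(3)]
      show ?thesis
        unfolding f_def i'(1) using lin(1)[OF i'(2) L(1)[OF x(1)] L(1)[OF x(2)] m] lin(1)[OF i'(2) L(2)[OF x(1)] L(2)[OF x(2)] m]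
        by (cases s) (simp_all only: prod.case fst_add snd_add if_True if_False)
    qed
    show "f i (c *\<^sub>R x) = c * f i x" if i: "i \<in> I" and x: "x \<in> V_es \<Omega> \<T>" for i x c
    proof -
      obtain T m s where i': "i = (T, m, s)" "T \<in> \<T>" "m \<in> moments T" using i by (auto simp: I_def)
      note L = V_pw_L2[OF V_esD(1)[OF x] i'(2)] V_pw_L2[OF V_esD(3)[OF x] i'(2)] and m = subsetD[OF moments_L2[OF i'(2)] i'(3)]
      show ?thesis
        unfolding f_def i'(1) using lin(2)[OF i'(2) L(1) m] lin(2)[OF i'(2) L(2) m]
        by (cases s) (simp_all only: prod.case fst_scaleR snd_scaleR if_True if_False)
    qed
    show "stab x x = 0" if x: "x \<in> V_es \<Omega> \<T>" and z: "\<And>i. i \<in> I \<Longrightarrow> f i x = 0" for x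
    proof (rule stab_null[OF x])
      fix T assume T: "T \<in> \<T>"
      have "inner_T T (fst x) m = 0" "inner_T T (snd x) m = 0" if "m \<in> moments T" for m
        using z[of "(T, m, True)"] z[of "(T, m, False)"] T that by (simp_all add: I_def f_def)
      then show "AE z in lebesgue_on T. fst x z = 0" "AE z in lebesgue_on T. snd x z = 0"
        using V_pw_moments_0[OF T V_esD(1)[OF x]] V_pw_moments_0[OF T V_esD(3)[OF x]] by blast+
    qed
    show "w j \<in> V_es \<Omega> \<T>" if "j < k" for j using y(1)[OF that] I_eCR_in_V_nc by (simp add: w_def V_es_def)
    fix c :: "nat \<Rightarrow> real" assume c: "\<exists>j<k. c j \<noteq> 0"
    let ?u = "\<Sum>j<k. c j *\<^sub>R u j" and ?y = "\<Sum>j<k. c j *\<^sub>R y j" and ?x = "\<Sum>j<k. c j *\<^sub>R w j"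
    have I_u: "I_eCR \<Omega> \<T> ?u = (\<Sum>j<k. c j *\<^sub>R I_eCR \<Omega> \<T> (u j))" by (rule I_eCR_sum) (rule u)
    have x: "?x = (?y, I_eCR \<Omega> \<T> ?u)"
      unfolding I_u w_def
      by (rule prod_eqI) (simp_all only: fst_sum snd_sum fst_scaleR snd_scaleR fst_conv snd_conv)
    have uH: "?u \<in> H10 \<Omega>" using u by (intro subspace_sum subspace_scale subspace_H10) auto
    have yV: "?y \<in> V_pw \<T>" using y(1) by (intro subspace_sum subspace_scale subspace_V_pw) auto
    have orth: "inner_T T (?u - ?y) z = 0" if T: "T \<in> \<T>" and z: "z \<in> V_pw \<T>" for T z
    proof -
      have L: "u j - y j \<in> L2_functions T" if "j \<in> {..<k}" for j
        using that by (intro subspace_diff subspace_L2 L2_T[OF T] H10_L2 u V_pw_L2[OF y(1) T]) auto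
      have s: "?u - ?y = (\<Sum>j<k. c j *\<^sub>R (u j - y j))" unfolding scaleR_diff_right sum_subtractf ..
      have "inner_T T (?u - ?y) z = (\<Sum>j<k. c j * inner_T T (u j - y j) z)"
        unfolding s
        by (rule bilinear_form.sum_left[OF psd_form.axioms(1)[OF inner_T_psd_form[OF T]] _ V_pw_L2[OF z T]]) (rule L)
      also have "\<dots> = 0" using y(2)[OF _ T z] by (intro sum.neutral) simp
      finally show ?thesis .
    qed
    note est = global_estimate[OF uH yV orth, folded x]
    have xV: "?x \<in> V_es \<Omega> \<T>" unfolding x using yV I_eCR_in_V_nc by (simp add: V_es_def)
    define B where "B = exact_b \<Omega> ?u ?u"
    define B' where "B' = b_es \<Omega> ?x ?x"
    have B: "0 < B" "exact ?u ?u \<le> \<mu> * B" using u_bound[OF c] by (simp_all add: B_def)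
    have e: "stab ?x ?x \<le> \<mu> * B - weight * (B - B')" "B' \<le> B" using est B(2) by (simp_all add: B_def B'_def)
    \<comment> \<open>The norm lost in the projection is charged at the rate \<open>weight\<close>,
      which exceeds \<open>\<mu>\<close>; what is left of the energy is at most
      \<open>\<mu> * B'\<close>.\<close>
    have d: "\<mu> * (B - B') \<le> weight * (B - B')" using \<mu>(2) e(2) by (intro mult_right_mono) auto
    have nn: "0 \<le> stab ?x ?x" "0 \<le> B'"
      unfolding B'_def by (rule psd_form.nonneg[OF stab_psd_form xV], rule psd_form.nonneg[OF b_es_psd_form xV])
    \<comment> \<open>If the quadratic part were null, the energy would be at most
      \<open>(\<mu> - weight) * B\<close>, which is negative by the strict inequality.\<close>
    have "B' \<noteq> 0"
    proof
      assume "B' = 0"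
      then have "0 \<le> \<mu> * B - weight * B" using e(1) nn(1) by simp
      moreover have "\<mu> * B < weight * B" using \<mu>(2) B(1) by (rule mult_strict_right_mono)
      ultimately show False by simp
    qed
    moreover have "stab ?x ?x \<le> \<mu> * B'" using e(1) d unfolding right_diff_distrib by linarith
    ultimately show "0 < b_es \<Omega> ?x ?x \<and> stab ?x ?x \<le> \<mu> * b_es \<Omega> ?x ?x" using nn(2) unfolding B'_def by simp
  qed (rule \<mu>(1))
qed

lemma lower_bound:
  assumes k: "k > 0"
  shows "GLB ((h_max \<T>)\<^sup>2 * \<kappa>\<^sup>2) \<alpha>lo (sCR_eigenvalue \<Omega> \<T> \<alpha> V \<alpha>lo \<kappa> k) \<le> exact_eigenvalue \<Omega> \<alpha> V k"
proof -
  let ?l = "sCR_eigenvalue \<Omega> \<T> \<alpha> V \<alpha>lo \<kappa> k" and ?\<epsilon> = "(h_max \<T>)\<^sup>2 * \<kappa>\<^sup>2"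
  have \<epsilon>: "0 < ?\<epsilon>" using h_max_pos \<kappa>_pos by simp
  have l: "0 \<le> ?l" unfolding sCR_eigenvalue_def kth_eigenvalue_def by (rule Inf_greatest) auto
  note G = GLB_le[OF \<epsilon> \<alpha>lo l]
  show ?thesis
    unfolding exact_eigenvalue_def kth_eigenvalue_def
  proof (rule Inf_greatest, elim CollectE exE conjE)
    fix e \<mu> assume e: "e = ereal \<mu>" and \<mu>: "0 < \<mu>"
      and count: "enat k \<le> eigenvalue_count (null_functions \<Omega>) (H10 \<Omega>) exact (exact_b \<Omega>) \<mu>"
    show "GLB ?\<epsilon> \<alpha>lo ?l \<le> e"
    proof (cases "\<mu> < weight")
      case True
      have "?l \<le> ereal \<mu>"
        unfolding sCR_eigenvalue_def kth_eigenvalue_def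
        using count_le[OF k \<mu> True count] \<mu> by (intro Inf_lower) blast
      then show ?thesis using G(1) e by simp
    next
      case False
      then have "ereal weight \<le> e" using e by simp
      with G(2) show ?thesis by (rule order_trans)
    qed
  qed
qed

end

text \<open>The interior of a simplex is open and nonempty, hence not a null set, so an almost
  everywhere bound reaches the constant value there.\<close>

lemma (in mesh) P0_lower_bound:
  assumes v: "v \<in> P0 \<T>" and ae: "AE x in lebesgue_on \<Omega>. c \<le> v x"
  obtains A where "\<And>T x. T \<in> \<T> \<Longrightarrow> x \<in> interior T \<Longrightarrow> v x = A T" "\<And>T. T \<in> \<T> \<Longrightarrow> c \<le> A T"
proof -
  have "\<exists>A. \<forall>T\<in>\<T>. \<forall>x\<in>interior T. v x = A T"
    using v unfolding P0_def by (intro bchoice) blast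
  then obtain A where A: "\<forall>T\<in>\<T>. \<forall>x\<in>interior T. v x = A T" by blast
  have "c \<le> A T" if T: "T \<in> \<T>" for T
  proof (rule ccontr)
    assume n: "\<not> c \<le> A T"
    have "\<not> c \<le> v x" if "x \<in> interior T" for x using A T that n by metis
    then have d: "\<not> c \<le> v x" if "x \<in> space (lebesgue_on (interior T))" for x using that by simp
    have "AE x in lebesgue_on (interior T). False"
      using AE_interior_T(1)[OF T ae] AE_space[of "lebesgue_on (interior T)"]
    proof eventually_elim
      case (elim x)
      then show ?case using d by blast
    qed
    then have "AE x in lebesgue. x \<notin> interior T" by (simp add: AE_restrict_space_iff)
    then have "negligible (interior T)" by (simp add: AE_iff_null_sets negligible_iff_null_sets)
    then show False using open_not_negligible[OF open_interior T_props(7)[OF T]] by simp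
  qed
  then show thesis using A that by blast
qed

theorem theorem5p5:
  fixes \<Omega> :: "'a::euclidean_space set"
    and \<T> :: "'a set set"
    and \<alpha> V :: "'a \<Rightarrow> real"
    and \<alpha>lo \<alpha>hi \<kappa> :: real
    and k :: nat
  assumes "DIM('a) \<ge> 2"
    and "bounded \<Omega>" and "lipschitz_domain \<Omega>" and "polyhedral \<Omega>"
    and "regular_triangulation \<T> \<Omega>"
    and "V \<in> L_infty \<Omega>" and "essinf (lebesgue_on \<Omega>) (\<lambda>x. ereal (V x)) = 0"
    and "0 < \<alpha>lo" and "AE x in lebesgue_on \<Omega>. \<alpha>lo \<le> \<alpha> x \<and> \<alpha> x \<le> \<alpha>hi"
    and "\<alpha> \<in> P0 \<T>" and "V \<in> P0 \<T>"
    and "eCR_constant \<Omega> \<T> \<kappa>"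
    and "k \<ge> 1"
  shows "GLB ((h_max \<T>)\<^sup>2 * \<kappa>\<^sup>2) \<alpha>lo (sCR_eigenvalue \<Omega> \<T> \<alpha> V \<alpha>lo \<kappa> k)
           \<le> exact_eigenvalue \<Omega> \<alpha> V k"
proof -
  interpret mesh \<Omega> \<T> by unfold_locales fact+
  have "AE x in lebesgue_on \<Omega>. \<alpha>lo \<le> \<alpha> x" using assms(9) by eventually_elim simp
  then obtain A where A: "\<And>T x. T \<in> \<T> \<Longrightarrow> x \<in> interior T \<Longrightarrow> \<alpha> x = A T" "\<And>T. T \<in> \<T> \<Longrightarrow> \<alpha>lo \<le> A T"
    using P0_lower_bound[OF assms(10)] by metis
  have "esssup (lebesgue_on \<Omega>) (\<lambda>x. - ereal (V x)) = 0"
    using assms(7) by (simp add: essinf_def ereal_uminus_eq_reorder)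
  with esssup_AE[of "\<lambda>x. - ereal (V x)" "lebesgue_on \<Omega>"]
  have "AE x in lebesgue_on \<Omega>. 0 \<le> V x" by (auto elim: eventually_mono)
  then obtain W where W: "\<And>T x. T \<in> \<T> \<Longrightarrow> x \<in> interior T \<Longrightarrow> V x = W T" "\<And>T. T \<in> \<T> \<Longrightarrow> 0 \<le> W T"
    using P0_lower_bound[OF assms(11)] by metis
  interpret sCR_problem \<Omega> \<T> \<alpha> V \<alpha>lo \<kappa> A W
    by unfold_locales (rule assms(8) A W assms(12); assumption?)+
  show ?thesis by (rule lower_bound) (use assms(13) in simp)
qed

end
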